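(* Let $T\subset D=\mathbb G_m^n$ be a unimodular torus embedding, $p$ a prime, $\lambda\in\mathfrak t_{\mathbb Z}^*$ a smooth parameter, and let the ground ring be either $\mathbb Z$ or a field $\mathbb K$ of characteristic $p$. The algebras $\tilde H=\tilde H^\lambda$ and $\tilde H^!=\tilde H^!_\lambda$ are quadratically dual, with the pairing $\tilde H_1\times\tilde H_1^!$ (of degree-$1$ parts) given by $$\langle c_{\mathbf x}^{\sigma i},d_{\mathbf y}^{\sigma'j}\rangle=\delta_{\mathbf x,\mathbf y}\delta_{i,j}\delta_{\sigma,\sigma'}\qquad(\sigma,\sigma'\in\{+,-\}).$$
   Context: **Tori and chambers.** $D=\mathbb G_m^n$; $T\subset D$ is a split subtorus with $G=D/T$ a torus; $\mathfrak t_{\mathbb Z}\subset\mathfrak d_{\mathbb Z}=\mathbb Z^n$, $\mathfrak g_{\mathbb Z}=\mathfrak d_{\mathbb Z}/\mathfrak t_{\mathbb Z}$; $\epsilon_i$ the $i$th unit vector. Unimodular: any set of coordinate cocharacters whose image is a basis of $\mathfrak g_{\mathbb Q}$ has image a $\mathbb Z$-basis of $\mathfrak g_{\mathbb Z}$. $\tilde\Lambda(\lambda)$ is the set of $\mathbf x\in\mathbb Z^n$ such that there is $\mathbf a\in\mathbb Z^n=\mathfrak d^*_{\mathbb Z}$ with $\mathbf a|_{\mathfrak t_{\mathbb Z}}=\lambda$ and $px_i\le a_i<px_i+p$ for all $i$; $\tilde\Lambda^{\mathbb R}(\lambda')$ is defined in the same way with $\mathbf a\in\mathbb R^n$. $\lambda$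 is smooth if $\tilde\Lambda(\lambda)=\tilde\Lambda^{\mathbb R}(\lambda')$ for all $\lambda'$ in a neighbourhood of $\lambda$ in $\mathfrak t^*_{\mathbb R}$. $\alpha_i(\mathbf x)=\{\mathbf x\pm\epsilon_i\}\cap\tilde\Lambda(\lambda)$. **$\tilde H^\lambda$.** Over a ground ring $R$: the graded algebra generated over $\operatorname{Sym}_R(\mathfrak g_R)$ (central; $\mathsf s_i\in\mathfrak g$ the image of the $i$th coordinate vector) by orthogonal idempotents $1_{\mathbf x}$ and $c_{\mathbf x,\mathbf y}=1_{\mathbf x}c_{\mathbf x,\mathbf y}1_{\mathbf y}$ ($\mathbf x,\mathbf y\in\tilde\Lambda(\lambda)$, $c_{\mathbf x,\mathbf x}=1_{\mathbf x}$) with $c_{\mathbf x,\mathbf y}c_{\mathbf y,\mathbf u}=\prod_i\mathsf s_i^{\eta_i}c_{\mathbf x,\mathbf u}$, $\eta_i=\frac12(|x_i-y_i|+|y_i-u_i|-|x_i-u_i|)$; $\deg c_{\mathbf x,\mathbf y}=\sum|x_i-y_i|$, $\deg\mathsf s_i=2$. $c_{\mathbf x}^{\pm i}=c_{\mathbf x\pm\epsilon_i,\mathbf x}$. **$\tilde H^!_\lambda$.** The graded algebra (zero differential) generated over $\operatorname{Sym}_R(\mathfrak t^*_R)$ (central, $\mathfrak t^*$ in degree $2$; $\mathsf t_i\in\mathfrak t^*$ the restriction of the $i$th coordinate weight) by orthogonal idempotents $e_{\mathbf x}$ ($\mathbf x\in\tilde\Lambda(\lambda)$) and degree-1 elements $d_{\mathbf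 x}^{\pm i}\in e_{\mathbf x\pm\epsilon_i}\tilde H^!e_{\mathbf x}$ for $\mathbf x,\mathbf x\pm\epsilon_i\in\tilde\Lambda(\lambda)$. Write $d_{\mathbf x,\mathbf u}\in e_{\mathbf x}\tilde H^!e_{\mathbf u}$ for $d_{\mathbf u}^{\pm i}$ when $\mathbf x=\mathbf u\pm\epsilon_i$. Relations: (1) $\sum_{\mathbf u\in\alpha_i(\mathbf x)}d_{\mathbf x,\mathbf u}d_{\mathbf u,\mathbf x}=\mathsf t_ie_{\mathbf x}$ for all $\mathbf x,i$. (2) If $\mathbf x,\mathbf x+\epsilon_i,\mathbf x+\epsilon_j,\mathbf x+\epsilon_i+\epsilon_j\in\tilde\Lambda(\lambda)$, $i\ne j$: $d_{\mathbf x+\epsilon_i}^{+j}d_{\mathbf x}^{+i}=-d_{\mathbf x+\epsilon_j}^{+i}d_{\mathbf x}^{+j}$, $d_{\mathbf x+\epsilon_j}^{-j}d_{\mathbf x+\epsilon_i+\epsilon_j}^{-i}=-d_{\mathbf x+\epsilon_i}^{-i}d_{\mathbf x+\epsilon_i+\epsilon_j}^{-j}$, $d_{\mathbf x+\epsilon_i+\epsilon_j}^{-j}d_{\mathbf x+\epsilon_j}^{+i}=-d_{\mathbf x}^{+i}d_{\mathbf x+\epsilon_j}^{-j}$, $d_{\mathbf x+\epsilon_i+\epsilon_j}^{-i}d_{\mathbf x+\epsilon_i}^{+j}=-d_{\mathbf x}^{+j}d_{\mathbf x+\epsilon_i}^{-i}$. (3) If $\sum_i|x_i-u_i|=2$ and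 there is exactly one length-2 path $(\mathbf x,\mathbf y,\mathbf u)$ in $\tilde\Lambda(\lambda)$ (consecutive elements at $\ell^1$-distance 1), then $d_{\mathbf x,\mathbf y}d_{\mathbf y,\mathbf u}=0$. **Quadratic duality.** Both algebras have degree-0 part $B=\bigoplus_{\mathbf x}R\cdot1_{\mathbf x}$. They are quadratically dual if each is the quotient of the tensor algebra over $B$ of its degree-1 part by its quadratic relations, and the quadratic relations in $\tilde H_1\otimes_B\tilde H_1$ and $\tilde H_1^!\otimes_B\tilde H_1^!$ are annihilators of each other under the induced pairing $\langle c\otimes c',d\otimes d'\rangle=\langle c,d\rangle\langle c',d'\rangle$. *)

theory Defs
  imports "HOL-Analysis.Analysis" "HOL-Library.Poly_Mapping" "HOL-Computational_Algebra.Computational_Algebra"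
begin

section \<open>Algebras given by generators and relations\<close>

text \<open>With concatenation of lists as addition of exponents, \<open>'g list \<Rightarrow>\<^sub>0 'r\<close> is the free
  associative unital \<open>'r\<close>-algebra on the letters \<open>'g\<close>.\<close>

instantiation list :: (type) monoid_add
begin
definition zero_list :: "'a list" where "zero_list = []"
definition plus_list :: "'a list \<Rightarrow> 'a list \<Rightarrow> 'a list" where "plus_list = (@)"
instance by intro_classes (simp_all add: zero_list_def plus_list_def)
end

definition gen :: "'g \<Rightarrow> ('g list \<Rightarrow>\<^sub>0 'r::comm_ring_1)" where
  "gen g = Poly_Mapping.single [g] 1"

definition scal :: "'r \<Rightarrow> ('g list \<Rightarrow>\<^sub>0 'r::comm_ring_1)" where
  "scal r = Poly_Mapping.single [] r"

definition free_on :: "'g set \<Rightarrow> ('g list \<Rightarrow>\<^sub>0 'r::comm_ring_1) set" where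
  "free_on G = {f. \<forall>w\<in>Poly_Mapping.keys f. set w \<subseteq> G}"

inductive_set gen_ideal ::
    "'g set \<Rightarrow> ('g list \<Rightarrow>\<^sub>0 'r::comm_ring_1) set \<Rightarrow> ('g list \<Rightarrow>\<^sub>0 'r) set"
  for G :: "'g set" and S :: "('g list \<Rightarrow>\<^sub>0 'r) set" where
  zero: "0 \<in> gen_ideal G S"
| mult: "s \<in> S \<Longrightarrow> a \<in> free_on G \<Longrightarrow> b \<in> free_on G \<Longrightarrow> a * s * b \<in> gen_ideal G S"
| add: "f \<in> gen_ideal G S \<Longrightarrow> g \<in> gen_ideal G S \<Longrightarrow> f + g \<in> gen_ideal G S"

text \<open>A presentation describes the graded, not necessarily unital, algebra generated by
  \<open>gens\<close> over the commutative unital algebra generated by \<open>central\<close>, subject to \<open>rels\<close>.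
  Its elements are the classes modulo \<open>alg_ideal\<close> of combinations of words
  containing at least one letter of \<open>gens\<close> (there is no unit when there are
  infinitely many orthogonal idempotents). Throughout, an element is
  handled through representatives in \<open>elems\<close>, and equality means congruence modulo
  \<open>alg_ideal\<close>.\<close>

record (overloaded) ('g, 'r) presentation =
  central :: "'g set"
  gens :: "'g set"
  rels :: "('g list \<Rightarrow>\<^sub>0 'r) set"
  deg :: "'g \<Rightarrow> nat"

definition alg_ideal :: "('g, 'r::comm_ring_1) presentation \<Rightarrow> ('g list \<Rightarrow>\<^sub>0 'r) set" where
  "alg_ideal P = gen_ideal (central P \<union> gens P)
     (rels P \<union> {gen z * gen g - gen g * gen z | z g. z \<in> central P \<and> g \<in> central P \<union> gens P})"

definition elems :: "('g, 'r::comm_ring_1) presentation \<Rightarrow> ('g list \<Rightarrow>\<^sub>0 'r) set" where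
  "elems P = {f. \<forall>w\<in>Poly_Mapping.keys f. set w \<subseteq> central P \<union> gens P \<and> set w \<inter> gens P \<noteq> {}}"

definition part :: "('g, 'r::comm_ring_1) presentation \<Rightarrow> nat \<Rightarrow> ('g list \<Rightarrow>\<^sub>0 'r) set" where
  "part P k = {f \<in> elems P. \<forall>w\<in>Poly_Mapping.keys f. sum_list (map (deg P) w) = k}"

section \<open>Quadratic duality over a sum of copies of the ground ring\<close>

text \<open>In this section \<open>\<Lambda>\<close> indexes the idempotents and the letter \<open>e x\<close> is the idempotent at
  \<open>x\<close>, so \<open>B\<close> is the direct sum of the \<open>R \<cdot> e x\<close>.\<close>

definition degree_zero_part_is_B ::
    "('g, 'r::comm_ring_1) presentation \<Rightarrow> 'x set \<Rightarrow> ('x \<Rightarrow> 'g) \<Rightarrow> bool" where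
  "degree_zero_part_is_B P \<Lambda> e \<longleftrightarrow>
     (\<forall>x\<in>\<Lambda>. gen (e x) \<in> part P 0) \<and>
     (\<forall>x\<in>\<Lambda>. \<forall>y\<in>\<Lambda>. gen (e x) * gen (e y) - (if x = y then gen (e x) else 0) \<in> alg_ideal P) \<and>
     (\<forall>f\<in>part P 0. \<exists>X r. finite X \<and> X \<subseteq> \<Lambda> \<and> f - (\<Sum>x\<in>X. scal (r x) * gen (e x)) \<in> alg_ideal P) \<and>
     (\<forall>X r. finite X \<and> X \<subseteq> \<Lambda> \<and> (\<Sum>x\<in>X. scal (r x) * gen (e x)) \<in> alg_ideal P
        \<longrightarrow> (\<forall>x\<in>X. r x = 0))"

datatype ('x, 'v) tensor_letter = TIdem 'x | TVec 'v

text \<open>The tensor algebra over \<open>B\<close> of the \<open>B\<close>-bimodule \<open>A\<^sub>1\<close>, by its universal property: it is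
  generated by \<open>B\<close> and by all elements of \<open>A\<^sub>1\<close>, and the relations state that \<open>B\<close> maps in as an
  algebra and \<open>A\<^sub>1\<close> as an \<open>R\<close>-module and \<open>B\<close>-bimodule; representatives of zero in \<open>A\<^sub>1\<close> are sent to
  zero. Its part of degree \<open>k > 0\<close> is the \<open>k\<close>-fold tensor power of \<open>A\<^sub>1\<close> over \<open>B\<close>.\<close>

definition tensor_algebra ::
    "('g, 'r::comm_ring_1) presentation \<Rightarrow> 'x set \<Rightarrow> ('x \<Rightarrow> 'g) \<Rightarrow>
     (('x, 'g list \<Rightarrow>\<^sub>0 'r) tensor_letter, 'r) presentation" where
  "tensor_algebra P \<Lambda> e =
    \<lparr> central = {},
      gens = TIdem ` \<Lambda> \<union> TVec ` part P 1,
      rels =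
        {gen (TIdem x) * gen (TIdem y) - (if x = y then gen (TIdem x) else 0) | x y. x \<in> \<Lambda> \<and> y \<in> \<Lambda>} \<union>
        {gen (TVec (f + g)) - gen (TVec f) - gen (TVec g) | f g. f \<in> part P 1 \<and> g \<in> part P 1} \<union>
        {gen (TVec (scal r * f)) - scal r * gen (TVec f) | r f. f \<in> part P 1} \<union>
        {gen (TVec f) | f. f \<in> part P 1 \<inter> alg_ideal P} \<union>
        {gen (TVec (gen (e x) * f)) - gen (TIdem x) * gen (TVec f) | x f. x \<in> \<Lambda> \<and> f \<in> part P 1} \<union>
        {gen (TVec (f * gen (e x))) - gen (TVec f) * gen (TIdem x) | x f. x \<in> \<Lambda> \<and> f \<in> part P 1},
      deg = (\<lambda>l. case l of TIdem x \<Rightarrow> 0 | TVec f \<Rightarrow> 1) \<rparr>"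

text \<open>The canonical homomorphism from the tensor algebra to \<open>A\<close>, on representatives.\<close>

definition tensor_mult ::
    "('x \<Rightarrow> 'g) \<Rightarrow> (('x, 'g list \<Rightarrow>\<^sub>0 'r) tensor_letter list \<Rightarrow>\<^sub>0 'r::comm_ring_1) \<Rightarrow> ('g list \<Rightarrow>\<^sub>0 'r)" where
  "tensor_mult e \<tau> = (\<Sum>w\<in>Poly_Mapping.keys \<tau>. scal (Poly_Mapping.lookup \<tau> w) *
     prod_list (map (\<lambda>l. case l of TIdem x \<Rightarrow> gen (e x) | TVec f \<Rightarrow> f) w))"

definition quadratic_rels ::
    "('g, 'r::comm_ring_1) presentation \<Rightarrow> 'x set \<Rightarrow> ('x \<Rightarrow> 'g) \<Rightarrow>
     (('x, 'g list \<Rightarrow>\<^sub>0 'r) tensor_letter list \<Rightarrow>\<^sub>0 'r) set" where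
  "quadratic_rels P \<Lambda> e = {\<tau> \<in> part (tensor_algebra P \<Lambda> e) 2. tensor_mult e \<tau> \<in> alg_ideal P}"

definition is_quadratic ::
    "('g, 'r::comm_ring_1) presentation \<Rightarrow> 'x set \<Rightarrow> ('x \<Rightarrow> 'g) \<Rightarrow> bool" where
  "is_quadratic P \<Lambda> e \<longleftrightarrow> (let T = tensor_algebra P \<Lambda> e in
     (\<forall>f\<in>elems P. \<exists>\<tau>\<in>elems T. f - tensor_mult e \<tau> \<in> alg_ideal P) \<and>
     (\<forall>\<tau>\<in>elems T. tensor_mult e \<tau> \<in> alg_ideal P \<longleftrightarrow>
        \<tau> \<in> alg_ideal (T\<lparr>rels := rels T \<union> quadratic_rels P \<Lambda> e\<rparr>)))"

text \<open>An \<open>R\<close>-bilinear pairing between the degree-\<open>k\<close> parts of two algebras, on representatives.\<close>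

definition bilinear_pairing ::
    "nat \<Rightarrow> ('g, 'r::comm_ring_1) presentation \<Rightarrow> ('h, 'r) presentation \<Rightarrow>
     (('g list \<Rightarrow>\<^sub>0 'r) \<Rightarrow> ('h list \<Rightarrow>\<^sub>0 'r) \<Rightarrow> 'r) \<Rightarrow> bool" where
  "bilinear_pairing k P P' \<beta> \<longleftrightarrow>
     (\<forall>f\<in>part P k. \<forall>f'\<in>part P k. \<forall>h\<in>part P' k. \<beta> (f + f') h = \<beta> f h + \<beta> f' h) \<and>
     (\<forall>r. \<forall>f\<in>part P k. \<forall>h\<in>part P' k. \<beta> (scal r * f) h = r * \<beta> f h) \<and>
     (\<forall>f\<in>part P k. \<forall>h\<in>part P' k. \<forall>h'\<in>part P' k. \<beta> f (h + h') = \<beta> f h + \<beta> f h') \<and>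
     (\<forall>r. \<forall>f\<in>part P k. \<forall>h\<in>part P' k. \<beta> f (scal r * h) = r * \<beta> f h) \<and>
     (\<forall>f\<in>part P k. \<forall>h\<in>part P' k. f \<in> alg_ideal P \<or> h \<in> alg_ideal P' \<longrightarrow> \<beta> f h = 0)"

text \<open>The formula for the induced pairing refers to pure tensors \<open>c \<otimes> c'\<close> whose factors meet at
  the same idempotent, that is, \<open>c = c e\<^sub>y\<close> and \<open>c' = e\<^sub>y c'\<close>: these span the tensor product over
  \<open>B\<close>, and for arbitrary \<open>c, c'\<close> the right-hand side of the formula is not \<open>B\<close>-balanced.\<close>

definition induced_pairing ::
    "('g, 'r::comm_ring_1) presentation \<Rightarrow> ('x \<Rightarrow> 'g) \<Rightarrow> ('h, 'r) presentation \<Rightarrow> ('x \<Rightarrow> 'h) \<Rightarrow> 'x set \<Rightarrow>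
     (('g list \<Rightarrow>\<^sub>0 'r) \<Rightarrow> ('h list \<Rightarrow>\<^sub>0 'r) \<Rightarrow> 'r) \<Rightarrow>
     ((('x, 'g list \<Rightarrow>\<^sub>0 'r) tensor_letter list \<Rightarrow>\<^sub>0 'r) \<Rightarrow>
      (('x, 'h list \<Rightarrow>\<^sub>0 'r) tensor_letter list \<Rightarrow>\<^sub>0 'r) \<Rightarrow> 'r) \<Rightarrow> bool" where
  "induced_pairing P e P' e' \<Lambda> \<beta> \<beta>2 \<longleftrightarrow>
     bilinear_pairing 2 (tensor_algebra P \<Lambda> e) (tensor_algebra P' \<Lambda> e') \<beta>2 \<and>
     (\<forall>y\<in>\<Lambda>. \<forall>z\<in>\<Lambda>. \<forall>c\<in>part P 1. \<forall>c'\<in>part P 1. \<forall>d\<in>part P' 1. \<forall>d'\<in>part P' 1.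
        c - c * gen (e y) \<in> alg_ideal P \<and> c' - gen (e y) * c' \<in> alg_ideal P \<and>
        d - d * gen (e' z) \<in> alg_ideal P' \<and> d' - gen (e' z) * d' \<in> alg_ideal P' \<longrightarrow>
        \<beta>2 (gen (TVec c) * gen (TVec c')) (gen (TVec d) * gen (TVec d')) = \<beta> c d * \<beta> c' d')"

definition quadratically_dual ::
    "('g, 'r::comm_ring_1) presentation \<Rightarrow> ('x \<Rightarrow> 'g) \<Rightarrow> ('h, 'r) presentation \<Rightarrow> ('x \<Rightarrow> 'h) \<Rightarrow> 'x set \<Rightarrow>
     (('g list \<Rightarrow>\<^sub>0 'r) \<Rightarrow> ('h list \<Rightarrow>\<^sub>0 'r) \<Rightarrow> 'r) \<Rightarrow> bool" where
  "quadratically_dual P e P' e' \<Lambda> \<beta> \<longleftrightarrow>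
     degree_zero_part_is_B P \<Lambda> e \<and> degree_zero_part_is_B P' \<Lambda> e' \<and>
     is_quadratic P \<Lambda> e \<and> is_quadratic P' \<Lambda> e' \<and>
     bilinear_pairing 1 P P' \<beta> \<and>
     (\<exists>\<beta>2. induced_pairing P e P' e' \<Lambda> \<beta> \<beta>2 \<and>
        quadratic_rels P \<Lambda> e =
          {\<tau> \<in> part (tensor_algebra P \<Lambda> e) 2. \<forall>\<tau>'\<in>quadratic_rels P' \<Lambda> e'. \<beta>2 \<tau> \<tau>' = 0} \<and>
        quadratic_rels P' \<Lambda> e' =
          {\<tau>' \<in> part (tensor_algebra P' \<Lambda> e') 2. \<forall>\<tau>\<in>quadratic_rels P \<Lambda> e. \<beta>2 \<tau> \<tau>' = 0})"

section \<open>Tori and chambers\<close>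

text \<open>Subtori \<open>T\<close> of \<open>D = G\<^sub>m\<^sup>n\<close> correspond to saturated subgroups \<open>t\<close> (the cocharacters of \<open>T\<close>)
  of \<open>\<int>\<^sup>n\<close>; saturation says that \<open>\<int>\<^sup>n/t\<close>, the cocharacter lattice of \<open>D/T\<close>, is torsion free.\<close>

definition subtorus :: "(int ^ 'n::finite) set \<Rightarrow> bool" where
  "subtorus t \<longleftrightarrow> 0 \<in> t \<and> (\<forall>v\<in>t. \<forall>w\<in>t. v - w \<in> t) \<and>
     (\<forall>k v. k \<noteq> 0 \<and> k *s v \<in> t \<longrightarrow> v \<in> t)"

text \<open>The image of \<open>t \<otimes> R\<close> in \<open>R\<^sup>n\<close>; the cokernel \<open>R\<^sup>n / base_change t\<close> is
  \<open>g\<^sub>R = (\<int>\<^sup>n/t) \<otimes> R\<close>, whose elements are the cosets \<open>g_class t v\<close>.\<close>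

definition base_change :: "(int ^ 'n::finite) set \<Rightarrow> ('r::comm_ring_1 ^ 'n) set" where
  "base_change t = module.span (*s) ((\<lambda>v. \<chi> i. of_int (v $ i)) ` t)"

definition g_class :: "(int ^ 'n::finite) set \<Rightarrow> 'r::comm_ring_1 ^ 'n \<Rightarrow> ('r ^ 'n) set" where
  "g_class t v = {w. w - v \<in> base_change t}"

text \<open>The images of the \<open>\<epsilon>\<^sub>i\<close>, \<open>i \<in> I\<close>, form an \<open>R\<close>-basis of \<open>g\<^sub>R\<close>.\<close>

definition coordinate_basis :: "'r::comm_ring_1 itself \<Rightarrow> (int ^ 'n::finite) set \<Rightarrow> 'n set \<Rightarrow> bool" where
  "coordinate_basis _ t I \<longleftrightarrow>
     (\<forall>v :: 'r ^ 'n. \<exists>!q. (\<forall>i. i \<notin> I \<longrightarrow> q i = 0) \<and>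
        g_class t (\<Sum>i\<in>I. q i *s axis i 1) = g_class t v)"

definition unimodular :: "(int ^ 'n::finite) set \<Rightarrow> bool" where
  "unimodular t \<longleftrightarrow>
     (\<forall>I. coordinate_basis TYPE(rat) t I \<longrightarrow> coordinate_basis TYPE(int) t I)"

text \<open>\<open>t\<^sup>*\<^sub>R = Hom(t, R)\<close>; homomorphisms are extended by zero outside \<open>t\<close>.\<close>

definition lattice_dual :: "(int ^ 'n::finite) set \<Rightarrow> (int ^ 'n \<Rightarrow> 'r::comm_ring_1) set" where
  "lattice_dual t = {\<phi>. (\<forall>v\<in>t. \<forall>w\<in>t. \<phi> (v + w) = \<phi> v + \<phi> w) \<and> (\<forall>v. v \<notin> t \<longrightarrow> \<phi> v = 0)}"

text \<open>For \<open>'a = int\<close> and \<open>'a = real\<close> these are the sets of \<open>x\<close> defined by integral and by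
  real \<open>a\<close>, respectively.\<close>

definition chambers :: "(int ^ 'n::finite) set \<Rightarrow> nat \<Rightarrow> (int ^ 'n \<Rightarrow> 'a::linordered_idom) \<Rightarrow> (int ^ 'n) set" where
  "chambers t p \<phi> = {x. \<exists>a :: 'a ^ 'n.
     (\<forall>v\<in>t. (\<Sum>i\<in>UNIV. a $ i * of_int (v $ i)) = \<phi> v) \<and>
     (\<forall>i. of_nat p * of_int (x $ i) \<le> a $ i \<and> a $ i < of_nat p * of_int (x $ i) + of_nat p)}"

text \<open>The product topology on functions induces on the finite-dimensional space \<open>t\<^sup>*\<^sub>\<real>\<close> its
  usual topology.\<close>

definition smooth_parameter :: "(int ^ 'n::finite) set \<Rightarrow> nat \<Rightarrow> (int ^ 'n \<Rightarrow> int) \<Rightarrow> bool" where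
  "smooth_parameter t p \<phi> \<longleftrightarrow>
     (\<exists>U :: (int ^ 'n \<Rightarrow> real) set. open U \<and> (\<lambda>v. of_int (\<phi> v)) \<in> U \<and>
        (\<forall>\<psi> \<in> U \<inter> lattice_dual t. chambers t p \<phi> = chambers t p \<psi>))"

definition l1_dist :: "int ^ 'n::finite \<Rightarrow> int ^ 'n \<Rightarrow> nat" where
  "l1_dist x y = nat (\<Sum>i\<in>UNIV. \<bar>x $ i - y $ i\<bar>)"

section \<open>The two algebras\<close>

datatype ('s, 'x) H_letter = HSym 's | HIdem 'x | HC 'x 'x

text \<open>The letter \<open>HSym s\<close> is the element \<open>s\<close> of the degree-one part of the symmetric algebra of
  \<open>g\<^sub>R\<close>. The product of powers of the central elements \<open>s\<^sub>i\<close> is taken along an arbitrary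
  enumeration of the coordinates.\<close>

definition H_pres ::
    "(int ^ 'n::finite) set \<Rightarrow> nat \<Rightarrow> (int ^ 'n \<Rightarrow> int) \<Rightarrow>
     ((('r::comm_ring_1 ^ 'n) set, int ^ 'n) H_letter, 'r) presentation" where
  "H_pres t p \<phi> = (let \<Lambda> = chambers t p \<phi>;
      sym = (\<lambda>v. gen (HSym (g_class t v)));
      eta = (\<lambda>x y u i. nat ((\<bar>x $ i - y $ i\<bar> + \<bar>y $ i - u $ i\<bar> - \<bar>x $ i - u $ i\<bar>) div 2)) in
    \<lparr> central = range (\<lambda>v. HSym (g_class t v)),
      gens = HIdem ` \<Lambda> \<union> {HC x y | x y. x \<in> \<Lambda> \<and> y \<in> \<Lambda>},
      rels =
        {sym (v + w) - sym v - sym w | v w. True} \<union>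
        {sym (r *s v) - scal r * sym v | r v. True} \<union>
        {gen (HIdem x) * gen (HIdem y) - (if x = y then gen (HIdem x) else 0) | x y. x \<in> \<Lambda> \<and> y \<in> \<Lambda>} \<union>
        {gen (HIdem x) * gen (HC x y) - gen (HC x y) | x y. x \<in> \<Lambda> \<and> y \<in> \<Lambda>} \<union>
        {gen (HC x y) * gen (HIdem y) - gen (HC x y) | x y. x \<in> \<Lambda> \<and> y \<in> \<Lambda>} \<union>
        {gen (HC x x) - gen (HIdem x) | x. x \<in> \<Lambda>} \<union>
        {gen (HC x y) * gen (HC y u)
           - prod_list (map (\<lambda>i. sym (axis i 1) ^ eta x y u i) is) * gen (HC x u)
         | x y u is. x \<in> \<Lambda> \<and> y \<in> \<Lambda> \<and> u \<in> \<Lambda> \<and> distinct is \<and> set is = UNIV},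
      deg = (\<lambda>l. case l of HSym s \<Rightarrow> 2 | HIdem x \<Rightarrow> 0 | HC x y \<Rightarrow> l1_dist x y) \<rparr>)"

datatype ('s, 'x) Hd_letter = DSym 's | DIdem 'x | DD 'x 'x

text \<open>The letter \<open>DD x u\<close> is \<open>d\<^bsub>x,u\<^esub>\<close>, which runs from \<open>u\<close> to the neighbour \<open>x = u \<plusminus> \<epsilon>\<^sub>i\<close>.\<close>

definition Hd_pres ::
    "(int ^ 'n::finite) set \<Rightarrow> nat \<Rightarrow> (int ^ 'n \<Rightarrow> int) \<Rightarrow>
     ((int ^ 'n \<Rightarrow> 'r::comm_ring_1, int ^ 'n) Hd_letter, 'r) presentation" where
  "Hd_pres t p \<phi> = (let \<Lambda> = chambers t p \<phi>;
      sym = (\<lambda>\<psi>. gen (DSym \<psi>));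
      weight = (\<lambda>i v. if v \<in> t then of_int (v $ i) else 0);
      \<alpha> = (\<lambda>i x. {x + axis i 1, x - axis i 1} \<inter> \<Lambda>);
      d = (\<lambda>x u. gen (DD x u)) in
    \<lparr> central = DSym ` lattice_dual t,
      gens = DIdem ` \<Lambda> \<union> {DD x u | x u. x \<in> \<Lambda> \<and> u \<in> \<Lambda> \<and> l1_dist x u = 1},
      rels =
        {sym (\<lambda>v. \<phi>1 v + \<phi>2 v) - sym \<phi>1 - sym \<phi>2 | \<phi>1 \<phi>2. \<phi>1 \<in> lattice_dual t \<and> \<phi>2 \<in> lattice_dual t} \<union>
        {sym (\<lambda>v. r * \<psi> v) - scal r * sym \<psi> | r \<psi>. \<psi> \<in> lattice_dual t} \<union>
        {gen (DIdem x) * gen (DIdem y) - (if x = y then gen (DIdem x) else 0) | x y. x \<in> \<Lambda> \<and> y \<in> \<Lambda>} \<union>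
        {gen (DIdem x) * d x u - d x u | x u. x \<in> \<Lambda> \<and> u \<in> \<Lambda> \<and> l1_dist x u = 1} \<union>
        {d x u * gen (DIdem u) - d x u | x u. x \<in> \<Lambda> \<and> u \<in> \<Lambda> \<and> l1_dist x u = 1} \<union>
        {(\<Sum>u\<in>\<alpha> i x. d x u * d u x) - sym (weight i) * gen (DIdem x) | i x. x \<in> \<Lambda>} \<union>
        \<Union>{ {d xij xi * d xi x + d xij xj * d xj x,
              d x xj * d xj xij + d x xi * d xi xij,
              d xi xij * d xij xj + d xi x * d x xj,
              d xj xij * d xij xi + d xj x * d x xi}
           | x xi xj xij i j. i \<noteq> j \<and> xi = x + axis i 1 \<and> xj = x + axis j 1 \<and>
               xij = x + axis i 1 + axis j 1 \<and> {x, xi, xj, xij} \<subseteq> \<Lambda>} \<union>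
        {d x y * d y u | x y u. x \<in> \<Lambda> \<and> u \<in> \<Lambda> \<and> l1_dist x u = 2 \<and>
           {z \<in> \<Lambda>. l1_dist x z = 1 \<and> l1_dist z u = 1} = {y}},
      deg = (\<lambda>l. case l of DSym s \<Rightarrow> 2 | DIdem x \<Rightarrow> 0 | DD x u \<Rightarrow> 1) \<rparr>)"

text \<open>The signs are \<open>\<sigma> = 1\<close> and \<open>\<sigma> = -1\<close>, and \<open>axis i \<sigma>\<close> is \<open>\<sigma>\<epsilon>\<^sub>i\<close>.\<close>

definition c_elem :: "int ^ 'n::finite \<Rightarrow> int \<Rightarrow> 'n \<Rightarrow> (('s, int ^ 'n) H_letter list \<Rightarrow>\<^sub>0 'r::comm_ring_1)" where
  "c_elem x \<sigma> i = gen (HC (x + axis i \<sigma>) x)"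

definition d_elem :: "int ^ 'n::finite \<Rightarrow> int \<Rightarrow> 'n \<Rightarrow> (('s, int ^ 'n) Hd_letter list \<Rightarrow>\<^sub>0 'r::comm_ring_1)" where
  "d_elem x \<sigma> i = gen (DD (x + axis i \<sigma>) x)"

definition delta_pairing ::
    "(int ^ 'n::finite) set \<Rightarrow>
     ((('s, int ^ 'n) H_letter list \<Rightarrow>\<^sub>0 'r::comm_ring_1) \<Rightarrow> (('u, int ^ 'n) Hd_letter list \<Rightarrow>\<^sub>0 'r) \<Rightarrow> 'r) \<Rightarrow> bool" where
  "delta_pairing \<Lambda> \<beta> \<longleftrightarrow>
     (\<forall>x\<in>\<Lambda>. \<forall>y\<in>\<Lambda>. \<forall>\<sigma>\<in>{1, -1}. \<forall>\<sigma>'\<in>{1, -1}. \<forall>i j.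
        x + axis i \<sigma> \<in> \<Lambda> \<and> y + axis j \<sigma>' \<in> \<Lambda> \<longrightarrow>
        \<beta> (c_elem x \<sigma> i) (d_elem y \<sigma>' j) = (if x = y \<and> i = j \<and> \<sigma> = \<sigma>' then 1 else 0))"

end

theory Submission
  imports Defs "HOL-Library.Function_Algebras"
begin

text \<open>
  Both algebras are quotients of the path algebra of one quiver: its vertices are the chambers,
  and an arrow joins two chambers that differ by a coordinate vector. Degree two is where they
  meet. For ends \<open>x\<close> and \<open>u\<close> let \<open>W x u\<close> be the space of coefficient vectors \<open>k\<close>, indexed by the
  common neighbours \<open>y\<close>, for which the combination of the paths through \<open>y\<close> vanishes (locale
  \<open>quiver_pres\<close>). Multiplying by idempotents shows that the quadratic relations are described by
  these spaces (\<open>in_quadratic_rels\<close>), and with the pairing for which arrows are dual to arrows,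
  quadratic duality amounts to orthogonality of the two spaces \<open>W x u\<close> for each pair of ends,
  together with the fact that each algebra has no further relations (\<open>quadratically_dualI\<close>).

  For \<open>x \<noteq> u\<close> all paths agree in \<open>H\<close>, so \<open>W x u\<close> consists of the \<open>k\<close> with sum zero
  (\<open>H_W_distinct\<close>). There are at most two common neighbours. If there are two, they form a square,
  and the dual algebra has the relation with equal coefficients; if there is one, the path is
  zero. For \<open>x = u\<close> a loop in direction \<open>i\<close> is \<open>s\<^sub>i\<close> in \<open>H\<close>, so \<open>k\<close> is a relation when the vector
  that collects its entries by direction lies in \<open>t\<close> (\<open>H_W_loop\<close>); in the dual algebra the sum of
  the loops in direction \<open>i\<close> is \<open>t\<^sub>i\<close>, so the relations are the covectors vanishing on \<open>t\<close>,
  restricted to the available directions. Lower bounds come from the defining relations and upper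
  bounds from explicit modules: functions on the chambers for \<open>H\<close>, and a module with three levels,
  built from a relation of \<open>H\<close>, for the dual algebra (\<open>W_orthogonal\<close>). That restricting to
  available directions loses nothing (\<open>Hd_W_complete\<close>) is a first use of the geometry below.

  To see that an algebra is quadratic one inverts the map from the path algebra modulo the
  quadratic relations: the remaining generators are expressed by paths, and their relations are
  derived from those of degree two (\<open>is_quadraticI\<close>). For the dual algebra this is the statement
  that the loops representing \<open>t\<^sub>i\<close> commute with arrows, which follows by moving a loop across
  squares (\<open>dual_coef_commute\<close>). For \<open>H\<close> one needs that \<open>c x y\<close> is represented by any shortest
  path (\<open>geo_closer\<close>) and that the loops representing \<open>s\<^sub>i\<close> commute with arrows (\<open>S_commute\<close>).

  Here smoothness enters, through three facts about the affine space \<open>A\<close> of all \<open>a\<close> restricting to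
  \<open>\<lambda>\<close>, cut into cells by the walls \<open>a $ i \<in> p \<int>\<close>. Smoothness says that a closed cube that meets
  \<open>A\<close> meets it in its interior (\<open>smooth_cube_arrangement\<close>), so every wall that a walk in \<open>A\<close> runs
  into leads to another chamber. Hence a segment from \<open>x\<close> to \<open>u\<close> provides a first step
  (\<open>first_step\<close>); moving its starting point shows that first steps are connected by squares
  (\<open>squares_connect\<close>); and a ray in the common facet of two adjacent chambers shows that no
  nonzero covector vanishing on \<open>t\<close> vanishes in all the directions in which both have a neighbour
  on the same side and in the one separating them (\<open>common_walls\<close>). By unimodularity these
  directions then generate \<open>\<int>\<^sup>n/t\<close> integrally, with an integral projection matrix that works over
  every ring (\<open>coordinate_projection\<close>).
\<close>

section \<open>Free algebras, their modules and congruences\<close>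

abbreviation word :: "'g list \<Rightarrow> ('g list \<Rightarrow>\<^sub>0 'r::comm_ring_1)" where
  "word w \<equiv> Poly_Mapping.single w 1"

lemma single_mult_list: "Poly_Mapping.single u a * Poly_Mapping.single v b = Poly_Mapping.single (u @ v) (a * b)"
  by (simp add: mult_single plus_list_def)

lemma scal_mult_single: "scal r * Poly_Mapping.single w a = Poly_Mapping.single w (r * a)"
  by (simp add: scal_def single_mult_list)

lemma word_Cons: "word (g # w) = gen g * word w"
  by (simp add: gen_def single_mult_list)

lemma one_word: "(1 :: 'g list \<Rightarrow>\<^sub>0 'r::comm_ring_1) = word []"
  by (metis single_one zero_list_def)

lemma scal_simps [simp]:
  "scal 0 = 0" "scal 1 = 1" "scal (- r) = - scal r"
  by (simp_all add: scal_def one_word single_uminus)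

lemma scal_add: "scal (a + b) = scal a + scal b"
  by (simp add: scal_def single_add)

lemma scal_diff: "scal (a - b) = scal a - scal b"
  by (simp add: scal_def single_diff)

lemma scal_mult: "scal (a * b) = scal a * scal b"
  by (simp add: scal_def single_mult_list)

lemma scal_sum: "scal (sum r X) = (\<Sum>x\<in>X. scal (r x))"
  by (induction X rule: infinite_finite_induct) (simp_all add: scal_add)

lemma free_expand: "(f :: 'g list \<Rightarrow>\<^sub>0 'r::comm_ring_1) = (\<Sum>w\<in>Poly_Mapping.keys f. Poly_Mapping.single w (Poly_Mapping.lookup f w))"
  by (rule poly_mapping_eqI)
    (simp add: lookup_sum lookup_single when_def not_in_keys_iff_lookup_eq_zero)

text \<open>Linear statements about a given element need to be checked only on its own monomials, so
  that side conditions on the occurring words remain available.\<close>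

lemma free_induct:
  fixes f :: "'g list \<Rightarrow>\<^sub>0 'r::comm_ring_1"
  assumes "P 0" and "\<And>f g. P f \<Longrightarrow> P g \<Longrightarrow> P (f + g)"
    and "\<And>w r. w \<in> Poly_Mapping.keys f \<Longrightarrow> P (Poly_Mapping.single w r)"
  shows "P f"
proof -
  have "P (\<Sum>w\<in>X. Poly_Mapping.single w (Poly_Mapping.lookup f w))"
    if "finite X" "X \<subseteq> Poly_Mapping.keys f" for X
    using that by (induction X rule: finite_induct) (auto intro: assms)
  from this[OF finite_keys order_refl] show ?thesis by (subst free_expand) simp
qed

lemma scal_comm: "f * scal r = scal r * (f :: 'g list \<Rightarrow>\<^sub>0 'r::comm_ring_1)"
  by (rule free_induct[where f = f])
    (simp_all add: distrib_left distrib_right scal_def single_mult_list mult.commute)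

lemma scal_left_comm: "f * (scal r * g) = scal r * (f * (g :: 'g list \<Rightarrow>\<^sub>0 'r::comm_ring_1))"
  by (metis mult.assoc scal_comm)

lemma keys_gen [simp]: "Poly_Mapping.keys (gen g :: 'g list \<Rightarrow>\<^sub>0 'r::comm_ring_1) = {[g]}"
  by (simp add: gen_def)

lemma keys_mult_list:
  fixes f g :: "'g list \<Rightarrow>\<^sub>0 'r::comm_ring_1"
  shows
  "w \<in> Poly_Mapping.keys (f * g) \<Longrightarrow> \<exists>u\<in>Poly_Mapping.keys f. \<exists>v\<in>Poly_Mapping.keys g. w = u @ v"
  using keys_mult[of f g] unfolding plus_list_def by blast

lemma keys_scal_mult:
  fixes f :: "'a list \<Rightarrow>\<^sub>0 'b::comm_ring_1"
  shows "Poly_Mapping.keys (scal r * f) \<subseteq> Poly_Mapping.keys f"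
proof
  fix w assume "w \<in> Poly_Mapping.keys (scal r * f)"
  from keys_mult_list[OF this] obtain u v where
    "u \<in> Poly_Mapping.keys (scal r :: 'a list \<Rightarrow>\<^sub>0 'b)" "v \<in> Poly_Mapping.keys f" "w = u @ v"
    by blast
  then show "w \<in> Poly_Mapping.keys f"
    by (simp add: scal_def split: if_splits)
qed

lemma keys_diff_list: "Poly_Mapping.keys (f - g) \<subseteq> Poly_Mapping.keys f \<union> Poly_Mapping.keys (g :: 'g list \<Rightarrow>\<^sub>0 'r::comm_ring_1)"
  by (auto simp: in_keys_iff lookup_minus)

lemma free_on_simps [simp]:
  fixes r :: "'r::comm_ring_1"
  shows "(0 :: 'g list \<Rightarrow>\<^sub>0 'r) \<in> free_on G" "(1 :: 'g list \<Rightarrow>\<^sub>0 'r) \<in> free_on G"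
    "(scal r :: 'g list \<Rightarrow>\<^sub>0 'r) \<in> free_on G"
    "(gen g :: 'g list \<Rightarrow>\<^sub>0 'r) \<in> free_on G \<longleftrightarrow> g \<in> G"
proof -
  show one: "(scal r :: 'g list \<Rightarrow>\<^sub>0 'r) \<in> free_on G" for r
    by (simp add: free_on_def scal_def)
  from one[of 1] show "(1 :: 'g list \<Rightarrow>\<^sub>0 'r) \<in> free_on G" by simp
qed (simp_all add: free_on_def)

lemma free_onI: "(\<And>w. w \<in> Poly_Mapping.keys f \<Longrightarrow> set w \<subseteq> G) \<Longrightarrow> f \<in> free_on G"
  by (simp add: free_on_def)

lemma free_onD: "f \<in> free_on G \<Longrightarrow> w \<in> Poly_Mapping.keys f \<Longrightarrow> set w \<subseteq> G"
  by (simp add: free_on_def)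

lemma free_on_add: "f \<in> free_on G \<Longrightarrow> g \<in> free_on G \<Longrightarrow> f + g \<in> free_on G"
  by (rule free_onI) (meson Un_iff free_onD keys_add subsetD)

lemma free_on_diff: "f \<in> free_on G \<Longrightarrow> g \<in> free_on G \<Longrightarrow> f - g \<in> free_on G"
  by (rule free_onI) (meson Un_iff free_onD keys_diff_list subsetD)

lemma free_on_mult:
  assumes "f \<in> free_on G" "g \<in> free_on G"
  shows "f * g \<in> free_on G"
proof (rule free_onI)
  fix w assume "w \<in> Poly_Mapping.keys (f * g)"
  then obtain u v where "u \<in> Poly_Mapping.keys f" "v \<in> Poly_Mapping.keys g" "w = u @ v"
    using keys_mult_list by blast
  then show "set w \<subseteq> G" using assms[THEN free_onD] by simp
qed

lemma free_on_sum: "(\<And>x. x \<in> X \<Longrightarrow> f x \<in> free_on G) \<Longrightarrow> sum f X \<in> free_on G"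
  by (induction X rule: infinite_finite_induct) (auto intro: free_on_add)

lemma free_on_prod_list: "(\<And>x. x \<in> set xs \<Longrightarrow> f x \<in> free_on G) \<Longrightarrow> prod_list (map f xs) \<in> free_on G"
  by (induction xs) (auto intro: free_on_mult)

lemma free_on_power: "f \<in> free_on G \<Longrightarrow> f ^ n \<in> free_on G"
  by (induction n) (auto intro: free_on_mult)

lemmas free_on_intros = free_on_add free_on_diff free_on_mult free_on_sum free_on_prod_list free_on_power

subsection \<open>Modules over a free algebra\<close>

definition act :: "('r::comm_ring_1 \<Rightarrow> 'v \<Rightarrow> 'v) \<Rightarrow> ('g \<Rightarrow> 'v \<Rightarrow> 'v) \<Rightarrow> ('g list \<Rightarrow>\<^sub>0 'r) \<Rightarrow> 'v \<Rightarrow> 'v::ab_group_add" where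
  "act sc h f v = (\<Sum>w\<in>Poly_Mapping.keys f. sc (Poly_Mapping.lookup f w) (foldr h w v))"

locale free_module = module sc for sc :: "'r::comm_ring_1 \<Rightarrow> 'v \<Rightarrow> 'v::ab_group_add" +
  fixes h :: "'g \<Rightarrow> 'v \<Rightarrow> 'v"
  assumes letter_add: "\<And>g u v. h g (u + v) = h g u + h g v"
    and letter_scale: "\<And>g r v. h g (sc r v) = sc r (h g v)"
begin

lemma foldr_add: "foldr h w (u + v) = foldr h w u + foldr h w v"
  by (induction w) (simp_all add: letter_add)

lemma foldr_scale: "foldr h w (sc r v) = sc r (foldr h w v)"
  by (induction w) (simp_all add: letter_scale)

lemma act_superset:
  assumes "finite X" "Poly_Mapping.keys f \<subseteq> X"
  shows "act sc h f v = (\<Sum>w\<in>X. sc (Poly_Mapping.lookup f w) (foldr h w v))"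
  unfolding act_def using assms
  by (intro sum.mono_neutral_left) (auto simp: not_in_keys_iff_lookup_eq_zero)

lemma act_0 [simp]: "act sc h 0 v = 0"
  by (simp add: act_def)

lemma act_add: "act sc h (f + g) v = act sc h f v + act sc h g v"
proof -
  let ?X = "Poly_Mapping.keys f \<union> Poly_Mapping.keys g"
  have "act sc h (f + g) v = (\<Sum>w\<in>?X. sc (Poly_Mapping.lookup (f + g) w) (foldr h w v))"
    using keys_add[of f g] by (intro act_superset) auto
  also have "\<dots> = act sc h f v + act sc h g v"
    by (subst (1 2) act_superset[where X = ?X]) (auto simp: lookup_add scale_left_distrib sum.distrib)
  finally show ?thesis .
qed

lemma act_uminus: "act sc h (- f) v = - act sc h f v"
  using act_add[of f "- f" v] by (simp add: eq_neg_iff_add_eq_0 add.commute)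

lemma act_diff: "act sc h (f - g) v = act sc h f v - act sc h g v"
  using act_add[of f "- g" v] by (simp add: act_uminus)

lemma act_sum: "act sc h (\<Sum>x\<in>X. f x) v = (\<Sum>x\<in>X. act sc h (f x) v)"
  by (induction X rule: infinite_finite_induct) (simp_all add: act_add)

lemma act_single: "act sc h (Poly_Mapping.single w r) v = sc r (foldr h w v)"
  by (cases "r = 0") (simp_all add: act_def)

lemma act_scal [simp]: "act sc h (scal r) v = sc r v"
  by (simp add: scal_def act_single)

lemma act_gen [simp]: "act sc h (gen g) v = h g v"
  by (simp add: gen_def act_single)

lemma act_one [simp]: "act sc h 1 v = v"
  by (simp add: one_word act_single)

lemma act_add_right: "act sc h f (u + v) = act sc h f u + act sc h f v"
  by (rule free_induct[where f = f]) (auto simp: act_add act_single foldr_add scale_right_distrib)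

lemma act_zero_right [simp]: "act sc h f 0 = 0"
  using act_add_right[of f 0 0] by simp

lemma act_mult: "act sc h (f * g) v = act sc h f (act sc h g v)"
proof (rule free_induct[where f = f])
  fix w r
  show "act sc h (Poly_Mapping.single w r * g) v = act sc h (Poly_Mapping.single w r) (act sc h g v)"
    by (rule free_induct[where f = g])
      (simp_all add: distrib_left act_add act_add_right single_mult_list act_single foldr_scale)
qed (simp_all add: distrib_right act_add)

lemma act_ideal:
  assumes "\<And>s v. s \<in> S \<Longrightarrow> act sc h s v = 0" and "f \<in> gen_ideal G S"
  shows "act sc h f v = 0"
  using assms(2) by induction (simp_all add: act_add act_mult assms(1))

end

text \<open>The action on another free algebra by left multiplication turns an assignment of letters
  into an algebra homomorphism.\<close>

definition lift :: "('g \<Rightarrow> ('h list \<Rightarrow>\<^sub>0 'r)) \<Rightarrow> ('g list \<Rightarrow>\<^sub>0 'r::comm_ring_1) \<Rightarrow> ('h list \<Rightarrow>\<^sub>0 'r)" where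
  "lift h f = act (\<lambda>r v. scal r * v) (\<lambda>g v. h g * v) f 1"

interpretation left_mult: free_module "\<lambda>r v :: 'h list \<Rightarrow>\<^sub>0 'r::comm_ring_1. scal r * v" "\<lambda>g v. h g * v"
  for h :: "'g \<Rightarrow> ('h list \<Rightarrow>\<^sub>0 'r::comm_ring_1)"
  by unfold_locales
    (simp_all add: distrib_left distrib_right scal_add scal_mult mult.assoc scal_left_comm[of "h _"])

lemma foldr_times: "foldr (\<lambda>g v. h g * v) w v = prod_list (map h w) * (v :: 'h list \<Rightarrow>\<^sub>0 'r::comm_ring_1)"
  by (induction w) (simp_all add: mult.assoc)

lemma lift_sum_keys:
  "lift h f = (\<Sum>w\<in>Poly_Mapping.keys f. scal (Poly_Mapping.lookup f w) * prod_list (map h w))"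
  by (simp add: lift_def act_def foldr_times)

lemma act_left_mult:
  "act (\<lambda>r v. scal r * v) (\<lambda>g v. h g * v) f v = lift h f * v"
  by (simp add: lift_def act_def foldr_times sum_distrib_right mult.assoc)

lemma lift_simps [simp]:
  "lift h 0 = 0" "lift h 1 = 1" "lift h (scal r) = scal r" "lift h (gen g) = h g"
  by (simp_all add: lift_def)

lemma lift_add: "lift h (f + g) = lift h f + lift h g"
  by (simp add: lift_def left_mult.act_add)

lemma lift_diff: "lift h (f - g) = lift h f - lift h g"
  by (simp add: lift_def left_mult.act_diff)

lemma lift_sum: "lift h (\<Sum>x\<in>X. f x) = (\<Sum>x\<in>X. lift h (f x))"
  by (simp add: lift_def left_mult.act_sum)

lemma lift_mult: "lift h (f * g) = lift h f * lift h g"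
proof -
  have "lift h (f * g) = act (\<lambda>r v. scal r * v) (\<lambda>g v. h g * v) f (lift h g)"
    by (simp only: lift_def left_mult.act_mult)
  then show ?thesis by (simp only: act_left_mult)
qed

lemma lift_power: "lift h (f ^ n) = lift h f ^ n"
  by (induction n) (simp_all add: lift_mult)

lemma lift_free_on:
  assumes "\<And>g. h g \<in> free_on G"
  shows "lift h f \<in> free_on G"
  unfolding lift_sum_keys by (intro free_on_intros) (use assms in auto)

lemma tensor_mult_lift: "tensor_mult e = lift (\<lambda>l. case l of TIdem x \<Rightarrow> gen (e x) | TVec f \<Rightarrow> f)"
  by (rule ext) (simp add: tensor_mult_def lift_sum_keys)

subsection \<open>Congruence modulo an ideal\<close>

abbreviation ideal :: "('g list \<Rightarrow>\<^sub>0 'r::comm_ring_1) set \<Rightarrow> ('g list \<Rightarrow>\<^sub>0 'r) set" where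
  "ideal S \<equiv> gen_ideal UNIV S"

definition cgr :: "('g list \<Rightarrow>\<^sub>0 'r::comm_ring_1) \<Rightarrow> ('g list \<Rightarrow>\<^sub>0 'r) set \<Rightarrow> ('g list \<Rightarrow>\<^sub>0 'r) \<Rightarrow> bool"
    (\<open>(_ \<simeq>[_]/ _)\<close> [51, 0, 51] 50) where
  "(f \<simeq>[S] g) \<longleftrightarrow> f - g \<in> ideal S"

lemma ideal_base: "s \<in> S \<Longrightarrow> s \<in> ideal S"
  using gen_ideal.mult[of s S 1 UNIV 1] by simp

lemma free_on_UNIV [simp]: "free_on UNIV = UNIV"
  by (simp add: free_on_def)

lemma ideal_mult_left: "f \<in> ideal S \<Longrightarrow> a * f \<in> ideal S"
proof (induction rule: gen_ideal.induct)
  case (mult s b c)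
  then show ?case using gen_ideal.mult[of s S "a * b" UNIV c] by (simp add: mult.assoc)
qed (auto simp: distrib_left intro: gen_ideal.intros)

lemma ideal_mult_right: "f \<in> ideal S \<Longrightarrow> f * a \<in> ideal S"
proof (induction rule: gen_ideal.induct)
  case (mult s b c)
  then show ?case using gen_ideal.mult[of s S b UNIV "c * a"] by (simp add: mult.assoc)
qed (auto simp: distrib_right intro: gen_ideal.intros)

lemma ideal_uminus: "f \<in> ideal S \<Longrightarrow> - f \<in> ideal S"
  using ideal_mult_left[of f S "- 1"] by simp

lemma ideal_diff: "f \<in> ideal S \<Longrightarrow> g \<in> ideal S \<Longrightarrow> f - g \<in> ideal S"
  using gen_ideal.add[of f UNIV S "- g"] by (simp add: ideal_uminus)

lemma ideal_sum: "(\<And>x. x \<in> X \<Longrightarrow> f x \<in> ideal S) \<Longrightarrow> sum f X \<in> ideal S"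
  by (induction X rule: infinite_finite_induct) (auto intro: gen_ideal.intros)

lemma gen_ideal_mono: "f \<in> gen_ideal G S \<Longrightarrow> G \<subseteq> G' \<Longrightarrow> S \<subseteq> S' \<Longrightarrow> f \<in> gen_ideal G' S'"
proof (induction rule: gen_ideal.induct)
  case (mult s a b)
  then have "a \<in> free_on G'" "b \<in> free_on G'" by (meson free_onI free_onD subset_trans)+
  with mult show ?case by (intro gen_ideal.mult) auto
qed (auto intro: gen_ideal.intros)

lemma lift_ideal:
  assumes "\<And>s. s \<in> S \<Longrightarrow> lift h s \<in> ideal S'" and "f \<in> gen_ideal G S"
  shows "lift h f \<in> ideal S'"
  using assms(2)
  by induction (auto simp: lift_add lift_mult intro: gen_ideal.intros ideal_mult_left ideal_mult_right assms(1))

text \<open>Killing all letters outside \<open>G\<close> shows that coefficients in superfluous letters do not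
  enlarge the ideal.\<close>

lemma gen_ideal_restrict:
  assumes "f \<in> ideal S" "S \<subseteq> free_on G" "f \<in> free_on G"
  shows "f \<in> gen_ideal G S"
proof -
  define \<kappa> where "\<kappa> = (\<lambda>g. if g \<in> G then gen g else 0 :: 'a list \<Rightarrow>\<^sub>0 'b)"
  have fix_word: "prod_list (map \<kappa> w) = word w" if "set w \<subseteq> G" for w
    using that by (induction w) (simp_all add: one_word word_Cons \<kappa>_def)
  have fixed: "lift \<kappa> k = k" if "k \<in> free_on G" for k
  proof -
    have "lift \<kappa> k = (\<Sum>w\<in>Poly_Mapping.keys k. Poly_Mapping.single w (Poly_Mapping.lookup k w))"
      unfolding lift_sum_keys
      by (rule sum.cong) (simp_all add: fix_word[OF free_onD[OF that]] scal_mult_single)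
    also have "\<dots> = k" by (rule free_expand[symmetric])
    finally show ?thesis .
  qed
  have in_G: "lift \<kappa> k \<in> free_on G" for k
    by (rule lift_free_on) (simp add: \<kappa>_def)
  from assms(1) have "lift \<kappa> f \<in> gen_ideal G S"
  proof induction
    case (mult s a b)
    then have "lift \<kappa> s = s" using assms(2) fixed by auto
    then show ?case using mult(1) in_G by (auto simp: lift_mult intro!: gen_ideal.mult)
  qed (auto simp: lift_add intro: gen_ideal.intros)
  then show ?thesis using fixed assms(3) by simp
qed

lemma cgr_refl [simp]: "f \<simeq>[S] f"
  by (simp add: cgr_def gen_ideal.zero)

lemma cgr_sym: "f \<simeq>[S] g \<Longrightarrow> g \<simeq>[S] f"
  unfolding cgr_def using ideal_uminus[of "f - g" S] by simp

lemma cgr_trans [trans]: "f \<simeq>[S] g \<Longrightarrow> g \<simeq>[S] k \<Longrightarrow> f \<simeq>[S] k"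
  unfolding cgr_def using gen_ideal.add[of "f - g" UNIV S "g - k"] by simp

lemma cgr_add: "f \<simeq>[S] g \<Longrightarrow> f' \<simeq>[S] g' \<Longrightarrow> f + f' \<simeq>[S] g + g'"
  unfolding cgr_def using gen_ideal.add[of "f - g" UNIV S "f' - g'"] by (simp add: algebra_simps)

lemma cgr_left: "f \<simeq>[S] g \<Longrightarrow> a * f \<simeq>[S] a * g"
  unfolding cgr_def using ideal_mult_left[of "f - g" S a] by (simp add: right_diff_distrib)

lemma cgr_right: "f \<simeq>[S] g \<Longrightarrow> f * a \<simeq>[S] g * a"
  unfolding cgr_def using ideal_mult_right[of "f - g" S a] by (simp add: left_diff_distrib)

lemma cgr_mult: "f \<simeq>[S] g \<Longrightarrow> f' \<simeq>[S] g' \<Longrightarrow> f * f' \<simeq>[S] g * g'"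
  using cgr_left[of f' S g' g] cgr_right[of f S g f'] by (rule cgr_trans[rotated])

lemma cgr_sum: "(\<And>x. x \<in> X \<Longrightarrow> f x \<simeq>[S] g x) \<Longrightarrow> sum f X \<simeq>[S] sum g X"
  by (induction X rule: infinite_finite_induct) (auto intro: cgr_add)

lemma cgr_0: "f \<simeq>[S] 0 \<longleftrightarrow> f \<in> ideal S"
  by (simp add: cgr_def)

lemma cgr_ideal: "f \<simeq>[S] g \<Longrightarrow> f \<in> ideal S \<longleftrightarrow> g \<in> ideal S"
  by (metis cgr_0 cgr_sym cgr_trans)

lemma cgr_mono: "f \<simeq>[S] g \<Longrightarrow> S \<subseteq> S' \<Longrightarrow> f \<simeq>[S'] g"
  unfolding cgr_def by (meson gen_ideal_mono order_refl)

lemma cgr_base: "f - g \<in> S \<Longrightarrow> f \<simeq>[S] g"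
  unfolding cgr_def by (rule ideal_base)

lemma cgr_eq_trans [trans]: "f = g \<Longrightarrow> g \<simeq>[S] k \<Longrightarrow> f \<simeq>[S] k" "f \<simeq>[S] g \<Longrightarrow> g = k \<Longrightarrow> f \<simeq>[S] k"
  by auto

subsection \<open>Finite linear combinations up to congruence\<close>

text \<open>The families in question are infinite, but every element involves finitely many members; the
  coefficients are kept implicit so that spanning statements can be composed.\<close>

definition spanned :: "('g list \<Rightarrow>\<^sub>0 'r::comm_ring_1) set \<Rightarrow> 'i set \<Rightarrow> ('i \<Rightarrow> ('g list \<Rightarrow>\<^sub>0 'r)) \<Rightarrow> ('g list \<Rightarrow>\<^sub>0 'r) \<Rightarrow> bool" where
  "spanned S Idx B f \<longleftrightarrow> (\<exists>X r. finite X \<and> X \<subseteq> Idx \<and> f \<simeq>[S] (\<Sum>i\<in>X. scal (r i) * B i))"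

lemma spanned_cgr: "spanned S Idx B f \<Longrightarrow> g \<simeq>[S] f \<Longrightarrow> spanned S Idx B g"
  unfolding spanned_def using cgr_trans[of g S f] by blast

lemma spanned_0: "spanned S Idx B 0"
  unfolding spanned_def by (intro exI[of _ "{}"]) simp

lemma spanned_base: "i \<in> Idx \<Longrightarrow> spanned S Idx B (B i)"
  unfolding spanned_def by (intro exI[of _ "{i}"] exI[of _ "\<lambda>_. 1"]) simp

lemma spanned_scal:
  assumes "spanned S Idx B f"
  shows "spanned S Idx B (scal a * f)"
proof -
  obtain X r where X: "finite X" "X \<subseteq> Idx" "f \<simeq>[S] (\<Sum>i\<in>X. scal (r i) * B i)"
    using assms unfolding spanned_def by blast
  have "scal a * f \<simeq>[S] scal a * (\<Sum>i\<in>X. scal (r i) * B i)"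
    by (intro cgr_left X)
  also have "\<dots> = (\<Sum>i\<in>X. scal (a * r i) * B i)"
    by (simp only: sum_distrib_left scal_mult mult.assoc)
  finally show ?thesis unfolding spanned_def using X by (intro exI[of _ X] exI[of _ "\<lambda>i. a * r i"]) simp
qed

lemma spanned_add: 
  assumes "spanned S Idx B f" "spanned S Idx B g"
  shows "spanned S Idx B (f + g)"
proof -
  obtain X r where 1: "finite X" "X \<subseteq> Idx" "f \<simeq>[S] (\<Sum>i\<in>X. scal (r i) * B i)"
    using assms(1) unfolding spanned_def by blast
  obtain Y s where 2: "finite Y" "Y \<subseteq> Idx" "g \<simeq>[S] (\<Sum>i\<in>Y. scal (s i) * B i)"
    using assms(2) unfolding spanned_def by blast
  let ?r = "\<lambda>i. (if i \<in> X then r i else 0) + (if i \<in> Y then s i else 0)"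
  have "(\<Sum>i\<in>X. scal (r i) * B i) = (\<Sum>i\<in>X \<union> Y. scal (if i \<in> X then r i else 0) * B i)"
    using 1 2 by (intro sum.mono_neutral_cong_left) auto
  moreover have "(\<Sum>i\<in>Y. scal (s i) * B i) = (\<Sum>i\<in>X \<union> Y. scal (if i \<in> Y then s i else 0) * B i)"
    using 1 2 by (intro sum.mono_neutral_cong_left) auto
  ultimately have "f + g \<simeq>[S] (\<Sum>i\<in>X \<union> Y. scal (?r i) * B i)"
    using cgr_add[OF 1(3) 2(3)] by (simp add: sum.distrib scal_add distrib_right)
  with 1 2 show ?thesis unfolding spanned_def
    by (intro exI[of _ "X \<union> Y"] exI[of _ ?r]) auto
qed

lemma spanned_sum: "(\<And>x. x \<in> X \<Longrightarrow> spanned S Idx B (f x)) \<Longrightarrow> spanned S Idx B (sum f X)"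
  by (induction X rule: infinite_finite_induct) (auto intro: spanned_0 spanned_add)

text \<open>Multiplying a spanning family from both sides: with one factor a letter, this is the step by
  which words are rewritten from one end.\<close>

lemma spanned_trans:
  assumes "spanned S Idx B f" and "\<And>i. i \<in> Idx \<Longrightarrow> spanned S Idx' B' (a * B i * b)"
  shows "spanned S Idx' B' (a * f * b)"
proof -
  obtain X r where X: "finite X" "X \<subseteq> Idx" "f \<simeq>[S] (\<Sum>i\<in>X. scal (r i) * B i)"
    using assms(1) unfolding spanned_def by blast
  have "a * f * b \<simeq>[S] a * (\<Sum>i\<in>X. scal (r i) * B i) * b"
    by (intro cgr_mult cgr_refl X)
  also have "\<dots> = (\<Sum>i\<in>X. scal (r i) * (a * B i * b))"
    by (simp add: sum_distrib_left sum_distrib_right scal_left_comm[of a] mult.assoc)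
  finally show ?thesis
    by (rule spanned_cgr[rotated]) (use X assms(2) in \<open>intro spanned_sum spanned_scal, auto\<close>)
qed

lemma spanned_free:
  assumes "\<And>w. w \<in> Poly_Mapping.keys f \<Longrightarrow> spanned S Idx B (word w)"
  shows "spanned S Idx B f"
proof (rule free_induct[where f = f])
  fix w r assume "w \<in> Poly_Mapping.keys f"
  from spanned_scal[OF assms[OF this], of r]
  show "spanned S Idx B (Poly_Mapping.single w r)" by (simp add: scal_mult_single)
qed (auto intro: spanned_0 spanned_add)

section \<open>Path bases of tensor algebras and a criterion for quadratic duality\<close>

definition full_rels :: "('g, 'r::comm_ring_1) presentation \<Rightarrow> ('g list \<Rightarrow>\<^sub>0 'r) set" where
  "full_rels P = rels P \<union> {gen z * gen g - gen g * gen z | z g. z \<in> central P \<and> g \<in> central P \<union> gens P}"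

text \<open>The ideal splits into a condition on the occurring letters and membership in the two-sided
  ideal of the whole free algebra; all later computations take place in the latter.\<close>

lemma alg_ideal_iff:
  assumes "rels P \<subseteq> free_on (central P \<union> gens P)"
  shows "f \<in> alg_ideal P \<longleftrightarrow> f \<in> free_on (central P \<union> gens P) \<and> f \<in> ideal (full_rels P)"
proof -
  let ?G = "central P \<union> gens P"
  have sub: "full_rels P \<subseteq> free_on ?G"
    using assms unfolding full_rels_def by (auto intro!: free_on_diff free_on_mult)
  have "f \<in> free_on ?G" if "f \<in> gen_ideal ?G (full_rels P)"
    using that by induction (use sub in \<open>auto intro: free_on_add free_on_mult\<close>)
  then show ?thesis
    unfolding alg_ideal_def full_rels_def[symmetric]
    using gen_ideal_mono[of f ?G "full_rels P" UNIV "full_rels P"] gen_ideal_restrict[OF _ sub] by auto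
qed

lemma elems_free_on: "f \<in> elems P \<Longrightarrow> f \<in> free_on (central P \<union> gens P)"
  by (simp add: elems_def free_on_def)

lemma partI: "(\<And>w. w \<in> Poly_Mapping.keys f \<Longrightarrow> set w \<subseteq> central P \<union> gens P \<and> set w \<inter> gens P \<noteq> {}
    \<and> sum_list (map (deg P) w) = k) \<Longrightarrow> f \<in> part P k"
  by (simp add: part_def elems_def)

lemma partD: "f \<in> part P k \<Longrightarrow> w \<in> Poly_Mapping.keys f \<Longrightarrow> set w \<subseteq> central P \<union> gens P \<and> set w \<inter> gens P \<noteq> {}
    \<and> sum_list (map (deg P) w) = k"
  by (simp add: part_def elems_def)

lemma part_elems: "f \<in> part P k \<Longrightarrow> f \<in> elems P"
  by (simp add: part_def)

lemma part_free_on: "f \<in> part P k \<Longrightarrow> f \<in> free_on (central P \<union> gens P)"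
  by (simp add: part_elems elems_free_on)

lemma part_0 [simp]: "0 \<in> part P k"
  by (rule partI) simp

lemma part_add: "f \<in> part P k \<Longrightarrow> g \<in> part P k \<Longrightarrow> f + g \<in> part P k"
  using keys_add[of f g] unfolding part_def elems_def by blast

lemma part_scal: "f \<in> part P k \<Longrightarrow> scal r * f \<in> part P k"
  using keys_scal_mult[of r f] unfolding part_def elems_def by blast

lemma part_diff: "f \<in> part P k \<Longrightarrow> g \<in> part P k \<Longrightarrow> f - g \<in> part P k"
  using keys_diff_list[of f g] unfolding part_def elems_def by blast

lemma part_sum: "(\<And>x. x \<in> X \<Longrightarrow> f x \<in> part P k) \<Longrightarrow> sum f X \<in> part P k"
  by (induction X rule: infinite_finite_induct) (auto intro: part_add)

lemma part_gen: "g \<in> gens P \<Longrightarrow> deg P g = k \<Longrightarrow> gen g \<in> part P k"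
  by (rule partI) simp

lemma part_mult:
  assumes "f \<in> part P k" "g \<in> part P m"
  shows "f * g \<in> part P (k + m)"
proof (rule partI)
  fix w assume "w \<in> Poly_Mapping.keys (f * g)"
  then obtain u v where uv: "u \<in> Poly_Mapping.keys f" "v \<in> Poly_Mapping.keys g" "w = u @ v"
    using keys_mult_list by blast
  with partD[OF assms(1) uv(1)] partD[OF assms(2) uv(2)]
  show "set w \<subseteq> central P \<union> gens P \<and> set w \<inter> gens P \<noteq> {} \<and> sum_list (map (deg P) w) = k + m"
    by auto
qed

lemma elems_mult_left:
  assumes "f \<in> free_on (central P \<union> gens P)" "g \<in> elems P"
  shows "f * g \<in> elems P"
  unfolding elems_def
proof (intro CollectI ballI)
  fix w assume "w \<in> Poly_Mapping.keys (f * g)"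
  then obtain u v where uv: "u \<in> Poly_Mapping.keys f" "v \<in> Poly_Mapping.keys g" "w = u @ v"
    using keys_mult_list by blast
  with free_onD[OF assms(1) uv(1)] assms(2)
  show "set w \<subseteq> central P \<union> gens P \<and> set w \<inter> gens P \<noteq> {}"
    by (auto simp: elems_def)
qed

lemma elems_0 [simp]: "0 \<in> elems P"
  by (simp add: elems_def)

lemma elems_add: "f \<in> elems P \<Longrightarrow> g \<in> elems P \<Longrightarrow> f + g \<in> elems P"
  using keys_add[of f g] unfolding elems_def by blast

subsection \<open>Pairings of finitely supported families\<close>

text \<open>The sum runs over the support of the first argument only, so that additivity in the second
  argument needs no finiteness.\<close>

definition fpair :: "('i \<Rightarrow> 'r::comm_ring_1) \<Rightarrow> ('i \<Rightarrow> 'r) \<Rightarrow> 'r" where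
  "fpair a b = (\<Sum>i | a i \<noteq> 0. a i * b i)"

lemma fpair_superset:
  assumes "finite X" "\<And>i. a i \<noteq> 0 \<Longrightarrow> i \<in> X"
  shows "fpair a b = (\<Sum>i\<in>X. a i * b i)"
  unfolding fpair_def using assms by (intro sum.mono_neutral_left) auto

lemma fpair_add_left:
  assumes "finite {i. a i \<noteq> 0}" "finite {i. a' i \<noteq> 0}"
  shows "fpair (\<lambda>i. a i + a' i) b = fpair a b + fpair a' b"
proof -
  let ?X = "{i. a i \<noteq> 0} \<union> {i. a' i \<noteq> 0}"
  have "finite ?X" using assms by simp
  note * = fpair_superset[OF this]
  have "fpair (\<lambda>i. a i + a' i) b = (\<Sum>i\<in>?X. (a i + a' i) * b i)" by (rule *) auto
  moreover have "fpair a b = (\<Sum>i\<in>?X. a i * b i)" by (rule *) auto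
  moreover have "fpair a' b = (\<Sum>i\<in>?X. a' i * b i)" by (rule *) auto
  ultimately show ?thesis by (simp add: distrib_right sum.distrib)
qed

lemma fpair_scale_left:
  assumes "finite {i. a i \<noteq> 0}"
  shows "fpair (\<lambda>i. r * a i) b = r * fpair a b"
  by (subst fpair_superset[OF assms]) (auto simp: fpair_def sum_distrib_left mult.assoc)

lemma fpair_add_right: "fpair a (\<lambda>i. b i + b' i) = fpair a b + fpair a b'"
  by (simp add: fpair_def distrib_left sum.distrib)

lemma fpair_scale_right: "fpair a (\<lambda>i. r * b i) = r * fpair a b"
  by (simp add: fpair_def sum_distrib_left mult.left_commute)

lemma fpair_zero [simp]: "fpair (\<lambda>i. 0) b = 0" "fpair a (\<lambda>i. 0) = 0"
  by (simp_all add: fpair_def)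

subsection \<open>Presentations generated by a quiver in low degree\<close>

text \<open>The vertices are the idempotents \<open>e x\<close> and the arrows \<open>ar x y\<close> run from \<open>y\<close> to \<open>x\<close>. The
  functionals \<open>\<kappa>\<close> witness that vertices and arrows are linearly independent modulo the relations.\<close>

locale quiver_pres =
  fixes P :: "('g, 'r::comm_ring_1) presentation" and L :: "'x set" and e :: "'x \<Rightarrow> 'g"
    and adj :: "'x \<Rightarrow> 'x \<Rightarrow> bool" and ar :: "'x \<Rightarrow> 'x \<Rightarrow> 'g"
    and \<kappa> :: "'x \<Rightarrow> 'x \<Rightarrow> ('g list \<Rightarrow>\<^sub>0 'r) \<Rightarrow> 'r"
  assumes rels_free: "rels P \<subseteq> free_on (central P \<union> gens P)"
    and adj_L: "\<And>x y. adj x y \<Longrightarrow> x \<in> L \<and> y \<in> L"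
    and finite_mid: "\<And>x u. finite {y. adj x y \<and> adj y u}"
    and central_deg: "\<And>z. z \<in> central P \<Longrightarrow> deg P z \<ge> 2"
    and deg0: "\<And>g. g \<in> gens P \<Longrightarrow> deg P g = 0 \<Longrightarrow> \<exists>x\<in>L. gen g \<simeq>[full_rels P] gen (e x)"
    and deg1: "\<And>g. g \<in> gens P \<Longrightarrow> deg P g = 1 \<Longrightarrow> \<exists>x y. adj x y \<and> gen g \<simeq>[full_rels P] gen (ar x y)"
    and e_gens: "\<And>x. x \<in> L \<Longrightarrow> e x \<in> gens P \<and> deg P (e x) = 0"
    and ar_gens: "\<And>x y. adj x y \<Longrightarrow> ar x y \<in> gens P \<and> deg P (ar x y) = 1"
    and idem: "\<And>x y. x \<in> L \<Longrightarrow> y \<in> L \<Longrightarrow>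
      gen (e x) * gen (e y) \<simeq>[full_rels P] (if x = y then gen (e x) else 0)"
    and ar_left: "\<And>x y. adj x y \<Longrightarrow> gen (e x) * gen (ar x y) \<simeq>[full_rels P] gen (ar x y)"
    and ar_right: "\<And>x y. adj x y \<Longrightarrow> gen (ar x y) * gen (e y) \<simeq>[full_rels P] gen (ar x y)"
    and kappa_add: "\<And>x y f g. \<kappa> x y (f + g) = \<kappa> x y f + \<kappa> x y g"
    and kappa_scal: "\<And>x y r f. \<kappa> x y (scal r * f) = r * \<kappa> x y f"
    and kappa_ideal: "\<And>x y f. f \<in> ideal (full_rels P) \<Longrightarrow> \<kappa> x y f = 0"
    and kappa_idem: "\<And>x y. x \<in> L \<Longrightarrow> y \<in> L \<Longrightarrow> \<kappa> x x (gen (e y)) = (if x = y then 1 else 0)"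
    and kappa_arrow: "\<And>x y x' y'. adj x y \<Longrightarrow> adj x' y' \<Longrightarrow>
      \<kappa> x y (gen (ar x' y')) = (if x = x' \<and> y = y' then 1 else 0)"
begin

abbreviation "I \<equiv> full_rels P"
abbreviation "G \<equiv> central P \<union> gens P"
abbreviation "arrow \<equiv> \<lambda>(x, y). gen (ar x y) :: 'g list \<Rightarrow>\<^sub>0 'r"
abbreviation "Arr \<equiv> {(x, y). adj x y}"
abbreviation "M x u \<equiv> {y. adj x y \<and> adj y u}"

lemmas in_alg_ideal = alg_ideal_iff[OF rels_free]

lemma kappa_sum: "\<kappa> x y (\<Sum>i\<in>X. f i) = (\<Sum>i\<in>X. \<kappa> x y (f i))"
  using kappa_ideal[OF gen_ideal.zero]
  by (induction X rule: infinite_finite_induct) (simp_all add: kappa_add)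

lemma kappa_cgr: "f \<simeq>[I] g \<Longrightarrow> \<kappa> x y f = \<kappa> x y g"
  using kappa_add[of x y "f - g" g] kappa_ideal[of "f - g" x y] by (simp add: cgr_def)

lemma e_arrow:
  assumes "z \<in> L" "adj x y"
  shows "gen (e z) * gen (ar x y) \<simeq>[I] (if z = x then gen (ar x y) else 0)"
proof -
  have "gen (e z) * gen (ar x y) \<simeq>[I] gen (e z) * (gen (e x) * gen (ar x y))"
    by (intro cgr_left cgr_sym[OF ar_left] assms)
  also have "\<dots> = gen (e z) * gen (e x) * gen (ar x y)" by (simp add: mult.assoc)
  also have "\<dots> \<simeq>[I] (if z = x then gen (e z) else 0) * gen (ar x y)"
    using assms adj_L by (intro cgr_right idem) auto
  also have "\<dots> \<simeq>[I] (if z = x then gen (ar x y) else 0)"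
    using ar_left assms by auto
  finally show ?thesis .
qed

lemma arrow_e:
  assumes "z \<in> L" "adj x y"
  shows "gen (ar x y) * gen (e z) \<simeq>[I] (if z = y then gen (ar x y) else 0)"
proof -
  have "gen (ar x y) * gen (e z) \<simeq>[I] gen (ar x y) * gen (e y) * gen (e z)"
    by (intro cgr_right cgr_sym[OF ar_right] assms)
  also have "\<dots> = gen (ar x y) * (gen (e y) * gen (e z))" by (simp add: mult.assoc)
  also have "\<dots> \<simeq>[I] gen (ar x y) * (if y = z then gen (e y) else 0)"
    using assms adj_L by (intro cgr_left idem) auto
  also have "\<dots> \<simeq>[I] (if z = y then gen (ar x y) else 0)"
    using ar_right assms by auto
  finally show ?thesis .
qed

text \<open>A central generator has degree at least two, so a word of degree zero consists of vertices,
  whose products are vertices or zero. The same argument with a single letter of degree one gives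
  the next lemma.\<close>

lemma spanned_word0:
  assumes "w \<noteq> []" "set w \<subseteq> G" "sum_list (map (deg P) w) = 0"
  shows "spanned I L (\<lambda>x. gen (e x)) (word w)"
  using assms
proof (induction w)
  case (Cons g w)
  then have "g \<in> gens P" "deg P g = 0" using central_deg[of g] by auto
  then obtain x where x: "x \<in> L" "gen g \<simeq>[I] gen (e x)" using deg0 by blast
  show ?case
  proof (cases "w = []")
    case True
    show ?thesis
      by (rule spanned_cgr[OF spanned_base[OF x(1)]]) (use x True in \<open>simp add: gen_def\<close>)
  next
    case False
    then have IH: "spanned I L (\<lambda>x. gen (e x)) (word w)" using Cons by auto
    have "spanned I L (\<lambda>x. gen (e x)) (gen (e x) * gen (e y) * 1)" if "y \<in> L" for y
      unfolding mult_1_right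
      by (rule spanned_cgr[OF _ idem[OF x(1) that]]) (use x(1) spanned_base in \<open>auto intro: spanned_0\<close>)
    from spanned_trans[OF IH this] have "spanned I L (\<lambda>x. gen (e x)) (gen (e x) * word w * 1)" by simp
    then show ?thesis
      unfolding word_Cons by (rule spanned_cgr) (simp add: cgr_right[OF x(2)])
  qed
qed simp

lemma spanned_word1:
  assumes "set w \<subseteq> G" "sum_list (map (deg P) w) = 1"
  shows "spanned I Arr arrow (word w)"
  using assms
proof (induction w)
  case (Cons g w)
  then have g: "g \<in> gens P" using central_deg[of g] by auto
  have "deg P g + sum_list (map (deg P) w) = 1" using Cons.prems(2) by simp
  then consider "deg P g = 0" "sum_list (map (deg P) w) = 1" | "deg P g = 1" "sum_list (map (deg P) w) = 0"
    by linarith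
  then show ?case
  proof cases
    case 1
    then have IH: "spanned I Arr arrow (word w)" using Cons by auto
    obtain x where x: "x \<in> L" "gen g \<simeq>[I] gen (e x)" using deg0 g 1 by blast
    have "spanned I Arr arrow (gen (e x) * arrow p * 1)" if pA: "p \<in> Arr" for p
    proof -
      obtain y z where p: "p = (y, z)" "adj y z" using pA by auto
      show ?thesis using spanned_base[of p Arr I arrow] pA p unfolding mult_1_right p(1) prod.case
        by (intro spanned_cgr[OF _ e_arrow[OF x(1) p(2)]]) (auto intro: spanned_0)
    qed
    from spanned_trans[OF IH this] have "spanned I Arr arrow (gen (e x) * word w * 1)" by simp
    then show ?thesis
      unfolding word_Cons by (rule spanned_cgr) (simp add: cgr_right[OF x(2)])
  next
    case 2
    obtain x y where x: "adj x y" "gen g \<simeq>[I] gen (ar x y)" using deg1 g 2 by blast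
    have base: "spanned I Arr arrow (gen (ar x y))"
      using spanned_base[of "(x, y)" Arr I arrow] x by simp
    show ?thesis
    proof (cases "w = []")
      case True
      show ?thesis
        by (rule spanned_cgr[OF base]) (use x True in \<open>simp add: gen_def\<close>)
    next
      case False
      then have IH: "spanned I L (\<lambda>x. gen (e x)) (word w)" using spanned_word0 Cons 2 by auto
      have "spanned I Arr arrow (gen (ar x y) * gen (e z) * 1)" if "z \<in> L" for z
        unfolding mult_1_right
        by (rule spanned_cgr[OF _ arrow_e[OF that x(1)]]) (use base in \<open>auto intro: spanned_0\<close>)
      from spanned_trans[OF IH this] have "spanned I Arr arrow (gen (ar x y) * word w * 1)" by simp
      then show ?thesis
        unfolding word_Cons by (rule spanned_cgr) (simp add: cgr_right[OF x(2)])
    qed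
  qed
qed simp

text \<open>The functionals \<open>\<kappa> x x\<close> separate the vertices that span the part of degree zero.\<close>

lemma degree_zero: "degree_zero_part_is_B P L e"
  unfolding degree_zero_part_is_B_def
proof (intro conjI ballI allI impI)
  fix x assume "x \<in> L"
  then show "gen (e x) \<in> part P 0" by (simp add: part_gen e_gens)
next
  fix x y assume "x \<in> L" "y \<in> L"
  then show "gen (e x) * gen (e y) - (if x = y then gen (e x) else 0) \<in> alg_ideal P"
    using idem[of x y] e_gens by (auto simp: in_alg_ideal cgr_def intro!: free_on_intros)
next
  fix f assume f: "f \<in> part P 0"
  have "spanned I L (\<lambda>x. gen (e x)) f"
  proof (rule spanned_free)
    fix w assume "w \<in> Poly_Mapping.keys f"
    from partD[OF f this] show "spanned I L (\<lambda>x. gen (e x)) (word w)"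
      by (intro spanned_word0) auto
  qed
  then obtain X r where X: "finite X" "X \<subseteq> L" "f \<simeq>[I] (\<Sum>x\<in>X. scal (r x) * gen (e x))"
    unfolding spanned_def by blast
  have "f - (\<Sum>x\<in>X. scal (r x) * gen (e x)) \<in> free_on G"
    using X part_free_on[OF f] e_gens by (intro free_on_intros) auto
  with X show "\<exists>X r. finite X \<and> X \<subseteq> L \<and> f - (\<Sum>x\<in>X. scal (r x) * gen (e x)) \<in> alg_ideal P"
    unfolding in_alg_ideal cgr_def by blast
next
  fix X and r :: "'x \<Rightarrow> 'r" and x
  assume X: "finite X \<and> X \<subseteq> L \<and> (\<Sum>x\<in>X. scal (r x) * gen (e x)) \<in> alg_ideal P" and x: "x \<in> X"
  then have "\<kappa> x x (\<Sum>y\<in>X. scal (r y) * gen (e y)) = 0"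
    by (intro kappa_ideal) (simp add: in_alg_ideal)
  moreover have "\<kappa> x x (\<Sum>y\<in>X. scal (r y) * gen (e y)) = (\<Sum>y\<in>X. if x = y then r y else 0)"
    unfolding kappa_sum kappa_scal using X x by (intro sum.cong) (auto simp: kappa_idem subset_iff)
  ultimately show "r x = 0" using X x by simp
qed

subsection \<open>Coefficients in degree one\<close>

definition coef :: "('g list \<Rightarrow>\<^sub>0 'r) \<Rightarrow> 'x \<times> 'x \<Rightarrow> 'r" where
  "coef f = (\<lambda>(x, y). if adj x y then \<kappa> x y f else 0)"

lemma coef_add: "coef (f + g) = (\<lambda>i. coef f i + coef g i)"
  and coef_scal: "coef (scal r * f) = (\<lambda>i. r * coef f i)"
  by (auto simp: coef_def kappa_add kappa_scal fun_eq_iff)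

lemma coef_ideal: "f \<in> ideal I \<Longrightarrow> coef f = (\<lambda>i. 0)"
  by (auto simp: coef_def kappa_ideal fun_eq_iff)

lemma coef_arrow: "adj x y \<Longrightarrow> coef (gen (ar x y)) = (\<lambda>i. if i = (x, y) then 1 else 0)"
  by (auto simp: coef_def kappa_arrow fun_eq_iff)

lemma arrow_expand:
  assumes "f \<in> part P 1"
  obtains X where "finite X" "X \<subseteq> Arr" "f \<simeq>[I] (\<Sum>p\<in>X. scal (coef f p) * arrow p)"
    "\<And>p. coef f p \<noteq> 0 \<Longrightarrow> p \<in> X"
proof -
  have "spanned I Arr arrow f"
    by (rule spanned_free) (use partD[OF assms] in \<open>auto intro!: spanned_word1\<close>)
  then obtain X r where X: "finite X" "X \<subseteq> Arr" "f \<simeq>[I] (\<Sum>p\<in>X. scal (r p) * arrow p)"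
    unfolding spanned_def by blast
  have c: "coef f p = (if p \<in> X then r p else 0)" for p
  proof (cases "p \<in> Arr")
    case True
    then obtain x y where p: "p = (x, y)" "adj x y" by auto
    have "coef f p = (\<Sum>q\<in>X. r q * \<kappa> x y (arrow q))"
      using p by (simp add: coef_def kappa_cgr[OF X(3)] kappa_sum kappa_scal)
    also have "\<dots> = (\<Sum>q\<in>X. if p = q then r q else 0)"
    proof (rule sum.cong[OF refl])
      fix q assume "q \<in> X"
      then obtain a b where q: "q = (a, b)" "adj a b" using X(2) by auto
      show "r q * \<kappa> x y (arrow q) = (if p = q then r q else 0)"
        using p(2) q by (simp add: p(1) kappa_arrow)
    qed
    finally show ?thesis using X(1) by simp
  qed (use X(2) in \<open>auto simp: coef_def\<close>)
  show thesis
  proof (rule that[OF X(1,2)])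
    show "f \<simeq>[I] (\<Sum>p\<in>X. scal (coef f p) * arrow p)"
      using X(3) by (simp add: c)
  qed (simp add: c split: if_splits)
qed

lemma finite_coef: "f \<in> part P 1 \<Longrightarrow> finite {p. coef f p \<noteq> 0}"
proof -
  assume "f \<in> part P 1"
  then obtain X where X: "finite X" "\<And>p. coef f p \<noteq> 0 \<Longrightarrow> p \<in> X"
    by (rule arrow_expand) (rule that)
  show ?thesis by (rule finite_subset[OF _ X(1)]) (simp add: subset_iff X(2))
qed

lemma part_arrow: "p \<in> Arr \<Longrightarrow> arrow p \<in> part P 1"
  by (auto simp: ar_gens intro!: part_gen)

lemma part_e_left: "x \<in> L \<Longrightarrow> f \<in> part P 1 \<Longrightarrow> gen (e x) * f \<in> part P 1"
  using part_mult[of "gen (e x)" P 0 f 1] by (simp add: part_gen e_gens)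

lemma part_e_right: "x \<in> L \<Longrightarrow> f \<in> part P 1 \<Longrightarrow> f * gen (e x) \<in> part P 1"
  using part_mult[of f P 1 "gen (e x)" 0] by (simp add: part_gen e_gens)

lemma coef_sum: "coef (\<Sum>i\<in>X. f i) p = (\<Sum>i\<in>X. coef (f i) p)"
  by (auto simp: coef_def kappa_sum split: prod.split)

lemma coef_cgr: "f \<simeq>[I] g \<Longrightarrow> coef f = coef g"
  by (auto simp: coef_def kappa_cgr fun_eq_iff)

text \<open>Coefficients are compatible with the action of vertices, which is what makes them descend to
  tensors over the sum of the copies of the ground ring.\<close>

lemma coef_e_left:
  assumes "z \<in> L" "f \<in> part P 1"
  shows "coef (gen (e z) * f) (x, y) = (if z = x then coef f (x, y) else 0)"
proof -
  obtain X where X: "finite X" "X \<subseteq> Arr" "f \<simeq>[I] (\<Sum>p\<in>X. scal (coef f p) * arrow p)"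
    "\<And>p. coef f p \<noteq> 0 \<Longrightarrow> p \<in> X" by (rule arrow_expand[OF assms(2)]) (rule that)
  have "coef (gen (e z) * f) (x, y) = coef (\<Sum>p\<in>X. scal (coef f p) * (gen (e z) * arrow p)) (x, y)"
    using cgr_left[OF X(3), of "gen (e z)"] by (intro fun_cong[OF coef_cgr]) (simp add: sum_distrib_left scal_left_comm[of "gen _"])
  also have "\<dots> = (\<Sum>p\<in>X. coef f p * coef (gen (e z) * arrow p) (x, y))"
    by (simp add: coef_sum coef_scal)
  also have "\<dots> = (\<Sum>p\<in>X. if p = (x, y) then (if z = x then coef f (x, y) else 0) else 0)"
  proof (rule sum.cong[OF refl])
    fix p assume "p \<in> X"
    then obtain a b where p: "p = (a, b)" "adj a b" using X(2) by auto
    have "coef (gen (e z) * arrow p) = coef (if z = a then gen (ar a b) else 0)"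
      unfolding p(1) prod.case by (intro coef_cgr e_arrow assms p)
    then show "coef f p * coef (gen (e z) * arrow p) (x, y) = (if p = (x, y) then (if z = x then coef f (x, y) else 0) else 0)"
      using p by (auto simp: coef_arrow coef_ideal[OF gen_ideal.zero])
  qed
  finally show ?thesis using X(1) X(4)[of "(x, y)"] by auto
qed

lemma coef_e_right:
  assumes "z \<in> L" "f \<in> part P 1"
  shows "coef (f * gen (e z)) (x, y) = (if z = y then coef f (x, y) else 0)"
proof -
  obtain X where X: "finite X" "X \<subseteq> Arr" "f \<simeq>[I] (\<Sum>p\<in>X. scal (coef f p) * arrow p)"
    "\<And>p. coef f p \<noteq> 0 \<Longrightarrow> p \<in> X" by (rule arrow_expand[OF assms(2)]) (rule that)
  have "coef (f * gen (e z)) (x, y) = coef (\<Sum>p\<in>X. scal (coef f p) * (arrow p * gen (e z))) (x, y)"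
    using cgr_right[OF X(3), of "gen (e z)"] by (intro fun_cong[OF coef_cgr]) (simp add: sum_distrib_right mult.assoc)
  also have "\<dots> = (\<Sum>p\<in>X. coef f p * coef (arrow p * gen (e z)) (x, y))"
    by (simp add: coef_sum coef_scal)
  also have "\<dots> = (\<Sum>p\<in>X. if p = (x, y) then (if z = y then coef f (x, y) else 0) else 0)"
  proof (rule sum.cong[OF refl])
    fix p assume "p \<in> X"
    then obtain a b where p: "p = (a, b)" "adj a b" using X(2) by auto
    have "coef (arrow p * gen (e z)) = coef (if z = b then gen (ar a b) else 0)"
      unfolding p(1) prod.case by (intro coef_cgr arrow_e assms p)
    then show "coef f p * coef (arrow p * gen (e z)) (x, y) = (if p = (x, y) then (if z = y then coef f (x, y) else 0) else 0)"
      using p by (auto simp: coef_arrow coef_ideal[OF gen_ideal.zero])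
  qed
  finally show ?thesis using X(1) X(4)[of "(x, y)"] by auto
qed

end

subsection \<open>The path basis of the tensor algebra\<close>

context quiver_pres
begin

abbreviation "T \<equiv> tensor_algebra P L e"
abbreviation "tm \<equiv> tensor_mult e"

lemma T_simps [simp]:
  "central T = {}" "gens T = TIdem ` L \<union> TVec ` part P 1"
  "deg T (TIdem x) = 0" "deg T (TVec f) = 1"
  by (simp_all add: tensor_algebra_def)

definition tar :: "'x \<Rightarrow> 'x \<Rightarrow> (('x, 'g list \<Rightarrow>\<^sub>0 'r) tensor_letter list \<Rightarrow>\<^sub>0 'r)" where
  "tar x y = gen (TVec (gen (ar x y)))"

lemma T_add: "f \<in> part P 1 \<Longrightarrow> g \<in> part P 1 \<Longrightarrow> gen (TVec (f + g)) \<simeq>[rels T] gen (TVec f) + gen (TVec g)"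
  unfolding tensor_algebra_def presentation.simps
  by (rule cgr_base) (auto simp: diff_diff_eq[symmetric])

lemma T_scal: "f \<in> part P 1 \<Longrightarrow> gen (TVec (scal r * f)) \<simeq>[rels T] scal r * gen (TVec f)"
  unfolding tensor_algebra_def presentation.simps by (rule cgr_base) blast

lemma T_idem: "x \<in> L \<Longrightarrow> y \<in> L \<Longrightarrow>
    gen (TIdem x) * gen (TIdem y) \<simeq>[rels T] (if x = y then gen (TIdem x) else 0)"
  unfolding tensor_algebra_def presentation.simps by (rule cgr_base) blast

lemma T_zero:
  assumes "f \<in> part P 1" "f \<in> ideal I" shows "gen (TVec f) \<simeq>[rels T] 0"
proof -
  have "f \<in> part P 1 \<inter> alg_ideal P" using assms by (simp add: in_alg_ideal part_free_on)
  then show ?thesis unfolding tensor_algebra_def presentation.simps by (intro cgr_base) auto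
qed

lemma T_left: "x \<in> L \<Longrightarrow> f \<in> part P 1 \<Longrightarrow> gen (TVec (gen (e x) * f)) \<simeq>[rels T] gen (TIdem x) * gen (TVec f)"
  unfolding tensor_algebra_def presentation.simps by (rule cgr_base) blast

lemma T_right: "x \<in> L \<Longrightarrow> f \<in> part P 1 \<Longrightarrow> gen (TVec (f * gen (e x))) \<simeq>[rels T] gen (TVec f) * gen (TIdem x)"
  unfolding tensor_algebra_def presentation.simps by (rule cgr_base) blast

lemma T_cgr:
  assumes "f \<in> part P 1" "g \<in> part P 1" "f \<simeq>[I] g"
  shows "gen (TVec f) \<simeq>[rels T] gen (TVec g)"
proof -
  have "gen (TVec f) = gen (TVec ((f - g) + g))" by simp
  also have "\<dots> \<simeq>[rels T] gen (TVec (f - g)) + gen (TVec g)"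
    by (rule T_add) (use assms in \<open>auto intro: part_diff\<close>)
  also have "\<dots> \<simeq>[rels T] 0 + gen (TVec g)"
    by (intro cgr_add T_zero cgr_refl part_diff assms assms(3)[unfolded cgr_def])
  finally show ?thesis by simp
qed

lemma T_sum:
  assumes "finite X" "\<And>i. i \<in> X \<Longrightarrow> f i \<in> part P 1"
  shows "gen (TVec (\<Sum>i\<in>X. f i)) \<simeq>[rels T] (\<Sum>i\<in>X. gen (TVec (f i)))"
  using assms
proof (induction X rule: finite_induct)
  case empty
  show ?case using T_zero[OF part_0 gen_ideal.zero] by simp
next
  case (insert i X)
  have "gen (TVec (f i + (\<Sum>i\<in>X. f i))) \<simeq>[rels T] gen (TVec (f i)) + gen (TVec (\<Sum>i\<in>X. f i))"
    by (rule T_add) (use insert in \<open>auto intro: part_sum\<close>)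
  also have "\<dots> \<simeq>[rels T] gen (TVec (f i)) + (\<Sum>i\<in>X. gen (TVec (f i)))"
    using insert by (intro cgr_add cgr_refl) auto
  finally show ?case using insert by simp
qed

text \<open>A generator of the tensor algebra for each element of degree one is redundant: those of the
  arrows suffice.\<close>

lemma T_expand:
  assumes "f \<in> part P 1" "finite X" "X \<subseteq> Arr" "f \<simeq>[I] (\<Sum>p\<in>X. scal (r p) * arrow p)"
  shows "gen (TVec f) \<simeq>[rels T] (\<Sum>p\<in>X. scal (r p) * (\<lambda>(x, y). tar x y) p)"
proof -
  have arr: "arrow p \<in> part P 1" if "p \<in> X" for p using part_arrow that assms(3) by blast
  have "gen (TVec f) \<simeq>[rels T] gen (TVec (\<Sum>p\<in>X. scal (r p) * arrow p))"
    by (intro T_cgr assms part_sum part_scal arr)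
  also have "\<dots> \<simeq>[rels T] (\<Sum>p\<in>X. gen (TVec (scal (r p) * arrow p)))"
    by (intro T_sum assms part_scal arr)
  also have "\<dots> \<simeq>[rels T] (\<Sum>p\<in>X. scal (r p) * gen (TVec (arrow p)))"
    by (intro cgr_sum T_scal arr)
  also have "\<dots> = (\<Sum>p\<in>X. scal (r p) * (\<lambda>(x, y). tar x y) p)"
    by (intro sum.cong) (auto simp: tar_def)
  finally show ?thesis .
qed

lemma part_tar: "adj x y \<Longrightarrow> tar x y \<in> part T 1"
  unfolding tar_def using part_arrow[of "(x, y)"] by (intro part_gen) auto

lemma TIdem_tar:
  assumes "z \<in> L" "adj x y"
  shows "gen (TIdem z) * tar x y \<simeq>[rels T] (if z = x then tar x y else 0)"
proof -
  have A: "gen (ar x y) \<in> part P 1" using part_arrow[of "(x, y)"] assms by simp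
  have "gen (TIdem z) * tar x y \<simeq>[rels T] gen (TVec (gen (e z) * gen (ar x y)))"
    unfolding tar_def by (intro cgr_sym[OF T_left] assms A)
  also have "\<dots> \<simeq>[rels T] gen (TVec (if z = x then gen (ar x y) else 0))"
    using A assms by (intro T_cgr e_arrow part_e_left) auto
  also have "\<dots> \<simeq>[rels T] (if z = x then tar x y else 0)"
    using T_zero[OF part_0 gen_ideal.zero] by (simp add: tar_def)
  finally show ?thesis .
qed

lemma tar_TIdem:
  assumes "z \<in> L" "adj x y"
  shows "tar x y * gen (TIdem z) \<simeq>[rels T] (if z = y then tar x y else 0)"
proof -
  have A: "gen (ar x y) \<in> part P 1" using part_arrow[of "(x, y)"] assms by simp
  have "tar x y * gen (TIdem z) \<simeq>[rels T] gen (TVec (gen (ar x y) * gen (e z)))"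
    unfolding tar_def by (intro cgr_sym[OF T_right] assms A)
  also have "\<dots> \<simeq>[rels T] gen (TVec (if z = y then gen (ar x y) else 0))"
    using A assms by (intro T_cgr arrow_e part_e_right) auto
  also have "\<dots> \<simeq>[rels T] (if z = y then tar x y else 0)"
    using T_zero[OF part_0 gen_ideal.zero] by (simp add: tar_def)
  finally show ?thesis .
qed

fun path :: "'x list \<Rightarrow> bool" where
  "path [] = False"
| "path [x] = (x \<in> L)"
| "path (x # y # p) = (adj x y \<and> path (y # p))"

fun pth :: "'x list \<Rightarrow> (('x, 'g list \<Rightarrow>\<^sub>0 'r) tensor_letter list \<Rightarrow>\<^sub>0 'r)" where
  "pth [] = 0"
| "pth [x] = gen (TIdem x)"
| "pth (x # y # p) = tar x y * pth (y # p)"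

lemma path_hd: "path (x # p) \<Longrightarrow> x \<in> L"
  by (cases p) (auto simp: adj_L)

lemma TIdem_pth: "z \<in> L \<Longrightarrow> path (x # p) \<Longrightarrow> gen (TIdem z) * pth (x # p) \<simeq>[rels T] (if z = x then pth (x # p) else 0)"
proof (cases p)
  case Nil
  assume "z \<in> L" "path (x # p)"
  then show ?thesis using T_idem[of z x] Nil by auto
next
  case (Cons y q)
  assume "z \<in> L" "path (x # p)"
  then have "gen (TIdem z) * tar x y * pth (y # q) \<simeq>[rels T] (if z = x then tar x y else 0) * pth (y # q)"
    using Cons by (intro cgr_right TIdem_tar) auto
  then show ?thesis using Cons by (auto simp: mult.assoc)
qed

lemma tar_pth:
  assumes "adj x z" "path (y # p)"
  shows "tar x z * pth (y # p) \<simeq>[rels T] (if z = y then pth (x # y # p) else 0)"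
proof -
  have z: "z \<in> L" using adj_L assms by blast
  have "tar x z * pth (y # p) \<simeq>[rels T] tar x z * gen (TIdem z) * pth (y # p)"
    using cgr_sym[OF tar_TIdem[OF z assms(1)]] by (intro cgr_right) simp
  also have "\<dots> = tar x z * (gen (TIdem z) * pth (y # p))" by (simp add: mult.assoc)
  also have "\<dots> \<simeq>[rels T] tar x z * (if z = y then pth (y # p) else 0)"
    by (intro cgr_left TIdem_pth z assms)
  also have "\<dots> = (if z = y then pth (x # y # p) else 0)" by simp
  finally show ?thesis .
qed

lemma spanned_TVec_mult:
  assumes f: "f \<in> part P 1" and *: "\<And>x y. adj x y \<Longrightarrow> spanned (rels T) Idx B (tar x y * b)"
  shows "spanned (rels T) Idx B (gen (TVec f) * b)"
proof -
  obtain X where X: "finite X" "X \<subseteq> Arr" "f \<simeq>[I] (\<Sum>p\<in>X. scal (coef f p) * arrow p)"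
    by (rule arrow_expand[OF f]) (rule that)
  have "gen (TVec f) * b \<simeq>[rels T] (\<Sum>p\<in>X. scal (coef f p) * ((\<lambda>(x, y). tar x y) p)) * b"
    by (intro cgr_right T_expand f X)
  also have "\<dots> = (\<Sum>p\<in>X. scal (coef f p) * ((\<lambda>(x, y). tar x y) p * b))"
    by (simp only: sum_distrib_right mult.assoc)
  finally show ?thesis
    by (rule spanned_cgr[rotated]) (intro spanned_sum spanned_scal, use * X(2) in force)
qed

text \<open>Rewriting from the left end, each letter either extends a path or projects on its first
  vertex.\<close>

lemma spanned_T_word:
  assumes "w \<noteq> []" "set w \<subseteq> gens T"
  shows "spanned (rels T) {p. path p \<and> length p = Suc (sum_list (map (deg T) w))} pth (word w)"
  using assms
proof (induction w)
  case (Cons l w)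
  show ?case
  proof (cases "w = []")
    case True
    show ?thesis
    proof (cases l)
      case (TIdem x)
      with Cons True have "path [x]" by auto
      then show ?thesis using True TIdem spanned_base[of "[x]" _ "rels T" pth]
        by (auto simp: gen_def)
    next
      case (TVec f)
      then have f: "f \<in> part P 1" using Cons.prems by auto
      let ?S = "{p. path p \<and> length p = Suc (sum_list (map (deg T) [l]))}"
      have "spanned (rels T) ?S pth (tar x y * 1)" if "adj x y" for x y
      proof -
        have y: "y \<in> L" using adj_L that by blast
        have "spanned (rels T) ?S pth (pth [x, y])"
          using that y TVec by (intro spanned_base) simp
        moreover have "tar x y * 1 \<simeq>[rels T] pth [x, y]"
          using cgr_sym[OF tar_TIdem[OF y that]] by simp
        ultimately show ?thesis by (rule spanned_cgr)
      qed
      then have "spanned (rels T) ?S pth (gen (TVec f) * 1)" by (rule spanned_TVec_mult[OF f])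
      then show ?thesis using TVec True by (simp add: gen_def)
    qed
  next
    case False
    let ?n = "Suc (sum_list (map (deg T) w))"
    let ?S = "{p. path p \<and> length p = Suc (sum_list (map (deg T) (l # w)))}"
    have IH: "spanned (rels T) {p. path p \<and> length p = ?n} pth (word w)"
      using Cons False by auto
    have "spanned (rels T) ?S pth (gen l * pth p * 1)" if p: "p \<in> {p. path p \<and> length p = ?n}" for p
    proof -
      from p obtain y q where q: "p = y # q" by (cases p) auto
      show ?thesis
      proof (cases l)
        case (TIdem x)
        then have x: "x \<in> L" using Cons.prems by auto
        show ?thesis unfolding mult_1_right q TIdem
          by (rule spanned_cgr[OF _ TIdem_pth[OF x]])
            (use p q TIdem in \<open>auto intro!: spanned_0 spanned_base\<close>)
      next
        case (TVec f)
        then have f: "f \<in> part P 1" using Cons.prems by auto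
        have "spanned (rels T) ?S pth (tar a b * pth p)" if "adj a b" for a b
          unfolding q
          by (rule spanned_cgr[OF _ tar_pth[OF that]])
            (use p q TVec that in \<open>auto intro!: spanned_0 spanned_base simp del: pth.simps\<close>)
        then show ?thesis unfolding mult_1_right TVec by (rule spanned_TVec_mult[OF f])
      qed
    qed
    from spanned_trans[OF IH this] show ?thesis by (simp add: word_Cons)
  qed
qed simp

lemma spanned_T_part:
  assumes "\<tau> \<in> part T n"
  shows "spanned (rels T) {p. path p \<and> length p = Suc n} pth \<tau>"
proof (rule spanned_free)
  fix w assume w: "w \<in> Poly_Mapping.keys \<tau>"
  from partD[OF assms this] have "w \<noteq> []" "set w \<subseteq> gens T" "sum_list (map (deg T) w) = n"
    by auto
  from spanned_T_word[OF this(1,2)] this(3)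
  show "spanned (rels T) {p. path p \<and> length p = Suc n} pth (word w)" by simp
qed

lemma spanned_T_elems:
  assumes "\<tau> \<in> elems T"
  shows "spanned (rels T) {p. path p} pth \<tau>"
proof (rule spanned_free)
  fix w assume w: "w \<in> Poly_Mapping.keys \<tau>"
  then have "w \<noteq> []" "set w \<subseteq> gens T" using assms by (auto simp: elems_def)
  from spanned_T_word[OF this] show "spanned (rels T) {p. path p} pth (word w)"
    unfolding spanned_def by blast
qed

lemma rels_T_cases:
  assumes "s \<in> rels T"
  obtains (idem) x y where "s = gen (TIdem x) * gen (TIdem y) - (if x = y then gen (TIdem x) else 0)" "x \<in> L" "y \<in> L"
    | (add) f g where "s = gen (TVec (f + g)) - gen (TVec f) - gen (TVec g)" "f \<in> part P 1" "g \<in> part P 1"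
    | (scal) r f where "s = gen (TVec (scal r * f)) - scal r * gen (TVec f)" "f \<in> part P 1"
    | (zero) f where "s = gen (TVec f)" "f \<in> alg_ideal P" "f \<in> part P 1"
    | (left) x f where "s = gen (TVec (gen (e x) * f)) - gen (TIdem x) * gen (TVec f)" "x \<in> L" "f \<in> part P 1"
    | (right) x f where "s = gen (TVec (f * gen (e x))) - gen (TVec f) * gen (TIdem x)" "x \<in> L" "f \<in> part P 1"
  using assms unfolding tensor_algebra_def presentation.simps by blast

text \<open>Functions on paths carry a representation of the tensor algebra, in which the matrix
  coefficients read off the coordinates of an element with respect to paths.\<close>

definition on_paths :: "('x, 'g list \<Rightarrow>\<^sub>0 'r) tensor_letter \<Rightarrow> ('x list \<Rightarrow> 'r) \<Rightarrow> ('x list \<Rightarrow> 'r)" where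
  "on_paths l v = (case l of
      TIdem x \<Rightarrow> (\<lambda>p. if p \<noteq> [] \<and> hd p = x then v p else 0)
    | TVec f \<Rightarrow> (\<lambda>p. case p of x # y # q \<Rightarrow> coef f (x, y) * v (y # q) | _ \<Rightarrow> 0))"

lemma on_paths_simps:
  "on_paths (TIdem x) v = (\<lambda>p. if p \<noteq> [] \<and> hd p = x then v p else 0)"
  "on_paths (TVec f) v = (\<lambda>p. case p of x # y # q \<Rightarrow> coef f (x, y) * v (y # q) | _ \<Rightarrow> 0)"
  by (simp_all add: on_paths_def)

abbreviation "path_act \<equiv> act (\<lambda>r v p. r * v p) on_paths"

sublocale paths: free_module "\<lambda>r v p. r * v p" on_paths
  by unfold_locales
    (auto simp: on_paths_def fun_eq_iff algebra_simps split: tensor_letter.split list.split)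

lemma path_act_rels:
  assumes "s \<in> rels T"
  shows "path_act s v = 0"
proof -
  note expand = paths.act_diff paths.act_add paths.act_mult paths.act_gen paths.act_scal paths.act_0
    on_paths_simps fun_eq_iff
  from assms show ?thesis
  proof (cases rule: rels_T_cases)
    case idem show ?thesis unfolding idem(1) by (auto simp: expand)
  next
    case add show ?thesis unfolding add(1) by (auto simp: expand coef_add algebra_simps split: list.split)
  next
    case scal show ?thesis unfolding scal(1) by (auto simp: expand coef_scal algebra_simps split: list.split)
  next
    case zero then show ?thesis by (auto simp: expand coef_ideal in_alg_ideal split: list.split)
  next
    case left show ?thesis unfolding left(1) by (auto simp: expand coef_e_left[OF left(2,3)] split: list.split)
  next
    case right show ?thesis unfolding right(1) by (auto simp: expand coef_e_right[OF right(2,3)] split: list.split)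
  qed
qed

text \<open>A path sends the indicator of its last vertex to its own indicator, hence the coefficients
  of a combination of paths can be recovered and paths are independent.\<close>

lemma path_act_pth:
  "path q \<Longrightarrow> path_act (pth q) (\<lambda>p. if p = [z] then 1 else 0) = (\<lambda>p. if p = q \<and> last q = z then 1 else 0)"
proof (induction q rule: pth.induct)
  case (2 x)
  show ?case by (auto simp: on_paths_simps fun_eq_iff neq_Nil_conv)
next
  case (3 x y q)
  then show ?case
    by (auto simp: paths.act_mult tar_def on_paths_simps fun_eq_iff coef_arrow split: list.split)
qed simp

definition coefT :: "(('x, 'g list \<Rightarrow>\<^sub>0 'r) tensor_letter list \<Rightarrow>\<^sub>0 'r) \<Rightarrow> 'x list \<Rightarrow> 'r" where
  "coefT \<tau> p = (if path p then path_act \<tau> (\<lambda>q. if q = [last p] then 1 else 0) p else 0)"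

lemma coefT_add: "coefT (\<sigma> + \<tau>) = (\<lambda>p. coefT \<sigma> p + coefT \<tau> p)"
  by (auto simp: coefT_def paths.act_add fun_eq_iff)

lemma coefT_scal: "coefT (scal r * \<tau>) = (\<lambda>p. r * coefT \<tau> p)"
  by (auto simp: coefT_def paths.act_mult fun_eq_iff)

lemma coefT_sum: "coefT (\<Sum>i\<in>X. f i) p = (\<Sum>i\<in>X. coefT (f i) p)"
  by (induction X rule: infinite_finite_induct) (auto simp: coefT_add, auto simp: coefT_def)

lemma coefT_ideal: "\<tau> \<in> ideal (rels T) \<Longrightarrow> coefT \<tau> = (\<lambda>p. 0)"
  using paths.act_ideal[OF path_act_rels] by (auto simp: coefT_def fun_eq_iff)

lemma coefT_cgr: "\<sigma> \<simeq>[rels T] \<tau> \<Longrightarrow> coefT \<sigma> = coefT \<tau>"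
  using coefT_add[of "\<sigma> - \<tau>" \<tau>] coefT_ideal[of "\<sigma> - \<tau>"] by (simp add: cgr_def)

lemma coefT_pth: "path q \<Longrightarrow> coefT (pth q) = (\<lambda>p. if p = q then 1 else 0)"
  by (auto simp: coefT_def path_act_pth fun_eq_iff)

lemma coefT_expand:
  assumes "\<tau> \<in> part T n"
  obtains X where "finite X" "X \<subseteq> {p. path p \<and> length p = Suc n}"
    "\<tau> \<simeq>[rels T] (\<Sum>p\<in>X. scal (coefT \<tau> p) * pth p)" "\<And>p. coefT \<tau> p \<noteq> 0 \<Longrightarrow> p \<in> X"
proof -
  obtain X r where X: "finite X" "X \<subseteq> {p. path p \<and> length p = Suc n}"
    "\<tau> \<simeq>[rels T] (\<Sum>p\<in>X. scal (r p) * pth p)"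
    using spanned_T_part[OF assms] unfolding spanned_def by auto
  have c: "coefT \<tau> p = (if p \<in> X then r p else 0)" for p
  proof -
    have "coefT \<tau> p = (\<Sum>q\<in>X. r q * coefT (pth q) p)"
      by (simp add: coefT_cgr[OF X(3)] coefT_sum coefT_scal)
    also have "\<dots> = (\<Sum>q\<in>X. if p = q then r q else 0)"
      by (rule sum.cong[OF refl]) (use X(2) in \<open>auto simp: coefT_pth\<close>)
    finally show ?thesis using X(1) by simp
  qed
  show thesis
  proof (rule that[OF X(1,2)])
    show "\<tau> \<simeq>[rels T] (\<Sum>p\<in>X. scal (coefT \<tau> p) * pth p)"
      using X(3) by (simp add: c)
  qed (simp add: c split: if_splits)
qed

lemma finite_coefT: 
  assumes "\<tau> \<in> part T n" shows "finite {p. coefT \<tau> p \<noteq> 0}"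
proof -
  obtain X where X: "finite X" "\<And>p. coefT \<tau> p \<noteq> 0 \<Longrightarrow> p \<in> X"
    by (rule coefT_expand[OF assms]) (rule that)
  show ?thesis by (rule finite_subset[OF _ X(1)]) (simp add: subset_iff X(2))
qed

lemma coefT_TVec2: "path [a, b, u] \<Longrightarrow>
    coefT (gen (TVec c) * gen (TVec c')) [a, b, u] = coef c (a, b) * coef c' (b, u)"
  by (simp add: coefT_def paths.act_mult on_paths_simps)

subsection \<open>Multiplication on the degree-two part\<close>

lemma tm_simps [simp]:
  "tm 0 = 0" "tm 1 = 1" "tm (scal r) = scal r" "tm (gen (TIdem x)) = gen (e x)" "tm (gen (TVec f)) = f"
  by (simp_all add: tensor_mult_lift)

lemma tm_hom: "tm (f + g) = tm f + tm g" "tm (f - g) = tm f - tm g" "tm (f * g) = tm f * tm g"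
  "tm (\<Sum>i\<in>X. h i) = (\<Sum>i\<in>X. tm (h i))"
  by (simp_all add: tensor_mult_lift lift_add lift_diff lift_mult lift_sum)

lemma tm_rels: 
  assumes "s \<in> rels T"
  shows "tm s \<in> ideal I"
  using assms
proof (cases rule: rels_T_cases)
  case (idem x y)
  then show ?thesis using quiver_pres.idem[OF quiver_pres_axioms, of x y]
    by (cases "x = y") (simp_all add: tm_hom cgr_def)
qed (simp_all add: tm_hom in_alg_ideal gen_ideal.zero)

lemma tm_cgr: "\<sigma> \<simeq>[rels T] \<tau> \<Longrightarrow> tm \<sigma> \<simeq>[I] tm \<tau>"
  using lift_ideal[of "rels T" _ I "\<sigma> - \<tau>" UNIV] tm_rels
  unfolding cgr_def tensor_mult_lift by (simp add: lift_diff)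

lemma tm_free_on: 
  assumes "\<tau> \<in> free_on (gens T)" shows "tm \<tau> \<in> free_on G"
proof -
  have *: "(case l of TIdem x \<Rightarrow> gen (e x) | TVec f \<Rightarrow> f) \<in> free_on G" if "l \<in> gens T" for l
    using that e_gens part_free_on by auto
  show ?thesis unfolding tensor_mult_def
    by (intro free_on_intros free_on_simps *) (use free_onD[OF assms] in auto)
qed

text \<open>The linear relations in the algebra between the paths of length two with given ends.\<close>

definition W :: "'x \<Rightarrow> 'x \<Rightarrow> ('x \<Rightarrow> 'r) set" where
  "W x u = {k. (\<Sum>y\<in>M x u. scal (k y) * (gen (ar x y) * gen (ar y u))) \<in> ideal I}"

lemma tm_pth2: "path [x, y, u] \<Longrightarrow> tm (pth [x, y, u]) \<simeq>[I] gen (ar x y) * gen (ar y u)"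
  using cgr_left[OF ar_right, of y u "gen (ar x y)"] by (simp add: tm_hom tar_def)

text \<open>Multiplying by vertices on both sides separates the paths with different end points. The
  quadratic relations are therefore determined by the sets \<open>W x u\<close>.\<close>

lemma in_quadratic_rels:
  assumes "\<tau> \<in> part T 2"
  shows "\<tau> \<in> quadratic_rels P L e \<longleftrightarrow> (\<forall>x\<in>L. \<forall>u\<in>L. (\<lambda>y. coefT \<tau> [x, y, u]) \<in> W x u)"
proof -
  let ?t = "\<lambda>x y u. scal (coefT \<tau> [x, y, u]) * (gen (ar x y) * gen (ar y u))"
  obtain X where X: "finite X" "X \<subseteq> {p. path p \<and> length p = Suc 2}"
    "\<tau> \<simeq>[rels T] (\<Sum>p\<in>X. scal (coefT \<tau> p) * pth p)" "\<And>p. coefT \<tau> p \<noteq> 0 \<Longrightarrow> p \<in> X"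
    by (rule coefT_expand[OF assms]) (rule that)
  have p3: "\<exists>x y u. p = [x, y, u] \<and> adj x y \<and> adj y u" if "p \<in> X" for p
  proof -
    have "path p" "length p = 3" using X(2) that by auto
    then obtain x y u where "p = [x, y, u]" by (auto simp: numeral_3_eq_3 length_Suc_conv)
    with \<open>path p\<close> show ?thesis by auto
  qed
  define F where "F = (\<lambda>p. (p ! 0, p ! 2)) ` X"
  have "tm \<tau> \<simeq>[I] (\<Sum>p\<in>X. scal (coefT \<tau> p) * tm (pth p))"
    using tm_cgr[OF X(3)] by (simp add: tm_hom)
  also have "\<dots> \<simeq>[I] (\<Sum>p\<in>X. ?t (p ! 0) (p ! 1) (p ! 2))"
  proof (intro cgr_sum)
    fix p assume p: "p \<in> X"
    then obtain x y u where "p = [x, y, u]" "path p" using p3[OF p] X(2) by auto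
    then show "scal (coefT \<tau> p) * tm (pth p) \<simeq>[I] ?t (p ! 0) (p ! 1) (p ! 2)"
      using tm_pth2[of x y u] by (auto intro!: cgr_left simp del: path.simps pth.simps)
  qed
  also have "\<dots> = (\<Sum>q\<in>F. \<Sum>p | p \<in> X \<and> (p ! 0, p ! 2) = q. ?t (p ! 0) (p ! 1) (p ! 2))"
    unfolding F_def using X(1) by (intro sum.image_gen)
  also have "\<dots> = (\<Sum>q\<in>F. \<Sum>y\<in>M (fst q) (snd q). ?t (fst q) y (snd q))"
  proof (rule sum.cong[OF refl])
    fix q :: "'x \<times> 'x"
    obtain x u where q: "q = (x, u)" by (cases q)
    have "{p. p \<in> X \<and> (p ! 0, p ! 2) = q} = (\<lambda>y. [x, y, u]) ` {y. [x, y, u] \<in> X}" (is "?A = ?B")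
    proof (intro set_eqI iffI)
      fix p assume p: "p \<in> ?A"
      then obtain a b c where abc: "p = [a, b, c]" using p3[of p] by auto
      with p q have "p = [x, b, u]" by simp
      with p show "p \<in> ?B" by auto
    qed (auto simp: q)
    moreover have "inj_on (\<lambda>y. [x, y, u]) {y. [x, y, u] \<in> X}" by (simp add: inj_on_def)
    ultimately have "(\<Sum>p | p \<in> X \<and> (p ! 0, p ! 2) = q. ?t (p ! 0) (p ! 1) (p ! 2))
        = (\<Sum>y | [x, y, u] \<in> X. ?t x y u)"
      by (simp only: sum.reindex) simp
    also have "\<dots> = (\<Sum>y\<in>M x u. ?t x y u)"
    proof (rule sum.mono_neutral_left)
      show "{y. [x, y, u] \<in> X} \<subseteq> M x u"
      proof
        fix y assume "y \<in> {y. [x, y, u] \<in> X}"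
        then show "y \<in> M x u" using p3[of "[x, y, u]"] by simp
      qed
      show "\<forall>y\<in>M x u - {y. [x, y, u] \<in> X}. ?t x y u = 0"
      proof
        fix y assume "y \<in> M x u - {y. [x, y, u] \<in> X}"
        then have "coefT \<tau> [x, y, u] = 0" using X(4)[of "[x, y, u]"] by auto
        then show "?t x y u = 0" by simp
      qed
    qed (rule finite_mid)
    finally show "(\<Sum>p | p \<in> X \<and> (p ! 0, p ! 2) = q. ?t (p ! 0) (p ! 1) (p ! 2))
        = (\<Sum>y\<in>M (fst q) (snd q). ?t (fst q) y (snd q))" by (simp add: q)
  qed
  finally have main: "tm \<tau> \<simeq>[I] (\<Sum>q\<in>F. \<Sum>y\<in>M (fst q) (snd q). ?t (fst q) y (snd q))" .
  have fF: "finite F" using X(1) by (simp add: F_def)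
  have "\<tau> \<in> quadratic_rels P L e \<longleftrightarrow> tm \<tau> \<in> ideal I"
    using assms tm_free_on[of \<tau>] part_free_on[OF assms] by (simp add: quadratic_rels_def in_alg_ideal)
  also have "\<dots> \<longleftrightarrow> (\<forall>x\<in>L. \<forall>u\<in>L. (\<lambda>y. coefT \<tau> [x, y, u]) \<in> W x u)"
  proof
    assume "\<forall>x\<in>L. \<forall>u\<in>L. (\<lambda>y. coefT \<tau> [x, y, u]) \<in> W x u"
    moreover have "fst q \<in> L \<and> snd q \<in> L" if "q \<in> F" for q
    proof -
      from that obtain p where p: "p \<in> X" "q = (p ! 0, p ! 2)" by (auto simp: F_def)
      then obtain x y u where "p = [x, y, u]" "adj x y" "adj y u" using p3[OF p(1)] by blast
      then show ?thesis using adj_L[of x y] adj_L[of y u] p(2) by simp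
    qed
    ultimately show "tm \<tau> \<in> ideal I"
      unfolding cgr_ideal[OF main] W_def by (intro ideal_sum[of F]) auto
  next
    assume tm: "tm \<tau> \<in> ideal I"
    show "\<forall>x\<in>L. \<forall>u\<in>L. (\<lambda>y. coefT \<tau> [x, y, u]) \<in> W x u"
    proof (intro ballI)
      fix x u assume xu: "x \<in> L" "u \<in> L"
      have "gen (e x) * tm \<tau> * gen (e u) \<simeq>[I]
          gen (e x) * (\<Sum>q\<in>F. \<Sum>y\<in>M (fst q) (snd q). ?t (fst q) y (snd q)) * gen (e u)"
        by (intro cgr_right cgr_left main)
      also have "\<dots> = (\<Sum>q\<in>F. \<Sum>y\<in>M (fst q) (snd q). scal (coefT \<tau> [fst q, y, snd q]) *
          ((gen (e x) * gen (ar (fst q) y)) * (gen (ar y (snd q)) * gen (e u))))"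
        by (simp add: sum_distrib_left sum_distrib_right scal_left_comm[of "gen _"] mult.assoc)
      also have "\<dots> \<simeq>[I] (\<Sum>q\<in>F. \<Sum>y\<in>M (fst q) (snd q). scal (coefT \<tau> [fst q, y, snd q]) *
          ((if x = fst q then gen (ar (fst q) y) else 0) * (if u = snd q then gen (ar y (snd q)) else 0)))"
        by (intro cgr_sum cgr_left cgr_mult e_arrow arrow_e xu) auto
      also have "\<dots> = (\<Sum>q\<in>F. if q = (x, u) then \<Sum>y\<in>M x u. ?t x y u else 0)"
      proof (rule sum.cong[OF refl])
        fix q :: "'x \<times> 'x"
        show "(\<Sum>y\<in>M (fst q) (snd q). scal (coefT \<tau> [fst q, y, snd q]) *
          ((if x = fst q then gen (ar (fst q) y) else 0) * (if u = snd q then gen (ar y (snd q)) else 0)))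
          = (if q = (x, u) then \<Sum>y\<in>M x u. ?t x y u else 0)"
        proof (cases "q = (x, u)")
          case False
          then have "x \<noteq> fst q \<or> u \<noteq> snd q" by (cases q) auto
          with False show ?thesis by (auto intro!: sum.neutral)
        qed simp
      qed
      also have "\<dots> = (\<Sum>y\<in>M x u. ?t x y u)"
      proof (cases "(x, u) \<in> F")
        case False
        have "coefT \<tau> [x, y, u] = 0" for y
        proof (rule ccontr)
          assume "coefT \<tau> [x, y, u] \<noteq> 0"
          then have "[x, y, u] \<in> X" by (rule X(4))
          then have "([x, y, u] ! 0, [x, y, u] ! 2) \<in> F" unfolding F_def by (rule imageI)
          with False show False by simp
        qed
        then show ?thesis using False by (simp add: sum.neutral)
      qed (use fF in simp)
      finally have c: "gen (e x) * tm \<tau> * gen (e u) \<simeq>[I] (\<Sum>y\<in>M x u. ?t x y u)" .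
      have "gen (e x) * tm \<tau> * gen (e u) \<in> ideal I"
        by (intro ideal_mult_left ideal_mult_right tm)
      then show "(\<lambda>y. coefT \<tau> [x, y, u]) \<in> W x u"
        using cgr_ideal[OF c] by (simp add: W_def)
    qed
  qed
  finally show ?thesis .
qed

end

subsection \<open>Duality of presentations with orthogonal quadratic relations\<close>

context quiver_pres
begin

lemma T_alg_ideal: "\<tau> \<in> alg_ideal T \<Longrightarrow> \<tau> \<in> ideal (rels T)"
  unfolding alg_ideal_def by (erule gen_ideal_mono) auto

lemma path3: "adj x y \<Longrightarrow> adj y u \<Longrightarrow> path [x, y, u]"
  by (simp add: adj_L)

lemma part_tar2: "adj x y \<Longrightarrow> adj y u \<Longrightarrow> tar x y * tar y u \<in> part T 2"
  unfolding one_add_one[symmetric] by (intro part_mult part_tar)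

lemma coefT_tar2:
  assumes "adj x y" "adj y u"
  shows "coefT (tar x y * tar y u) = (\<lambda>p. if p = [x, y, u] then 1 else 0)"
proof -
  have "tar x y * tar y u \<simeq>[rels T] pth [x, y, u]"
    using cgr_sym[OF cgr_left[OF tar_TIdem, of u y u "tar x y"]] assms adj_L by simp
  then have "coefT (tar x y * tar y u) = coefT (pth [x, y, u])" by (rule coefT_cgr)
  then show ?thesis by (simp only: coefT_pth[OF path3[OF assms]])
qed

end

text \<open>The two quivers share vertices and arrows. By the previous section, orthogonality of the
  quadratic relations is a condition on each pair of end points.\<close>

locale dual_quivers =
  A: quiver_pres P L e adj ar \<kappa> + B: quiver_pres P' L e' adj ar' \<kappa>'
  for P :: "('g, 'r::comm_ring_1) presentation" and L :: "'x set" and e adj ar \<kappa>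
    and P' :: "('h, 'r) presentation" and e' ar' \<kappa>' +
  assumes orth: "\<And>x u k. x \<in> L \<Longrightarrow> u \<in> L \<Longrightarrow> k \<in> A.W x u \<longleftrightarrow>
      (\<forall>k'\<in>B.W x u. (\<Sum>y | adj x y \<and> adj y u. k y * k' y) = 0)"
    and orth': "\<And>x u k'. x \<in> L \<Longrightarrow> u \<in> L \<Longrightarrow> k' \<in> B.W x u \<longleftrightarrow>
      (\<forall>k\<in>A.W x u. (\<Sum>y | adj x y \<and> adj y u. k y * k' y) = 0)"
begin

definition pair1 :: "('g list \<Rightarrow>\<^sub>0 'r) \<Rightarrow> ('h list \<Rightarrow>\<^sub>0 'r) \<Rightarrow> 'r" where
  "pair1 f h = fpair (A.coef f) (B.coef h)"

definition pair2 where
  "pair2 \<sigma> \<tau> = fpair (A.coefT \<sigma>) (B.coefT \<tau>)"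

lemma pair1_arrows:
  "adj x y \<Longrightarrow> adj x' y' \<Longrightarrow> pair1 (gen (ar x y)) (gen (ar' x' y')) = (if x = x' \<and> y = y' then 1 else 0)"
  unfolding pair1_def A.coef_arrow B.coef_arrow
  by (subst fpair_superset[of "{(x, y)}"]) (auto split: if_splits)

lemma bilinear1: "bilinear_pairing 1 P P' pair1"
  unfolding bilinear_pairing_def pair1_def
  by (auto simp: A.coef_add B.coef_add A.coef_scal B.coef_scal fpair_add_right fpair_scale_right
      A.coef_ideal B.coef_ideal A.in_alg_ideal B.in_alg_ideal
      intro!: fpair_add_left fpair_scale_left A.finite_coef[simplified])

lemma bilinear2: "bilinear_pairing 2 A.T B.T pair2"
  unfolding bilinear_pairing_def pair2_def
  by (auto simp: A.coefT_add B.coefT_add A.coefT_scal B.coefT_scal fpair_add_right fpair_scale_right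
      A.coefT_ideal B.coefT_ideal dest!: A.T_alg_ideal B.T_alg_ideal
      intro!: fpair_add_left fpair_scale_left A.finite_coefT)

lemma coefT_length:
  assumes "\<sigma> \<in> part A.T 2" "A.coefT \<sigma> p \<noteq> 0"
  shows "\<exists>x y u. p = [x, y, u] \<and> adj x y \<and> adj y u"
proof -
  obtain X where X: "X \<subseteq> {p. A.path p \<and> length p = Suc 2}" "\<And>p. A.coefT \<sigma> p \<noteq> 0 \<Longrightarrow> p \<in> X"
    by (rule A.coefT_expand[OF assms(1)]) (rule that)
  then have "A.path p" "length p = 3" using assms(2) by auto
  then obtain x y u where "p = [x, y, u]" by (auto simp: numeral_3_eq_3 length_Suc_conv)
  with \<open>A.path p\<close> show ?thesis by auto
qed

text \<open>Paths with different end points do not interact, so orthogonality can be tested for one pair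
  of end points at a time.\<close>

lemma pair2_fibres:
  assumes "\<sigma> \<in> part A.T 2"
  obtains F where "finite F" "F \<subseteq> L \<times> L" "\<And>\<tau>. pair2 \<sigma> \<tau> =
    (\<Sum>(x, u)\<in>F. \<Sum>y | adj x y \<and> adj y u. A.coefT \<sigma> [x, y, u] * B.coefT \<tau> [x, y, u])"
proof -
  let ?X = "{p. A.coefT \<sigma> p \<noteq> 0}"
  let ?F = "(\<lambda>p. (p ! 0, p ! 2)) ` ?X"
  have fX: "finite ?X" using assms by (rule A.finite_coefT)
  show thesis
  proof (rule that)
    show "finite ?F" using fX by simp
    show "?F \<subseteq> L \<times> L"
    proof
      fix q assume "q \<in> ?F"
      then obtain p where p: "A.coefT \<sigma> p \<noteq> 0" "q = (p ! 0, p ! 2)" by auto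
      obtain x y u where "p = [x, y, u]" "adj x y" "adj y u" using coefT_length[OF assms p(1)] by blast
      then show "q \<in> L \<times> L" using A.adj_L[of x y] A.adj_L[of y u] p(2) by simp
    qed
    fix \<tau>
    let ?t = "\<lambda>p. A.coefT \<sigma> p * B.coefT \<tau> p"
    have "pair2 \<sigma> \<tau> = sum ?t ?X" by (simp add: pair2_def fpair_def)
    also have "\<dots> = (\<Sum>q\<in>?F. \<Sum>p | p \<in> ?X \<and> (p ! 0, p ! 2) = q. ?t p)"
      using fX by (intro sum.image_gen)
    also have "\<dots> = (\<Sum>(x, u)\<in>?F. \<Sum>y | adj x y \<and> adj y u. ?t [x, y, u])"
    proof (rule sum.cong[OF refl])
      fix q :: "'x \<times> 'x"
      obtain x u where q: "q = (x, u)" by (cases q)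
      have "{p. p \<in> ?X \<and> (p ! 0, p ! 2) = q} = (\<lambda>y. [x, y, u]) ` {y. [x, y, u] \<in> ?X}" (is "?A = ?B")
      proof (intro set_eqI iffI)
        fix p assume p: "p \<in> ?A"
        then obtain a b c where abc: "p = [a, b, c]" using coefT_length[OF assms, of p] by auto
        with p q have "p = [x, b, u]" by simp
        with p show "p \<in> ?B" by auto
      qed (auto simp: q)
      moreover have "inj_on (\<lambda>y. [x, y, u]) {y. [x, y, u] \<in> ?X}" by (simp add: inj_on_def)
      ultimately have "(\<Sum>p | p \<in> ?X \<and> (p ! 0, p ! 2) = q. ?t p) = (\<Sum>y | [x, y, u] \<in> ?X. ?t [x, y, u])"
        by (simp only: sum.reindex) simp
      also have "\<dots> = (\<Sum>y | adj x y \<and> adj y u. ?t [x, y, u])"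
      proof (rule sum.mono_neutral_left)
        show "{y. [x, y, u] \<in> ?X} \<subseteq> {y. adj x y \<and> adj y u}"
        proof
          fix y assume "y \<in> {y. [x, y, u] \<in> ?X}"
          then show "y \<in> {y. adj x y \<and> adj y u}" using coefT_length[OF assms, of "[x, y, u]"] by simp
        qed
      qed (use A.finite_mid in auto)
      finally show "(\<Sum>p | p \<in> ?X \<and> (p ! 0, p ! 2) = q. ?t p) =
          (case q of (x, u) \<Rightarrow> \<Sum>y | adj x y \<and> adj y u. ?t [x, y, u])" by (simp add: q)
    qed
    finally show "pair2 \<sigma> \<tau> = (\<Sum>(x, u)\<in>?F. \<Sum>y | adj x y \<and> adj y u. ?t [x, y, u])" .
  qed
qed

lemma pair2_zero:
  assumes "\<sigma> \<in> quadratic_rels P L e" "\<tau> \<in> quadratic_rels P' L e'"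
  shows "pair2 \<sigma> \<tau> = 0"
proof -
  have p: "\<sigma> \<in> part A.T 2" "\<tau> \<in> part B.T 2" using assms by (simp_all add: quadratic_rels_def)
  obtain F where F: "finite F" "F \<subseteq> L \<times> L" "\<And>\<tau>. pair2 \<sigma> \<tau> =
    (\<Sum>(x, u)\<in>F. \<Sum>y | adj x y \<and> adj y u. A.coefT \<sigma> [x, y, u] * B.coefT \<tau> [x, y, u])"
    by (rule pair2_fibres[OF p(1)]) (rule that)
  have "(\<Sum>y | adj x y \<and> adj y u. A.coefT \<sigma> [x, y, u] * B.coefT \<tau> [x, y, u]) = 0"
    if "(x, u) \<in> F" for x u
  proof -
    have xu: "x \<in> L" "u \<in> L" using that F(2) by auto
    then have "(\<lambda>y. A.coefT \<sigma> [x, y, u]) \<in> A.W x u" "(\<lambda>y. B.coefT \<tau> [x, y, u]) \<in> B.W x u"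
      using assms A.in_quadratic_rels[OF p(1)] B.in_quadratic_rels[OF p(2)] by blast+
    then show ?thesis using orth[OF xu, of "\<lambda>y. A.coefT \<sigma> [x, y, u]"] by simp
  qed
  then show ?thesis unfolding F(3) by (intro sum.neutral) auto
qed

text \<open>Every linear relation \<open>k\<close> of the second algebra with given ends is realised by an element of
  its tensor algebra, and pairing with that element tests one fibre.\<close>

lemma annihilator1:
  assumes \<sigma>: "\<sigma> \<in> part A.T 2" and *: "\<And>\<tau>. \<tau> \<in> quadratic_rels P' L e' \<Longrightarrow> pair2 \<sigma> \<tau> = 0"
  shows "\<sigma> \<in> quadratic_rels P L e"
  unfolding A.in_quadratic_rels[OF \<sigma>]
proof (intro ballI)
  fix x u assume xu: "x \<in> L" "u \<in> L"
  have "(\<Sum>y | adj x y \<and> adj y u. A.coefT \<sigma> [x, y, u] * k y) = 0" if k: "k \<in> B.W x u" for k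
  proof -
    define \<tau> where "\<tau> = (\<Sum>y\<in>B.M x u. scal (k y) * (B.tar x y * B.tar y u))"
    have \<tau>2: "\<tau> \<in> part B.T 2"
      unfolding \<tau>_def by (intro part_sum part_scal B.part_tar2) auto
    have c: "B.coefT \<tau> p = (\<Sum>y\<in>B.M x u. if p = [x, y, u] then k y else 0)" for p
      unfolding \<tau>_def B.coefT_sum B.coefT_scal
      by (intro sum.cong) (auto simp: B.coefT_tar2)
    have c0: "B.coefT \<tau> p = 0" if "p \<notin> (\<lambda>y. [x, y, u]) ` B.M x u" for p
      unfolding c using that by (intro sum.neutral) auto
    have "\<tau> \<in> quadratic_rels P' L e'"
      unfolding B.in_quadratic_rels[OF \<tau>2]
    proof (intro ballI)
      fix a b assume "a \<in> L" "b \<in> L"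
      show "(\<lambda>y. B.coefT \<tau> [a, y, b]) \<in> B.W a b"
      proof (cases "a = x \<and> b = u")
        case True
        have "(\<Sum>y\<in>B.M x u. scal (B.coefT \<tau> [x, y, u]) * (gen (ar' x y) * gen (ar' y u)))
          = (\<Sum>y\<in>B.M x u. scal (k y) * (gen (ar' x y) * gen (ar' y u)))"
          using B.finite_mid by (intro sum.cong) (auto simp: c)
        then show ?thesis using k True by (simp add: B.W_def)
      next
        case False
        then have "B.coefT \<tau> [a, y, b] = 0" for y unfolding c by (intro sum.neutral) auto
        then show ?thesis by (simp add: B.W_def gen_ideal.zero)
      qed
    qed
    from *[OF this] have "0 = pair2 \<sigma> \<tau>" by simp
    also have "\<dots> = (\<Sum>p\<in>{p. A.coefT \<sigma> p \<noteq> 0} \<union> (\<lambda>y. [x, y, u]) ` B.M x u. A.coefT \<sigma> p * B.coefT \<tau> p)"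
      unfolding pair2_def using A.finite_coefT[OF \<sigma>] B.finite_mid by (intro fpair_superset) auto
    also have "\<dots> = (\<Sum>p\<in>(\<lambda>y. [x, y, u]) ` B.M x u. A.coefT \<sigma> p * B.coefT \<tau> p)"
      using A.finite_coefT[OF \<sigma>] B.finite_mid
      by (intro sum.mono_neutral_right) (auto simp: c0)
    also have "\<dots> = (\<Sum>y\<in>B.M x u. A.coefT \<sigma> [x, y, u] * B.coefT \<tau> [x, y, u])"
      by (subst sum.reindex) (auto simp: inj_on_def)
    also have "\<dots> = (\<Sum>y\<in>B.M x u. A.coefT \<sigma> [x, y, u] * k y)"
      using B.finite_mid by (intro sum.cong) (auto simp: c)
    finally show ?thesis by simp
  qed
  then show "(\<lambda>y. A.coefT \<sigma> [x, y, u]) \<in> A.W x u"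
    unfolding orth[OF xu] by blast
qed

text \<open>The matching condition \<open>c = c e\<^sub>y\<close>, \<open>c' = e\<^sub>y c'\<close> confines the middle vertex of all paths to
  \<open>y\<close>, so the sum over paths is a product of two sums.\<close>

lemma induced: "induced_pairing P e P' e' L pair1 pair2"
  unfolding induced_pairing_def
proof (intro conjI bilinear2 ballI impI, elim conjE)
  fix y z c c' d d'
  assume y: "y \<in> L" and c: "c \<in> part P 1" "c' \<in> part P 1" "d \<in> part P' 1" "d' \<in> part P' 1"
    and cy: "c - c * gen (e y) \<in> alg_ideal P" and cy': "c' - gen (e y) * c' \<in> alg_ideal P"
  have z1: "A.coef c (a, b) = (if b = y then A.coef c (a, y) else 0)" for a b
    using A.coef_cgr[of c "c * gen (e y)"] A.coef_e_right[OF y c(1), of a b] cy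
    by (auto simp: cgr_def A.in_alg_ideal)
  have z2: "A.coef c' (a, b) = (if a = y then A.coef c' (y, b) else 0)" for a b
    using A.coef_cgr[of c' "gen (e y) * c'"] A.coef_e_left[OF y c(2), of a b] cy'
    by (auto simp: cgr_def A.in_alg_ideal)
  define S where "S = fst ` {p. A.coef c p \<noteq> 0}"
  define U where "U = snd ` {p. A.coef c' p \<noteq> 0}"
  have fin: "finite S" "finite U" unfolding S_def U_def using A.finite_coef c by auto
  have S: "a \<in> S" if "A.coef c (a, b) \<noteq> 0" for a b using that unfolding S_def by force
  have U: "b \<in> U" if "A.coef c' (a, b) \<noteq> 0" for a b using that unfolding U_def by force
  let ?\<sigma> = "gen (TVec c) * gen (TVec c')" and ?\<tau> = "gen (TVec d) * gen (TVec d')"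
  have prt: "?\<sigma> \<in> part A.T 2"
    unfolding one_add_one[symmetric] by (intro part_mult part_gen) (use c in auto)
  have coef0: "A.coefT ?\<sigma> [a, b, u] = A.coef c (a, b) * A.coef c' (b, u)"
    "B.coefT ?\<tau> [a, b, u] = B.coef d (a, b) * B.coef d' (b, u)" if "adj a b" "adj b u" for a b u
    using A.coefT_TVec2[OF A.path3[OF that]] B.coefT_TVec2[OF B.path3[OF that]] by auto
  have coef1: "A.coefT ?\<sigma> [a, b, u] * B.coefT ?\<tau> [a, b, u] =
     (A.coef c (a, b) * A.coef c' (b, u)) * (B.coef d (a, b) * B.coef d' (b, u))" for a b u
  proof (cases "adj a b \<and> adj b u")
    case False
    then have "A.coefT ?\<sigma> [a, b, u] = 0" "A.coef c (a, b) = 0 \<or> A.coef c' (b, u) = 0"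
      by (auto simp: A.coefT_def A.coef_def)
    then show ?thesis by auto
  qed (use coef0 in simp)
  have "pair2 ?\<sigma> ?\<tau> = (\<Sum>p\<in>(\<lambda>(a, u). [a, y, u]) ` (S \<times> U). A.coefT ?\<sigma> p * B.coefT ?\<tau> p)"
    unfolding pair2_def
  proof (rule fpair_superset)
    fix p assume p: "A.coefT ?\<sigma> p \<noteq> 0"
    obtain a b u where abu: "p = [a, b, u]" "adj a b" "adj b u"
      using coefT_length[OF prt p] by blast
    then have n: "A.coef c (a, b) \<noteq> 0" "A.coef c' (b, u) \<noteq> 0" using p coef0(1)[of a b u] by auto
    then have "b = y" using z1[of a b] by presburger
    moreover have "a \<in> S" "u \<in> U" using S U n by blast+
    ultimately show "p \<in> (\<lambda>(a, u). [a, y, u]) ` (S \<times> U)" using abu by auto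
  qed (use fin in simp)
  also have "\<dots> = (\<Sum>(a, u)\<in>S \<times> U. A.coefT ?\<sigma> [a, y, u] * B.coefT ?\<tau> [a, y, u])"
    by (subst sum.reindex) (auto simp: inj_on_def intro!: sum.cong)
  also have "\<dots> = (\<Sum>a\<in>S. \<Sum>u\<in>U. (A.coef c (a, y) * B.coef d (a, y)) * (A.coef c' (y, u) * B.coef d' (y, u)))"
    unfolding sum.cartesian_product[symmetric] coef1 by (intro sum.cong) (auto simp: mult_ac)
  also have "\<dots> = (\<Sum>a\<in>S. A.coef c (a, y) * B.coef d (a, y)) * (\<Sum>u\<in>U. A.coef c' (y, u) * B.coef d' (y, u))"
    by (simp only: sum_product)
  finally have main: "pair2 ?\<sigma> ?\<tau> = (\<Sum>a\<in>S. A.coef c (a, y) * B.coef d (a, y)) * (\<Sum>u\<in>U. A.coef c' (y, u) * B.coef d' (y, u))" .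
  have "(\<Sum>a\<in>S. A.coef c (a, y) * B.coef d (a, y)) = (\<Sum>p\<in>(\<lambda>a. (a, y)) ` S. A.coef c p * B.coef d p)"
    by (subst sum.reindex) (auto simp: inj_on_def)
  also have "\<dots> = pair1 c d"
    unfolding pair1_def
  proof (rule fpair_superset[symmetric])
    fix i assume i: "A.coef c i \<noteq> 0"
    obtain a b where ab: "i = (a, b)" by (cases i)
    then have "b = y" using z1[of a b] i by presburger
    then show "i \<in> (\<lambda>a. (a, y)) ` S" using S[of a b] i ab by blast
  qed (use fin in simp)
  finally have e1: "(\<Sum>a\<in>S. A.coef c (a, y) * B.coef d (a, y)) = pair1 c d" .
  have "(\<Sum>u\<in>U. A.coef c' (y, u) * B.coef d' (y, u)) = (\<Sum>p\<in>Pair y ` U. A.coef c' p * B.coef d' p)"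
    by (subst sum.reindex) (auto simp: inj_on_def)
  also have "\<dots> = pair1 c' d'"
    unfolding pair1_def
  proof (rule fpair_superset[symmetric])
    fix i assume i: "A.coef c' i \<noteq> 0"
    obtain a b where ab: "i = (a, b)" by (cases i)
    then have "a = y" using z2[of a b] i by presburger
    then show "i \<in> Pair y ` U" using U[of a b] i ab by blast
  qed (use fin in simp)
  finally have e2: "(\<Sum>u\<in>U. A.coef c' (y, u) * B.coef d' (y, u)) = pair1 c' d'" .
  show "pair2 ?\<sigma> ?\<tau> = pair1 c d * pair1 c' d'" by (simp only: main e1 e2)
qed

end

text \<open>By this symmetry the annihilator statement for the second algebra follows from that for the
  first.\<close>

sublocale dual_quivers \<subseteq> swap: dual_quivers P' L e' adj ar' \<kappa>' P e ar \<kappa>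
  by unfold_locales (use orth orth' in \<open>simp_all add: mult.commute\<close>)

context dual_quivers
begin

lemma pair2_swap:
  assumes "\<sigma> \<in> part A.T 2" "\<tau> \<in> part B.T 2"
  shows "swap.pair2 \<tau> \<sigma> = pair2 \<sigma> \<tau>"
proof -
  let ?X = "{p. A.coefT \<sigma> p \<noteq> 0} \<union> {p. B.coefT \<tau> p \<noteq> 0}"
  have "finite ?X" using A.finite_coefT[OF assms(1)] B.finite_coefT[OF assms(2)] by simp
  note * = fpair_superset[OF this]
  have "pair2 \<sigma> \<tau> = (\<Sum>p\<in>?X. A.coefT \<sigma> p * B.coefT \<tau> p)" unfolding pair2_def by (rule *) simp
  moreover have "swap.pair2 \<tau> \<sigma> = (\<Sum>p\<in>?X. B.coefT \<tau> p * A.coefT \<sigma> p)" 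
    unfolding swap.pair2_def by (rule *) simp
  ultimately show ?thesis by (simp add: mult.commute)
qed

theorem quadratically_dualI:
  assumes "is_quadratic P L e" "is_quadratic P' L e'"
  shows "quadratically_dual P e P' e' L pair1"
  unfolding quadratically_dual_def
proof (intro conjI exI[of _ pair2] assms A.degree_zero B.degree_zero bilinear1 induced)
  show "quadratic_rels P L e = {\<tau> \<in> part A.T 2. \<forall>\<tau>'\<in>quadratic_rels P' L e'. pair2 \<tau> \<tau>' = 0}"
    using pair2_zero annihilator1 by (auto simp: quadratic_rels_def[of P])
  have "pair2 \<sigma> \<tau> = swap.pair2 \<tau> \<sigma>" if "\<sigma> \<in> quadratic_rels P L e" "\<tau> \<in> part B.T 2" for \<sigma> \<tau>
    using pair2_swap that by (simp add: quadratic_rels_def)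
  then show "quadratic_rels P' L e' = {\<tau>' \<in> part B.T 2. \<forall>\<tau>\<in>quadratic_rels P L e. pair2 \<tau> \<tau>' = 0}"
    using pair2_zero swap.annihilator1 by (auto simp: quadratic_rels_def[of P'])
qed

end

subsection \<open>A criterion for being quadratic\<close>

context quiver_pres
begin

abbreviation "J \<equiv> rels T \<union> quadratic_rels P L e"

lemma rels_T_sub: "\<sigma> \<simeq>[rels T] \<tau> \<Longrightarrow> \<sigma> \<simeq>[J] \<tau>"
  by (erule cgr_mono) simp

lemma rels_T_free: "rels T \<subseteq> free_on (gens T)"
proof
  fix s assume "s \<in> rels T"
  note mem = iffD2[OF free_on_simps(4)]
  from \<open>s \<in> rels T\<close> show "s \<in> free_on (gens T)"
  proof (cases rule: rels_T_cases)
    case (idem x y)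
    then show ?thesis by (cases "x = y") (auto intro!: free_on_diff free_on_mult mem)
  next
    case (add f g)
    show ?thesis unfolding add(1)
      by (intro free_on_diff mem) (use add(2,3) part_add[OF add(2,3)] in auto)
  next
    case (scal r f)
    show ?thesis unfolding scal(1)
      by (intro free_on_diff free_on_mult free_on_simps(3) mem) (use scal(2) part_scal[OF scal(2), of r] in auto)
  next
    case (zero f)
    then show ?thesis by auto
  next
    case (left x f)
    show ?thesis unfolding left(1)
      by (intro free_on_diff free_on_mult mem) (use left(2,3) part_e_left[OF left(2,3)] in auto)
  next
    case (right x f)
    show ?thesis unfolding right(1)
      by (intro free_on_diff free_on_mult mem) (use right(2,3) part_e_right[OF right(2,3)] in auto)
  qed
qed

lemma in_quadratic_closure:
  "\<tau> \<in> alg_ideal (T\<lparr>rels := J\<rparr>) \<longleftrightarrow> \<tau> \<in> free_on (gens T) \<and> \<tau> \<in> ideal J"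
proof -
  have "quadratic_rels P L e \<subseteq> free_on (gens T)"
    using part_free_on[of _ T 2] by (auto simp: quadratic_rels_def)
  then have "rels (T\<lparr>rels := J\<rparr>) \<subseteq> free_on (central (T\<lparr>rels := J\<rparr>) \<union> gens (T\<lparr>rels := J\<rparr>))"
    using rels_T_free by simp
  moreover have "full_rels (T\<lparr>rels := J\<rparr>) = J" by (auto simp: full_rels_def)
  ultimately show ?thesis by (simp add: alg_ideal_iff)
qed

lemma J_quadratic:
  assumes "x \<in> L" "u \<in> L" "k \<in> W x u"
  shows "(\<Sum>y\<in>M x u. scal (k y) * (tar x y * tar y u)) \<in> ideal J"
proof -
  let ?\<tau> = "\<Sum>y\<in>M x u. scal (k y) * (tar x y * tar y u)"
  have p: "?\<tau> \<in> part T 2" by (intro part_sum part_scal part_tar2) auto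
  have "tm ?\<tau> = (\<Sum>y\<in>M x u. scal (k y) * (gen (ar x y) * gen (ar y u)))"
    by (simp add: tm_hom tar_def)
  then have "tm ?\<tau> \<in> alg_ideal P"
    using assms(3) tm_free_on[of ?\<tau>] part_free_on[OF p] by (simp add: in_alg_ideal W_def)
  then show ?thesis using p by (intro ideal_base) (simp add: quadratic_rels_def)
qed

text \<open>The relations make a central generator commute with letters only.\<close>

lemma central_commutes:
  assumes "z \<in> central P" "f \<in> free_on G"
  shows "gen z * f \<simeq>[I] f * gen z"
proof -
  have w: "gen z * word w \<simeq>[I] word w * gen z" if "set w \<subseteq> G" for w
    using that
  proof (induction w)
    case (Cons g w)
    have "gen z * word (g # w) = gen z * gen g * word w" by (simp add: word_Cons mult.assoc)
    also have "\<dots> \<simeq>[I] gen g * gen z * word w"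
      by (intro cgr_right cgr_base) (use Cons assms in \<open>auto simp: full_rels_def\<close>)
    also have "\<dots> = gen g * (gen z * word w)" by (simp add: mult.assoc)
    also have "\<dots> \<simeq>[I] gen g * (word w * gen z)" by (intro cgr_left Cons.IH) (use Cons in auto)
    also have "\<dots> = word (g # w) * gen z" by (simp add: word_Cons mult.assoc)
    finally show ?case .
  qed (simp add: one_word[symmetric])
  show ?thesis
  proof (rule free_induct[where f = f])
    fix v r assume "v \<in> Poly_Mapping.keys f"
    from w[OF free_onD[OF assms(2) this]] have "scal r * (gen z * word v) \<simeq>[I] scal r * (word v * gen z)"
      by (rule cgr_left)
    then have "gen z * (scal r * word v) \<simeq>[I] scal r * word v * gen z"
      by (simp only: scal_left_comm[of "gen z"] mult.assoc)
    then show "gen z * Poly_Mapping.single v r \<simeq>[I] Poly_Mapping.single v r * gen z"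
      by (simp add: scal_mult_single)
  qed (simp_all add: distrib_left distrib_right cgr_add)
qed

definition tm_image :: "('g list \<Rightarrow>\<^sub>0 'r) \<Rightarrow> bool" where
  "tm_image f \<longleftrightarrow> (\<exists>\<tau>\<in>elems T. f \<simeq>[I] tm \<tau>)"

lemma tm_image_cgr: "tm_image g \<Longrightarrow> f \<simeq>[I] g \<Longrightarrow> tm_image f"
  unfolding tm_image_def using cgr_trans[of f I g] by blast

lemma tm_image_0: "tm_image 0"
  unfolding tm_image_def by (intro bexI[of _ 0]) simp_all

lemma tm_image_add:
  assumes "tm_image f" "tm_image g" shows "tm_image (f + g)"
proof -
  obtain \<sigma> \<tau> where *: "\<sigma> \<in> elems T" "f \<simeq>[I] tm \<sigma>" "\<tau> \<in> elems T" "g \<simeq>[I] tm \<tau>"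
    using assms unfolding tm_image_def by blast
  then show ?thesis unfolding tm_image_def
    by (intro bexI[of _ "\<sigma> + \<tau>"] elems_add) (auto simp: tm_hom intro: cgr_add)
qed

lemma tm_image_mult:
  assumes "tm_image f" "tm_image g" shows "tm_image (f * g)"
proof -
  obtain \<sigma> \<tau> where *: "\<sigma> \<in> elems T" "f \<simeq>[I] tm \<sigma>" "\<tau> \<in> elems T" "g \<simeq>[I] tm \<tau>"
    using assms unfolding tm_image_def by blast
  then show ?thesis unfolding tm_image_def
    by (intro bexI[of _ "\<sigma> * \<tau>"] elems_mult_left elems_free_on) (auto simp: tm_hom intro: cgr_mult)
qed

lemma tm_image_scal: 
  assumes "tm_image f" shows "tm_image (scal r * f)"
proof -
  obtain \<sigma> where *: "\<sigma> \<in> elems T" "f \<simeq>[I] tm \<sigma>"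
    using assms unfolding tm_image_def by blast
  then show ?thesis unfolding tm_image_def
    by (intro bexI[of _ "scal r * \<sigma>"] elems_mult_left) (auto simp: tm_hom intro: cgr_left)
qed

lemma tm_image_sum: "(\<And>i. i \<in> X \<Longrightarrow> tm_image (f i)) \<Longrightarrow> tm_image (sum f X)"
  by (induction X rule: infinite_finite_induct) (auto intro: tm_image_0 tm_image_add)

lemma tm_image_e: "x \<in> L \<Longrightarrow> tm_image (gen (e x))"
  unfolding tm_image_def by (intro bexI[of _ "gen (TIdem x)"]) (auto simp: elems_def)

lemma tm_image_ar: "adj x y \<Longrightarrow> tm_image (gen (ar x y))"
  unfolding tm_image_def using part_elems[OF part_tar]
  by (intro bexI[of _ "tar x y"]) (auto simp: tar_def)

lemma tm_image_pth: "path p \<Longrightarrow> tm_image (tm (pth p))"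
  by (induction p rule: path.induct) (auto simp: tm_image_e tm_hom tar_def intro!: tm_image_mult tm_image_ar)

text \<open>A word has at least one letter that is not central. Central letters can be moved to a
  vertex: on its left they meet the first vertex of a path, and on its right they are first
  commuted to the left.\<close>

lemma elems_tm_image:
  assumes gens: "\<And>g. g \<in> gens P \<Longrightarrow> tm_image (gen g)"
    and central: "\<And>z x. z \<in> central P \<Longrightarrow> x \<in> L \<Longrightarrow> tm_image (gen z * gen (e x))"
    and f: "f \<in> elems P"
  shows "tm_image f"
proof -
  have left: "tm_image (gen z * f)" if z: "z \<in> central P" and f: "tm_image f" for z f
  proof -
    obtain \<tau> where \<tau>: "\<tau> \<in> elems T" "f \<simeq>[I] tm \<tau>" using f unfolding tm_image_def by blast
    obtain X r where X: "finite X" "X \<subseteq> {p. path p}" "\<tau> \<simeq>[rels T] (\<Sum>p\<in>X. scal (r p) * pth p)"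
      using spanned_T_elems[OF \<tau>(1)] unfolding spanned_def by auto
    have "gen z * f \<simeq>[I] gen z * (\<Sum>p\<in>X. scal (r p) * tm (pth p))"
      using cgr_trans[OF \<tau>(2) tm_cgr[OF X(3)]] by (intro cgr_left) (simp add: tm_hom)
    also have "\<dots> = (\<Sum>p\<in>X. scal (r p) * (gen z * tm (pth p)))"
      by (simp add: sum_distrib_left scal_left_comm[of "gen z"])
    finally have *: "gen z * f \<simeq>[I] (\<Sum>p\<in>X. scal (r p) * (gen z * tm (pth p)))" .
    have "tm_image (gen z * tm (pth p))" if "p \<in> X" for p
    proof -
      have p: "path p" using that X(2) by auto
      then obtain x q where q: "p = x # q" by (cases p) auto
      have x: "x \<in> L" using path_hd p q by blast
      have "tm (gen (TIdem x) * pth p) \<simeq>[I] tm (pth p)"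
        using tm_cgr[OF TIdem_pth[OF x, of x q]] p q by simp
      then have "gen z * tm (pth p) \<simeq>[I] gen z * (gen (e x) * tm (pth p))"
        by (intro cgr_left, intro cgr_sym[of "gen (e x) * tm (pth p)"]) (simp add: tm_hom)
      also have "\<dots> = gen z * gen (e x) * tm (pth p)" by (simp add: mult.assoc)
      finally show ?thesis
        by (rule tm_image_cgr[rotated]) (intro tm_image_mult central z x tm_image_pth p)
    qed
    then show ?thesis by (intro tm_image_cgr[OF _ *] tm_image_sum tm_image_scal)
  qed
  have right: "tm_image (f * word w)" if "set w \<subseteq> central P" "tm_image f" "f \<in> free_on G" for f w
    using that
  proof (induction w arbitrary: f)
    case (Cons z w)
    have "tm_image (f * gen z)"
      by (rule tm_image_cgr[OF left[of z f] cgr_sym[OF central_commutes[of z f]]]) (use Cons in auto)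
    then have "tm_image (f * gen z * word w)"
      using Cons by (intro Cons.IH) (auto intro: free_on_mult)
    then show ?case by (simp add: word_Cons mult.assoc)
  qed (simp add: one_word[symmetric])
  have "tm_image (word w)" if "set w \<subseteq> G" "set w \<inter> gens P \<noteq> {}" for w
    using that
  proof (induction w)
    case (Cons g w)
    show ?case
    proof (cases "set w \<inter> gens P = {}")
      case True
      then have "set w \<subseteq> central P" "g \<in> gens P" using Cons.prems by auto
      then show ?thesis using right[of w "gen g"] gens by (simp add: word_Cons)
    next
      case False
      then have "tm_image (word w)" using Cons by auto
      then show ?thesis using Cons.prems left gens tm_image_mult by (auto simp: word_Cons)
    qed
  qed simp
  note word = this
  show ?thesis
  proof (rule free_induct[where f = f])
    fix w r assume "w \<in> Poly_Mapping.keys f"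
    then have "tm_image (word w)" using f by (intro word) (auto simp: elems_def)
    from tm_image_scal[OF this, of r] show "tm_image (Poly_Mapping.single w r)"
      by (simp add: scal_mult_single)
  qed (auto intro: tm_image_0 tm_image_add)
qed

text \<open>The presented algebra need not have a unit when there are infinitely many vertices, so a
  central generator is sent to a finite sum over vertices, and its relations hold only once this
  sum is large enough. Each element of the ideal involves finitely many relations, hence is killed
  by all sufficiently large truncations.\<close>

theorem is_quadraticI:
  fixes \<rho> :: "'x set \<Rightarrow> 'g \<Rightarrow> (('x, 'g list \<Rightarrow>\<^sub>0 'r) tensor_letter list \<Rightarrow>\<^sub>0 'r)"
  assumes gens: "\<And>g. g \<in> gens P \<Longrightarrow> tm_image (gen g)"
    and central: "\<And>z x. z \<in> central P \<Longrightarrow> x \<in> L \<Longrightarrow> tm_image (gen z * gen (e x))"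
    and rels: "\<And>s. s \<in> I \<Longrightarrow> \<forall>\<^sub>F X in finite_subsets_at_top L. lift (\<rho> X) s \<in> ideal J"
    and idem: "\<And>X x. x \<in> L \<Longrightarrow> \<rho> X (e x) \<simeq>[J] gen (TIdem x)"
    and arrow: "\<And>X x y. adj x y \<Longrightarrow> \<rho> X (ar x y) \<simeq>[J] tar x y"
  shows "is_quadratic P L e"
proof -
  have ideal: "\<forall>\<^sub>F X in finite_subsets_at_top L. lift (\<rho> X) f \<in> ideal J" if "f \<in> ideal I" for f
    using that
  proof induction
    case (mult s a b)
    from rels[OF mult(1)] show ?case
      by (rule eventually_mono) (simp add: lift_mult ideal_mult_left ideal_mult_right)
  next
    case (add f g)
    from eventually_conj[OF add.IH] show ?case
      by (rule eventually_mono) (simp add: lift_add gen_ideal.add)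
  qed (simp add: gen_ideal.zero)
  have letter: "\<forall>\<^sub>F X in finite_subsets_at_top L. lift (\<rho> X) (tm (gen l)) \<simeq>[J] gen l" if "l \<in> gens T" for l
  proof (cases l)
    case (TIdem x)
    then have "x \<in> L" using that by auto
    then show ?thesis using idem TIdem by simp
  next
    case (TVec f)
    then have f: "f \<in> part P 1" using that by auto
    obtain X where X: "finite X" "X \<subseteq> Arr" "f \<simeq>[I] (\<Sum>p\<in>X. scal (coef f p) * arrow p)"
      by (rule arrow_expand[OF f]) (rule that)
    have t: "gen (TVec f) \<simeq>[J] (\<Sum>p\<in>X. scal (coef f p) * (\<lambda>(x, y). tar x y) p)"
      by (intro rels_T_sub T_expand f X)
    from ideal[OF X(3)[unfolded cgr_def]] show ?thesis
    proof (rule eventually_mono)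
      fix Y assume "lift (\<rho> Y) (f - (\<Sum>p\<in>X. scal (coef f p) * arrow p)) \<in> ideal J"
      then have "lift (\<rho> Y) f \<simeq>[J] (\<Sum>p\<in>X. scal (coef f p) * lift (\<rho> Y) (arrow p))"
        by (simp add: cgr_def lift_diff lift_sum lift_mult)
      also have "\<dots> \<simeq>[J] (\<Sum>p\<in>X. scal (coef f p) * (\<lambda>(x, y). tar x y) p)"
        using X(2) by (intro cgr_sum cgr_left) (auto intro!: arrow)
      also note cgr_sym[OF t]
      finally show "lift (\<rho> Y) (tm (gen l)) \<simeq>[J] gen l" by (simp add: TVec)
    qed
  qed
  have word: "\<forall>\<^sub>F X in finite_subsets_at_top L. lift (\<rho> X) (tm (word w)) \<simeq>[J] word w" if "set w \<subseteq> gens T" for w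
    using that
  proof (induction w)
    case (Cons l w)
    have "\<forall>\<^sub>F X in finite_subsets_at_top L. lift (\<rho> X) (tm (gen l)) \<simeq>[J] gen l \<and> lift (\<rho> X) (tm (word w)) \<simeq>[J] word w"
      using Cons letter by (intro eventually_conj) auto
    then show ?case
      by (rule eventually_mono) (simp add: word_Cons tm_hom lift_mult cgr_mult)
  qed (simp add: one_word[symmetric])
  have inv: "\<forall>\<^sub>F X in finite_subsets_at_top L. lift (\<rho> X) (tm \<tau>) \<simeq>[J] \<tau>" if \<tau>: "\<tau> \<in> free_on (gens T)" for \<tau>
  proof (rule free_induct[where f = \<tau>])
    fix f g assume "\<forall>\<^sub>F X in finite_subsets_at_top L. lift (\<rho> X) (tm f) \<simeq>[J] f"
      "\<forall>\<^sub>F X in finite_subsets_at_top L. lift (\<rho> X) (tm g) \<simeq>[J] g"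
    from eventually_conj[OF this] show "\<forall>\<^sub>F X in finite_subsets_at_top L. lift (\<rho> X) (tm (f + g)) \<simeq>[J] f + g"
      by (rule eventually_mono) (simp add: tm_hom lift_add cgr_add)
  next
    fix w r assume "w \<in> Poly_Mapping.keys \<tau>"
    from word[OF free_onD[OF \<tau> this]]
    have "\<forall>\<^sub>F X in finite_subsets_at_top L. lift (\<rho> X) (tm (scal r * word w)) \<simeq>[J] scal r * word w"
      by (rule eventually_mono) (simp add: tm_hom lift_mult cgr_left del: scal_mult_single)
    then show "\<forall>\<^sub>F X in finite_subsets_at_top L. lift (\<rho> X) (tm (Poly_Mapping.single w r)) \<simeq>[J] Poly_Mapping.single w r"
      by (simp add: scal_mult_single)
  qed simp
  show ?thesis
    unfolding is_quadratic_def Let_def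
  proof (intro conjI ballI)
    fix f assume f: "f \<in> elems P"
    then obtain \<tau> where \<tau>: "\<tau> \<in> elems T" "f \<simeq>[I] tm \<tau>"
      using elems_tm_image[OF gens central] unfolding tm_image_def by blast
    have "tm \<tau> \<in> free_on G" using elems_free_on[OF \<tau>(1)] by (intro tm_free_on) simp
    then have "f - tm \<tau> \<in> alg_ideal P"
      using \<tau>(2) elems_free_on[OF f] by (auto simp: in_alg_ideal cgr_def intro: free_on_diff)
    with \<tau>(1) show "\<exists>\<tau>\<in>elems T. f - tm \<tau> \<in> alg_ideal P" by blast
  next
    fix \<tau> assume "\<tau> \<in> elems T"
    then have \<tau>: "\<tau> \<in> free_on (gens T)" using elems_free_on[of \<tau> T] by simp
    have "tm \<tau> \<in> alg_ideal P \<longleftrightarrow> tm \<tau> \<in> ideal I"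
      using tm_free_on[OF \<tau>] by (simp add: in_alg_ideal)
    also have "\<dots> \<longleftrightarrow> \<tau> \<in> ideal J"
    proof
      assume "tm \<tau> \<in> ideal I"
      from eventually_conj[OF ideal[OF this] inv[OF \<tau>]]
      obtain X where "lift (\<rho> X) (tm \<tau>) \<in> ideal J" "lift (\<rho> X) (tm \<tau>) \<simeq>[J] \<tau>"
        using eventually_happens'[OF finite_subsets_at_top_neq_bot] by blast
      then show "\<tau> \<in> ideal J" using cgr_ideal by blast
    next
      assume "\<tau> \<in> ideal J"
      moreover have "tm s \<in> ideal I" if "s \<in> J" for s
        using that tm_rels by (auto simp: quadratic_rels_def in_alg_ideal)
      ultimately show "tm \<tau> \<in> ideal I"
        unfolding tensor_mult_lift by (rule lift_ideal[rotated])
    qed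
    also have "\<dots> \<longleftrightarrow> \<tau> \<in> alg_ideal (T\<lparr>rels := J\<rparr>)"
      using in_quadratic_closure \<tau> by blast
    finally show "tm \<tau> \<in> alg_ideal P \<longleftrightarrow> \<tau> \<in> alg_ideal (T\<lparr>rels := J\<rparr>)" .
  qed
qed

end

no_notation fps_nth (infixl "$" 75)

section \<open>Chambers of a smooth parameter\<close>

definition in_cube :: "real \<Rightarrow> int ^ 'n::finite \<Rightarrow> real ^ 'n \<Rightarrow> bool" where
  "in_cube P x a \<longleftrightarrow> (\<forall>i. P * x $ i \<le> a $ i \<and> a $ i \<le> P * x $ i + P)"

definition in_open_cube :: "real \<Rightarrow> int ^ 'n::finite \<Rightarrow> real ^ 'n \<Rightarrow> bool" where
  "in_open_cube P x a \<longleftrightarrow> (\<forall>i. P * x $ i < a $ i \<and> a $ i < P * x $ i + P)"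

definition wall :: "real \<Rightarrow> int ^ 'n::finite \<Rightarrow> 'n \<Rightarrow> int \<Rightarrow> real" where
  "wall P x i \<sigma> = (if \<sigma> > 0 then P * x $ i + P else P * x $ i)"

lemma in_cube_step:
  assumes "\<sigma> = 1 \<or> \<sigma> = -1" "in_cube P x a" "a $ k = wall P x k \<sigma>" "P > 0"
  shows "in_cube P (x + axis k \<sigma>) a"
proof -
  have "P * (x + axis k \<sigma>) $ i \<le> a $ i \<and> a $ i \<le> P * (x + axis k \<sigma>) $ i + P" for i
  proof (cases "i = k")
    case True
    then show ?thesis using assms by (auto simp: wall_def axis_def algebra_simps)
  next
    case False
    then show ?thesis using assms by (simp add: in_cube_def axis_def)
  qed
  then show ?thesis by (simp add: in_cube_def)
qed

lemma convex_bounds: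
  fixes a b lo hi s :: real
  assumes "lo \<le> a" "a \<le> hi" "lo \<le> b" "b \<le> hi" "0 \<le> s" "s \<le> 1"
  shows "lo \<le> (1 - s) * a + s * b \<and> (1 - s) * a + s * b \<le> hi"
proof -
  have "0 \<le> (1 - s) * (a - lo) + s * (b - lo)" "0 \<le> (1 - s) * (hi - a) + s * (hi - b)"
    using assms by simp_all
  then show ?thesis by (simp add: algebra_simps)
qed

text \<open>The set \<open>A\<close> is an affine subspace with directions \<open>D\<close>, cut into cells by the walls
  \<open>a $ i \<in> P \<int>\<close>; smoothness says that a closed cube meeting \<open>A\<close> meets it in an interior point.
  Walking in \<open>A\<close> and recording the walls that are crossed turns convexity into statements about
  the graph on \<open>L\<close>.\<close>

locale cube_arrangement =
  fixes P :: real and A D :: "(real ^ 'n::finite) set" and L :: "(int ^ 'n) set"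
  assumes P_pos: "P > 0"
    and affine_A: "\<And>a b s. a \<in> A \<Longrightarrow> b \<in> A \<Longrightarrow> (1 - s) *\<^sub>R a + s *\<^sub>R b \<in> A"
    and dir_A: "\<And>a q s. a \<in> A \<Longrightarrow> q \<in> D \<Longrightarrow> a + s *\<^sub>R q \<in> A"
    and closed_L: "\<And>a x. a \<in> A \<Longrightarrow> in_cube P x a \<Longrightarrow> x \<in> L"
    and open_L: "\<And>x. x \<in> L \<Longrightarrow> \<exists>a\<in>A. in_open_cube P x a"
begin

definition sg :: "int ^ 'n \<Rightarrow> int ^ 'n \<Rightarrow> 'n \<Rightarrow> int" where
  "sg x u i = (if u $ i > x $ i then 1 else - 1)"

text \<open>The parameter at which the segment from \<open>a\<close> to \<open>b\<close> reaches the wall in direction \<open>i\<close>.\<close>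

definition time :: "int ^ 'n \<Rightarrow> int ^ 'n \<Rightarrow> real ^ 'n \<Rightarrow> real ^ 'n \<Rightarrow> 'n \<Rightarrow> real" where
  "time x u b a i = (wall P x i (sg x u i) - a $ i) / (b $ i - a $ i)"

definition first_walls :: "int ^ 'n \<Rightarrow> int ^ 'n \<Rightarrow> real ^ 'n \<Rightarrow> real ^ 'n \<Rightarrow> 'n set" where
  "first_walls x u b a = {k. x $ k \<noteq> u $ k \<and> (\<forall>l. x $ l \<noteq> u $ l \<longrightarrow> time x u b a k \<le> time x u b a l)}"

lemma cube_gap:
  assumes "in_cube P x a" "in_open_cube P u b" "x $ i \<noteq> u $ i"
  shows "if u $ i > x $ i then a $ i \<le> P * x $ i + P \<and> P * x $ i + P < b $ i
    else b $ i < P * x $ i \<and> P * x $ i \<le> a $ i"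
proof (cases "u $ i > x $ i")
  case True
  then have "real_of_int (x $ i) + 1 \<le> u $ i" by linarith
  then have "P * (real_of_int (x $ i) + 1) \<le> P * u $ i" using P_pos by simp
  moreover have "P * u $ i < b $ i" "a $ i \<le> P * x $ i + P" 
    using assms by (auto simp: in_cube_def in_open_cube_def)
  ultimately show ?thesis using True by (simp add: algebra_simps)
next
  case False
  then have "real_of_int (u $ i) + 1 \<le> x $ i" using assms(3) by linarith
  then have "P * (real_of_int (u $ i) + 1) \<le> P * x $ i" using P_pos by simp
  moreover have "b $ i < P * u $ i + P" "P * x $ i \<le> a $ i" 
    using assms by (auto simp: in_cube_def in_open_cube_def)
  ultimately show ?thesis using False by (simp add: algebra_simps)
qed

lemma time_bounds:
  assumes "in_cube P x a" "in_open_cube P u b" "x $ i \<noteq> u $ i"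
  shows "0 \<le> time x u b a i" "time x u b a i < 1" "b $ i - a $ i \<noteq> 0"
  using cube_gap[OF assms]
  by (auto simp: time_def sg_def wall_def divide_simps split: if_splits)

text \<open>At the smallest crossing time the segment is still in the closed cube of \<open>x\<close> and lies on
  every wall with that crossing time. It need not avoid intersections of walls, because smoothness
  turns contact with a closed cube into membership.\<close>

lemma exit_point:
  assumes a: "a \<in> A" "in_cube P x a" and b: "b \<in> A" "in_open_cube P u b"
    and k: "k \<in> first_walls x u b a"
  obtains c where "c \<in> A" "in_cube P x c" "\<And>l. l \<in> first_walls x u b a \<Longrightarrow> c $ l = wall P x l (sg x u l)"
proof -
  let ?t = "time x u b a k"
  define c where "c = (1 - ?t) *\<^sub>R a + ?t *\<^sub>R b"
  have kx: "x $ k \<noteq> u $ k" using k by (simp add: first_walls_def)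
  note t = time_bounds(1,2)[OF a(2) b(2) kx]
  have ci: "c $ i = a $ i + ?t * (b $ i - a $ i)" for i
    by (simp add: c_def algebra_simps)
  have w: "a $ l + time x u b a l * (b $ l - a $ l) = wall P x l (sg x u l)" if "x $ l \<noteq> u $ l" for l
    using time_bounds(3)[OF a(2) b(2) that] by (simp add: time_def)
  have "P * x $ i \<le> c $ i \<and> c $ i \<le> P * x $ i + P" for i
  proof (cases "x $ i = u $ i")
    case True
    have "P * x $ i \<le> a $ i" "a $ i \<le> P * x $ i + P" using a(2) unfolding in_cube_def by blast+
    moreover have "P * x $ i \<le> b $ i" "b $ i \<le> P * x $ i + P"
      using b(2) True unfolding in_open_cube_def by (metis less_imp_le)+
    moreover have "c $ i = (1 - ?t) * a $ i + ?t * b $ i" by (simp add: c_def)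
    ultimately show ?thesis using t convex_bounds[of "P * x $ i" "a $ i" "P * x $ i + P" "b $ i" ?t] by simp
  next
    case False
    then have le: "?t \<le> time x u b a i" using k by (simp add: first_walls_def)
    have g: "P * x $ i \<le> a $ i" "a $ i \<le> P * x $ i + P" using a(2) by (auto simp: in_cube_def)
    show ?thesis
    proof (cases "u $ i > x $ i")
      case True
      then have pos: "b $ i - a $ i > 0" using cube_gap[OF a(2) b(2) False] by simp
      then have "?t * (b $ i - a $ i) \<le> time x u b a i * (b $ i - a $ i)" "0 \<le> ?t * (b $ i - a $ i)"
        using le t by simp_all
      moreover have "wall P x i (sg x u i) = P * x $ i + P" using True by (simp add: wall_def sg_def)
      ultimately show ?thesis using w[OF False] g unfolding ci by linarith
    next
      case Fl: False
      then have neg: "b $ i - a $ i < 0" using cube_gap[OF a(2) b(2) False] by simp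
      then have "?t * (b $ i - a $ i) \<ge> time x u b a i * (b $ i - a $ i)" "0 \<ge> ?t * (b $ i - a $ i)"
        using le t by (simp_all add: mult_right_mono_neg mult_nonneg_nonpos)
      moreover have "wall P x i (sg x u i) = P * x $ i" using Fl by (simp add: wall_def sg_def)
      ultimately show ?thesis using w[OF False] g unfolding ci by linarith
    qed
  qed
  then have "in_cube P x c" by (simp add: in_cube_def)
  moreover have "c $ l = wall P x l (sg x u l)" if l: "l \<in> first_walls x u b a" for l
  proof -
    have "time x u b a l = ?t" "x $ l \<noteq> u $ l" using l k by (auto simp: first_walls_def intro: antisym)
    then show ?thesis using w[of l] by (simp add: ci)
  qed
  moreover have "c \<in> A" unfolding c_def using a b by (intro affine_A)
  ultimately show thesis using that by blast
qed

lemma sg_cases: "sg x u i = 1 \<or> sg x u i = - 1"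
  by (simp add: sg_def)

lemma exit_steps:
  assumes "a \<in> A" "in_cube P x a" "b \<in> A" "in_open_cube P u b"
    and k: "k \<in> first_walls x u b a"
  shows "x + axis k (sg x u k) \<in> L"
    and "l \<in> first_walls x u b a \<Longrightarrow> l \<noteq> k \<Longrightarrow> x + axis k (sg x u k) + axis l (sg x u l) \<in> L"
proof -
  obtain c where c: "c \<in> A" "in_cube P x c" "\<And>l. l \<in> first_walls x u b a \<Longrightarrow> c $ l = wall P x l (sg x u l)"
    by (rule exit_point[OF assms]) (rule that)
  have c1: "in_cube P (x + axis k (sg x u k)) c"
    by (intro in_cube_step sg_cases c P_pos k)
  then show "x + axis k (sg x u k) \<in> L" by (rule closed_L[OF c(1)])
  assume l: "l \<in> first_walls x u b a" "l \<noteq> k"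
  have "wall P (x + axis k (sg x u k)) l (sg x u l) = wall P x l (sg x u l)"
    using l(2) by (simp add: wall_def axis_def)
  then have "in_cube P (x + axis k (sg x u k) + axis l (sg x u l)) c"
    using c(3)[OF l(1)] by (intro in_cube_step sg_cases c1 P_pos) simp
  then show "x + axis k (sg x u k) + axis l (sg x u l) \<in> L" by (rule closed_L[OF c(1)])
qed

lemma first_walls_nonempty:
  assumes "x \<noteq> u"
  obtains k where "k \<in> first_walls x u b a"
proof -
  let ?S = "{k. x $ k \<noteq> u $ k}"
  have "?S \<noteq> {}" "finite ?S" using assms by (auto simp: vec_eq_iff)
  then obtain k where "k \<in> ?S" "\<And>l. l \<in> ?S \<Longrightarrow> time x u b a k \<le> time x u b a l"
    using ex_is_arg_min_if_finite[of ?S "time x u b a"] by (auto simp: is_arg_min_linorder)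
  then show thesis by (intro that[of k]) (simp add: first_walls_def)
qed

lemma open_cubeD: "in_open_cube P x a \<Longrightarrow> in_cube P x a"
  by (simp add: in_cube_def in_open_cube_def less_imp_le)

text \<open>The first wall crossed on the way from \<open>x\<close> to \<open>u\<close> leads to a chamber closer to \<open>u\<close>.\<close>

lemma first_step:
  assumes "x \<in> L" "u \<in> L" "x \<noteq> u"
  obtains k where "x $ k \<noteq> u $ k" "x + axis k (sg x u k) \<in> L"
proof -
  obtain a where a: "a \<in> A" "in_open_cube P x a" using open_L assms by blast
  obtain b where b: "b \<in> A" "in_open_cube P u b" using open_L assms by blast
  obtain k where k: "k \<in> first_walls x u b a" using first_walls_nonempty[OF assms(3)] by blast
  show thesis
    by (rule that[of k]) (use k exit_steps(1)[OF a(1) open_cubeD[OF a(2)] b k] in \<open>auto simp: first_walls_def\<close>)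
qed

text \<open>The exit point on the way from \<open>x\<close> to a neighbour lies in both closed cubes, since only one
  coordinate separates them.\<close>

lemma facet_point:
  assumes "x \<in> L" "x + axis k \<sigma> \<in> L" "\<sigma> = 1 \<or> \<sigma> = - 1"
  obtains a where "a \<in> A" "in_cube P x a" "in_cube P (x + axis k \<sigma>) a" "a $ k = wall P x k \<sigma>"
proof -
  let ?y = "x + axis k \<sigma>"
  have y: "x $ i \<noteq> ?y $ i \<longleftrightarrow> i = k" for i using assms(3) by (auto simp: axis_def)
  have s: "sg x ?y k = \<sigma>" using assms(3) by (auto simp: sg_def axis_def)
  obtain a where a: "a \<in> A" "in_open_cube P x a" using open_L assms by blast
  obtain b where b: "b \<in> A" "in_open_cube P ?y b" using open_L assms by blast
  have k: "k \<in> first_walls x ?y b a" unfolding first_walls_def y by simp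
  obtain c where c: "c \<in> A" "in_cube P x c" "\<And>l. l \<in> first_walls x ?y b a \<Longrightarrow> c $ l = wall P x l (sg x ?y l)"
    by (rule exit_point[OF a(1) open_cubeD[OF a(2)] b k]) (rule that)
  have ck: "c $ k = wall P x k \<sigma>" using c(3)[OF k] s by simp
  show thesis
    by (rule that[OF c(1,2) in_cube_step[OF assms(3) c(2) ck P_pos] ck])
qed

definition squares :: "int ^ 'n \<Rightarrow> int ^ 'n \<Rightarrow> ('n \<times> 'n) set" where
  "squares x u = {(k, l). k \<noteq> l \<and> x $ k \<noteq> u $ k \<and> x $ l \<noteq> u $ l \<and> x + axis k (sg x u k) \<in> L \<and>
     x + axis l (sg x u l) \<in> L \<and> x + axis k (sg x u k) + axis l (sg x u l) \<in> L}"

text \<open>Moving the starting point along a segment in the closed cell of \<open>x\<close>, the first wall on the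
  way to \<open>u\<close> changes only at points where two walls are met simultaneously, and there the two
  steps span a square of chambers. Connectedness of the segment yields a chain of squares.\<close>

lemma squares_connect:
  assumes x: "x \<in> L" "u \<in> L" and i: "x $ i \<noteq> u $ i" "x + axis i (sg x u i) \<in> L"
    and j: "x $ j \<noteq> u $ j" "x + axis j (sg x u j) \<in> L"
  shows "(i, j) \<in> (squares x u)\<^sup>*"
proof (rule ccontr)
  assume not: "(i, j) \<notin> (squares x u)\<^sup>*"
  obtain b where b: "b \<in> A" "in_open_cube P u b" using open_L x by blast
  obtain a0 where a0: "a0 \<in> A" "in_cube P x a0" "a0 $ i = wall P x i (sg x u i)"
    by (rule facet_point[OF x(1) i(2) sg_cases]) (rule that)
  obtain a1 where a1: "a1 \<in> A" "in_cube P x a1" "a1 $ j = wall P x j (sg x u j)"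
    by (rule facet_point[OF x(1) j(2) sg_cases]) (rule that)
  define \<gamma> where "\<gamma> = (\<lambda>s. (1 - s) *\<^sub>R a0 + s *\<^sub>R a1)"
  have \<gamma>A: "\<gamma> s \<in> A" for s unfolding \<gamma>_def by (intro affine_A a0 a1)
  have \<gamma>x: "in_cube P x (\<gamma> s)" if "s \<in> {0..1}" for s
    unfolding in_cube_def
  proof
    fix l
    have "P * x $ l \<le> a0 $ l" "a0 $ l \<le> P * x $ l + P" "P * x $ l \<le> a1 $ l" "a1 $ l \<le> P * x $ l + P"
      using a0(2) a1(2) by (auto simp: in_cube_def)
    then show "P * x $ l \<le> \<gamma> s $ l \<and> \<gamma> s $ l \<le> P * x $ l + P"
      using that convex_bounds[of "P * x $ l" "a0 $ l" "P * x $ l + P" "a1 $ l" s] by (simp add: \<gamma>_def)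
  qed
  \<comment> \<open>The parameters for which the wall \<open>k\<close> is met first form a closed set, and these finitely many
    sets cover.\<close>
  define C where "C = (\<lambda>k. {s \<in> {0..1}. k \<in> first_walls x u b (\<gamma> s)})"
  let ?S = "{k. x $ k \<noteq> u $ k}"
  have cont: "continuous_on {0..1} (\<lambda>s. time x u b (\<gamma> s) k)" if "k \<in> ?S" for k
    unfolding time_def
  proof (intro continuous_intros ballI)
    fix s :: real assume "s \<in> {0..1}"
    then show "b $ k - \<gamma> s $ k \<noteq> 0" using time_bounds(3)[OF \<gamma>x b(2)] that by blast
  qed (simp_all add: \<gamma>_def, (intro continuous_intros)+)
  have closedC: "closed (C k)" if "k \<in> ?S" for k
  proof -
    have "C k = {0..1} \<inter> (\<Inter>l\<in>?S. {s \<in> {0..1}. time x u b (\<gamma> s) k \<le> time x u b (\<gamma> s) l})"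
      using that by (auto simp: C_def first_walls_def)
    also have "closed \<dots>"
      by (intro closed_Int closed_INT ballI continuous_on_closed_Collect_le cont that closed_atLeastAtMost) auto
    finally show ?thesis .
  qed
  \<comment> \<open>Were \<open>j\<close> not reachable from \<open>i\<close>, the reachable and the other walls would disconnect the
    interval.\<close>
  define R where "R = {k \<in> ?S. (i, k) \<in> (squares x u)\<^sup>*}"
  let ?Z1 = "\<Union>k\<in>R. C k" and ?Z2 = "\<Union>k\<in>?S - R. C k"
  have "closed ?Z1" by (rule closed_UN) (auto simp: R_def intro: closedC)
  moreover have "closed ?Z2" by (rule closed_UN) (auto intro: closedC)
  moreover have "{0..1} \<subseteq> ?Z1 \<union> ?Z2"
  proof
    fix s :: real assume s: "s \<in> {0..1}"
    have "x \<noteq> u" using i by auto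
    then obtain k where "k \<in> first_walls x u b (\<gamma> s)" by (rule first_walls_nonempty)
    then have "k \<in> ?S" "s \<in> C k" using s by (auto simp: C_def first_walls_def)
    then show "s \<in> ?Z1 \<union> ?Z2" by blast
  qed
  moreover have "?Z1 \<inter> ?Z2 \<inter> {0..1} = {}"
  proof (rule ccontr)
    assume "?Z1 \<inter> ?Z2 \<inter> {0..1} \<noteq> {}"
    then obtain s k l where s: "k \<in> R" "l \<in> ?S" "l \<notin> R" "s \<in> C k" "s \<in> C l" by blast
    then have f: "s \<in> {0..1}" "k \<in> first_walls x u b (\<gamma> s)" "l \<in> first_walls x u b (\<gamma> s)" "k \<noteq> l"
      by (auto simp: C_def)
    note e = exit_steps[OF \<gamma>A \<gamma>x[OF f(1)] b]
    have "(k, l) \<in> squares x u"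
      unfolding squares_def using f e(1)[OF f(2)] e(1)[OF f(3)] e(2)[OF f(2,3)]
      by (auto simp: first_walls_def)
    then have "l \<in> R" using s(1,2) unfolding R_def by (auto intro: rtrancl_into_rtrancl)
    with s(3) show False ..
  qed
  moreover have "?Z1 \<inter> {0..1} \<noteq> {}"
  proof -
    have "time x u b (\<gamma> 0) i = 0" using a0(3) by (simp add: time_def \<gamma>_def)
    then have "i \<in> first_walls x u b (\<gamma> 0)"
      using time_bounds(1)[OF \<gamma>x[of 0] b(2)] i by (simp add: first_walls_def)
    then have "0 \<in> C i" "i \<in> R" using i by (auto simp: C_def R_def)
    then show ?thesis by force
  qed
  moreover have "?Z2 \<inter> {0..1} \<noteq> {}"
  proof -
    have "time x u b (\<gamma> 1) j = 0" using a1(3) by (simp add: time_def \<gamma>_def)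
    then have "j \<in> first_walls x u b (\<gamma> 1)"
      using time_bounds(1)[OF \<gamma>x[of 1] b(2)] j by (simp add: first_walls_def)
    then have "1 \<in> C j" "j \<in> ?S - R" using j not by (auto simp: C_def R_def)
    then show ?thesis by force
  qed
  ultimately have "\<exists>A B. closed A \<and> closed B \<and> {0..1::real} \<subseteq> A \<union> B \<and> A \<inter> B \<inter> {0..1} = {} \<and>
      A \<inter> {0..1} \<noteq> {} \<and> B \<inter> {0..1} \<noteq> {}"
    by (intro exI[of _ ?Z1] exI[of _ ?Z2] conjI)
  with connected_Icc[of "0::real" 1, unfolded connected_closed] show False by (rule notE)
qed

text \<open>A ray in the common facet of two adjacent chambers must leave it, and the wall it crosses
  separates both chambers from neighbours in the same direction.\<close>

lemma common_walls:
  assumes xy: "y = x \<or> (\<exists>i \<sigma>. (\<sigma> = 1 \<or> \<sigma> = - 1) \<and> y = x + axis i \<sigma>)" "x \<in> L" "y \<in> L"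
    and q: "q \<in> D"
    and zero: "\<And>k. x $ k \<noteq> y $ k \<or> (\<exists>\<sigma>\<in>{1, -1}. x + axis k \<sigma> \<in> L \<and> y + axis k \<sigma> \<in> L) \<Longrightarrow> q $ k = 0"
  shows "q = 0"
proof (rule ccontr)
  assume "q \<noteq> 0"
  have "\<exists>a\<in>A. in_cube P x a \<and> in_cube P y a"
  proof (cases "y = x")
    case True
    then show ?thesis using open_L[OF xy(2)] open_cubeD by blast
  next
    case False
    then obtain i \<sigma> where \<sigma>: "\<sigma> = 1 \<or> \<sigma> = - 1" "y = x + axis i \<sigma>" using xy(1) by blast
    show ?thesis
      by (rule facet_point[OF xy(2) xy(3)[unfolded \<sigma>(2)] \<sigma>(1)]) (use \<sigma>(2) in blast)
  qed
  then obtain a where a: "a \<in> A" "in_cube P x a" "in_cube P y a" by blast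
  define \<sigma> :: "'n \<Rightarrow> int" where "\<sigma> = (\<lambda>k. if q $ k > 0 then 1 else - 1)"
  define \<tau> where "\<tau> = (\<lambda>k. (wall P x k (\<sigma> k) - a $ k) / q $ k)"
  let ?S = "{k. q $ k \<noteq> 0}"
  have "?S \<noteq> {}" "finite ?S" using \<open>q \<noteq> 0\<close> by (auto simp: vec_eq_iff)
  then obtain k where k: "k \<in> ?S" "\<And>l. l \<in> ?S \<Longrightarrow> \<tau> k \<le> \<tau> l"
    using ex_is_arg_min_if_finite[of ?S \<tau>] by (auto simp: is_arg_min_linorder)
  define c where "c = a + \<tau> k *\<^sub>R q"
  have bd: "P * x $ l \<le> a $ l" "a $ l \<le> P * x $ l + P" for l using a(2) by (auto simp: in_cube_def)
  have \<tau>0: "0 \<le> \<tau> l" if "l \<in> ?S" for l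
    using bd[of l] that by (auto simp: \<tau>_def \<sigma>_def wall_def divide_simps)
  have w: "a $ l + \<tau> l * q $ l = wall P x l (\<sigma> l)" if "l \<in> ?S" for l
    using that by (simp add: \<tau>_def)
  have cl: "c $ l = a $ l + \<tau> k * q $ l" for l by (simp add: c_def)
  have cx: "P * x $ l \<le> c $ l \<and> c $ l \<le> P * x $ l + P" for l
  proof (cases "q $ l = 0")
    case True then show ?thesis using bd by (simp add: c_def)
  next
    case False
    have le: "\<tau> k \<le> \<tau> l" "0 \<le> \<tau> k" using k \<tau>0 False by auto
    show ?thesis
    proof (cases "q $ l > 0")
      case True
      then have "\<tau> k * q $ l \<le> \<tau> l * q $ l" "0 \<le> \<tau> k * q $ l" using le by simp_all
      moreover have "wall P x l (\<sigma> l) = P * x $ l + P" using True by (simp add: wall_def \<sigma>_def)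
      ultimately show ?thesis using w[of l] False bd[of l] unfolding cl by (smt (verit) mem_Collect_eq)
    next
      case Fl: False
      then have "\<tau> k * q $ l \<ge> \<tau> l * q $ l" "0 \<ge> \<tau> k * q $ l"
        using le by (simp_all add: mult_right_mono_neg mult_nonneg_nonpos)
      moreover have "wall P x l (\<sigma> l) = P * x $ l" using Fl by (simp add: wall_def \<sigma>_def)
      ultimately show ?thesis using w[of l] False bd[of l] unfolding cl by (smt (verit) mem_Collect_eq)
    qed
  qed
  then have inx: "in_cube P x c" by (simp add: in_cube_def)
  have iny: "in_cube P y c"
    unfolding in_cube_def
  proof
    fix l
    show "P * y $ l \<le> c $ l \<and> c $ l \<le> P * y $ l + P"
    proof (cases "x $ l = y $ l")
      case False
      then have "c $ l = a $ l" using zero[of l] by (simp add: c_def)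
      then show ?thesis using a(3) by (simp add: in_cube_def)
    qed (use cx[of l] in simp)
  qed
  have xyk: "x $ k = y $ k" using zero[of k] k(1) by auto
  have ck: "c $ k = wall P x k (\<sigma> k)" "c $ k = wall P y k (\<sigma> k)"
    using w[OF k(1)] xyk by (simp_all add: c_def wall_def)
  have s: "\<sigma> k = 1 \<or> \<sigma> k = - 1" by (simp add: \<sigma>_def)
  have cA: "c \<in> A" unfolding c_def by (intro dir_A a q)
  have "x + axis k (\<sigma> k) \<in> L" "y + axis k (\<sigma> k) \<in> L"
    using closed_L[OF cA] in_cube_step[OF s inx ck(1) P_pos] in_cube_step[OF s iny ck(2) P_pos] by auto
  then have "q $ k = 0" using s zero[of k] by auto
  with k(1) show False by simp
qed

end

text \<open>Moving \<open>\<lambda>\<close> slightly towards or away from the restriction of the centre of a cube \<open>x\<close> turns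
  boundary points of the cube into interior ones.\<close>

lemma smooth_cube_arrangement:
  fixes t :: "(int ^ 'n::finite) set" and \<phi> :: "int ^ 'n \<Rightarrow> int"
  assumes t: "subtorus t" and p: "p > 0" and \<phi>: "\<phi> \<in> lattice_dual t" and smooth: "smooth_parameter t p \<phi>"
  shows "cube_arrangement (real p) {a. \<forall>v\<in>t. (\<Sum>i\<in>UNIV. a $ i * of_int (v $ i)) = of_int (\<phi> v)}
    {q. \<forall>v\<in>t. (\<Sum>i\<in>UNIV. q $ i * of_int (v $ i)) = 0} (chambers t p \<phi>)"
proof -
  let ?L = "chambers t p \<phi>"
  let ?dot = "\<lambda>(a :: real ^ 'n) (v :: int ^ 'n). \<Sum>i\<in>UNIV. a $ i * of_int (v $ i)"
  have dot_lin: "?dot ((1 - s) *\<^sub>R a + s *\<^sub>R b) v = (1 - s) * ?dot a v + s * ?dot b v" 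
    "?dot (a + s *\<^sub>R b) v = ?dot a v + s * ?dot b v" for a b s v
    by (simp_all add: sum_distrib_left sum.distrib[symmetric] algebra_simps)
  obtain U :: "(int ^ 'n \<Rightarrow> real) set" where U: "open U" "(\<lambda>v. of_int (\<phi> v)) \<in> U"
    "\<And>\<psi>. \<psi> \<in> U \<Longrightarrow> \<psi> \<in> lattice_dual t \<Longrightarrow> ?L = chambers t p \<psi>"
    using smooth unfolding smooth_parameter_def by blast
  have t_add: "v + w \<in> t" if "v \<in> t" "w \<in> t" for v w
  proof -
    have "0 - w \<in> t" using t that unfolding subtorus_def by blast
    then have "v - (0 - w) \<in> t" using t that(1) unfolding subtorus_def by blast
    then show ?thesis by simp
  qed
  have \<phi>_add: "\<phi> (v + w) = \<phi> v + \<phi> w" if "v \<in> t" "w \<in> t" for v w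
    using \<phi> that by (simp add: lattice_dual_def)
  have \<phi>_0: "\<phi> v = 0" if "v \<notin> t" for v using \<phi> that by (simp add: lattice_dual_def)
  \<comment> \<open>The parameter at \<open>s\<close> on the line from \<open>\<lambda>\<close> (at \<open>s = 0\<close>) to the restriction of \<open>c\<close> (at
    \<open>s = 1\<close>).\<close>
  define \<psi> where "\<psi> = (\<lambda>c s v. if v \<in> t then (1 - s) * of_int (\<phi> v) + s * ?dot c v else 0)"
  have \<psi>_dual: "\<psi> c s \<in> lattice_dual t" for c s
    by (auto simp: lattice_dual_def \<psi>_def t_add \<phi>_add sum.distrib algebra_simps)
  have near: "\<exists>\<delta>>0. \<forall>s. \<bar>s\<bar> < \<delta> \<longrightarrow> ?L = chambers t p (\<psi> c s)" for c
  proof -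
    have "continuous_on UNIV (\<psi> c)"
    proof (rule continuous_on_coordinatewise_then_product)
      fix v show "continuous_on UNIV (\<lambda>s. \<psi> c s v)"
        by (cases "v \<in> t") (auto simp: \<psi>_def intro!: continuous_intros)
    qed
    then have "open (\<psi> c -` U)" using U(1) by (intro open_vimage)
    moreover have "\<psi> c 0 = (\<lambda>v. of_int (\<phi> v))" by (auto simp: \<psi>_def \<phi>_0)
    then have "0 \<in> \<psi> c -` U" using U(2) by simp
    ultimately obtain \<delta> where d: "\<delta> > 0" "ball 0 \<delta> \<subseteq> \<psi> c -` U"
      using open_contains_ball by blast
    show ?thesis
    proof (intro exI[of _ \<delta>] conjI allI impI d)
      fix s :: real assume "\<bar>s\<bar> < \<delta>"
      then have "\<psi> c s \<in> U" using d(2) by (auto simp: subset_iff)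
      then show "?L = chambers t p (\<psi> c s)" using \<psi>_dual by (rule U(3))
    qed
  qed
  define cen :: "int ^ 'n \<Rightarrow> real ^ 'n" where "cen = (\<lambda>x. \<chi> i. real p * x $ i + real p / 2)"
  show ?thesis
  proof
    show "real p > 0" using p by simp
  next
    fix a b :: "real ^ 'n" and s
    assume ab: "a \<in> {a. \<forall>v\<in>t. ?dot a v = of_int (\<phi> v)}" "b \<in> {a. \<forall>v\<in>t. ?dot a v = of_int (\<phi> v)}"
    show "(1 - s) *\<^sub>R a + s *\<^sub>R b \<in> {a. \<forall>v\<in>t. ?dot a v = of_int (\<phi> v)}"
    proof (intro CollectI ballI)
      fix v assume "v \<in> t"
      then have "?dot a v = of_int (\<phi> v)" "?dot b v = of_int (\<phi> v)" using ab by auto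
      then show "?dot ((1 - s) *\<^sub>R a + s *\<^sub>R b) v = of_int (\<phi> v)"
        unfolding dot_lin(1) by (simp add: algebra_simps)
    qed
  next
    fix a q :: "real ^ 'n" and s
    assume "a \<in> {a. \<forall>v\<in>t. ?dot a v = of_int (\<phi> v)}" "q \<in> {q. \<forall>v\<in>t. ?dot q v = 0}"
    then show "a + s *\<^sub>R q \<in> {a. \<forall>v\<in>t. ?dot a v = of_int (\<phi> v)}"
      using dot_lin(2)[of a s q] by simp
  next
    fix a x assume a: "a \<in> {a. \<forall>v\<in>t. ?dot a v = of_int (\<phi> v)}" "in_cube (real p) x a"
    obtain \<delta> where \<delta>: "\<delta> > 0" "\<And>s. \<bar>s\<bar> < \<delta> \<Longrightarrow> ?L = chambers t p (\<psi> (cen x) s)"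
      using near[of "cen x"] by blast
    define s where "s = min (\<delta> / 2) (1 / 2)"
    have s: "0 < s" "s < 1" "\<bar>s\<bar> < \<delta>" using \<delta>(1) by (auto simp: s_def)
    let ?a = "(1 - s) *\<^sub>R a + s *\<^sub>R cen x"
    have "x \<in> chambers t p (\<psi> (cen x) s)"
      unfolding chambers_def
    proof (intro CollectI exI[of _ ?a] conjI ballI allI)
      fix v assume "v \<in> t"
      then show "?dot ?a v = \<psi> (cen x) s v"
        using a(1) dot_lin(1)[of s a "cen x" v] by (simp add: \<psi>_def)
    next
      fix i
      have b: "real p * x $ i \<le> a $ i" "a $ i \<le> real p * x $ i + real p" using a(2) by (auto simp: in_cube_def)
      have e: "?a $ i = real p * x $ i + (1 - s) * (a $ i - real p * x $ i) + s * (real p / 2)"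
        "?a $ i = real p * x $ i + real p - (1 - s) * (real p * x $ i + real p - a $ i) - s * (real p / 2)"
        by (simp_all add: cen_def algebra_simps)
      have "0 \<le> (1 - s) * (a $ i - real p * x $ i)" "0 \<le> (1 - s) * (real p * x $ i + real p - a $ i)" "0 < s * (real p / 2)"
        using b s p by simp_all
      then show "of_nat p * of_int (x $ i) \<le> ?a $ i" "?a $ i < of_nat p * of_int (x $ i) + of_nat p"
        using e by linarith+
    qed
    then show "x \<in> ?L" using \<delta>(2)[OF s(3)] by simp
  next
    fix x assume x: "x \<in> ?L"
    obtain \<delta> where \<delta>: "\<delta> > 0" "\<And>s. \<bar>s\<bar> < \<delta> \<Longrightarrow> ?L = chambers t p (\<psi> (cen x) s)"
      using near[of "cen x"] by blast
    define s where "s = \<delta> / 2"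
    have s: "0 < s" "\<bar>- s\<bar> < \<delta>" using \<delta>(1) by (auto simp: s_def)
    \<comment> \<open>Starting beyond \<open>\<lambda>\<close>, as seen from the centre, leaves room to move back to \<open>\<lambda>\<close> into the
      interior.\<close>
    have "x \<in> chambers t p (\<psi> (cen x) (- s))" using x \<delta>(2)[OF s(2)] by simp
    then obtain a where a: "\<And>v. v \<in> t \<Longrightarrow> ?dot a v = (1 + s) * \<phi> v - s * ?dot (cen x) v"
      "\<And>i. real p * x $ i \<le> a $ i" "\<And>i. a $ i < real p * x $ i + real p"
      unfolding chambers_def by (auto simp: \<psi>_def)
    \<comment> \<open>The weight for which the combination with the centre restricts to \<open>\<lambda>\<close> again.\<close>
    define r where "r = s / (1 + s)"
    have r: "0 < r" "r < 1" "1 - r = 1 / (1 + s)" using s by (auto simp: r_def field_simps)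
    let ?a = "(1 - r) *\<^sub>R a + r *\<^sub>R cen x"
    show "\<exists>a\<in>{a. \<forall>v\<in>t. ?dot a v = of_int (\<phi> v)}. in_open_cube (real p) x a"
    proof (intro bexI[of _ ?a] CollectI ballI)
      fix v assume v: "v \<in> t"
      show "?dot ?a v = of_int (\<phi> v)"
      proof -
        have "(1 - r) * (1 + s) = 1" "(1 - r) * s = r" using s by (simp_all add: r(3), simp add: r_def)
        moreover have "(1 - r) * ((1 + s) * \<phi> v - s * ?dot (cen x) v) + r * ?dot (cen x) v
            = ((1 - r) * (1 + s)) * \<phi> v - ((1 - r) * s) * ?dot (cen x) v + r * ?dot (cen x) v"
          by (simp only: right_diff_distrib mult.assoc)
        ultimately show ?thesis unfolding dot_lin(1) a(1)[OF v] by simp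
      qed
    next
      show "in_open_cube (real p) x ?a"
        unfolding in_open_cube_def
      proof
        fix i
        have e: "?a $ i = real p * x $ i + (1 - r) * (a $ i - real p * x $ i) + r * (real p / 2)"
          "?a $ i = real p * x $ i + real p - (1 - r) * (real p * x $ i + real p - a $ i) - r * (real p / 2)"
          by (simp_all add: cen_def algebra_simps)
        have "0 \<le> (1 - r) * (a $ i - real p * x $ i)" "0 \<le> (1 - r) * (real p * x $ i + real p - a $ i)" "0 < r * (real p / 2)"
          using a(2)[of i] a(3)[of i] r(1,2) p by simp_all
        then show "real p * x $ i < ?a $ i \<and> ?a $ i < real p * x $ i + real p"
          using e by linarith
      qed
    qed
  qed
qed

section \<open>Lattices with unimodular projections\<close>

interpretation rvec: module "(*s) :: 'r::comm_ring_1 \<Rightarrow> 'r ^ 'n \<Rightarrow> 'r ^ 'n::finite"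
  by unfold_locales (simp_all add: vec_eq_iff algebra_simps)

abbreviation cast :: "int ^ 'n::finite \<Rightarrow> 'r::comm_ring_1 ^ 'n" where
  "cast v \<equiv> \<chi> i. of_int (v $ i)"

lemma base_change_span: "base_change t = rvec.span (cast ` t)"
  by (simp add: base_change_def)

lemma base_change_intros:
  "0 \<in> base_change t" "v \<in> base_change t \<Longrightarrow> w \<in> base_change t \<Longrightarrow> v + w \<in> base_change t"
  "v \<in> base_change t \<Longrightarrow> w \<in> base_change t \<Longrightarrow> v - w \<in> base_change t"
  "v \<in> base_change t \<Longrightarrow> r *s v \<in> base_change t" "u \<in> t \<Longrightarrow> cast u \<in> base_change t"
  unfolding base_change_span
  by (auto intro: rvec.span_zero rvec.span_add rvec.span_diff rvec.span_scale rvec.span_base)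

lemma base_change_sum: "(\<And>x. x \<in> X \<Longrightarrow> f x \<in> base_change t) \<Longrightarrow> sum f X \<in> base_change t"
  by (induction X rule: infinite_finite_induct) (auto intro: base_change_intros)

lemma g_class_eq: "g_class t v = g_class t w \<longleftrightarrow> v - w \<in> base_change t"
proof
  assume "g_class t v = g_class t w"
  moreover have "v \<in> g_class t v" by (simp add: g_class_def base_change_intros)
  ultimately show "v - w \<in> base_change t" by (simp add: g_class_def)
next
  assume *: "v - w \<in> base_change t"
  have "u - v \<in> base_change t \<longleftrightarrow> u - w \<in> base_change t" for u
    using base_change_intros(2)[OF _ *, of "u - v"] base_change_intros(3)[OF _ *, of "u - w"] by auto
  then show "g_class t v = g_class t w" by (auto simp: g_class_def)
qed

lemma supported_sum:
  assumes "\<And>i. i \<notin> I \<Longrightarrow> q i = 0"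
  shows "(\<Sum>i\<in>I. q i *s axis i (1 :: 'r::comm_ring_1)) = (\<chi> i. q i :: 'r ^ 'n::finite)"
  using assms by (auto simp: vec_eq_iff axis_def if_distrib[of "\<lambda>x. _ * x"] cong: if_cong)

lemma ex1_unique: "\<exists>!x. Q x \<Longrightarrow> Q a \<Longrightarrow> Q b \<Longrightarrow> a = b"
  by blast

lemma coordinate_basis_iff:
  "coordinate_basis TYPE('r::comm_ring_1) t I \<longleftrightarrow>
    (\<forall>v :: 'r ^ 'n::finite. \<exists>!q. (\<forall>i. i \<notin> I \<longrightarrow> q i = 0) \<and> (\<chi> i. q i) - v \<in> base_change t)"
proof -
  have "((\<forall>i. i \<notin> I \<longrightarrow> q i = 0) \<and> g_class t (\<Sum>i\<in>I. q i *s axis i 1) = g_class t v) \<longleftrightarrow>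
      ((\<forall>i. i \<notin> I \<longrightarrow> q i = 0) \<and> (\<chi> i. q i) - v \<in> base_change t)" for q and v :: "'r ^ 'n"
    using supported_sum[of I q] by (auto simp: g_class_eq)
  then show ?thesis unfolding coordinate_basis_def by simp
qed

lemma subtorus_span:
  assumes "subtorus t"
  shows "base_change t = t"
proof -
  have add: "v + w \<in> t" if "v \<in> t" "w \<in> t" for v w
  proof -
    have "0 - w \<in> t" using assms that unfolding subtorus_def by blast
    then have "v - (0 - w) \<in> t" using assms that(1) unfolding subtorus_def by blast
    then show ?thesis by simp
  qed
  have scale: "c *s v \<in> t" if v: "v \<in> t" for c v
  proof (induction c rule: int_induct[where k = 0])
    case base
    then show ?case using assms by (simp add: subtorus_def)
  next
    case (step1 i)
    then show ?case using add[OF step1(2) v] by (simp add: vector_sadd_rdistrib)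
  next
    case (step2 i)
    have "i *s v - v \<in> t" using assms step2(2) v unfolding subtorus_def by blast
    then show ?case by (simp add: vec_eq_iff algebra_simps)
  qed
  have "(\<lambda>v. cast v) ` t = t" by (simp add: vec_eq_iff)
  then have "base_change t = rvec.span t" by (simp add: base_change_span)
  also have "\<dots> = t"
  proof (rule rvec.span_eq_iff[THEN iffD2], rule rvec.subspaceI)
    show "0 \<in> t" using assms by (simp add: subtorus_def)
  qed (fact add scale)+
  finally show ?thesis .
qed

lemma subtorus_closed:
  assumes "subtorus t"
  shows "0 \<in> t" "v \<in> t \<Longrightarrow> w \<in> t \<Longrightarrow> v + w \<in> t" "v \<in> t \<Longrightarrow> w \<in> t \<Longrightarrow> v - w \<in> t" "v \<in> t \<Longrightarrow> k *s v \<in> t"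
    "(\<And>x. x \<in> X \<Longrightarrow> f x \<in> t) \<Longrightarrow> sum f X \<in> t"
proof -
  show "0 \<in> t" using assms by (simp add: subtorus_def)
qed (use base_change_intros(2,3)[of v t w] base_change_intros(4)[of v t k] base_change_sum[of X f t]
  in \<open>simp_all add: subtorus_span[OF assms]\<close>)

text \<open>A rational functional that vanishes on \<open>t\<close> and on the coordinates in \<open>N\<close> is a forbidden real
  covector, so \<open>t\<close> and these coordinates span.\<close>

lemma rational_span:
  fixes t :: "(int ^ 'n::finite) set"
  assumes N: "\<And>q :: real ^ 'n. (\<And>v. v \<in> t \<Longrightarrow> (\<Sum>i\<in>UNIV. q $ i * of_int (v $ i)) = 0) \<Longrightarrow>
      (\<And>k. k \<in> N \<Longrightarrow> q $ k = 0) \<Longrightarrow> q = 0"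
  shows "\<exists>q :: rat ^ 'n. (\<forall>i. i \<notin> N \<longrightarrow> q $ i = 0) \<and> v - q \<in> base_change t"
proof -
  let ?S = "cast ` t \<union> (\<lambda>k. axis k 1) ` N :: (rat ^ 'n) set"
  have "v \<in> vec.span ?S"
  proof (rule ccontr)
    assume v: "v \<notin> vec.span ?S"
    obtain B where B: "B \<subseteq> ?S" "vec.independent B" "?S \<subseteq> vec.span B"
      by (rule vec.maximal_independent_subset[of ?S])
    then have sp: "vec.span B = vec.span ?S" by (intro subset_antisym vec.span_mono B vec.span_minimal vec.subspace_span)
    then have ind: "vec.independent (insert v B)"
      using vec.independent_insert[of v B] B v by auto
    \<comment> \<open>The coordinate along \<open>v\<close> in a basis extending \<open>v\<close> and a basis of the span is the required
      functional.\<close>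
    define C where "C = vec.extend_basis (insert v B)"
    have C: "vec.independent C" "insert v B \<subseteq> C" "vec.span C = UNIV"
      unfolding C_def using vec.independent_extend_basis[OF ind] vec.extend_basis_superset[OF ind]
        vec.span_extend_basis[OF ind] by auto
    define f where "f = (\<lambda>w. vec.representation C w v)"
    have f_add: "f (a + b) = f a + f b" for a b
      unfolding f_def using vec.representation_add[OF C(1), of b a] C(3) by simp
    have f_scale: "f (r *s a) = r * f a" for r a
      unfolding f_def using vec.representation_scale[OF C(1), of a r] C(3) by simp
    have "f v = 1" unfolding f_def using vec.representation_basis[OF C(1), of v] C(2) by auto
    have fB: "f b = 0" if "b \<in> B" for b
    proof -
      have "b \<noteq> v" using that v sp vec.span_base by blast
      then show ?thesis unfolding f_def using vec.representation_basis[OF C(1), of b] C(2) that by auto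
    qed
    have f0: "f w = 0" if "w \<in> vec.span B" for w
      using that
    proof (induction rule: vec.span_induct_alt)
      case base
      show ?case using f_scale[of 0 0] by simp
    qed (simp add: f_add f_scale fB)
    have expand: "f w = (\<Sum>k\<in>UNIV. w $ k * f (axis k 1))" for w
    proof -
      have "f (\<Sum>k\<in>X. w $ k *s axis k 1) = (\<Sum>k\<in>X. w $ k * f (axis k 1))" for X
        by (induction X rule: infinite_finite_induct)
          (simp_all add: f_add f_scale, (use f_scale[of 0 0] in simp)+)
      from this[of UNIV] show ?thesis by (simp add: basis_expansion)
    qed
    define q :: "real ^ 'n" where "q = (\<chi> k. of_rat (f (axis k 1)))"
    have "q = 0"
    proof (rule N)
      fix u assume u: "u \<in> t"
      have "f (cast u) = 0" using u B(3) by (intro f0) auto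
      then have "of_rat (\<Sum>k\<in>UNIV. of_int (u $ k) * f (axis k 1)) = (0 :: real)"
        using expand[of "cast u"] by simp
      then show "(\<Sum>i\<in>UNIV. q $ i * of_int (u $ i)) = 0"
        by (simp add: q_def of_rat_sum of_rat_mult mult.commute)
    next
      fix k assume "k \<in> N"
      then have "f (axis k 1) = 0" using B(3) by (intro f0) auto
      then show "q $ k = 0" by (simp add: q_def)
    qed
    then have "f (axis k 1) = 0" for k by (simp add: q_def vec_eq_iff)
    then have "f v = 0" using expand[of v] by simp
    with \<open>f v = 1\<close> show False by simp
  qed
  then obtain a b where ab: "a \<in> vec.span (cast ` t)" "b \<in> vec.span ((\<lambda>k. axis k 1) ` N)" "v = a + b"
    unfolding vec.span_Un by auto
  have "b $ i = 0" if "i \<notin> N" for i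
    using ab(2)
  proof (induction rule: vec.span_induct_alt)
    case (step c x y)
    then show ?case using that by (auto simp: axis_def split: if_splits)
  qed simp
  with ab show ?thesis by (intro exI[of _ b]) (simp add: base_change_def)
qed

text \<open>A spanning set of coordinates of least cardinality is a basis: a dependency would allow a
  coordinate to be eliminated.\<close>

lemma rational_coordinate_basis:
  fixes t :: "(int ^ 'n::finite) set"
  assumes N: "\<And>v :: rat ^ 'n. \<exists>q. (\<forall>i. i \<notin> N \<longrightarrow> q $ i = 0) \<and> v - q \<in> base_change t"
  shows "\<exists>I\<subseteq>N. coordinate_basis TYPE(rat) t I"
proof -
  define sp where "sp = (\<lambda>I. \<forall>v :: rat ^ 'n. \<exists>q. (\<forall>i. i \<notin> I \<longrightarrow> q $ i = 0) \<and> v - q \<in> base_change t)"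
  have "\<exists>I. (I \<subseteq> N \<and> sp I) \<and> (\<forall>I'. I' \<subseteq> N \<and> sp I' \<longrightarrow> card I \<le> card I')"
    by (rule ex_has_least_nat[of "\<lambda>I. I \<subseteq> N \<and> sp I" N]) (use N in \<open>simp add: sp_def\<close>)
  then obtain I where I: "I \<subseteq> N" "sp I" "\<And>I'. I' \<subseteq> N \<Longrightarrow> sp I' \<Longrightarrow> card I \<le> card I'"
    by auto
  have indep: "q = 0" if q: "\<And>i. i \<notin> I \<Longrightarrow> q $ i = 0" "q \<in> base_change t" for q :: "rat ^ 'n"
  proof (rule ccontr)
    assume "q \<noteq> 0"
    then obtain k where k: "q $ k \<noteq> 0" by (auto simp: vec_eq_iff)
    then have kI: "k \<in> I" using q(1) by blast
    \<comment> \<open>Subtract the multiple of the dependency that cancels the coordinate \<open>k\<close>.\<close>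
    have "sp (I - {k})"
      unfolding sp_def
    proof
      fix v :: "rat ^ 'n"
      obtain r where r: "\<And>i. i \<notin> I \<Longrightarrow> r $ i = 0" "v - r \<in> base_change t"
        using I(2) unfolding sp_def by blast
      let ?r = "r - (r $ k / q $ k) *s q"
      have "v - ?r = (v - r) + (r $ k / q $ k) *s q" by simp
      also have "\<dots> \<in> base_change t" by (intro base_change_intros(2,4) r(2) q(2))
      finally have "v - ?r \<in> base_change t" .
      moreover have "?r $ i = 0" if "i \<notin> I - {k}" for i
        using that r(1)[of i] q(1)[of i] k by (cases "i = k") auto
      ultimately show "\<exists>q. (\<forall>i. i \<notin> I - {k} \<longrightarrow> q $ i = 0) \<and> v - q \<in> base_change t" by blast
    qed
    then have "card I \<le> card (I - {k})" using I(1) by (intro I(3)) auto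
    moreover have "card (I - {k}) < card I" using kI by (intro psubset_card_mono) auto
    ultimately show False by simp
  qed
  have "coordinate_basis TYPE(rat) t I"
    unfolding coordinate_basis_iff
  proof
    fix v :: "rat ^ 'n"
    obtain r where r: "\<And>i. i \<notin> I \<Longrightarrow> r $ i = 0" "v - r \<in> base_change t"
      using I(2) unfolding sp_def by blast
    have "r - v \<in> base_change t" using base_change_intros(4)[OF r(2), of "- 1"] by simp
    show "\<exists>!q. (\<forall>i. i \<notin> I \<longrightarrow> q i = 0) \<and> (\<chi> i. q i) - v \<in> base_change t"
    proof (rule ex1I[of _ "\<lambda>i. r $ i"])
      show "(\<forall>i. i \<notin> I \<longrightarrow> r $ i = 0) \<and> (\<chi> i. r $ i) - v \<in> base_change t"
        using r(1) \<open>r - v \<in> base_change t\<close> by simp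
      fix q assume q: "(\<forall>i. i \<notin> I \<longrightarrow> q i = 0) \<and> (\<chi> i. q i) - v \<in> base_change t"
      have "(\<chi> i. q i) - r = ((\<chi> i. q i) - v) + (v - r)" by simp
      also have "\<dots> \<in> base_change t" using q r(2) by (intro base_change_intros(2)) auto
      finally have "(\<chi> i. q i) - r \<in> base_change t" .
      then have "(\<chi> i. q i) - r = 0" using q r(1) by (intro indep) auto
      then show "q = (\<lambda>i. r $ i)" by (auto simp: vec_eq_iff fun_eq_iff)
    qed
  qed
  with I(1) show ?thesis by blast
qed

text \<open>The matrix of an integral projection of \<open>\<int>\<^sup>n\<close> with kernel \<open>t\<close> onto coordinates in \<open>N\<close>. As it
  is integral, it does the same job over every ring.\<close>

lemma coordinate_projection:
  fixes t :: "(int ^ 'n::finite) set"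
  assumes t: "subtorus t" "unimodular t"
    and N: "\<And>q :: real ^ 'n. (\<And>v. v \<in> t \<Longrightarrow> (\<Sum>i\<in>UNIV. q $ i * of_int (v $ i)) = 0) \<Longrightarrow>
      (\<And>k. k \<in> N \<Longrightarrow> q $ k = 0) \<Longrightarrow> q = 0"
  obtains m :: "'n \<Rightarrow> 'n \<Rightarrow> int" where "\<And>i j. i \<notin> N \<Longrightarrow> m i j = 0"
    "\<And>j. axis j 1 - (\<chi> i. m i j) \<in> t" "\<And>v i. v \<in> t \<Longrightarrow> (\<Sum>j\<in>UNIV. m i j * v $ j) = 0"
proof -
  have "\<exists>I\<subseteq>N. coordinate_basis TYPE(rat) t I"
    by (rule rational_coordinate_basis) (rule rational_span[OF N])
  then obtain I where I: "I \<subseteq> N" "coordinate_basis TYPE(int) t I"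
    using t(2) unfolding unimodular_def by blast
  note basis = I(2)[unfolded coordinate_basis_iff subtorus_span[OF t(1)], rule_format]
  have "\<exists>q. (\<forall>i. i \<notin> I \<longrightarrow> q i = 0) \<and> (\<chi> i. q i) - axis j 1 \<in> t" for j
    using basis[of "axis j 1"] by blast
  then obtain q where q: "\<And>j i. i \<notin> I \<Longrightarrow> q j i = 0" "\<And>j. (\<chi> i. q j i) - axis j 1 \<in> t" by metis
  show thesis
  proof (rule that[of "\<lambda>i j. q j i"])
    show "q j i = 0" if "i \<notin> N" for i j using that I(1) q(1) by blast
    have neg: "axis j 1 - (\<chi> i. q j i) \<in> t" for j
      using subtorus_closed(4)[OF t(1) q(2), of "- 1"] by simp
    then show "axis j 1 - (\<chi> i. q j i) \<in> t" for j .
    fix v i assume v: "v \<in> t"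
    let ?w = "\<lambda>i. \<Sum>j\<in>UNIV. q j i * v $ j"
    have "(\<Sum>j\<in>UNIV. v $ j *s ((\<chi> i. q j i) - axis j 1)) \<in> t"
      by (intro subtorus_closed(4,5)[OF t(1)] q(2))
    also have "(\<Sum>j\<in>UNIV. v $ j *s ((\<chi> i. q j i) - axis j 1)) = (\<chi> i. ?w i) - v"
      by (simp add: vec_eq_iff algebra_simps sum_subtractf axis_def if_distrib[of "\<lambda>x. _ * x"] cong: if_cong)
    finally have "(\<chi> i. ?w i) - v \<in> t" .
    from subtorus_closed(2)[OF t(1) this v]
    have w: "(\<chi> i. ?w i) - 0 \<in> t" by simp
    have z: "(\<chi> i. 0) - 0 \<in> t" by (simp add: zero_vec_def[symmetric] subtorus_closed(1)[OF t(1)])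
    have wI: "\<forall>i. i \<notin> I \<longrightarrow> ?w i = 0" using q(1) by simp
    have "?w = (\<lambda>i. 0)"
      by (rule ex1_unique[OF basis[of 0]]) (use wI w z in simp_all)
    then show "(\<Sum>j\<in>UNIV. q j i * v $ j) = 0" by (rule fun_cong)
  qed
qed

locale lattice_projection =
  fixes t :: "(int ^ 'n::finite) set" and N :: "'n set" and m :: "'n \<Rightarrow> 'n \<Rightarrow> int"
  assumes supp: "\<And>i j. i \<notin> N \<Longrightarrow> m i j = 0"
    and m_t: "\<And>j. axis j 1 - (\<chi> i. m i j) \<in> t"
    and m_0: "\<And>v i. v \<in> t \<Longrightarrow> (\<Sum>j\<in>UNIV. m i j * v $ j) = 0"
begin

definition prj :: "'r::comm_ring_1 ^ 'n \<Rightarrow> 'r ^ 'n" where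
  "prj v = (\<chi> i. \<Sum>j\<in>UNIV. of_int (m i j) * v $ j)"

definition tvec :: "'n \<Rightarrow> int ^ 'n" where
  "tvec j = axis j 1 - (\<chi> i. m i j)"

lemma tvec_t: "tvec j \<in> t"
  unfolding tvec_def by (rule m_t)

lemma prj_complement: "v - prj v = (\<Sum>j\<in>UNIV. v $ j *s cast (tvec j))"
  by (simp add: vec_eq_iff prj_def tvec_def axis_def algebra_simps sum_subtractf
      if_distrib[of of_int] if_distrib[of "\<lambda>x. _ * x"] cong: if_cong)

lemma prj_congruent: "v - prj v \<in> base_change t"
  unfolding prj_complement by (intro base_change_sum base_change_intros tvec_t)

lemma prj_add: "prj (v + w) = prj v + prj w"
  by (simp add: prj_def vec_eq_iff algebra_simps sum.distrib)

lemma prj_scale: "prj (r *s v) = r *s prj v"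
  by (simp add: prj_def vec_eq_iff algebra_simps sum_distrib_left)

lemma prj_supp: "i \<notin> N \<Longrightarrow> prj v $ i = 0"
  by (simp add: prj_def supp)

text \<open>The same integral equations cut out \<open>t \<otimes> R\<close> over every ring \<open>R\<close>; this replaces duality of
  finite-dimensional spaces.\<close>

lemma base_change_iff: "v \<in> base_change t \<longleftrightarrow> prj v = 0"
proof
  assume "v \<in> base_change t"
  then show "prj v = 0"
    unfolding base_change_span
  proof (induction rule: rvec.span_induct_alt)
    case base show ?case by (simp add: prj_def vec_eq_iff)
  next
    case (step c x y)
    then obtain u where u: "u \<in> t" "x = cast u" by blast
    have "(\<Sum>j\<in>UNIV. of_int (m i j) * (cast u :: 'a ^ 'n) $ j) = of_int (\<Sum>j\<in>UNIV. m i j * u $ j)" for i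
      by simp
    then have "prj x = 0" unfolding u(2) prj_def by (simp only: m_0[OF u(1)]) (simp add: vec_eq_iff)
    with step show ?case by (simp add: prj_add prj_scale)
  qed
next
  assume "prj v = 0"
  then show "v \<in> base_change t" using prj_congruent[of v] by simp
qed

lemma base_change_expand: "v \<in> base_change t \<Longrightarrow> v = (\<Sum>j\<in>UNIV. v $ j *s cast (tvec j))"
  using prj_complement[of v] by (simp add: base_change_iff)

text \<open>The weights \<open>v \<mapsto> v $ j\<close> generate the dual of \<open>t\<close>, with coefficients that do not depend on
  the ring.\<close>

lemma lattice_dual_expand:
  assumes t: "subtorus t" and \<psi>: "\<psi> \<in> lattice_dual t" and v: "v \<in> t"
  shows "(\<psi> v :: 'r::comm_ring_1) = (\<Sum>j\<in>UNIV. \<psi> (tvec j) * of_int (v $ j))"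
proof -
  note T' = subtorus_closed[OF t]
  have add: "\<psi> (a + b) = \<psi> a + \<psi> b" if "a \<in> t" "b \<in> t" for a b
    using \<psi> that by (simp add: lattice_dual_def)
  have zero: "\<psi> 0 = 0" using add[OF T'(1) T'(1)] by simp
  have neg: "\<psi> (a - b) = \<psi> a - \<psi> b" if "a \<in> t" "b \<in> t" for a b
    using add[OF T'(3)[OF that] that(2)] by simp
  have scale: "\<psi> (c *s a) = of_int c * \<psi> a" if a: "a \<in> t" for c a
  proof (induction c rule: int_induct[where k = 0])
    case base show ?case by (simp add: zero)
  next
    case (step1 i)
    have "(i + 1) *s a = i *s a + a" by (simp add: vec_eq_iff algebra_simps)
    then show ?case using add[OF T'(4)[OF a] a, of i] step1 by (simp add: algebra_simps)
  next
    case (step2 i)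
    have "(i - 1) *s a = i *s a - a" by (simp add: vec_eq_iff algebra_simps)
    then show ?case using neg[OF T'(4)[OF a] a, of i] step2 by (simp add: algebra_simps)
  qed
  have sum: "\<psi> (\<Sum>j\<in>X. v $ j *s tvec j) = (\<Sum>j\<in>X. \<psi> (tvec j) * of_int (v $ j)) \<and> (\<Sum>j\<in>X. v $ j *s tvec j) \<in> t" for X
    by (induction X rule: infinite_finite_induct)
      (simp_all add: zero T' add scale tvec_t mult.commute)
  have "v = (\<Sum>j\<in>UNIV. v $ j *s tvec j)"
    using base_change_expand[of v] v by (simp add: subtorus_span[OF t])
  then show ?thesis using sum[of UNIV] by metis
qed

end

section \<open>Sums of loops\<close>

text \<open>In both algebras a central generator of degree two acts at each vertex as a combination of
  loops of length two; the results below reduce its centrality to commutation with single arrows.\<close>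

context quiver_pres
begin

definition loops :: "'x \<Rightarrow> ('x \<Rightarrow> 'r) \<Rightarrow> (('x, 'g list \<Rightarrow>\<^sub>0 'r) tensor_letter list \<Rightarrow>\<^sub>0 'r)" where
  "loops x k = (\<Sum>y\<in>M x x. scal (k y) * (tar x y * tar y x))"

definition loops_commute :: "('x \<Rightarrow> 'x \<Rightarrow> 'r) \<Rightarrow> bool" where
  "loops_commute K \<longleftrightarrow> (\<forall>x y. adj x y \<longrightarrow> loops x (K x) * tar x y \<simeq>[J] tar x y * loops y (K y))"

lemma loops_add: "loops x (\<lambda>y. k y + l y) = loops x k + loops x l"
  by (simp add: loops_def scal_add distrib_right sum.distrib)

lemma loops_scal: "loops x (\<lambda>y. r * k y) = scal r * loops x k"
  by (simp only: loops_def scal_mult sum_distrib_left mult.assoc)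

lemma TIdem_tar_J: "adj x y \<Longrightarrow> gen (TIdem x) * tar x y \<simeq>[J] tar x y"
  using rels_T_sub[OF TIdem_tar[of x x y]] adj_L by simp

lemma tar_TIdem_J: "adj x y \<Longrightarrow> tar x y * gen (TIdem y) \<simeq>[J] tar x y"
  using rels_T_sub[OF tar_TIdem[of y x y]] adj_L by simp

lemma TIdem_loops: "gen (TIdem x) * loops x k \<simeq>[J] loops x k"
proof -
  have "gen (TIdem x) * loops x k = (\<Sum>y\<in>M x x. scal (k y) * (gen (TIdem x) * tar x y * tar y x))"
    by (simp add: loops_def sum_distrib_left scal_left_comm[of "gen _"] mult.assoc)
  also have "\<dots> \<simeq>[J] loops x k"
    unfolding loops_def by (intro cgr_sum cgr_left cgr_right TIdem_tar_J) simp
  finally show ?thesis .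
qed

lemma loops_TIdem: "loops x k * gen (TIdem x) \<simeq>[J] loops x k"
proof -
  have "loops x k * gen (TIdem x) = (\<Sum>y\<in>M x x. scal (k y) * (tar x y * (tar y x * gen (TIdem x))))"
    by (simp add: loops_def sum_distrib_right mult.assoc)
  also have "\<dots> \<simeq>[J] loops x k"
    unfolding loops_def by (intro cgr_sum cgr_left tar_TIdem_J) simp
  finally show ?thesis .
qed

lemma loops_mult_left:
  assumes "x \<in> L" "y \<in> L" "gen (TIdem y) * f \<simeq>[J] f"
  shows "loops x k * f \<simeq>[J] (if x = y then loops x k * f else 0)"
proof (cases "x = y")
  case False
  have "loops x k * f \<simeq>[J] (loops x k * gen (TIdem x)) * (gen (TIdem y) * f)"
    by (rule cgr_mult) (rule cgr_sym, rule loops_TIdem, rule cgr_sym, rule assms(3))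
  also have "\<dots> = loops x k * (gen (TIdem x) * gen (TIdem y)) * f" by (simp add: mult.assoc)
  also have "\<dots> \<simeq>[J] loops x k * 0 * f"
    using rels_T_sub[OF T_idem[OF assms(1,2)]] False by (intro cgr_right cgr_left) simp
  finally show ?thesis using False by simp
qed simp

lemma loops_mult_right:
  assumes "x \<in> L" "y \<in> L" "f * gen (TIdem y) \<simeq>[J] f"
  shows "f * loops x k \<simeq>[J] (if x = y then f * loops x k else 0)"
proof (cases "x = y")
  case False
  have "f * loops x k \<simeq>[J] (f * gen (TIdem y)) * (gen (TIdem x) * loops x k)"
    by (rule cgr_mult) (rule cgr_sym, rule assms(3), rule cgr_sym, rule TIdem_loops)
  also have "\<dots> = f * (gen (TIdem y) * gen (TIdem x)) * loops x k" by (simp add: mult.assoc)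
  also have "\<dots> \<simeq>[J] f * 0 * loops x k"
    using rels_T_sub[OF T_idem[OF assms(2,1)]] False by (intro cgr_right cgr_left) simp
  finally show ?thesis using False by simp
qed simp

definition loop_sum :: "'x set \<Rightarrow> ('x \<Rightarrow> 'x \<Rightarrow> 'r) \<Rightarrow> (('x, 'g list \<Rightarrow>\<^sub>0 'r) tensor_letter list \<Rightarrow>\<^sub>0 'r)" where
  "loop_sum X K = (\<Sum>x\<in>X. loops x (K x))"

text \<open>Only the summand at the first vertex of \<open>f\<close> survives. For this the sum has to contain that
  vertex, which is why relations are checked for large sets of vertices.\<close>

lemma loop_sum_left:
  assumes "finite X" "X \<subseteq> L" "y \<in> L" "gen (TIdem y) * f \<simeq>[J] f"
  shows "loop_sum X K * f \<simeq>[J] (if y \<in> X then loops y (K y) * f else 0)"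
proof -
  have "loop_sum X K * f = (\<Sum>x\<in>X. loops x (K x) * f)"
    by (simp add: loop_sum_def sum_distrib_right)
  also have "\<dots> \<simeq>[J] (\<Sum>x\<in>X. if x = y then loops x (K x) * f else 0)"
    using assms by (intro cgr_sum loops_mult_left) auto
  also have "\<dots> = (if y \<in> X then loops y (K y) * f else 0)" using assms(1) by simp
  finally show ?thesis .
qed

lemma loop_sum_right:
  assumes "finite X" "X \<subseteq> L" "y \<in> L" "f * gen (TIdem y) \<simeq>[J] f"
  shows "f * loop_sum X K \<simeq>[J] (if y \<in> X then f * loops y (K y) else 0)"
proof -
  have "f * loop_sum X K = (\<Sum>x\<in>X. f * loops x (K x))"
    by (simp add: loop_sum_def sum_distrib_left)
  also have "\<dots> \<simeq>[J] (\<Sum>x\<in>X. if x = y then f * loops x (K x) else 0)"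
    using assms by (intro cgr_sum loops_mult_right) auto
  also have "\<dots> = (if y \<in> X then f * loops y (K y) else 0)" using assms(1) by simp
  finally show ?thesis .
qed

lemma loop_sum_TIdem:
  assumes "finite X" "X \<subseteq> L" "y \<in> L"
  shows "loop_sum X K * gen (TIdem y) \<simeq>[J] gen (TIdem y) * loop_sum X K"
proof -
  have ee: "gen (TIdem y) * gen (TIdem y) \<simeq>[J] gen (TIdem y)"
    using rels_T_sub[OF T_idem[OF assms(3,3)]] by simp
  have "loop_sum X K * gen (TIdem y) \<simeq>[J] (if y \<in> X then loops y (K y) * gen (TIdem y) else 0)"
    by (intro loop_sum_left assms ee)
  also have "\<dots> \<simeq>[J] (if y \<in> X then loops y (K y) else 0)" using loops_TIdem by simp
  also have "\<dots> \<simeq>[J] (if y \<in> X then gen (TIdem y) * loops y (K y) else 0)"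
    using cgr_sym[OF TIdem_loops] by simp
  also have "\<dots> \<simeq>[J] gen (TIdem y) * loop_sum X K"
    by (rule cgr_sym, intro loop_sum_right assms ee)
  finally show ?thesis .
qed

text \<open>The second factor is a combination of products of two arrows, and the first moves past each
  of them.\<close>

lemma loops_commute_loops:
  assumes "loops_commute K"
  shows "loops x (K x) * loops x k \<simeq>[J] loops x k * loops x (K x)"
proof -
  have "loops x (K x) * loops x k = (\<Sum>y\<in>M x x. scal (k y) * (loops x (K x) * tar x y * tar y x))"
    by (simp add: loops_def[of x k] sum_distrib_left scal_left_comm[of "loops _ _"] mult.assoc)
  also have "\<dots> \<simeq>[J] (\<Sum>y\<in>M x x. scal (k y) * (tar x y * tar y x * loops x (K x)))"
  proof (intro cgr_sum cgr_left)
    fix y assume "y \<in> M x x"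
    then have y: "adj x y" "adj y x" by auto
    have "loops x (K x) * tar x y * tar y x \<simeq>[J] tar x y * loops y (K y) * tar y x"
      using assms y by (intro cgr_right) (simp add: loops_commute_def)
    also have "\<dots> = tar x y * (loops y (K y) * tar y x)" by (simp add: mult.assoc)
    also have "\<dots> \<simeq>[J] tar x y * (tar y x * loops x (K x))"
      using assms y by (intro cgr_left) (simp add: loops_commute_def)
    finally show "loops x (K x) * tar x y * tar y x \<simeq>[J] tar x y * tar y x * loops x (K x)"
      by (simp add: mult.assoc)
  qed
  also have "\<dots> = loops x k * loops x (K x)"
    by (simp add: loops_def[of x k] sum_distrib_right mult.assoc)
  finally show ?thesis .
qed

lemma loop_sum_commute:
  assumes "finite X" "X \<subseteq> L" "loops_commute K"
  shows "loop_sum X K * loop_sum X K' \<simeq>[J] loop_sum X K' * loop_sum X K"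
proof -
  have "loop_sum X K * loop_sum X K' = (\<Sum>y\<in>X. loop_sum X K * loops y (K' y))"
    by (simp add: loop_sum_def[of X K'] sum_distrib_left)
  also have "\<dots> \<simeq>[J] (\<Sum>y\<in>X. if y \<in> X then loops y (K y) * loops y (K' y) else 0)"
    using assms by (intro cgr_sum loop_sum_left TIdem_loops) auto
  also have "\<dots> \<simeq>[J] (\<Sum>y\<in>X. if y \<in> X then loops y (K' y) * loops y (K y) else 0)"
    by (intro cgr_sum) (simp add: loops_commute_loops[OF assms(3)])
  also have "\<dots> \<simeq>[J] (\<Sum>y\<in>X. loops y (K' y) * loop_sum X K)"
    by (intro cgr_sum, rule cgr_sym, intro loop_sum_right assms loops_TIdem) (use assms in auto)
  also have "\<dots> = loop_sum X K' * loop_sum X K"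
    by (simp add: loop_sum_def[of X K'] sum_distrib_right)
  finally show ?thesis .
qed

end

section \<open>The graph of chambers\<close>

lemma int_l1_dist: "int (l1_dist x y) = (\<Sum>i\<in>UNIV. \<bar>x $ i - y $ i\<bar>)"
  unfolding l1_dist_def by (simp add: sum_nonneg)

lemma l1_dist_sym: "l1_dist x y = l1_dist y x"
  by (simp add: l1_dist_def abs_minus_commute)

lemma l1_dist_eq_0: "l1_dist x y = 0 \<longleftrightarrow> x = y"
proof -
  have "l1_dist x y = 0 \<longleftrightarrow> (\<Sum>i\<in>UNIV. \<bar>x $ i - y $ i\<bar>) = 0" using int_l1_dist[of x y] by linarith
  also have "\<dots> \<longleftrightarrow> x = y" by (subst sum_nonneg_eq_0_iff) (auto simp: vec_eq_iff)
  finally show ?thesis .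
qed

lemma l1_dist_self [simp]: "l1_dist x x = 0"
  by (simp add: l1_dist_eq_0)

lemma l1_dist_step:
  "int (l1_dist (x + axis k \<sigma>) u) = int (l1_dist x u) - \<bar>x $ k - u $ k\<bar> + \<bar>x $ k + \<sigma> - u $ k\<bar>"
proof -
  have "(\<Sum>i\<in>UNIV - {k}. \<bar>(x + axis k \<sigma>) $ i - u $ i\<bar>) = (\<Sum>i\<in>UNIV - {k}. \<bar>x $ i - u $ i\<bar>)"
    by (rule sum.cong) (auto simp: axis_def)
  then show ?thesis
    unfolding int_l1_dist by (subst (1 2) sum.remove[of UNIV k]) (simp_all add: axis_def)
qed

lemma l1_dist_1_iff: "l1_dist x y = 1 \<longleftrightarrow> (\<exists>k \<sigma>. (\<sigma> = 1 \<or> \<sigma> = - 1) \<and> y = x + axis k \<sigma>)"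
proof
  assume 1: "l1_dist x y = 1"
  then have "x \<noteq> y" by auto
  then obtain k where k: "x $ k \<noteq> y $ k" by (auto simp: vec_eq_iff)
  have s: "\<bar>x $ k - y $ k\<bar> + (\<Sum>i\<in>UNIV - {k}. \<bar>x $ i - y $ i\<bar>) = 1"
    using 1 int_l1_dist[of x y] by (simp add: sum.remove[of UNIV k])
  moreover have "(\<Sum>i\<in>UNIV - {k}. \<bar>x $ i - y $ i\<bar>) \<ge> 0" by (simp add: sum_nonneg)
  ultimately have z: "\<bar>x $ k - y $ k\<bar> = 1" "(\<Sum>i\<in>UNIV - {k}. \<bar>x $ i - y $ i\<bar>) = 0" using k by linarith+
  then have "\<forall>i\<in>UNIV - {k}. \<bar>x $ i - y $ i\<bar> = 0"
    by (subst (asm) sum_nonneg_eq_0_iff) auto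
  then have "y = x + axis k (y $ k - x $ k)" by (auto simp: vec_eq_iff axis_def)
  moreover have "y $ k - x $ k = 1 \<or> y $ k - x $ k = - 1" using z by linarith
  ultimately show "\<exists>k \<sigma>. (\<sigma> = 1 \<or> \<sigma> = - 1) \<and> y = x + axis k \<sigma>" by blast
next
  assume "\<exists>k \<sigma>. (\<sigma> = 1 \<or> \<sigma> = - 1) \<and> y = x + axis k \<sigma>"
  then obtain k \<sigma> where ks: "\<sigma> = 1 \<or> \<sigma> = - 1" "y = x + axis k \<sigma>" by blast
  have "int (l1_dist y x) = 1" unfolding ks(2) l1_dist_step using ks(1) by auto
  then show "l1_dist x y = 1" by (simp add: l1_dist_sym)
qed

lemma axis_nth [simp]: "(axis k s :: int ^ 'n::finite) $ i = (if i = k then s else 0)"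
  by (simp add: axis_def)

definition dir :: "int ^ 'n::finite \<Rightarrow> int ^ 'n \<Rightarrow> 'n" where
  "dir x y = (SOME i. x $ i \<noteq> y $ i)"

lemma dir_step: "\<sigma> \<noteq> 0 \<Longrightarrow> dir x (x + axis k \<sigma>) = k" "\<sigma> \<noteq> 0 \<Longrightarrow> dir (x + axis k \<sigma>) x = k"
  unfolding dir_def by (auto split: if_splits)

lemma dir_sym: "dir x y = dir y x"
  unfolding dir_def by (rule arg_cong[of _ _ Eps]) auto

locale chamber_ring =
  fixes t :: "(int ^ 'n::finite) set" and p :: nat and \<phi> :: "int ^ 'n \<Rightarrow> int" and ring :: "'r::comm_ring_1 itself"
  assumes subtorus: "subtorus t" and unimodular: "unimodular t" and p_pos: "p > 0"
    and \<phi>_dual: "\<phi> \<in> lattice_dual t" and smooth: "smooth_parameter t p \<phi>"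
begin

abbreviation "L \<equiv> chambers t p \<phi>"

definition adj :: "int ^ 'n \<Rightarrow> int ^ 'n \<Rightarrow> bool" where
  "adj x y \<longleftrightarrow> x \<in> L \<and> y \<in> L \<and> l1_dist x y = 1"

sublocale cube_arrangement "real p" "{a. \<forall>v\<in>t. (\<Sum>i\<in>UNIV. a $ i * of_int (v $ i)) = of_int (\<phi> v)}"
    "{q. \<forall>v\<in>t. (\<Sum>i\<in>UNIV. q $ i * of_int (v $ i)) = 0}" L
  by (rule smooth_cube_arrangement) (fact subtorus p_pos \<phi>_dual smooth)+

lemma adj_sym: "adj x y \<longleftrightarrow> adj y x"
  by (auto simp: adj_def l1_dist_sym)

lemma adjE:
  assumes "adj x y"
  obtains k \<sigma> where "\<sigma> = 1 \<or> \<sigma> = - 1" "y = x + axis k \<sigma>" "dir x y = k" "x \<in> L" "y \<in> L"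
proof -
  obtain k \<sigma> where ks: "\<sigma> = 1 \<or> \<sigma> = - 1" "y = x + axis k \<sigma>"
    using assms unfolding adj_def l1_dist_1_iff by blast
  moreover have "dir x y = k" using ks by (auto simp: dir_step)
  ultimately show thesis using that assms by (auto simp: adj_def)
qed

lemma adjI: "x \<in> L \<Longrightarrow> x + axis k \<sigma> \<in> L \<Longrightarrow> \<sigma> = 1 \<or> \<sigma> = - 1 \<Longrightarrow> adj x (x + axis k \<sigma>)"
  unfolding adj_def l1_dist_1_iff by blast

lemma finite_neighbours: "finite {y. adj x y}"
proof (rule finite_subset)
  show "{y. adj x y} \<subseteq> (\<lambda>(k, \<sigma>). x + axis k \<sigma>) ` (UNIV \<times> {1, - 1})"
  proof
    fix y assume "y \<in> {y. adj x y}"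
    then have "adj x y" by simp
    then obtain k \<sigma> where "\<sigma> = 1 \<or> \<sigma> = - 1" "y = x + axis k \<sigma>" by (rule adjE)
    then show "y \<in> (\<lambda>(k, \<sigma>). x + axis k \<sigma>) ` (UNIV \<times> {1, - 1})" by force
  qed
qed simp

lemma finite_common: "finite {y. adj x y \<and> adj y u}"
  by (rule finite_subset[OF _ finite_neighbours[of x]]) auto

lemma adj_diff: 
  assumes "adj x y" shows "x $ i \<noteq> y $ i \<longleftrightarrow> i = dir x y" "\<bar>x $ i - y $ i\<bar> = (if i = dir x y then 1 else 0)"
proof -
  obtain k \<sigma> where "\<sigma> = 1 \<or> \<sigma> = - 1" "y = x + axis k \<sigma>" "dir x y = k" using assms by (rule adjE)
  then show "x $ i \<noteq> y $ i \<longleftrightarrow> i = dir x y" "\<bar>x $ i - y $ i\<bar> = (if i = dir x y then 1 else 0)" by auto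
qed

definition closer :: "int ^ 'n \<Rightarrow> int ^ 'n \<Rightarrow> int ^ 'n \<Rightarrow> bool" where
  "closer x u y \<longleftrightarrow> adj x y \<and> l1_dist x u = Suc (l1_dist y u)"

lemma closer_step:
  assumes "x \<in> L" "x + axis k (sg x u k) \<in> L" "x $ k \<noteq> u $ k"
  shows "closer x u (x + axis k (sg x u k))"
  unfolding closer_def
proof
  show "adj x (x + axis k (sg x u k))" by (intro adjI assms sg_cases)
  have "int (l1_dist (x + axis k (sg x u k)) u) = int (l1_dist x u) - 1"
    unfolding l1_dist_step using assms(3) by (auto simp: sg_def)
  then show "l1_dist x u = Suc (l1_dist (x + axis k (sg x u k)) u)" by linarith
qed

lemma closerE:
  assumes "closer x u y"
  obtains k where "y = x + axis k (sg x u k)" "x $ k \<noteq> u $ k" "dir x y = k"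
proof -
  obtain k \<sigma> where ks: "\<sigma> = 1 \<or> \<sigma> = - 1" "y = x + axis k \<sigma>" "dir x y = k"
    using assms adjE unfolding closer_def by metis
  have "\<bar>x $ k + \<sigma> - u $ k\<bar> = \<bar>x $ k - u $ k\<bar> - 1"
    using assms l1_dist_step[of x k \<sigma> u] unfolding closer_def ks(2) by linarith
  then have "\<sigma> = sg x u k" "x $ k \<noteq> u $ k" using ks(1) by (auto simp: sg_def)
  then show thesis using that[of k] ks by simp
qed

lemma closer_exists:
  assumes "x \<in> L" "u \<in> L" "x \<noteq> u"
  obtains y where "closer x u y"
proof -
  obtain k where "x $ k \<noteq> u $ k" "x + axis k (sg x u k) \<in> L" by (rule first_step[OF assms])
  then show thesis using that closer_step[OF assms(1)] by blast
qed

lemma adj_dist: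
  assumes "adj x y"
  shows "closer x u y \<or> closer y u x"
proof -
  obtain k \<sigma> where ks: "\<sigma> = 1 \<or> \<sigma> = - 1" "y = x + axis k \<sigma>" using assms by (rule adjE)
  have "int (l1_dist y u) = int (l1_dist x u) + 1 \<or> int (l1_dist y u) = int (l1_dist x u) - 1"
    unfolding ks(2) l1_dist_step using ks(1) by auto
  then have "l1_dist y u = Suc (l1_dist x u) \<or> l1_dist x u = Suc (l1_dist y u)" by linarith
  then show ?thesis using assms adj_sym by (auto simp: closer_def)
qed

text \<open>First steps of shortest paths are connected by squares; this is the form in which
  independence of the path is used.\<close>

lemma closer_connect:
  assumes "x \<in> L" "u \<in> L" "closer x u y" "closer x u y'"
    and step: "\<And>a b z. closer x u a \<Longrightarrow> closer x u b \<Longrightarrow> closer a u z \<Longrightarrow> closer b u z \<Longrightarrow> Q a \<Longrightarrow> Q b"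
    and Q: "Q y"
  shows "Q y'"
proof -
  obtain i where i: "y = x + axis i (sg x u i)" "x $ i \<noteq> u $ i" using assms(3) by (rule closerE)
  obtain j where j: "y' = x + axis j (sg x u j)" "x $ j \<noteq> u $ j" using assms(4) by (rule closerE)
  have yL: "y \<in> L" "y' \<in> L" using assms(3,4) by (auto simp: closer_def adj_def)
  have "(i, j) \<in> (squares x u)\<^sup>*"
    using squares_connect[OF assms(1,2) i(2) _ j(2)] yL i(1) j(1) by simp
  then have "Q (x + axis j (sg x u j))"
  proof (induction rule: rtrancl_induct)
    case base
    then show ?case using Q i by simp
  next
    case (step k l)
    let ?z = "x + axis k (sg x u k) + axis l (sg x u l)"
    from step(2) have kl: "k \<noteq> l" "x $ k \<noteq> u $ k" "x $ l \<noteq> u $ l" "x + axis k (sg x u k) \<in> L"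
      "x + axis l (sg x u l) \<in> L" "?z \<in> L" by (auto simp: squares_def)
    have z: "?z = x + axis l (sg x u l) + axis k (sg x u k)" by (simp add: add_ac)
    have sg: "sg (x + axis k (sg x u k)) u l = sg x u l" "sg (x + axis l (sg x u l)) u k = sg x u k"
      using kl(1) by (auto simp: sg_def)
    have "closer (x + axis k (sg x u k)) u ?z"
      using closer_step[of "x + axis k (sg x u k)" l u] kl sg by auto
    moreover have "closer (x + axis l (sg x u l)) u ?z"
      using closer_step[of "x + axis l (sg x u l)" k u] kl sg unfolding z by auto
    ultimately show ?case
      using assms(5)[OF closer_step[OF assms(1) kl(4,2)] closer_step[OF assms(1) kl(5,3)] _ _ step(3)] by blast
  qed
  then show ?thesis by (simp add: j(1))
qed

text \<open>These are the directions in which a loop at one end of an arrow can be transported to the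
  other end.\<close>

definition common_dirs :: "int ^ 'n \<Rightarrow> int ^ 'n \<Rightarrow> 'n set" where
  "common_dirs x y = {k. x $ k \<noteq> y $ k \<or> (\<exists>\<sigma>\<in>{1, - 1}. x + axis k \<sigma> \<in> L \<and> y + axis k \<sigma> \<in> L)}"

lemma common_projection:
  assumes "adj x y \<or> x = y \<and> x \<in> L"
  obtains m where "lattice_projection t (common_dirs x y) m"
proof -
  have xy: "y = x \<or> (\<exists>i \<sigma>. (\<sigma> = 1 \<or> \<sigma> = - 1) \<and> y = x + axis i \<sigma>)" "x \<in> L" "y \<in> L"
    using assms unfolding adj_def l1_dist_1_iff by auto
  obtain m :: "'n \<Rightarrow> 'n \<Rightarrow> int" where "\<And>i j. i \<notin> common_dirs x y \<Longrightarrow> m i j = 0"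
    "\<And>j. axis j 1 - (\<chi> i. m i j) \<in> t" "\<And>v i. v \<in> t \<Longrightarrow> (\<Sum>j\<in>UNIV. m i j * v $ j) = 0"
  proof (rule coordinate_projection[OF subtorus unimodular, of "common_dirs x y"])
    fix q :: "real ^ 'n"
    assume q: "\<And>v. v \<in> t \<Longrightarrow> (\<Sum>i\<in>UNIV. q $ i * of_int (v $ i)) = 0" "\<And>k. k \<in> common_dirs x y \<Longrightarrow> q $ k = 0"
    show "q = 0"
      by (rule common_walls[OF xy]) (use q in \<open>auto simp: common_dirs_def\<close>)
  qed (rule that)
  then have "lattice_projection t (common_dirs x y) m" by unfold_locales
  then show thesis by (rule that)
qed

text \<open>One projection for all chambers, for choices that must not vary with the vertex.\<close>

definition mat :: "'n \<Rightarrow> 'n \<Rightarrow> int" where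
  "mat = (SOME m. lattice_projection t UNIV m)"

sublocale proj: lattice_projection t UNIV mat
proof -
  obtain m :: "'n \<Rightarrow> 'n \<Rightarrow> int" where "\<And>i j. i \<notin> UNIV \<Longrightarrow> m i j = 0"
    "\<And>j. axis j 1 - (\<chi> i. m i j) \<in> t" "\<And>v i. v \<in> t \<Longrightarrow> (\<Sum>j\<in>UNIV. m i j * v $ j) = 0"
    by (rule coordinate_projection[OF subtorus unimodular, of UNIV]) (auto simp: vec_eq_iff intro: that)
  then have "lattice_projection t UNIV m" by unfold_locales
  then show "lattice_projection t UNIV mat" unfolding mat_def by (rule someI[where P = "lattice_projection t UNIV"])
qed

text \<open>A loop in direction \<open>i\<close> stands for the central element \<open>s\<^sub>i\<close>, so this vector represents the
  class in the cocharacter lattice of the quotient torus of a combination of loops.\<close>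

definition loop_vec :: "int ^ 'n \<Rightarrow> (int ^ 'n \<Rightarrow> 'r) \<Rightarrow> 'r ^ 'n" where
  "loop_vec x k = (\<Sum>y | adj x y \<and> adj y x. k y *s axis (dir x y) 1)"

lemma loop_vec_add: "loop_vec x (\<lambda>y. k y + l y) = loop_vec x k + loop_vec x l"
  by (simp add: loop_vec_def vector_sadd_rdistrib sum.distrib)

lemma loop_vec_diff: "loop_vec x (\<lambda>y. k y - l y) = loop_vec x k - loop_vec x l"
  unfolding loop_vec_def sum_subtractf[symmetric] by (rule sum.cong) (auto simp: vec_eq_iff algebra_simps)

lemma loop_vec_scale: "loop_vec x (\<lambda>y. r * k y) = r *s loop_vec x k"
  by (simp add: loop_vec_def vec_eq_iff sum_distrib_left mult.assoc)

lemma loop_vec_single: "adj x z \<Longrightarrow> loop_vec x (\<lambda>y. if y = z then 1 else 0) = axis (dir x z) 1"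
proof -
  assume z: "adj x z"
  have "loop_vec x (\<lambda>y. if y = z then 1 else 0) = (\<Sum>y | adj x y \<and> adj y x. if y = z then axis (dir x z) 1 else 0)"
    unfolding loop_vec_def by (rule sum.cong) auto
  also have "\<dots> = axis (dir x z) 1"
    using finite_common[of x x] z adj_sym[of x z] by (simp add: sum.delta)
  finally show ?thesis .
qed

lemma loop_vec_sum: "loop_vec x (\<lambda>y. \<Sum>i\<in>X. f i y) = (\<Sum>i\<in>X. loop_vec x (f i))"
proof (induction X rule: infinite_finite_induct)
  case (insert i X)
  then show ?case using loop_vec_add[of x "f i" "\<lambda>y. \<Sum>i\<in>X. f i y"] by simp
qed (simp_all add: loop_vec_def)

text \<open>The directions of the neighbours of a chamber generate the quotient by \<open>t\<close>.\<close>

lemma loop_vec_onto: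
  assumes "x \<in> L"
  shows "\<exists>k. loop_vec x k - v \<in> base_change t"
proof -
  obtain m where "lattice_projection t (common_dirs x x) m" by (rule common_projection[of x x]) (use assms in auto)
  then interpret m: lattice_projection t "common_dirs x x" m .
  have "\<exists>z. adj x z \<and> dir x z = i" if "i \<in> common_dirs x x" for i
  proof -
    have "\<exists>\<sigma>. (\<sigma> = 1 \<or> \<sigma> = - 1) \<and> x + axis i \<sigma> \<in> L" using that by (auto simp: common_dirs_def)
    then obtain \<sigma> where s: "\<sigma> = 1 \<or> \<sigma> = - 1" "x + axis i \<sigma> \<in> L" by blast
    then have "adj x (x + axis i \<sigma>)" "dir x (x + axis i \<sigma>) = i" 
      using assms adjI dir_step(1)[of \<sigma> x i] by auto
    then show ?thesis by blast
  qed
  then obtain z where z: "\<And>i. i \<in> common_dirs x x \<Longrightarrow> adj x (z i) \<and> dir x (z i) = i" by metis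
  \<comment> \<open>Choose one neighbour \<open>z i\<close> in each available direction and use the coordinates of the
    projection.\<close>
  let ?k = "\<lambda>y. \<Sum>i\<in>common_dirs x x. m.prj v $ i * (if y = z i then 1 else 0)"
  have "loop_vec x ?k = (\<Sum>i\<in>common_dirs x x. m.prj v $ i *s axis i 1)"
    unfolding loop_vec_sum loop_vec_scale using z by (intro sum.cong) (auto simp: loop_vec_single)
  also have "\<dots> = m.prj v"
    by (subst supported_sum) (simp_all add: m.prj_supp)
  finally have "v - loop_vec x ?k \<in> base_change t" using m.prj_congruent by simp
  from base_change_intros(4)[OF this, of "- 1"] show ?thesis by (intro exI[of _ ?k]) simp
qed

text \<open>Distances change by exactly one along an arrow, so two different vertices with a common
  neighbour have distance two.\<close>

lemma common_neighbours:
  assumes "x \<noteq> u" "adj x y" "adj y u"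
  shows "l1_dist x u = 2" "closer x u y" "closer u x y"
proof -
  have "closer x u y"
  proof (rule ccontr)
    assume "\<not> closer x u y"
    then have "closer y u x" using adj_dist[OF assms(2)] by blast
    then have "l1_dist x u = 0" using assms(3) by (simp add: closer_def adj_def)
    with assms(1) show False by (simp add: l1_dist_eq_0)
  qed
  then show "closer x u y" "l1_dist x u = 2" using assms(3) by (auto simp: closer_def adj_def)
  then show "closer u x y" using assms adj_sym by (auto simp: closer_def adj_def l1_dist_sym)
qed

end

section \<open>The algebra of the chambers\<close>

lemma fun_sum_apply: "(\<Sum>i\<in>X. f i) a = (\<Sum>i\<in>X. f i a)"
  by (induction X rule: infinite_finite_induct) simp_all

lemma abs_even: "2 * int (nat ((\<bar>a\<bar> + \<bar>b\<bar> - \<bar>a + b\<bar>) div 2)) = \<bar>a\<bar> + \<bar>b\<bar> - \<bar>a + b :: int\<bar>"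
proof -
  have "even (\<bar>a\<bar> + \<bar>b\<bar> - \<bar>a + b\<bar>)" by (cases "a \<ge> 0"; cases "b \<ge> 0"; cases "a + b \<ge> 0") auto
  moreover have "\<bar>a\<bar> + \<bar>b\<bar> - \<bar>a + b\<bar> \<ge> 0" by linarith
  ultimately show ?thesis by simp
qed

text \<open>Half the excess length of the detour from \<open>x\<close> to \<open>u\<close> through \<open>y\<close> in direction \<open>i\<close>.\<close>

definition eta :: "int ^ 'n::finite \<Rightarrow> int ^ 'n \<Rightarrow> int ^ 'n \<Rightarrow> 'n \<Rightarrow> nat" where
  "eta x y u i = nat ((\<bar>x $ i - y $ i\<bar> + \<bar>y $ i - u $ i\<bar> - \<bar>x $ i - u $ i\<bar>) div 2)"

lemma eta2: "2 * int (eta x y u i) = \<bar>x $ i - y $ i\<bar> + \<bar>y $ i - u $ i\<bar> - \<bar>x $ i - u $ i\<bar>"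
  using abs_even[of "x $ i - y $ i" "y $ i - u $ i"] by (simp add: eta_def)

lemma eta_cocycle: "eta x y w i + eta y u w i = eta x y u i + eta x u w i"
  using eta2[of x y w i] eta2[of y u w i] eta2[of x y u i] eta2[of x u w i] by linarith

lemma eta_same [simp]: "eta x x u i = 0" "eta x u u i = 0"
  by (simp_all add: eta_def)

context chamber_ring
begin

abbreviation H :: "((('r ^ 'n) set, int ^ 'n) H_letter, 'r) presentation" where
  "H \<equiv> H_pres t p \<phi>"

abbreviation sym :: "'r ^ 'n \<Rightarrow> ((('r ^ 'n) set, int ^ 'n) H_letter list \<Rightarrow>\<^sub>0 'r)" where
  "sym v \<equiv> gen (HSym (g_class t v))"

abbreviation c :: "int ^ 'n \<Rightarrow> int ^ 'n \<Rightarrow> ((('r ^ 'n) set, int ^ 'n) H_letter list \<Rightarrow>\<^sub>0 'r)" where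
  "c x y \<equiv> gen (HC x y)"

lemma H_simps [simp]:
  "central H = range (\<lambda>v. HSym (g_class t v))"
  "gens H = HIdem ` L \<union> {HC x y | x y. x \<in> L \<and> y \<in> L}"
  "deg H (HSym s) = 2" "deg H (HIdem x) = 0" "deg H (HC x y) = l1_dist x y"
  by (simp_all add: H_pres_def Let_def)

lemma rels_H_cases:
  assumes "s \<in> rels H"
  obtains (add) v w where "s = sym (v + w) - sym v - sym w"
    | (scal) r v where "s = sym (r *s v) - scal r * sym v"
    | (idem) x y where "s = gen (HIdem x) * gen (HIdem y) - (if x = y then gen (HIdem x) else 0)" "x \<in> L" "y \<in> L"
    | (left) x y where "s = gen (HIdem x) * c x y - c x y" "x \<in> L" "y \<in> L"
    | (right) x y where "s = c x y * gen (HIdem y) - c x y" "x \<in> L" "y \<in> L"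
    | (same) x where "s = c x x - gen (HIdem x)" "x \<in> L"
    | (mult) x y u js where "s = c x y * c y u - prod_list (map (\<lambda>i. sym (axis i 1) ^ eta x y u i) js) * c x u"
      "x \<in> L" "y \<in> L" "u \<in> L" "distinct js" "set js = UNIV"
  using assms unfolding H_pres_def Let_def presentation.simps eta_def[symmetric] by blast

lemma rels_H:
  "sym (v + w) - sym v - sym w \<in> rels H"
  "sym (r *s v) - scal r * sym v \<in> rels H"
  "x \<in> L \<Longrightarrow> y \<in> L \<Longrightarrow> gen (HIdem x) * gen (HIdem y) - (if x = y then gen (HIdem x) else 0) \<in> rels H"
  "x \<in> L \<Longrightarrow> y \<in> L \<Longrightarrow> gen (HIdem x) * c x y - c x y \<in> rels H"
  "x \<in> L \<Longrightarrow> y \<in> L \<Longrightarrow> c x y * gen (HIdem y) - c x y \<in> rels H"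
  "x \<in> L \<Longrightarrow> c x x - gen (HIdem x) \<in> rels H"
  "x \<in> L \<Longrightarrow> y \<in> L \<Longrightarrow> u \<in> L \<Longrightarrow> distinct js \<Longrightarrow> set js = UNIV \<Longrightarrow>
     c x y * c y u - prod_list (map (\<lambda>i. sym (axis i 1) ^ eta x y u i) js) * c x u \<in> rels H"
  unfolding H_pres_def Let_def presentation.simps eta_def by blast+

lemma rels_H_cgr: "f - g \<in> rels H \<Longrightarrow> f \<simeq>[full_rels H] g"
  by (rule cgr_base) (simp add: full_rels_def)

lemma sym_add: "sym (v + w) \<simeq>[full_rels H] sym v + sym w"
  using rels_H(1)[of v w] by (intro rels_H_cgr) (simp add: diff_diff_eq)

lemmas sym_scal = rels_H_cgr[OF rels_H(2)]
  and H_idem = rels_H_cgr[OF rels_H(3)]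
  and c_left = rels_H_cgr[OF rels_H(4)]
  and c_right = rels_H_cgr[OF rels_H(5)]
  and c_same = rels_H_cgr[OF rels_H(6)]
  and c_mult = rels_H_cgr[OF rels_H(7)]

lemma sym_base_change: 
  assumes "v \<in> base_change t" shows "sym v \<simeq>[full_rels H] 0"
proof -
  have "g_class t v = g_class t (0 *s v)" using assms by (simp add: g_class_eq)
  then have "sym v = sym (0 *s v)" by simp
  also have "\<dots> \<simeq>[full_rels H] scal 0 * sym v" by (rule sym_scal)
  finally show ?thesis by simp
qed

lemma sym_sum: "sym (\<Sum>i\<in>X. f i) \<simeq>[full_rels H] (\<Sum>i\<in>X. sym (f i))"
proof (induction X rule: infinite_finite_induct)
  case (insert i X)
  have "sym (f i + sum f X) \<simeq>[full_rels H] sym (f i) + sym (sum f X)" by (rule sym_add)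
  also have "\<dots> \<simeq>[full_rels H] sym (f i) + (\<Sum>i\<in>X. sym (f i))" by (intro cgr_add cgr_refl insert)
  finally show ?case using insert by simp
qed (simp_all add: sym_base_change base_change_intros)

subsection \<open>A representation on functions on the chambers\<close>

text \<open>A covector \<open>\<xi>\<close> vanishing on \<open>t\<close> specialises the symmetric algebra to polynomials in one
  variable. The indicator function of \<open>x\<close> plays the part of \<open>c x z0\<close>, and the defining relation
  becomes the cocycle identity for \<open>eta\<close>.\<close>

definition on_chambers :: "'r ^ 'n \<Rightarrow> int ^ 'n \<Rightarrow> (('r ^ 'n) set, int ^ 'n) H_letter \<Rightarrow>
    (int ^ 'n \<Rightarrow> 'r poly) \<Rightarrow> (int ^ 'n \<Rightarrow> 'r poly)" where
  "on_chambers \<xi> z0 l f = (case l of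
      HSym s \<Rightarrow> (\<lambda>a. monom (\<Sum>i\<in>UNIV. \<xi> $ i * (SOME v. v \<in> s) $ i) 1 * f a)
    | HIdem x \<Rightarrow> (\<lambda>a. if a = x then f a else 0)
    | HC x y \<Rightarrow> (\<lambda>a. if a = x then (\<Prod>i\<in>UNIV. monom (\<xi> $ i) 1 ^ eta x y z0 i) * f y else 0))"

lemma on_chambers_simps:
  "on_chambers \<xi> z0 (HIdem x) f = (\<lambda>a. if a = x then f a else 0)"
  "on_chambers \<xi> z0 (HC x y) f = (\<lambda>a. if a = x then (\<Prod>i\<in>UNIV. monom (\<xi> $ i) 1 ^ eta x y z0 i) * f y else 0)"
  by (simp_all add: on_chambers_def)

sublocale chamber_module: free_module "\<lambda>r f a. smult r (f a)" "on_chambers \<xi> z0" for \<xi> z0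
  by unfold_locales
    (auto simp: on_chambers_def fun_eq_iff algebra_simps smult_add_right smult_add_left split: H_letter.split)

abbreviation chamber_act :: "'r ^ 'n \<Rightarrow> int ^ 'n \<Rightarrow> ((('r ^ 'n) set, int ^ 'n) H_letter list \<Rightarrow>\<^sub>0 'r) \<Rightarrow>
    (int ^ 'n \<Rightarrow> 'r poly) \<Rightarrow> (int ^ 'n \<Rightarrow> 'r poly)" where
  "chamber_act \<xi> z0 \<equiv> act (\<lambda>r f a. smult r (f a)) (on_chambers \<xi> z0)"

definition conormal :: "'r ^ 'n \<Rightarrow> bool" where
  "conormal \<xi> \<longleftrightarrow> (\<forall>v\<in>base_change t. (\<Sum>i\<in>UNIV. \<xi> $ i * v $ i) = 0)"

lemma on_chambers_sym:
  assumes "conormal \<xi>"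
  shows "on_chambers \<xi> z0 (HSym (g_class t v)) f = (\<lambda>a. monom (\<Sum>i\<in>UNIV. \<xi> $ i * v $ i) 1 * f a)"
proof -
  have "v \<in> g_class t v" by (simp add: g_class_def base_change_intros)
  then have "(SOME v'. v' \<in> g_class t v) \<in> g_class t v" by (rule someI)
  then have "(\<Sum>i\<in>UNIV. \<xi> $ i * ((SOME v'. v' \<in> g_class t v) - v) $ i) = 0"
    using assms unfolding conormal_def g_class_def by blast
  then show ?thesis by (simp add: on_chambers_def algebra_simps sum_subtractf)
qed

lemma chamber_act_sym_prod:
  assumes "conormal \<xi>"
  shows "chamber_act \<xi> z0 (prod_list (map (\<lambda>i. sym (axis i 1) ^ e i) js)) f
    = (\<lambda>a. prod_list (map (\<lambda>i. monom (\<xi> $ i) 1 ^ e i) js) * f a)"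
proof -
  have one: "chamber_act \<xi> z0 (sym (axis i 1)) f = (\<lambda>a. monom (\<xi> $ i) 1 * f a)" for i f
    by (simp add: on_chambers_sym[OF assms] axis_def if_distrib[of "\<lambda>x. _ * x"] cong: if_cong)
  have power: "chamber_act \<xi> z0 (sym (axis i 1) ^ n) f = (\<lambda>a. monom (\<xi> $ i) 1 ^ n * f a)" for i n f
  proof (induction n)
    case (Suc n)
    show ?case unfolding power_Suc chamber_module.act_mult Suc one by (simp add: mult.assoc)
  qed simp
  show ?thesis
    by (induction js) (simp_all add: chamber_module.act_mult power mult.assoc)
qed

lemma chamber_act_rels:
  assumes \<xi>: "conormal \<xi>" and s: "s \<in> full_rels H"
  shows "chamber_act \<xi> z0 s f = 0"
proof -
  note expand = chamber_module.act_diff chamber_module.act_add chamber_module.act_mult chamber_module.act_gen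
    chamber_module.act_scal chamber_module.act_0 on_chambers_simps on_chambers_sym[OF \<xi>] fun_eq_iff
  from s consider "s \<in> rels H" | z g where "s = gen z * gen g - gen g * gen z" "z \<in> central H" "g \<in> central H \<union> gens H"
    unfolding full_rels_def by blast
  then show ?thesis
  proof cases
    case 1
    then show ?thesis
    proof (cases rule: rels_H_cases)
      case (add v w)
      have "(\<Sum>i\<in>UNIV. \<xi> $ i * (v + w) $ i) = (\<Sum>i\<in>UNIV. \<xi> $ i * v $ i) + (\<Sum>i\<in>UNIV. \<xi> $ i * w $ i)"
        by (simp add: distrib_left sum.distrib)
      then show ?thesis unfolding add by (simp add: expand add_monom[symmetric] algebra_simps)
    next
      case (scal r v)
      have "(\<Sum>i\<in>UNIV. \<xi> $ i * (r *s v) $ i) = r * (\<Sum>i\<in>UNIV. \<xi> $ i * v $ i)"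
        by (simp add: sum_distrib_left mult.left_commute)
      then show ?thesis unfolding scal by (simp add: expand smult_monom[symmetric])
    next
      case (mult x y u js)
      have pr: "prod_list (map (\<lambda>i. monom (\<xi> $ i) 1 ^ eta x y u i) js) = (\<Prod>i\<in>UNIV. monom (\<xi> $ i) 1 ^ eta x y u i)"
        using prod.distinct_set_conv_list[OF mult(5), of "\<lambda>i. monom (\<xi> $ i) 1 ^ eta x y u i"] mult(6) by simp
      have "(\<Prod>i\<in>UNIV. monom (\<xi> $ i) 1 ^ eta x y z0 i) * ((\<Prod>i\<in>UNIV. monom (\<xi> $ i) 1 ^ eta y u z0 i) * q)
        = (\<Prod>i\<in>UNIV. monom (\<xi> $ i) 1 ^ eta x y u i) * ((\<Prod>i\<in>UNIV. monom (\<xi> $ i) 1 ^ eta x u z0 i) * q)" for q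
        unfolding mult.assoc[symmetric] prod.distrib[symmetric] power_add[symmetric] eta_cocycle ..
      then show ?thesis unfolding mult(1)
        by (simp add: chamber_module.act_diff chamber_module.act_mult chamber_act_sym_prod[OF \<xi>] pr[unfolded One_nat_def] on_chambers_simps fun_eq_iff)
    qed (auto simp: expand)
  next
    case 2
    then obtain v where v: "z = HSym (g_class t v)" by auto
    from 2(3) show ?thesis unfolding 2(1) v
      by (auto simp: expand algebra_simps)
  qed
qed

lemma chamber_act_ideal: "conormal \<xi> \<Longrightarrow> f \<in> ideal (full_rels H) \<Longrightarrow> chamber_act \<xi> z0 f v = 0"
  by (rule chamber_module.act_ideal[OF chamber_act_rels])

abbreviation delta :: "int ^ 'n \<Rightarrow> int ^ 'n \<Rightarrow> 'r poly" where
  "delta y \<equiv> (\<lambda>a. if a = y then 1 else 0)"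

definition H_coef :: "int ^ 'n \<Rightarrow> int ^ 'n \<Rightarrow> ((('r ^ 'n) set, int ^ 'n) H_letter list \<Rightarrow>\<^sub>0 'r) \<Rightarrow> 'r" where
  "H_coef x y f = poly.coeff (chamber_act 0 y f (delta y) x) 0"

lemma conormal_0: "conormal 0"
  by (simp add: conormal_def)

lemma rels_H_free: "rels H \<subseteq> free_on (central H \<union> gens H)"
proof
  fix s assume "s \<in> rels H"
  then show "s \<in> free_on (central H \<union> gens H)"
    by (cases rule: rels_H_cases) (auto intro!: free_on_intros)
qed

sublocale Hq: quiver_pres H L HIdem adj HC H_coef
proof
  show "rels H \<subseteq> free_on (central H \<union> gens H)" by (rule rels_H_free)
  show "adj x y \<Longrightarrow> x \<in> L \<and> y \<in> L" for x y by (simp add: adj_def)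
  show "finite {y. adj x y \<and> adj y u}" for x u by (rule finite_common)
  show "z \<in> central H \<Longrightarrow> deg H z \<ge> 2" for z by auto
  show "\<exists>x\<in>L. gen g \<simeq>[full_rels H] gen (HIdem x)" if g: "g \<in> gens H" "deg H g = 0" for g
  proof -
    consider x where "g = HIdem x" "x \<in> L" | x y where "g = HC x y" "x \<in> L" "y \<in> L"
      using g(1) by auto
    then show ?thesis
    proof cases
      case 1
      then show ?thesis using cgr_refl by blast
    next
      case 2
      then have "x = y" using g(2) by (simp add: l1_dist_eq_0)
      then show ?thesis using 2 c_same by blast
    qed
  qed
  show "\<exists>x y. adj x y \<and> gen g \<simeq>[full_rels H] c x y" if g1: "g \<in> gens H" "deg H g = 1" for g
  proof -
    obtain x y where "g = HC x y" "adj x y" using g1 by (auto simp: adj_def)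
    then show ?thesis using cgr_refl by blast
  qed
  show "x \<in> L \<Longrightarrow> HIdem x \<in> gens H \<and> deg H (HIdem x) = 0" for x by simp
  show "adj x y \<Longrightarrow> HC x y \<in> gens H \<and> deg H (HC x y) = 1" for x y by (simp add: adj_def)
  show "x \<in> L \<Longrightarrow> y \<in> L \<Longrightarrow>
      gen (HIdem x) * gen (HIdem y) \<simeq>[full_rels H] (if x = y then gen (HIdem x) else 0)" for x y
    by (rule H_idem)
  show "adj x y \<Longrightarrow> gen (HIdem x) * c x y \<simeq>[full_rels H] c x y" for x y
    by (rule c_left) (simp_all add: adj_def)
  show "adj x y \<Longrightarrow> c x y * gen (HIdem y) \<simeq>[full_rels H] c x y" for x y
    by (rule c_right) (simp_all add: adj_def)
  show "H_coef x y (f + g) = H_coef x y f + H_coef x y g" for x y f g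
    by (simp add: H_coef_def chamber_module.act_add)
  show "H_coef x y (scal r * f) = r * H_coef x y f" for x y r f
    by (simp add: H_coef_def chamber_module.act_mult)
  show "f \<in> ideal (full_rels H) \<Longrightarrow> H_coef x y f = 0" for x y f
    by (simp add: H_coef_def chamber_act_ideal[OF conormal_0])
  show "H_coef x x (gen (HIdem y)) = (if x = y then 1 else 0)" for x y
    by (simp add: H_coef_def on_chambers_simps)
  show "H_coef x y (c x' y') = (if x = x' \<and> y = y' then 1 else 0)" for x y x' y'
    by (simp add: H_coef_def on_chambers_simps)
qed

subsection \<open>The linear relations between paths of length two\<close>

lemma eta_geodesic:
  assumes "l1_dist x y + l1_dist y u = l1_dist x u"
  shows "eta x y u i = 0"
proof -
  have "(\<Sum>i\<in>UNIV. 2 * int (eta x y u i)) = int (l1_dist x y) + int (l1_dist y u) - int (l1_dist x u)"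
    unfolding eta2 int_l1_dist by (simp add: sum.distrib sum_subtractf)
  also have "\<dots> = 0" using assms by linarith
  finally show ?thesis by (subst (asm) sum_nonneg_eq_0_iff) auto
qed

lemma eta_loop: "adj x y \<Longrightarrow> eta x y x i = (if i = dir x y then 1 else 0)"
  using eta2[of x y x i] adj_diff(2)[of x y i] by (auto simp: abs_minus_commute)

lemma finite_list: obtains js :: "'n list" where "distinct js" "set js = UNIV"
  using finite_distinct_list[of "UNIV :: 'n set"] by auto

lemma c_geodesic: 
  assumes "x \<in> L" "y \<in> L" "u \<in> L" "l1_dist x y + l1_dist y u = l1_dist x u"
  shows "c x y * c y u \<simeq>[full_rels H] c x u"
proof -
  obtain js :: "'n list" where i: "distinct js" "set js = UNIV" by (rule finite_list)
  have "prod_list (map (\<lambda>i. sym (axis i 1) ^ eta x y u i) js) = 1"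
    by (induction js) (simp_all add: eta_geodesic[OF assms(4)])
  then show ?thesis using c_mult[of x y u js] assms i by simp
qed

lemma c_path: "x \<noteq> u \<Longrightarrow> adj x y \<Longrightarrow> adj y u \<Longrightarrow> c x y * c y u \<simeq>[full_rels H] c x u"
  using common_neighbours(1)[of x u y] by (intro c_geodesic) (auto simp: adj_def)

lemma prod_list_single:
  assumes "distinct js" "k \<in> set js" 
  shows "prod_list (map (\<lambda>i. f i ^ (if i = k then 1 else 0)) js) = (f k :: 'a :: monoid_mult)"
  using assms
proof (induction js)
  case (Cons i js)
  show ?case
  proof (cases "i = k")
    case True
    then have "map (\<lambda>i. f i ^ (if i = k then 1 else 0)) js = map (\<lambda>i. 1) js" using Cons by auto
    then show ?thesis using True by (simp add: map_replicate_const prod_list_replicate)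
  qed (use Cons in simp)
qed simp

lemma c_loop: "adj x y \<Longrightarrow> c x y * c y x \<simeq>[full_rels H] sym (axis (dir x y) 1) * gen (HIdem x)"
proof -
  assume xy: "adj x y"
  then have L: "x \<in> L" "y \<in> L" by (auto simp: adj_def)
  obtain js :: "'n list" where i: "distinct js" "set js = UNIV" by (rule finite_list)
  have "prod_list (map (\<lambda>i. sym (axis i 1) ^ eta x y x i) js) = sym (axis (dir x y) 1)"
    unfolding eta_loop[OF xy] using i by (intro prod_list_single) auto
  then have "c x y * c y x \<simeq>[full_rels H] sym (axis (dir x y) 1) * c x x"
    using c_mult[of x y x js] L i by simp
  also have "\<dots> \<simeq>[full_rels H] sym (axis (dir x y) 1) * gen (HIdem x)"
    by (intro cgr_left c_same L)
  finally show ?thesis .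
qed

text \<open>All shortest paths have the same product, which the representation shows to be free.\<close>

lemma H_W_distinct:
  assumes "x \<in> L" "u \<in> L" "x \<noteq> u"
  shows "k \<in> Hq.W x u \<longleftrightarrow> (\<Sum>y | adj x y \<and> adj y u. k y) = 0"
proof -
  have "(\<Sum>y\<in>Hq.M x u. scal (k y) * (c x y * c y u)) \<simeq>[full_rels H] (\<Sum>y\<in>Hq.M x u. scal (k y) * c x u)"
    by (intro cgr_sum cgr_left c_path assms) auto
  also have "\<dots> = scal (\<Sum>y\<in>Hq.M x u. k y) * c x u" by (simp add: scal_sum sum_distrib_right)
  finally have *: "k \<in> Hq.W x u \<longleftrightarrow> scal (\<Sum>y\<in>Hq.M x u. k y) * c x u \<in> ideal (full_rels H)"
    unfolding Hq.W_def by (simp add: cgr_ideal)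
  show ?thesis
  proof
    assume "k \<in> Hq.W x u"
    then have "chamber_act 0 u (scal (\<Sum>y\<in>Hq.M x u. k y) * c x u) (delta u) x = 0"
      using chamber_act_ideal[OF conormal_0] * by simp
    then show "(\<Sum>y | adj x y \<and> adj y u. k y) = 0"
      by (simp add: chamber_module.act_mult on_chambers_simps)
  qed (simp add: * gen_ideal.zero)
qed

lemma conormal_row: "conormal (\<chi> j. of_int (mat i j))"
proof -
  have "(\<Sum>j\<in>UNIV. of_int (mat i j) * v $ j) = proj.prj v $ i" for v :: "'r ^ 'n"
    by (simp add: proj.prj_def)
  then show ?thesis by (simp add: conormal_def proj.base_change_iff)
qed

lemma loop_vec_nth: "loop_vec x k $ i = (\<Sum>y\<in>Hq.M x x. if dir x y = i then k y else 0)"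
  unfolding loop_vec_def by (simp add: axis_def) (rule sum.cong, auto)

lemma H_loops:
  "(\<Sum>y\<in>Hq.M x x. scal (k y) * (c x y * c y x)) \<simeq>[full_rels H] sym (loop_vec x k) * gen (HIdem x)"
proof -
  have "(\<Sum>y\<in>Hq.M x x. scal (k y) * (c x y * c y x))
      \<simeq>[full_rels H] (\<Sum>y\<in>Hq.M x x. sym (k y *s axis (dir x y) 1) * gen (HIdem x))"
  proof (intro cgr_sum)
    fix y assume "y \<in> Hq.M x x"
    then have "scal (k y) * (c x y * c y x) \<simeq>[full_rels H] scal (k y) * (sym (axis (dir x y) 1) * gen (HIdem x))"
      by (intro cgr_left c_loop) simp
    also have "\<dots> = scal (k y) * sym (axis (dir x y) 1) * gen (HIdem x)" by (simp add: mult.assoc)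
    also have "\<dots> \<simeq>[full_rels H] sym (k y *s axis (dir x y) 1) * gen (HIdem x)"
      by (intro cgr_right, rule cgr_sym, rule sym_scal)
    finally show "scal (k y) * (c x y * c y x) \<simeq>[full_rels H] sym (k y *s axis (dir x y) 1) * gen (HIdem x)" .
  qed
  also have "\<dots> = (\<Sum>y\<in>Hq.M x x. sym (k y *s axis (dir x y) 1)) * gen (HIdem x)"
    by (simp add: sum_distrib_right)
  also have "\<dots> \<simeq>[full_rels H] sym (loop_vec x k) * gen (HIdem x)"
    unfolding loop_vec_def by (intro cgr_right, rule cgr_sym, rule sym_sum)
  finally show ?thesis .
qed

text \<open>A combination of loops is a linear element of the symmetric algebra. Specialising at the
  rows of the projection matrix detects whether it is zero.\<close>

lemma H_W_loop:
  assumes x: "x \<in> L"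
  shows "k \<in> Hq.W x x \<longleftrightarrow> loop_vec x k \<in> base_change t"
proof
  assume k: "k \<in> Hq.W x x"
  let ?f = "\<Sum>y\<in>Hq.M x x. scal (k y) * (c x y * c y x)"
  have zero: "(\<Sum>j\<in>UNIV. \<xi> $ j * loop_vec x k $ j) = 0" if \<xi>: "conormal \<xi>" for \<xi>
  proof -
    have "chamber_act \<xi> x ?f (delta x) x = (\<Sum>y\<in>Hq.M x x. smult (k y) (monom (\<xi> $ dir x y) 1))"
    proof -
      have "chamber_act \<xi> x (scal (k y) * (c x y * c y x)) (delta x) x = smult (k y) (monom (\<xi> $ dir x y) 1)"
        if "y \<in> Hq.M x x" for y
      proof -
        have "(\<Prod>i\<in>UNIV. monom (\<xi> $ i) 1 ^ eta x y x i) = (\<Prod>i\<in>UNIV. if i = dir x y then monom (\<xi> $ i) 1 else 1)"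
          using that by (intro prod.cong) (auto simp: eta_loop)
        then show ?thesis by (simp add: chamber_module.act_mult on_chambers_simps)
      qed
      then show ?thesis by (simp add: chamber_module.act_sum fun_sum_apply)
    qed
    moreover have "chamber_act \<xi> x ?f (delta x) x = 0"
      using k chamber_act_ideal[OF \<xi>] unfolding Hq.W_def by simp
    ultimately have "(\<Sum>y\<in>Hq.M x x. smult (k y) (monom (\<xi> $ dir x y) 1)) = 0" by (simp only:)
    from arg_cong[OF this, of "\<lambda>q. poly.coeff q 1"]
    have "0 = (\<Sum>y\<in>Hq.M x x. poly.coeff (smult (k y) (monom (\<xi> $ dir x y) 1)) 1)"
      by (simp only: coeff_sum coeff_0)
    also have "\<dots> = (\<Sum>y\<in>Hq.M x x. k y * \<xi> $ dir x y)" by simp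
    also have "\<dots> = (\<Sum>y\<in>Hq.M x x. \<Sum>j\<in>UNIV. \<xi> $ j * (if dir x y = j then k y else 0))"
      by (intro sum.cong) (auto simp: if_distrib[of "\<lambda>x. _ * x"] mult.commute cong: if_cong)
    also have "\<dots> = (\<Sum>j\<in>UNIV. \<xi> $ j * loop_vec x k $ j)"
      unfolding loop_vec_nth sum_distrib_left by (rule sum.swap)
    finally show ?thesis by simp
  qed
  have "proj.prj (loop_vec x k) $ i = 0" for i
    using zero[OF conormal_row, of i] by (simp add: proj.prj_def)
  then show "loop_vec x k \<in> base_change t" by (simp add: proj.base_change_iff vec_eq_iff)
next
  assume k: "loop_vec x k \<in> base_change t"
  have "(\<Sum>y\<in>Hq.M x x. scal (k y) * (c x y * c y x)) \<simeq>[full_rels H] sym (loop_vec x k) * gen (HIdem x)"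
    by (rule H_loops)
  also have "\<dots> \<simeq>[full_rels H] 0 * gen (HIdem x)"
    by (intro cgr_right sym_base_change k)
  finally show "k \<in> Hq.W x x" by (simp add: Hq.W_def cgr_0)
qed

end

subsection \<open>The algebra of the chambers is quadratic\<close>

context quiver_pres
begin

lemma loops_diff: "loops x (\<lambda>y. k y - l y) = loops x k - loops x l"
  by (simp add: loops_def scal_diff left_diff_distrib sum_subtractf)

lemma loops_single: "adj x z \<Longrightarrow> adj z x \<Longrightarrow> loops x (\<lambda>y. if y = z then 1 else 0) = tar x z * tar z x"
  using finite_mid[of x x] by (simp add: loops_def if_distrib[of scal] if_distrib[of "\<lambda>a. a * _"] sum.delta' cong: if_cong)

lemma loops_ideal: "x \<in> L \<Longrightarrow> k \<in> W x x \<Longrightarrow> loops x k \<simeq>[J] 0"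
  unfolding cgr_0 loops_def by (rule J_quadratic)

lemma TIdem_TIdem: "x \<in> L \<Longrightarrow> gen (TIdem x) * gen (TIdem x) \<simeq>[J] gen (TIdem x)"
  using rels_T_sub[OF T_idem[of x x]] by simp

end

lemma commute_power:
  assumes "a * b \<simeq>[S] b * a"
  shows "a * b ^ n \<simeq>[S] b ^ n * a"
proof (induction n)
  case (Suc n)
  have "a * b ^ Suc n = (a * b) * b ^ n" by (simp add: mult.assoc)
  also have "\<dots> \<simeq>[S] (b * a) * b ^ n" by (intro cgr_right assms)
  also have "\<dots> = b * (a * b ^ n)" by (simp add: mult.assoc)
  also have "\<dots> \<simeq>[S] b * (b ^ n * a)" by (intro cgr_left Suc)
  finally show ?case by (simp add: mult.assoc)
qed simp

lemma commute_prod_list: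
  assumes "\<And>i. i \<in> set js \<Longrightarrow> a * f i \<simeq>[S] f i * a"
  shows "a * prod_list (map f js) \<simeq>[S] prod_list (map f js) * a"
  using assms
proof (induction js)
  case (Cons i js)
  have "a * (f i * prod_list (map f js)) = (a * f i) * prod_list (map f js)" by (simp add: mult.assoc)
  also have "\<dots> \<simeq>[S] (f i * a) * prod_list (map f js)" using Cons by (intro cgr_right) auto
  also have "\<dots> = f i * (a * prod_list (map f js))" by (simp add: mult.assoc)
  also have "\<dots> \<simeq>[S] f i * (prod_list (map f js) * a)" using Cons by (intro cgr_left) auto
  finally show ?case by (simp add: mult.assoc)
qed simp

context chamber_ring
begin

lemma H_two:
  assumes "x \<noteq> z" "adj x y1" "adj y1 z" "adj x y2" "adj y2 z"
  shows "Hq.tar x y1 * Hq.tar y1 z \<simeq>[Hq.J] Hq.tar x y2 * Hq.tar y2 z"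
proof -
  let ?k = "\<lambda>y. (if y = y1 then 1 else 0) - (if y = y2 then 1 else (0 :: 'r))"
  let ?t = "\<lambda>y. Hq.tar x y * Hq.tar y z"
  have L: "x \<in> L" "z \<in> L" using assms by (auto simp: adj_def)
  have single: "(\<Sum>y\<in>Hq.M x z. scal (if y = y0 then 1 else 0) * ?t y) = ?t y0" if "adj x y0" "adj y0 z" for y0
  proof -
    have "(\<Sum>y\<in>Hq.M x z. scal (if y = y0 then 1 else 0) * ?t y) = (\<Sum>y\<in>Hq.M x z. if y = y0 then ?t y else 0)"
      by (rule sum.cong) auto
    then show ?thesis using that finite_common[of x z] by simp
  qed
  have "(\<Sum>y\<in>Hq.M x z. ?k y) = 0"
    unfolding sum_subtractf using assms finite_common[of x z] by simp
  then have "?k \<in> Hq.W x z" using H_W_distinct[OF L assms(1)] by simp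
  from Hq.J_quadratic[OF L this] have "(\<Sum>y\<in>Hq.M x z. scal (?k y) * ?t y) \<in> ideal Hq.J" .
  then show ?thesis
    unfolding scal_diff left_diff_distrib sum_subtractf using single assms by (simp add: cgr_def)
qed

text \<open>A vector is represented by a combination of loops at each chamber; by the quadratic
  relations the choice does not matter.\<close>

definition loop_coef :: "'r ^ 'n \<Rightarrow> int ^ 'n \<Rightarrow> int ^ 'n \<Rightarrow> 'r" where
  "loop_coef v x = (SOME k. loop_vec x k - v \<in> base_change t)"

definition S :: "int ^ 'n \<Rightarrow> 'r ^ 'n \<Rightarrow> ((int ^ 'n, ((('r ^ 'n) set, int ^ 'n) H_letter list \<Rightarrow>\<^sub>0 'r)) tensor_letter list \<Rightarrow>\<^sub>0 'r)" where
  "S x v = Hq.loops x (loop_coef v x)"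

lemma loop_coef: "x \<in> L \<Longrightarrow> loop_vec x (loop_coef v x) - v \<in> base_change t"
  unfolding loop_coef_def by (rule someI_ex[OF loop_vec_onto])

lemma S_eq:
  assumes "x \<in> L" "loop_vec x k - v \<in> base_change t"
  shows "Hq.loops x k \<simeq>[Hq.J] S x v"
proof -
  have "loop_vec x (\<lambda>y. k y - loop_coef v x y) = (loop_vec x k - v) - (loop_vec x (loop_coef v x) - v)"
    by (simp add: loop_vec_diff)
  also have "\<dots> \<in> base_change t" by (intro base_change_intros(3) assms loop_coef)
  finally have "Hq.loops x (\<lambda>y. k y - loop_coef v x y) \<simeq>[Hq.J] 0"
    using assms(1) by (intro Hq.loops_ideal) (simp_all add: H_W_loop)
  then show ?thesis unfolding Hq.loops_diff S_def by (simp add: cgr_def)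
qed

lemma S_congr: "x \<in> L \<Longrightarrow> v - w \<in> base_change t \<Longrightarrow> S x v \<simeq>[Hq.J] S x w"
  unfolding S_def[of x v] using base_change_intros(2)[OF loop_coef[of x v], of "v - w"] by (intro S_eq) simp_all

lemma S_add: 
  assumes "x \<in> L" shows "S x (v + w) \<simeq>[Hq.J] S x v + S x w"
proof -
  have "loop_vec x (\<lambda>y. loop_coef v x y + loop_coef w x y) - (v + w) =
      (loop_vec x (loop_coef v x) - v) + (loop_vec x (loop_coef w x) - w)"
    by (simp add: loop_vec_add)
  also have "\<dots> \<in> base_change t" by (intro base_change_intros(2) loop_coef assms)
  finally have "Hq.loops x (\<lambda>y. loop_coef v x y + loop_coef w x y) \<simeq>[Hq.J] S x (v + w)"
    by (rule S_eq[OF assms])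
  then show ?thesis unfolding Hq.loops_add S_def[symmetric] by (rule cgr_sym)
qed

lemma S_scale: 
  assumes "x \<in> L" shows "S x (r *s v) \<simeq>[Hq.J] scal r * S x v"
proof -
  have "loop_vec x (\<lambda>y. r * loop_coef v x y) - r *s v = r *s (loop_vec x (loop_coef v x) - v)"
    by (simp add: loop_vec_scale vec_eq_iff algebra_simps)
  also have "\<dots> \<in> base_change t" by (intro base_change_intros(4) loop_coef assms)
  finally have "Hq.loops x (\<lambda>y. r * loop_coef v x y) \<simeq>[Hq.J] S x (r *s v)"
    by (rule S_eq[OF assms])
  then show ?thesis unfolding Hq.loops_scal S_def[symmetric] by (rule cgr_sym)
qed

lemma S_zero: "x \<in> L \<Longrightarrow> S x 0 \<simeq>[Hq.J] 0"
  using S_scale[of x 0 0] by simp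

lemma S_sum: "x \<in> L \<Longrightarrow> S x (\<Sum>i\<in>X. f i) \<simeq>[Hq.J] (\<Sum>i\<in>X. S x (f i))"
proof (induction X rule: infinite_finite_induct)
  case (insert i X)
  have "S x (f i + sum f X) \<simeq>[Hq.J] S x (f i) + S x (sum f X)" by (intro S_add insert)
  also have "\<dots> \<simeq>[Hq.J] S x (f i) + (\<Sum>i\<in>X. S x (f i))" by (intro cgr_add cgr_refl insert)
  finally show ?case using insert by simp
qed (simp_all add: S_zero)

text \<open>A loop along any arrow in direction \<open>i\<close> may serve as the element \<open>s\<^sub>i\<close> at its vertex.\<close>

lemma S_arrow:
  assumes "adj x y" shows "Hq.tar x y * Hq.tar y x \<simeq>[Hq.J] S x (axis (dir x y) 1)"
  using S_eq[of x "\<lambda>z. if z = y then 1 else 0" "axis (dir x y) 1"] assms adj_sym[of x y]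
    Hq.loops_single[of x y] loop_vec_single[of x y]
  by (simp add: base_change_intros adj_def)

text \<open>In a direction in which both ends of an arrow have a neighbour, commutation is a transport
  along a square; these directions generate everything.\<close>

lemma S_commute:
  assumes xy: "adj x y"
  shows "S x v * Hq.tar x y \<simeq>[Hq.J] Hq.tar x y * S y v"
proof -
  have L: "x \<in> L" "y \<in> L" using xy by (auto simp: adj_def)
  obtain m where "lattice_projection t (common_dirs x y) m" by (rule common_projection[of x y]) (use xy in auto)
  then interpret m: lattice_projection t "common_dirs x y" m .
  have one: "S x (axis k 1) * Hq.tar x y \<simeq>[Hq.J] Hq.tar x y * S y (axis k 1)" if k: "k \<in> common_dirs x y" for k
  proof (cases "x $ k = y $ k")
    case False
    then have d: "dir x y = k" using adj_diff(1)[OF xy] by simp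
    have yx: "adj y x" using xy adj_sym by blast
    have "S x (axis k 1) * Hq.tar x y \<simeq>[Hq.J] Hq.tar x y * Hq.tar y x * Hq.tar x y"
      using S_arrow[OF xy] d by (intro cgr_right, intro cgr_sym[of "Hq.tar x y * Hq.tar y x"]) simp
    also have "\<dots> = Hq.tar x y * (Hq.tar y x * Hq.tar x y)" by (simp add: mult.assoc)
    also have "\<dots> \<simeq>[Hq.J] Hq.tar x y * S y (axis k 1)"
      using S_arrow[OF yx] d by (intro cgr_left) (simp add: dir_sym)
    finally show ?thesis .
  next
    case True
    then obtain \<sigma> where s: "\<sigma> = 1 \<or> \<sigma> = - 1" "x + axis k \<sigma> \<in> L" "y + axis k \<sigma> \<in> L"
      using k unfolding common_dirs_def by blast
    let ?x = "x + axis k \<sigma>" and ?y = "y + axis k \<sigma>"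
    have a: "adj x ?x" "adj y ?y" using adjI s L by blast+
    then have a': "adj ?x x" "adj ?y y" using adj_sym by blast+
    have sq: "adj ?x ?y" using xy s unfolding adj_def l1_dist_def by simp
    have d: "dir x ?x = k" "dir y ?y = k" using s(1) by (auto simp: dir_step)
    have ne: "?x \<noteq> y" "x \<noteq> ?y" using True s(1) by (auto simp: vec_eq_iff intro!: exI[of _ k])
    have "S x (axis k 1) * Hq.tar x y \<simeq>[Hq.J] Hq.tar x ?x * Hq.tar ?x x * Hq.tar x y"
      using S_arrow[OF a(1)] d by (intro cgr_right, intro cgr_sym[of "Hq.tar x ?x * Hq.tar ?x x"]) simp
    also have "\<dots> = Hq.tar x ?x * (Hq.tar ?x x * Hq.tar x y)" by (simp add: mult.assoc)
    also have "\<dots> \<simeq>[Hq.J] Hq.tar x ?x * (Hq.tar ?x ?y * Hq.tar ?y y)"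
      by (intro cgr_left H_two ne a' sq xy)
    also have "\<dots> = (Hq.tar x ?x * Hq.tar ?x ?y) * Hq.tar ?y y" by (simp add: mult.assoc)
    also have "\<dots> \<simeq>[Hq.J] (Hq.tar x y * Hq.tar y ?y) * Hq.tar ?y y"
      by (intro cgr_right H_two ne a sq xy)
    also have "\<dots> = Hq.tar x y * (Hq.tar y ?y * Hq.tar ?y y)" by (simp add: mult.assoc)
    also have "\<dots> \<simeq>[Hq.J] Hq.tar x y * S y (axis k 1)"
      using S_arrow[OF a(2)] d by (intro cgr_left) simp
    finally show ?thesis .
  qed
  let ?D = "common_dirs x y"
  have w: "m.prj v = (\<Sum>k\<in>?D. m.prj v $ k *s axis k 1)"
    by (subst supported_sum) (simp_all add: m.prj_supp)
  have expand: "S z v \<simeq>[Hq.J] (\<Sum>k\<in>?D. scal (m.prj v $ k) * S z (axis k 1))" if z: "z \<in> L" for z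
  proof -
    have "S z v \<simeq>[Hq.J] S z (m.prj v)" by (intro S_congr z m.prj_congruent)
    also have "S z (m.prj v) = S z (\<Sum>k\<in>?D. m.prj v $ k *s axis k 1)" using w by simp
    also have "\<dots> \<simeq>[Hq.J] (\<Sum>k\<in>?D. S z (m.prj v $ k *s axis k 1))" by (intro S_sum z)
    also have "\<dots> \<simeq>[Hq.J] (\<Sum>k\<in>?D. scal (m.prj v $ k) * S z (axis k 1))" by (intro cgr_sum S_scale z)
    finally show ?thesis .
  qed
  have "S x v * Hq.tar x y \<simeq>[Hq.J] (\<Sum>k\<in>?D. scal (m.prj v $ k) * S x (axis k 1)) * Hq.tar x y"
    by (intro cgr_right expand L)
  also have "\<dots> = (\<Sum>k\<in>?D. scal (m.prj v $ k) * (S x (axis k 1) * Hq.tar x y))"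
    by (simp add: sum_distrib_right mult.assoc)
  also have "\<dots> \<simeq>[Hq.J] (\<Sum>k\<in>?D. scal (m.prj v $ k) * (Hq.tar x y * S y (axis k 1)))"
    by (intro cgr_sum cgr_left one)
  also have "\<dots> = Hq.tar x y * (\<Sum>k\<in>?D. scal (m.prj v $ k) * S y (axis k 1))"
    by (simp add: sum_distrib_left scal_left_comm[of "Hq.tar x y"])
  also have "\<dots> \<simeq>[Hq.J] Hq.tar x y * S y v"
    by (intro cgr_left, intro cgr_sym[of "S y v"] expand L)
  finally show ?thesis .
qed

lemma S_loops_commute: "Hq.loops_commute (loop_coef v)"
  unfolding Hq.loops_commute_def S_def[symmetric] using S_commute by blast

lemma S_S_commute: "S x v * S x w \<simeq>[Hq.J] S x w * S x v"
  unfolding S_def by (rule Hq.loops_commute_loops[OF S_loops_commute])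

subsubsection \<open>Shortest paths\<close>

fun steps :: "nat \<Rightarrow> int ^ 'n \<Rightarrow> int ^ 'n \<Rightarrow>
    ((int ^ 'n, ((('r ^ 'n) set, int ^ 'n) H_letter list \<Rightarrow>\<^sub>0 'r)) tensor_letter list \<Rightarrow>\<^sub>0 'r)" where
  "steps 0 x u = gen (TIdem x)"
| "steps (Suc n) x u = Hq.tar x (SOME y. closer x u y) * steps n (SOME y. closer x u y) u"

text \<open>An arbitrary shortest path, chosen one step at a time.\<close>

definition geo :: "int ^ 'n \<Rightarrow> int ^ 'n \<Rightarrow>
    ((int ^ 'n, ((('r ^ 'n) set, int ^ 'n) H_letter list \<Rightarrow>\<^sub>0 'r)) tensor_letter list \<Rightarrow>\<^sub>0 'r)" where
  "geo x u = steps (l1_dist x u) x u"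

lemma geo_self [simp]: "geo x x = gen (TIdem x)"
  by (simp add: geo_def)

lemma geo_step:
  assumes "x \<in> L" "u \<in> L" "x \<noteq> u"
  obtains y where "closer x u y" "geo x u = Hq.tar x y * geo y u"
proof -
  let ?y = "SOME y. closer x u y"
  obtain y where "closer x u y" by (rule closer_exists[OF assms])
  then have y: "closer x u ?y" by (rule someI)
  then have "l1_dist x u = Suc (l1_dist ?y u)" by (simp add: closer_def)
  then have "geo x u = Hq.tar x ?y * geo ?y u" by (simp add: geo_def)
  with y that show thesis by blast
qed

lemma closer_L: "closer x u y \<Longrightarrow> x \<in> L \<and> y \<in> L \<and> adj x y \<and> adj y x"
  using adj_sym by (auto simp: closer_def adj_def)

lemma closer_trans2: "closer x u a \<Longrightarrow> closer a u z \<Longrightarrow> x \<noteq> z"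
  by (auto simp: closer_def)

text \<open>By induction on the length it suffices to exchange two first steps that span a square, and
  squares connect all first steps.\<close>

lemma geo_closer: "closer x u y \<Longrightarrow> u \<in> L \<Longrightarrow> Hq.tar x y * geo y u \<simeq>[Hq.J] geo x u"
proof (induction "l1_dist x u" arbitrary: x y rule: less_induct)
  case less
  have x: "x \<in> L" "x \<noteq> u" using less.prems closer_L[of x u y] by (auto simp: closer_def)
  obtain y0 where y0: "closer x u y0" "geo x u = Hq.tar x y0 * geo y0 u"
    by (rule geo_step[OF x(1) less.prems(2) x(2)])
  show ?case
  proof (rule closer_connect[of x u y0 y "\<lambda>a. Hq.tar x a * geo a u \<simeq>[Hq.J] geo x u"])
    fix a b z
    assume az: "closer x u a" "closer x u b" "closer a u z" "closer b u z"
      and a: "Hq.tar x a * geo a u \<simeq>[Hq.J] geo x u"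
    have IH: "Hq.tar d z * geo z u \<simeq>[Hq.J] geo d u" if "closer x u d" "closer d u z" for d
      using less.hyps[OF _ that(2) less.prems(2)] that(1) by (simp add: closer_def)
    have "Hq.tar x b * geo b u \<simeq>[Hq.J] Hq.tar x b * (Hq.tar b z * geo z u)"
      by (intro cgr_left, intro cgr_sym[of "Hq.tar b z * geo z u"] IH az)
    also have "\<dots> = (Hq.tar x b * Hq.tar b z) * geo z u" by (simp add: mult.assoc)
    also have "\<dots> \<simeq>[Hq.J] (Hq.tar x a * Hq.tar a z) * geo z u"
      using closer_L az closer_trans2[OF az(1,3)] by (intro cgr_right H_two) blast+
    also have "\<dots> = Hq.tar x a * (Hq.tar a z * geo z u)" by (simp add: mult.assoc)
    also have "\<dots> \<simeq>[Hq.J] Hq.tar x a * geo a u" by (intro cgr_left IH az)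
    also note a
    finally show "Hq.tar x b * geo b u \<simeq>[Hq.J] geo x u" .
  qed (use x less.prems y0 in auto)
qed

lemma geo_adj:
  assumes "adj x y" shows "geo x y \<simeq>[Hq.J] Hq.tar x y"
proof -
  have "closer x y y" using assms by (auto simp: closer_def adj_def)
  then have "geo x y \<simeq>[Hq.J] Hq.tar x y * geo y y"
    using assms by (intro cgr_sym[OF geo_closer]) (auto simp: adj_def)
  also have "\<dots> \<simeq>[Hq.J] Hq.tar x y" using Hq.tar_TIdem_J[OF assms] by simp
  finally show ?thesis .
qed

lemma geo_induct [consumes 2, case_names same step]:
  assumes "x \<in> L" "u \<in> L"
    and "Q u" and "\<And>x y. closer x u y \<Longrightarrow> geo x u = Hq.tar x y * geo y u \<Longrightarrow> Q y \<Longrightarrow> Q x"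
  shows "Q x"
  using assms(1)
proof (induction "l1_dist x u" arbitrary: x rule: less_induct)
  case less
  show ?case
  proof (cases "x = u")
    case False
    obtain y where y: "closer x u y" "geo x u = Hq.tar x y * geo y u"
      by (rule geo_step[OF less.prems assms(2) False])
    then have "Q y" using closer_L[OF y(1)] by (intro less.hyps) (auto simp: closer_def)
    with y show ?thesis by (rule assms(4))
  qed (use assms(3) in simp)
qed

lemma TIdem_geo: 
  assumes "x \<in> L" "u \<in> L" shows "gen (TIdem x) * geo x u \<simeq>[Hq.J] geo x u"
  using assms
proof (induction rule: geo_induct)
  case (step x y)
  then have "adj x y" using closer_L by blast
  then have "gen (TIdem x) * Hq.tar x y * geo y u \<simeq>[Hq.J] Hq.tar x y * geo y u"
    by (intro cgr_right Hq.TIdem_tar_J)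
  then show ?case using step by (simp add: mult.assoc)
qed (simp add: Hq.TIdem_TIdem assms)

lemma geo_TIdem:
  assumes "x \<in> L" "u \<in> L" shows "geo x u * gen (TIdem u) \<simeq>[Hq.J] geo x u"
  using assms
proof (induction rule: geo_induct)
  case (step x y)
  then show ?case using cgr_left[OF step(3), of "Hq.tar x y"] by (simp add: mult.assoc)
qed (simp add: Hq.TIdem_TIdem assms)

lemma S_TIdem: "gen (TIdem x) * S x v \<simeq>[Hq.J] S x v" "S x v * gen (TIdem x) \<simeq>[Hq.J] S x v"
  "gen (TIdem x) * S x v \<simeq>[Hq.J] S x v * gen (TIdem x)"
proof -
  show a: "gen (TIdem x) * S x v \<simeq>[Hq.J] S x v" and b: "S x v * gen (TIdem x) \<simeq>[Hq.J] S x v"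
    unfolding S_def by (rule Hq.TIdem_loops Hq.loops_TIdem)+
  show "gen (TIdem x) * S x v \<simeq>[Hq.J] S x v * gen (TIdem x)"
    by (rule cgr_trans[OF a cgr_sym[OF b]])
qed

lemma S_geo: "x \<in> L \<Longrightarrow> u \<in> L \<Longrightarrow> S x v * geo x u \<simeq>[Hq.J] geo x u * S u v"
proof (induction rule: geo_induct)
  case (step x y)
  then have xy: "adj x y" using closer_L by blast
  have "S x v * geo x u = (S x v * Hq.tar x y) * geo y u" by (simp add: step(2) mult.assoc)
  also have "\<dots> \<simeq>[Hq.J] (Hq.tar x y * S y v) * geo y u" by (intro cgr_right S_commute xy)
  also have "\<dots> = Hq.tar x y * (S y v * geo y u)" by (simp add: mult.assoc)
  also have "\<dots> \<simeq>[Hq.J] Hq.tar x y * (geo y u * S u v)" by (intro cgr_left step)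
  finally show ?case by (simp add: step(2) mult.assoc)
qed (use cgr_sym[OF S_TIdem(3)] in simp)

definition mon :: "int ^ 'n \<Rightarrow> ('n \<Rightarrow> nat) \<Rightarrow> 'n list \<Rightarrow>
    ((int ^ 'n, ((('r ^ 'n) set, int ^ 'n) H_letter list \<Rightarrow>\<^sub>0 'r)) tensor_letter list \<Rightarrow>\<^sub>0 'r)" where
  "mon x e js = prod_list (map (\<lambda>i. S x (axis i 1) ^ e i) js)"

lemma S_mon: "S x v * mon x e js \<simeq>[Hq.J] mon x e js * S x v"
  unfolding mon_def by (intro commute_prod_list commute_power S_S_commute)

lemma TIdem_mon: "gen (TIdem x) * mon x e js \<simeq>[Hq.J] mon x e js * gen (TIdem x)"
  unfolding mon_def by (intro commute_prod_list commute_power S_TIdem)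

lemma tar_mon:
  assumes "adj x z"
  shows "Hq.tar x z * mon z e js \<simeq>[Hq.J] mon x e js * Hq.tar x z"
proof -
  have one: "Hq.tar x z * S z v ^ n \<simeq>[Hq.J] S x v ^ n * Hq.tar x z" for v n
  proof (induction n)
    case (Suc n)
    have "Hq.tar x z * S z v ^ Suc n = (Hq.tar x z * S z v) * S z v ^ n" by (simp add: mult.assoc)
    also have "\<dots> \<simeq>[Hq.J] (S x v * Hq.tar x z) * S z v ^ n"
      by (intro cgr_right, intro cgr_sym[OF S_commute] assms)
    also have "\<dots> = S x v * (Hq.tar x z * S z v ^ n)" by (simp add: mult.assoc)
    also have "\<dots> \<simeq>[Hq.J] S x v * (S x v ^ n * Hq.tar x z)" by (intro cgr_left Suc)
    finally show ?case by (simp add: mult.assoc)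
  qed simp
  show ?thesis
  proof (induction js)
    case (Cons i js)
    have "Hq.tar x z * mon z e (i # js) = (Hq.tar x z * S z (axis i 1) ^ e i) * mon z e js"
      by (simp add: mon_def mult.assoc)
    also have "\<dots> \<simeq>[Hq.J] (S x (axis i 1) ^ e i * Hq.tar x z) * mon z e js" by (intro cgr_right one)
    also have "\<dots> = S x (axis i 1) ^ e i * (Hq.tar x z * mon z e js)" by (simp add: mult.assoc)
    also have "\<dots> \<simeq>[Hq.J] S x (axis i 1) ^ e i * (mon x e js * Hq.tar x z)" by (intro cgr_left Cons)
    finally show ?case by (simp add: mon_def mult.assoc)
  qed (simp add: mon_def)
qed

lemma mon_incr:
  assumes "distinct js" "k \<in> set js"
  shows "mon x e js * S x (axis k 1) \<simeq>[Hq.J] mon x (e(k := Suc (e k))) js"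
  using assms
proof (induction js)
  case (Cons i js)
  show ?case
  proof (cases "i = k")
    case True
    then have same: "mon x (e(k := Suc (e k))) js = mon x e js"
      unfolding mon_def using Cons.prems(1) by (intro arg_cong[of _ _ prod_list] map_cong) auto
    have "mon x e (i # js) * S x (axis k 1) = S x (axis k 1) ^ e k * (mon x e js * S x (axis k 1))"
      by (simp add: mon_def True mult.assoc)
    also have "\<dots> \<simeq>[Hq.J] S x (axis k 1) ^ e k * (S x (axis k 1) * mon x e js)"
      by (intro cgr_left, intro cgr_sym[OF S_mon])
    also have "\<dots> = mon x (e(k := Suc (e k))) (i # js)"
      using same by (simp add: mon_def True mult.assoc[symmetric] power_commutes)
    finally show ?thesis .
  next
    case False
    have "mon x e (i # js) * S x (axis k 1) = S x (axis i 1) ^ e i * (mon x e js * S x (axis k 1))"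
      by (simp add: mon_def mult.assoc)
    also have "\<dots> \<simeq>[Hq.J] S x (axis i 1) ^ e i * mon x (e(k := Suc (e k))) js"
      by (intro cgr_left Cons.IH) (use Cons.prems False in auto)
    also have "\<dots> = mon x (e(k := Suc (e k))) (i # js)" using False by (simp add: mon_def)
    finally show ?thesis .
  qed
qed simp

lemma eta_step:
  assumes "closer x y z"
  shows "closer x u z \<Longrightarrow> eta x y u = eta z y u"
    and "closer z u x \<Longrightarrow> eta x y u = (eta z y u)(dir x z := Suc (eta z y u (dir x z)))"
proof -
  obtain k where z: "z = x + axis k (sg x y k)" "x $ k \<noteq> y $ k" "dir x z = k"
    using assms by (rule closerE)
  have off: "eta x y u i = eta z y u i" if "i \<noteq> k" for i using that by (simp add: eta_def z)
  have dy: "\<bar>z $ k - y $ k\<bar> = \<bar>x $ k - y $ k\<bar> - 1" using z by (auto simp: sg_def)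
  have du: "int (l1_dist z u) = int (l1_dist x u) - \<bar>x $ k - u $ k\<bar> + \<bar>z $ k - u $ k\<bar>"
    unfolding z(1) l1_dist_step by simp
  show "eta x y u = eta z y u" if "closer x u z"
  proof
    fix i
    have "\<bar>z $ k - u $ k\<bar> = \<bar>x $ k - u $ k\<bar> - 1" using du that unfolding closer_def by linarith
    then have "eta x y u k = eta z y u k" using eta2[of x y u k] eta2[of z y u k] dy by linarith
    then show "eta x y u i = eta z y u i" using off by (cases "i = k") auto
  qed
  show "eta x y u = (eta z y u)(dir x z := Suc (eta z y u (dir x z)))" if "closer z u x"
  proof
    fix i
    have "\<bar>z $ k - u $ k\<bar> = \<bar>x $ k - u $ k\<bar> + 1" using du that unfolding closer_def by linarith
    then have "eta x y u k = Suc (eta z y u k)" using eta2[of x y u k] eta2[of z y u k] dy by linarith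
    then show "eta x y u i = ((eta z y u)(dir x z := Suc (eta z y u (dir x z)))) i"
      using off z(3) by (cases "i = k") auto
  qed
qed

text \<open>Each arrow of the first path either shortens the distance to \<open>u\<close> and is absorbed by the
  shortest path, or lengthens it and then contributes one loop, that is, one factor \<open>s\<^sub>i\<close>; \<open>eta\<close>
  counts the latter.\<close>

lemma geo_mult:
  assumes "x \<in> L" "y \<in> L" "u \<in> L" and js: "distinct js" "set js = UNIV"
  shows "geo x y * geo y u \<simeq>[Hq.J] mon x (eta x y u) js * geo x u"
  using assms(1,2)
proof (induction rule: geo_induct)
  case same
  have 1: "mon y (eta y y u) js = 1" unfolding mon_def by (induction js) auto
  show ?case unfolding 1 using TIdem_geo[OF assms(2,3)] by simp
next
  case (step x z)
  have xz: "x \<in> L" "z \<in> L" "adj x z" using closer_L[OF step(1)] by auto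
  have "geo x y * geo y u = Hq.tar x z * (geo z y * geo y u)" by (simp add: step(2) mult.assoc)
  also have "\<dots> \<simeq>[Hq.J] Hq.tar x z * (mon z (eta z y u) js * geo z u)" by (intro cgr_left step)
  also have "\<dots> = (Hq.tar x z * mon z (eta z y u) js) * geo z u" by (simp add: mult.assoc)
  also have "\<dots> \<simeq>[Hq.J] (mon x (eta z y u) js * Hq.tar x z) * geo z u" by (intro cgr_right tar_mon xz)
  also have "\<dots> = mon x (eta z y u) js * (Hq.tar x z * geo z u)" by (simp add: mult.assoc)
  also have "\<dots> \<simeq>[Hq.J] mon x (eta x y u) js * geo x u"
  proof (cases "closer x u z")
    case True
    then show ?thesis unfolding eta_step(1)[OF step(1) True] by (intro cgr_left geo_closer assms)
  next
    case False
    then have c: "closer z u x" using adj_dist[OF xz(3)] by blast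
    let ?e = "eta z y u" and ?k = "dir x z"
    have "Hq.tar x z * geo z u \<simeq>[Hq.J] Hq.tar x z * (Hq.tar z x * geo x u)"
      by (intro cgr_left, intro cgr_sym[OF geo_closer] c assms)
    also have "\<dots> = (Hq.tar x z * Hq.tar z x) * geo x u" by (simp add: mult.assoc)
    also have "\<dots> \<simeq>[Hq.J] S x (axis ?k 1) * geo x u" by (intro cgr_right S_arrow xz)
    finally have "mon x ?e js * (Hq.tar x z * geo z u) \<simeq>[Hq.J] mon x ?e js * (S x (axis ?k 1) * geo x u)"
      by (intro cgr_left)
    also have "\<dots> = (mon x ?e js * S x (axis ?k 1)) * geo x u" by (simp add: mult.assoc)
    also have "\<dots> \<simeq>[Hq.J] mon x (?e(?k := Suc (?e ?k))) js * geo x u"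
      using js by (intro cgr_right mon_incr) auto
    finally show ?thesis unfolding eta_step(2)[OF step(1) c] .
  qed
  finally show ?case .
qed

subsubsection \<open>The inverse of the multiplication map\<close>

definition H_inv :: "(int ^ 'n) set \<Rightarrow> (('r ^ 'n) set, int ^ 'n) H_letter \<Rightarrow>
    ((int ^ 'n, ((('r ^ 'n) set, int ^ 'n) H_letter list \<Rightarrow>\<^sub>0 'r)) tensor_letter list \<Rightarrow>\<^sub>0 'r)" where
  "H_inv X l = (case l of HSym s \<Rightarrow> Hq.loop_sum X (loop_coef (SOME v. v \<in> s))
    | HIdem x \<Rightarrow> gen (TIdem x) | HC x y \<Rightarrow> geo x y)"

lemma H_inv_simps [simp]:
  "H_inv X (HIdem x) = gen (TIdem x)" "H_inv X (HC x y) = geo x y"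
  by (simp_all add: H_inv_def)

lemma H_inv_sym:
  obtains v' where "v' - v \<in> base_change t" "H_inv X (HSym (g_class t v)) = Hq.loop_sum X (loop_coef v')"
proof -
  have "v \<in> g_class t v" by (simp add: g_class_def base_change_intros)
  then have "(SOME v'. v' \<in> g_class t v) \<in> g_class t v" by (rule someI)
  then show thesis by (intro that[of "SOME v'. v' \<in> g_class t v"]) (simp_all add: g_class_def H_inv_def)
qed

lemma H_inv_sym_left:
  assumes "finite X" "X \<subseteq> L" "x \<in> X" "gen (TIdem x) * f \<simeq>[Hq.J] f"
  shows "H_inv X (HSym (g_class t v)) * f \<simeq>[Hq.J] S x v * f"
proof -
  have x: "x \<in> L" using assms by blast
  obtain v' where v': "v' - v \<in> base_change t" "H_inv X (HSym (g_class t v)) = Hq.loop_sum X (loop_coef v')"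
    by (rule H_inv_sym)
  have "H_inv X (HSym (g_class t v)) * f \<simeq>[Hq.J] S x v' * f"
    using Hq.loop_sum_left[OF assms(1,2) x assms(4)] assms(3) by (simp add: v'(2) S_def)
  also have "\<dots> \<simeq>[Hq.J] S x v * f" by (intro cgr_right S_congr x v')
  finally show ?thesis .
qed

lemma H_inv_sym_right:
  assumes "finite X" "X \<subseteq> L" "x \<in> X" "f * gen (TIdem x) \<simeq>[Hq.J] f"
  shows "f * H_inv X (HSym (g_class t v)) \<simeq>[Hq.J] f * S x v"
proof -
  have x: "x \<in> L" using assms by blast
  obtain v' where v': "v' - v \<in> base_change t" "H_inv X (HSym (g_class t v)) = Hq.loop_sum X (loop_coef v')"
    by (rule H_inv_sym)
  have "f * H_inv X (HSym (g_class t v)) \<simeq>[Hq.J] f * S x v'"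
    using Hq.loop_sum_right[OF assms(1,2) x assms(4)] assms(3) by (simp add: v'(2) S_def)
  also have "\<dots> \<simeq>[Hq.J] f * S x v" by (intro cgr_left S_congr x v')
  finally show ?thesis .
qed

lemma H_inv_sym_sum:
  assumes "X \<subseteq> L" shows "H_inv X (HSym (g_class t v)) \<simeq>[Hq.J] (\<Sum>x\<in>X. S x v)"
proof -
  obtain v' where v': "v' - v \<in> base_change t" "H_inv X (HSym (g_class t v)) = Hq.loop_sum X (loop_coef v')"
    by (rule H_inv_sym)
  show ?thesis unfolding v'(2) Hq.loop_sum_def S_def[symmetric]
    by (intro cgr_sum S_congr v'(1)) (use assms in blast)
qed

lemma H_inv_mon:
  assumes X: "finite X" "X \<subseteq> L" "x \<in> X" and f: "gen (TIdem x) * f \<simeq>[Hq.J] f"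
  shows "lift (H_inv X) (prod_list (map (\<lambda>i. sym (axis i 1) ^ e i) js)) * f \<simeq>[Hq.J] mon x e js * f"
proof -
  have stable: "gen (TIdem x) * (a * g) \<simeq>[Hq.J] a * g"
    if "gen (TIdem x) * a \<simeq>[Hq.J] a * gen (TIdem x)" "gen (TIdem x) * g \<simeq>[Hq.J] g" for a g
  proof -
    have "gen (TIdem x) * (a * g) = gen (TIdem x) * a * g" by (simp add: mult.assoc)
    also have "\<dots> \<simeq>[Hq.J] a * gen (TIdem x) * g" by (intro cgr_right that)
    also have "\<dots> = a * (gen (TIdem x) * g)" by (simp add: mult.assoc)
    also have "\<dots> \<simeq>[Hq.J] a * g" by (intro cgr_left that)
    finally show ?thesis .
  qed
  have power: "H_inv X (HSym (g_class t v)) ^ n * g \<simeq>[Hq.J] S x v ^ n * g"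
    if g: "gen (TIdem x) * g \<simeq>[Hq.J] g" for v n g
  proof (induction n)
    case (Suc n)
    have "H_inv X (HSym (g_class t v)) ^ Suc n * g = H_inv X (HSym (g_class t v)) * (H_inv X (HSym (g_class t v)) ^ n * g)"
      by (simp add: mult.assoc)
    also have "\<dots> \<simeq>[Hq.J] H_inv X (HSym (g_class t v)) * (S x v ^ n * g)" by (intro cgr_left Suc)
    also have "\<dots> \<simeq>[Hq.J] S x v * (S x v ^ n * g)"
      by (intro H_inv_sym_left X stable commute_power S_TIdem g)
    finally show ?case by (simp add: mult.assoc)
  qed simp
  show ?thesis
  proof (induction js)
    case (Cons i js)
    let ?r = "lift (H_inv X) (prod_list (map (\<lambda>i. sym (axis i 1) ^ e i) js))"
    have "lift (H_inv X) (prod_list (map (\<lambda>i. sym (axis i 1) ^ e i) (i # js))) * f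
      = H_inv X (HSym (g_class t (axis i 1))) ^ e i * (?r * f)"
      by (simp add: lift_mult lift_power mult.assoc)
    also have "\<dots> \<simeq>[Hq.J] H_inv X (HSym (g_class t (axis i 1))) ^ e i * (mon x e js * f)"
      by (intro cgr_left Cons)
    also have "\<dots> \<simeq>[Hq.J] S x (axis i 1) ^ e i * (mon x e js * f)"
      by (intro power stable TIdem_mon f)
    finally show ?case by (simp add: mon_def mult.assoc)
  qed (simp add: mon_def)
qed

lemma eventually_large:
  assumes "finite X0" "X0 \<subseteq> L" "\<And>X. finite X \<Longrightarrow> X0 \<subseteq> X \<Longrightarrow> X \<subseteq> L \<Longrightarrow> Q X"
  shows "\<forall>\<^sub>F X in finite_subsets_at_top L. Q X"
  unfolding eventually_finite_subsets_at_top using assms by (intro exI[of _ X0]) blast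

lemma H_inv_rels:
  assumes "s \<in> rels H"
  shows "\<forall>\<^sub>F X in finite_subsets_at_top L. lift (H_inv X) s \<in> ideal Hq.J"
  using assms
proof (cases rule: rels_H_cases)
  case (add v w)
  show ?thesis
  proof (rule eventually_large[of "{}"])
    fix X assume X: "X \<subseteq> L"
    have "H_inv X (HSym (g_class t (v + w))) \<simeq>[Hq.J] (\<Sum>x\<in>X. S x (v + w))" by (rule H_inv_sym_sum[OF X])
    also have "\<dots> \<simeq>[Hq.J] (\<Sum>x\<in>X. S x v + S x w)" by (intro cgr_sum S_add) (use X in blast)
    also have "\<dots> = (\<Sum>x\<in>X. S x v) + (\<Sum>x\<in>X. S x w)" by (simp add: sum.distrib)
    also have "\<dots> \<simeq>[Hq.J] H_inv X (HSym (g_class t v)) + H_inv X (HSym (g_class t w))"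
      by (rule cgr_add) (rule cgr_sym, rule H_inv_sym_sum[OF X])+
    finally show "lift (H_inv X) s \<in> ideal Hq.J"
      unfolding add by (simp add: lift_diff lift_add cgr_def diff_diff_eq)
  qed auto
next
  case (scal r v)
  show ?thesis
  proof (rule eventually_large[of "{}"])
    fix X assume X: "X \<subseteq> L"
    have "H_inv X (HSym (g_class t (r *s v))) \<simeq>[Hq.J] (\<Sum>x\<in>X. S x (r *s v))" by (rule H_inv_sym_sum[OF X])
    also have "\<dots> \<simeq>[Hq.J] (\<Sum>x\<in>X. Defs.scal r * S x v)" by (intro cgr_sum S_scale) (use X in blast)
    also have "\<dots> = Defs.scal r * (\<Sum>x\<in>X. S x v)" by (simp add: sum_distrib_left)
    also have "\<dots> \<simeq>[Hq.J] Defs.scal r * H_inv X (HSym (g_class t v))"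
      by (rule cgr_left) (rule cgr_sym, rule H_inv_sym_sum[OF X])
    finally show "lift (H_inv X) s \<in> ideal Hq.J"
      unfolding scal by (simp add: lift_diff lift_mult cgr_def)
  qed auto
next
  case (idem x y)
  have "gen (TIdem x) * gen (TIdem y) \<simeq>[Hq.J] (if x = y then gen (TIdem x) else 0)"
    by (intro Hq.rels_T_sub Hq.T_idem idem)
  then have "lift (H_inv X) s \<in> ideal Hq.J" for X
    unfolding idem by (cases "x = y") (simp_all add: lift_diff lift_mult cgr_def)
  then show ?thesis by simp
next
  case (left x y)
  have "lift (H_inv X) s \<in> ideal Hq.J" for X
    using TIdem_geo[OF left(2,3)] unfolding left by (simp add: lift_diff lift_mult cgr_def)
  then show ?thesis by simp
next
  case (right x y)
  have "lift (H_inv X) s \<in> ideal Hq.J" for X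
    using geo_TIdem[OF right(2,3)] unfolding right by (simp add: lift_diff lift_mult cgr_def)
  then show ?thesis by simp
next
  case (same x)
  then show ?thesis by (simp add: lift_diff gen_ideal.zero)
next
  case (mult x y u js)
  show ?thesis
  proof (rule eventually_large[of "{x}"])
    fix X assume X: "finite X" "{x} \<subseteq> X" "X \<subseteq> L"
    have "geo x y * geo y u \<simeq>[Hq.J] mon x (eta x y u) js * geo x u"
      by (intro geo_mult mult)
    also have "\<dots> \<simeq>[Hq.J] lift (H_inv X) (prod_list (map (\<lambda>i. sym (axis i 1) ^ eta x y u i) js)) * geo x u"
      by (rule cgr_sym, rule H_inv_mon) (use X TIdem_geo mult in auto)
    finally show "lift (H_inv X) s \<in> ideal Hq.J"
      unfolding mult(1) by (simp add: lift_diff lift_mult cgr_def)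
  qed (use mult in auto)
qed

lemma H_inv_commute:
  assumes "g \<in> central H \<union> gens H"
  shows "\<forall>\<^sub>F X in finite_subsets_at_top L. lift (H_inv X) (sym v * gen g - gen g * sym v) \<in> ideal Hq.J"
proof -
  consider w where "g = HSym (g_class t w)" | x where "g = HIdem x" "x \<in> L" | x y where "g = HC x y" "x \<in> L" "y \<in> L"
    using assms by auto
  then show ?thesis
  proof cases
    case 1
    show ?thesis
    proof (rule eventually_large[of "{}"])
      fix X assume X: "finite X" "X \<subseteq> L"
      obtain v' where v': "H_inv X (HSym (g_class t v)) = Hq.loop_sum X (loop_coef v')" by (rule H_inv_sym)
      obtain w' where w': "H_inv X (HSym (g_class t w)) = Hq.loop_sum X (loop_coef w')" by (rule H_inv_sym)
      show "lift (H_inv X) (sym v * gen g - gen g * sym v) \<in> ideal Hq.J"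
        using Hq.loop_sum_commute[OF X S_loops_commute, of v' "loop_coef w'"]
        by (simp add: 1 lift_diff lift_mult v' w' cgr_def)
    qed auto
  next
    case 2
    show ?thesis
    proof (rule eventually_large[of "{}"])
      fix X assume X: "finite X" "X \<subseteq> L"
      obtain v' where v': "H_inv X (HSym (g_class t v)) = Hq.loop_sum X (loop_coef v')" by (rule H_inv_sym)
      show "lift (H_inv X) (sym v * gen g - gen g * sym v) \<in> ideal Hq.J"
        using Hq.loop_sum_TIdem[OF X 2(2), of "loop_coef v'"]
        by (simp add: 2 lift_diff lift_mult v' cgr_def)
    qed auto
  next
    case 3
    show ?thesis
    proof (rule eventually_large[of "{x, y}"])
      fix X assume X: "finite X" "{x, y} \<subseteq> X" "X \<subseteq> L"
      have "H_inv X (HSym (g_class t v)) * geo x y \<simeq>[Hq.J] S x v * geo x y"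
        by (rule H_inv_sym_left) (use X 3 TIdem_geo in auto)
      also have "\<dots> \<simeq>[Hq.J] geo x y * S y v" by (intro S_geo 3)
      also have "\<dots> \<simeq>[Hq.J] geo x y * H_inv X (HSym (g_class t v))"
        by (rule cgr_sym, rule H_inv_sym_right) (use X 3 geo_TIdem in auto)
      finally show "lift (H_inv X) (sym v * gen g - gen g * sym v) \<in> ideal Hq.J"
        by (simp add: 3 lift_diff lift_mult cgr_def)
    qed (use 3 in auto)
  qed
qed

lemma c_tm_image:
  assumes "x \<in> L" "y \<in> L" shows "Hq.tm_image (c x y)"
  using assms
proof (induction rule: geo_induct)
  case same
  show ?case by (intro Hq.tm_image_cgr[OF Hq.tm_image_e c_same] assms(2))
next
  case (step x z)
  have xz: "x \<in> L" "z \<in> L" "adj x z" using closer_L[OF step(1)] by auto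
  have "l1_dist x z + l1_dist z y = l1_dist x y" using step(1) by (simp add: closer_def adj_def)
  then have "c x z * c z y \<simeq>[full_rels H] c x y" by (intro c_geodesic xz assms(2))
  then show ?case
    by (rule Hq.tm_image_cgr[OF _ cgr_sym, rotated]) (intro Hq.tm_image_mult Hq.tm_image_ar xz step)
qed

text \<open>In degree zero and one there is nothing to invert; the elements \<open>c x y\<close> of higher degree go
  to shortest paths and the symmetric algebra to loops, and the relations hold by the two previous
  parts.\<close>

theorem H_quadratic: "is_quadratic H L HIdem"
proof (rule Hq.is_quadraticI[of H_inv])
  show "Hq.tm_image (gen g)" if "g \<in> gens H" for g
    using that Hq.tm_image_e c_tm_image by auto
next
  fix z x assume z: "z \<in> central H" and x: "x \<in> L"
  from z obtain v where v: "z = HSym (g_class t v)" by auto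
  obtain k where k: "loop_vec x k - v \<in> base_change t" using loop_vec_onto[OF x] by blast
  have "g_class t (loop_vec x k) = g_class t v" using k by (simp add: g_class_eq)
  then have "(\<Sum>y\<in>Hq.M x x. scal (k y) * (c x y * c y x)) \<simeq>[full_rels H] gen z * gen (HIdem x)"
    using H_loops[of k x] by (simp add: v)
  then show "Hq.tm_image (gen z * gen (HIdem x))"
    by (rule Hq.tm_image_cgr[OF _ cgr_sym, rotated])
      (intro Hq.tm_image_sum Hq.tm_image_scal Hq.tm_image_mult Hq.tm_image_ar, auto)
next
  fix s assume "s \<in> full_rels H"
  then consider "s \<in> rels H" | v g where "s = sym v * gen g - gen g * sym v" "g \<in> central H \<union> gens H"
    unfolding full_rels_def H_simps(1) by blast
  then show "\<forall>\<^sub>F X in finite_subsets_at_top L. lift (H_inv X) s \<in> ideal Hq.J"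
    by cases (use H_inv_rels H_inv_commute in simp_all)
next
  show "H_inv X (HIdem x) \<simeq>[Hq.J] gen (TIdem x)" for X x by simp
  show "adj x y \<Longrightarrow> H_inv X (HC x y) \<simeq>[Hq.J] Hq.tar x y" for X x y by (simp add: geo_adj)
qed

end

section \<open>The dual algebra\<close>

context chamber_ring
begin

subsection \<open>Common neighbours\<close>

text \<open>At most two coordinates differ between the ends, and a common neighbour changes one of
  them.\<close>

lemma common_two:
  assumes "x \<noteq> u" "adj x y1" "adj y1 u" "adj x y2" "adj y2 u" "y1 \<noteq> y2"
  shows "{y. adj x y \<and> adj y u} = {y1, y2}"
proof -
  let ?D = "{k. x $ k \<noteq> u $ k}"
  let ?f = "\<lambda>k. x + axis k (sg x u k)"
  have "int (card ?D) \<le> (\<Sum>k\<in>?D. \<bar>x $ k - u $ k\<bar>)"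
    using sum_mono[of ?D "\<lambda>k. 1 :: int" "\<lambda>k. \<bar>x $ k - u $ k\<bar>"] by simp
  also have "\<dots> \<le> (\<Sum>k\<in>UNIV. \<bar>x $ k - u $ k\<bar>)" by (rule sum_mono2) auto
  also have "\<dots> = 2" using common_neighbours(1)[OF assms(1-3)] int_l1_dist[of x u] by simp
  finally have "card ?D \<le> 2" by simp
  have "{y. adj x y \<and> adj y u} \<subseteq> ?f ` ?D"
  proof
    fix y assume "y \<in> {y. adj x y \<and> adj y u}"
    then have "closer x u y" using common_neighbours(2)[OF assms(1)] by blast
    then obtain k where "y = ?f k" "x $ k \<noteq> u $ k" by (rule closerE)
    then show "y \<in> ?f ` ?D" by blast
  qed
  then have "card {y. adj x y \<and> adj y u} \<le> card (?f ` ?D)" by (intro card_mono) auto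
  also have "\<dots> \<le> card ?D" by (intro card_image_le) auto
  finally have "card {y. adj x y \<and> adj y u} \<le> card {y1, y2}" using \<open>card ?D \<le> 2\<close> assms(6) by simp
  then show ?thesis
    using assms finite_common[of x u] by (intro card_seteq[symmetric]) auto
qed

lemma square_corners:
  assumes "x \<noteq> u" "adj x y1" "adj y1 u" "adj x y2" "adj y2 u" "y1 \<noteq> y2"
  obtains i j \<sigma> \<tau> where "i \<noteq> j" "\<sigma> = 1 \<or> \<sigma> = - 1" "\<tau> = 1 \<or> \<tau> = - 1"
    "y1 = x + axis i \<sigma>" "y2 = x + axis j \<tau>" "u = x + axis i \<sigma> + axis j \<tau>"
proof -
  obtain i where i: "y1 = x + axis i (sg x u i)" "x $ i \<noteq> u $ i"
    using closerE[OF common_neighbours(2)[OF assms(1-3)]] by metis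
  obtain j where j: "y2 = x + axis j (sg x u j)" "x $ j \<noteq> u $ j"
    using closerE[OF common_neighbours(2)[OF assms(1,4,5)]] by metis
  have ij: "i \<noteq> j" using i(1) j(1) assms(6) by auto
  obtain k \<rho> where k: "\<rho> = 1 \<or> \<rho> = - 1" "u = y1 + axis k \<rho>" using assms(3) by (rule adjE)
  have "y1 $ j \<noteq> u $ j" using i(1) j(2) ij by simp
  then have "k = j" using k(2) by (simp split: if_splits)
  have "u $ j = y1 $ j + \<rho>" using arg_cong[OF k(2), of "\<lambda>v. v $ j"] \<open>k = j\<close> by simp
  moreover have "y1 $ j = x $ j" using arg_cong[OF i(1), of "\<lambda>v. v $ j"] ij by simp
  ultimately have "u $ j = x $ j + \<rho>" by simp
  then have "sg x u j = \<rho>" using k(1) by (auto simp: sg_def)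
  note sgj = this
  have u1: "u = y1 + axis j \<rho>" using k(2) unfolding \<open>k = j\<close> .
  show thesis
  proof (rule that[OF ij sg_cases[of x u i] k(1) i(1)])
    show "y2 = x + axis j \<rho>" using j(1) unfolding sgj .
    show "u = x + axis i (sg x u i) + axis j \<rho>" unfolding i(1)[symmetric] by (rule u1)
  qed
qed

subsection \<open>Generators and relations\<close>

abbreviation Hd :: "((int ^ 'n \<Rightarrow> 'r, int ^ 'n) Hd_letter, 'r) presentation" where
  "Hd \<equiv> Hd_pres t p \<phi>"

abbreviation dsym :: "(int ^ 'n \<Rightarrow> 'r) \<Rightarrow> ((int ^ 'n \<Rightarrow> 'r, int ^ 'n) Hd_letter list \<Rightarrow>\<^sub>0 'r)" where
  "dsym \<psi> \<equiv> gen (DSym \<psi>)"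

abbreviation dd :: "int ^ 'n \<Rightarrow> int ^ 'n \<Rightarrow> ((int ^ 'n \<Rightarrow> 'r, int ^ 'n) Hd_letter list \<Rightarrow>\<^sub>0 'r)" where
  "dd x u \<equiv> gen (DD x u)"

definition weight :: "'n \<Rightarrow> int ^ 'n \<Rightarrow> 'r" where
  "weight i v = (if v \<in> t then of_int (v $ i) else 0)"

lemma Hd_simps [simp]:
  "central Hd = DSym ` lattice_dual t"
  "gens Hd = DIdem ` L \<union> {DD x u | x u. x \<in> L \<and> u \<in> L \<and> l1_dist x u = 1}"
  "deg Hd (DSym s) = 2" "deg Hd (DIdem x) = 0" "deg Hd (DD x y) = 1"
  by (simp_all add: Hd_pres_def Let_def)

lemma weight_fun: "weight i = (\<lambda>v. if v \<in> t then of_int (v $ i) else 0)"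
  by (auto simp: weight_def)

lemma alpha_iff:
  assumes "x \<in> L"
  shows "{x + axis i 1, x - axis i 1} \<inter> L = {y. (adj x y \<and> adj y x) \<and> dir x y = i}"
proof -
  have m: "x - axis i 1 = x + axis i (- 1)" by (simp add: vec_eq_iff)
  show ?thesis
  proof (intro set_eqI iffI)
    fix y assume "y \<in> {x + axis i 1, x - axis i 1} \<inter> L"
    then obtain \<sigma> where "\<sigma> = 1 \<or> \<sigma> = - 1" "y = x + axis i \<sigma>" "y \<in> L" unfolding m by blast
    then show "y \<in> {y. (adj x y \<and> adj y x) \<and> dir x y = i}"
      using adjI[OF assms, of i \<sigma>] adj_sym dir_step(1)[of \<sigma> x i] by auto
  next
    fix y assume "y \<in> {y. (adj x y \<and> adj y x) \<and> dir x y = i}"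
    then have y: "adj x y" "dir x y = i" by auto
    obtain k \<sigma> where "\<sigma> = 1 \<or> \<sigma> = - 1" "y = x + axis k \<sigma>" "dir x y = k" "y \<in> L" using y(1) by (rule adjE)
    then show "y \<in> {x + axis i 1, x - axis i 1} \<inter> L" unfolding m using y(2) by auto
  qed
qed

lemma rels_Hd_cases:
  assumes "s \<in> rels Hd"
  obtains (add) \<psi>1 \<psi>2 where "s = dsym (\<lambda>v. \<psi>1 v + \<psi>2 v) - dsym \<psi>1 - dsym \<psi>2" "\<psi>1 \<in> lattice_dual t" "\<psi>2 \<in> lattice_dual t"
    | (scal) r \<psi> where "s = dsym (\<lambda>v. r * \<psi> v) - scal r * dsym \<psi>" "\<psi> \<in> lattice_dual t"
    | (idem) x y where "s = gen (DIdem x) * gen (DIdem y) - (if x = y then gen (DIdem x) else 0)" "x \<in> L" "y \<in> L"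
    | (left) x u where "s = gen (DIdem x) * dd x u - dd x u" "adj x u"
    | (right) x u where "s = dd x u * gen (DIdem u) - dd x u" "adj x u"
    | (loop) i x where "s = (\<Sum>u\<in>{x + axis i 1, x - axis i 1} \<inter> L. dd x u * dd u x) - dsym (weight i) * gen (DIdem x)" "x \<in> L"
    | (square) x u y1 y2 where "s = dd x y1 * dd y1 u + dd x y2 * dd y2 u" "x \<noteq> u" "adj x y1" "adj y1 u" "adj x y2" "adj y2 u" "y1 \<noteq> y2"
    | (path) x y u where "s = dd x y * dd y u" "x \<in> L" "u \<in> L" "l1_dist x u = 2" "{z \<in> L. l1_dist x z = 1 \<and> l1_dist z u = 1} = {y}"
proof -
  have sq: thesis if st: "s \<in> {dd xij xi * dd xi x + dd xij xj * dd xj x, dd x xj * dd xj xij + dd x xi * dd xi xij,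
      dd xi xij * dd xij xj + dd xi x * dd x xj, dd xj xij * dd xij xi + dd xj x * dd x xi}"
    "i \<noteq> j" "xi = x + axis i 1" "xj = x + axis j 1" "xij = x + axis i 1 + axis j 1" "{x, xi, xj, xij} \<subseteq> L"
    for x xi xj xij i j
  proof -
    \<comment> \<open>The four relations of a square are one relation read at its four pairs of opposite
      corners.\<close>
    have xij': "xij = xj + axis i 1" using that by (simp add: add_ac)
    have a: "adj x xi" "adj x xj" "adj xi xij" "adj xj xij"
      using st(6) adjI[of x i 1] adjI[of x j 1] adjI[of xi j 1] adjI[of xj i 1, folded xij'] st(3-5)
      by simp_all
    then have a': "adj xi x" "adj xj x" "adj xij xi" "adj xij xj" using adj_sym by blast+
    have ne: "xi \<noteq> xj" "x \<noteq> xij"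
      using st(2) unfolding st(3-5) vec_eq_iff by (auto intro!: exI[of _ i])
    from st(1) show thesis
      using square[of xij xi x xj] square[of x xj xij xi] square[of xi xij xj x] square[of xj xij xi x] a a' ne
      by auto
  qed
  show thesis
    using assms unfolding Hd_pres_def Let_def presentation.simps weight_fun[symmetric]
    apply (elim UnE)
    subgoal using add by blast
    subgoal using scal by blast
    subgoal using idem by blast
    subgoal using left unfolding adj_def by blast
    subgoal using right unfolding adj_def by blast
    subgoal using loop by blast
    subgoal
      apply (elim UnionE CollectE exE conjE)
      subgoal premises prems by (rule sq[OF prems(1)[unfolded prems(2)] prems(3-)])
      done
    subgoal using path by blast
    done
qed

lemma rels_Hd:
  "\<psi>1 \<in> lattice_dual t \<Longrightarrow> \<psi>2 \<in> lattice_dual t \<Longrightarrow> dsym (\<lambda>v. \<psi>1 v + \<psi>2 v) - dsym \<psi>1 - dsym \<psi>2 \<in> rels Hd"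
  "\<psi> \<in> lattice_dual t \<Longrightarrow> dsym (\<lambda>v. r * \<psi> v) - scal r * dsym \<psi> \<in> rels Hd"
  "x \<in> L \<Longrightarrow> y \<in> L \<Longrightarrow> gen (DIdem x) * gen (DIdem y) - (if x = y then gen (DIdem x) else 0) \<in> rels Hd"
  "adj x u \<Longrightarrow> gen (DIdem x) * dd x u - dd x u \<in> rels Hd"
  "adj x u \<Longrightarrow> dd x u * gen (DIdem u) - dd x u \<in> rels Hd"
  "x \<in> L \<Longrightarrow> (\<Sum>u\<in>{x + axis i 1, x - axis i 1} \<inter> L. dd x u * dd u x) - dsym (weight i) * gen (DIdem x) \<in> rels Hd"
  "x \<in> L \<Longrightarrow> u \<in> L \<Longrightarrow> l1_dist x u = 2 \<Longrightarrow> {z \<in> L. l1_dist x z = 1 \<and> l1_dist z u = 1} = {y} \<Longrightarrow> dd x y * dd y u \<in> rels Hd"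
  unfolding Hd_pres_def Let_def presentation.simps weight_fun adj_def by blast+

lemma rels_Hd_square:
  assumes "i \<noteq> j" "xi = x + axis i 1" "xj = x + axis j 1" "xij = x + axis i 1 + axis j 1" "{x, xi, xj, xij} \<subseteq> L"
  shows "dd xij xi * dd xi x + dd xij xj * dd xj x \<in> rels Hd" "dd x xj * dd xj xij + dd x xi * dd xi xij \<in> rels Hd"
    "dd xi xij * dd xij xj + dd xi x * dd x xj \<in> rels Hd" "dd xj xij * dd xij xi + dd xj x * dd x xi \<in> rels Hd"
proof -
  have "{dd xij xi * dd xi x + dd xij xj * dd xj x, dd x xj * dd xj xij + dd x xi * dd xi xij,
      dd xi xij * dd xij xj + dd xi x * dd x xj, dd xj xij * dd xij xi + dd xj x * dd x xi} \<subseteq> rels Hd"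
    unfolding Hd_pres_def Let_def presentation.simps
    by (rule le_supI1, rule le_supI2, rule Union_upper) (use assms in blast)
  then show "dd xij xi * dd xi x + dd xij xj * dd xj x \<in> rels Hd" "dd x xj * dd xj xij + dd x xi * dd xi xij \<in> rels Hd"
    "dd xi xij * dd xij xj + dd xi x * dd x xj \<in> rels Hd" "dd xj xij * dd xij xi + dd xj x * dd x xi \<in> rels Hd"
    by simp_all
qed

lemma rels_Hd_cgr: "f - g \<in> rels Hd \<Longrightarrow> f \<simeq>[full_rels Hd] g"
  by (rule cgr_base) (simp add: full_rels_def)

lemmas dsym_scal = rels_Hd_cgr[OF rels_Hd(2)]
  and Hd_idem = rels_Hd_cgr[OF rels_Hd(3)]
  and dd_left = rels_Hd_cgr[OF rels_Hd(4)]
  and dd_right = rels_Hd_cgr[OF rels_Hd(5)]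
  and dd_loop = rels_Hd_cgr[OF rels_Hd(6)]

lemma dsym_add: "\<psi>1 \<in> lattice_dual t \<Longrightarrow> \<psi>2 \<in> lattice_dual t \<Longrightarrow>
    dsym (\<lambda>v. \<psi>1 v + \<psi>2 v) \<simeq>[full_rels Hd] dsym \<psi>1 + dsym \<psi>2"
  using rels_Hd(1)[of \<psi>1 \<psi>2] by (intro rels_Hd_cgr) (simp add: diff_diff_eq)

lemma weight_dual: "weight i \<in> lattice_dual t"
  using subtorus_closed(2)[OF subtorus] by (auto simp: lattice_dual_def weight_def)

lemma scaled_dual: "\<psi> \<in> lattice_dual t \<Longrightarrow> (\<lambda>v. r * \<psi> v) \<in> lattice_dual t"
  by (auto simp: lattice_dual_def distrib_left)

lemma zero_dual: "(\<lambda>v. 0) \<in> lattice_dual t"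
  by (simp add: lattice_dual_def)

lemma sum_dual: "(\<And>i. i \<in> X \<Longrightarrow> f i \<in> lattice_dual t) \<Longrightarrow> (\<lambda>v. \<Sum>i\<in>X. f i v) \<in> lattice_dual t"
  by (auto simp: lattice_dual_def sum.distrib)

lemma dsym_zero: "dsym (\<lambda>v. 0) \<simeq>[full_rels Hd] 0"
  using dsym_scal[OF zero_dual, of 0] by simp

lemma dsym_sum: "(\<And>i. i \<in> X \<Longrightarrow> f i \<in> lattice_dual t) \<Longrightarrow>
    dsym (\<lambda>v. \<Sum>i\<in>X. f i v) \<simeq>[full_rels Hd] (\<Sum>i\<in>X. dsym (f i))"
proof (induction X rule: infinite_finite_induct)
  case (insert i X)
  have "dsym (\<lambda>v. f i v + (\<Sum>i\<in>X. f i v)) \<simeq>[full_rels Hd] dsym (f i) + dsym (\<lambda>v. \<Sum>i\<in>X. f i v)"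
    using insert by (intro dsym_add sum_dual) auto
  also have "\<dots> \<simeq>[full_rels Hd] dsym (f i) + (\<Sum>i\<in>X. dsym (f i))"
    using insert by (intro cgr_add cgr_refl) auto
  finally show ?case using insert by simp
qed (simp_all add: dsym_zero)

lemma dd_square:
  assumes "x \<noteq> u" "adj x y1" "adj y1 u" "adj x y2" "adj y2 u" "y1 \<noteq> y2"
  shows "dd x y1 * dd y1 u + dd x y2 * dd y2 u \<simeq>[full_rels Hd] 0"
proof -
  have L: "x \<in> L" "y1 \<in> L" "y2 \<in> L" "u \<in> L" using assms by (auto simp: adj_def)
  obtain i j \<sigma> \<tau> where c: "i \<noteq> j" "\<sigma> = 1 \<or> \<sigma> = - 1" "\<tau> = 1 \<or> \<tau> = - 1"
    "y1 = x + axis i \<sigma>" "y2 = x + axis j \<tau>" "u = x + axis i \<sigma> + axis j \<tau>"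
    by (rule square_corners[OF assms])
  have "dd x y1 * dd y1 u + dd x y2 * dd y2 u \<in> rels Hd"
  proof -
    consider "\<sigma> = 1" "\<tau> = 1" | "\<sigma> = - 1" "\<tau> = - 1" | "\<sigma> = - 1" "\<tau> = 1" | "\<sigma> = 1" "\<tau> = - 1"
      using c(2,3) by blast
    then show ?thesis
    proof cases
      case 1
      then show ?thesis using rels_Hd_square(2)[of i j y1 x y2 u] c L by (simp add: add.commute)
    next
      case 2
      have "y2 = u + axis i 1" "y1 = u + axis j 1" "x = u + axis i 1 + axis j 1"
        unfolding c(4-6) 2 by (auto simp: vec_eq_iff)
      then show ?thesis using rels_Hd_square(1)[of i j y2 u y1 x] c(1) L by (simp add: add.commute)
    next
      case 3
      have "x = y1 + axis i 1" "u = y1 + axis j 1" "y2 = y1 + axis i 1 + axis j 1"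
        unfolding c(4-6) 3 by (auto simp: vec_eq_iff)
      then show ?thesis using rels_Hd_square(3)[of i j x y1 u y2] c(1) L by (simp add: add.commute)
    next
      case 4
      have "u = y2 + axis i 1" "x = y2 + axis j 1" "y1 = y2 + axis i 1 + axis j 1"
        unfolding c(4-6) 4 by (auto simp: vec_eq_iff)
      then show ?thesis using rels_Hd_square(4)[of i j u y2 x y1] c(1) L by simp
    qed
  qed
  then show ?thesis by (intro rels_Hd_cgr) simp
qed

lemma dd_path:
  assumes "x \<noteq> u" "{y. adj x y \<and> adj y u} = {y}"
  shows "dd x y * dd y u \<simeq>[full_rels Hd] 0"
proof -
  have y: "adj x y" "adj y u" using assms(2) by blast+
  then have L: "x \<in> L" "u \<in> L" by (auto simp: adj_def)
  have "{z \<in> L. l1_dist x z = 1 \<and> l1_dist z u = 1} = {y. adj x y \<and> adj y u}" using L by (auto simp: adj_def)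
  then show ?thesis
    using rels_Hd(7)[OF L common_neighbours(1)[OF assms(1) y]] assms(2) by (intro rels_Hd_cgr) simp
qed

subsection \<open>Modules concentrated in three levels\<close>

text \<open>A linear relation \<open>r\<close> between paths from \<open>u0\<close> to \<open>x0\<close> in the first algebra defines a module
  of the dual algebra: a generator at \<open>u0\<close> in level \<open>0\<close>, a basis vector for each vertex in level
  \<open>1\<close> and one at \<open>x0\<close> in level \<open>2\<close>, with the arrow from \<open>y\<close> to \<open>x0\<close> acting by \<open>r y\<close> between the
  last two. An element of \<open>t\<^sup>*\<close> is evaluated on the vector in \<open>t\<close> that \<open>r\<close> represents.\<close>

definition on_levels :: "int ^ 'n \<Rightarrow> int ^ 'n \<Rightarrow> (int ^ 'n \<Rightarrow> 'r) \<Rightarrow> (int ^ 'n \<Rightarrow> 'r, int ^ 'n) Hd_letter \<Rightarrow>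
    (nat \<times> (int ^ 'n) \<Rightarrow> 'r) \<Rightarrow> (nat \<times> (int ^ 'n) \<Rightarrow> 'r)" where
  "on_levels x0 u0 r l f = (\<lambda>(n, a). case l of
      DSym \<psi> \<Rightarrow> if n = 2 \<and> a = x0 \<and> x0 = u0 then (\<Sum>k\<in>UNIV. loop_vec x0 r $ k * \<psi> (proj.tvec k)) * f (0, u0) else 0
    | DIdem x \<Rightarrow> if a = x then f (n, a) else 0
    | DD y u \<Rightarrow> if n = 1 \<and> a = y \<and> u = u0 then f (0, u0)
        else if n = 2 \<and> a = x0 \<and> y = x0 then r u * f (1, u) else 0)"

lemma on_levels_simps:
  "on_levels x0 u0 r (DSym \<psi>) f = (\<lambda>(n, a). if n = 2 \<and> a = x0 \<and> x0 = u0
    then (\<Sum>k\<in>UNIV. loop_vec x0 r $ k * \<psi> (proj.tvec k)) * f (0, u0) else 0)"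
  "on_levels x0 u0 r (DIdem x) f = (\<lambda>(n, a). if a = x then f (n, a) else 0)"
  "on_levels x0 u0 r (DD y u) f = (\<lambda>(n, a). if n = 1 \<and> a = y \<and> u = u0 then f (0, u0)
        else if n = 2 \<and> a = x0 \<and> y = x0 then r u * f (1, u) else 0)"
  by (simp_all add: on_levels_def)

sublocale levels: free_module "\<lambda>s f a. s * f a" "on_levels x0 u0 r" for x0 u0 r
  by unfold_locales
    (auto simp: on_levels_def fun_eq_iff algebra_simps split: Hd_letter.split)

abbreviation level_act :: "int ^ 'n \<Rightarrow> int ^ 'n \<Rightarrow> (int ^ 'n \<Rightarrow> 'r) \<Rightarrow>
    ((int ^ 'n \<Rightarrow> 'r, int ^ 'n) Hd_letter list \<Rightarrow>\<^sub>0 'r) \<Rightarrow> (nat \<times> (int ^ 'n) \<Rightarrow> 'r) \<Rightarrow> (nat \<times> (int ^ 'n) \<Rightarrow> 'r)" where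
  "level_act x0 u0 r \<equiv> act (\<lambda>s f a. s * f a) (on_levels x0 u0 r)"

lemma level_act_dd2:
  "level_act x0 u0 r (dd x y * dd y u) f =
    (\<lambda>(n, a). if n = 2 \<and> a = x0 \<and> x = x0 \<and> u = u0 then r y * f (0, u0) else 0)"
  by (auto simp: levels.act_mult on_levels_simps fun_eq_iff)

lemma sum_if: "(\<Sum>u\<in>A. if b then h u * z else 0) = (if b then sum h A * z else (0 :: 'b :: semiring_0))"
  by (cases b) (simp_all add: sum_distrib_right)

lemma level_act_rels:
  assumes r: "x0 \<noteq> u0 \<Longrightarrow> (\<Sum>y | adj x0 y \<and> adj y u0. r y) = 0"
    "x0 = u0 \<Longrightarrow> loop_vec x0 r \<in> base_change t"
    and s: "s \<in> full_rels Hd"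
  shows "level_act x0 u0 r s f = 0"
proof -
  note expand = levels.act_diff levels.act_add levels.act_mult levels.act_gen
    levels.act_scal levels.act_0 on_levels_simps fun_eq_iff
  from s consider "s \<in> rels Hd" | z g where "s = gen z * gen g - gen g * gen z" "z \<in> central Hd" "g \<in> central Hd \<union> gens Hd"
    unfolding full_rels_def by blast
  then show ?thesis
  proof cases
    case 1
    then show ?thesis
    proof (cases rule: rels_Hd_cases)
      case (add \<psi>1 \<psi>2)
      show ?thesis unfolding add(1) by (auto simp: expand distrib_left distrib_right sum.distrib)
    next
      case (scal a \<psi>)
      show ?thesis unfolding scal(1) by (auto simp: expand sum_distrib_left mult_ac)
    next
      case (loop i x)
      have w: "(\<Sum>k\<in>UNIV. loop_vec x0 r $ k * weight i (proj.tvec k)) = loop_vec x0 r $ i" if "x0 = u0"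
      proof -
        have "loop_vec x0 r $ i = (\<Sum>j\<in>UNIV. loop_vec x0 r $ j *s cast (proj.tvec j)) $ i"
          using proj.base_change_expand[OF r(2)[OF that]] by simp
        then show ?thesis by (simp add: weight_def proj.tvec_t)
      qed
      have "level_act x0 u0 r (\<Sum>u\<in>{x + axis i 1, x - axis i 1} \<inter> L. dd x u * dd u x) f =
        (\<lambda>(n, a). if n = 2 \<and> a = x0 \<and> x = x0 \<and> x = u0 then loop_vec x0 r $ i * f (0, u0) else 0)"
      proof -
        have "loop_vec x r $ i = (\<Sum>u\<in>{x + axis i 1, x - axis i 1} \<inter> L. r u)"
          unfolding alpha_iff[OF loop(2)] loop_vec_nth
          using finite_common[of x x] by (subst sum.inter_filter[symmetric]) auto
        note lv = this
        show ?thesis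
        proof (rule ext, clarify)
          fix n :: nat and a
          let ?c = "n = 2 \<and> a = x0 \<and> x = x0 \<and> x = u0"
          have "level_act x0 u0 r (\<Sum>u\<in>{x + axis i 1, x - axis i 1} \<inter> L. dd x u * dd u x) f (n, a)
            = (\<Sum>u\<in>{x + axis i 1, x - axis i 1} \<inter> L. if ?c then r u * f (0, u0) else 0)"
            by (simp only: levels.act_sum level_act_dd2 fun_sum_apply prod.case)
          also have "\<dots> = (if ?c then (\<Sum>u\<in>{x + axis i 1, x - axis i 1} \<inter> L. r u) * f (0, u0) else 0)"
            by (rule sum_if)
          also have "\<dots> = (if ?c then loop_vec x0 r $ i * f (0, u0) else 0)"
          proof (rule if_cong[OF refl _ refl])
            assume ?c
            then have "x = x0" by blast
            then show "(\<Sum>u\<in>{x + axis i 1, x - axis i 1} \<inter> L. r u) * f (0, u0) = loop_vec x0 r $ i * f (0, u0)"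
              using lv by (simp only:)
          qed
          finally show "level_act x0 u0 r (\<Sum>u\<in>{x + axis i 1, x - axis i 1} \<inter> L. dd x u * dd u x) f (n, a)
            = (if ?c then loop_vec x0 r $ i * f (0, u0) else 0)" .
        qed
      qed
      then show ?thesis unfolding loop(1) using w by (auto simp: expand)
    next
      case (square x u y1 y2)
      have "r y1 + r y2 = 0" if "x = x0" "u = u0"
        using r(1) square(2) common_two[OF square(2-)] square(7) unfolding that by simp
      then have "r y1 * a + r y2 * a = 0" if "x = x0" "u = u0" for a
        using that by (metis distrib_right mult_zero_left)
      then show ?thesis unfolding square(1) by (auto simp: levels.act_add level_act_dd2 fun_eq_iff)
    next
      case (path x y u)
      have "{z \<in> L. l1_dist x z = 1 \<and> l1_dist z u = 1} = {y. adj x y \<and> adj y u}" using path by (auto simp: adj_def)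
      moreover have "x \<noteq> u" using path(4) by auto
      ultimately have "r y = 0" if "x = x0" "u = u0"
        using r(1) path(5) unfolding that by simp
      then show ?thesis unfolding path(1) by (auto simp: level_act_dd2 fun_eq_iff)
    qed (auto simp: expand)
  next
    case 2
    then obtain \<psi> where v: "z = DSym \<psi>" by auto
    from 2(3) show ?thesis unfolding 2(1) v by (auto simp: expand)
  qed
qed

lemma level_act_ideal: 
  assumes "x0 \<noteq> u0 \<Longrightarrow> (\<Sum>y | adj x0 y \<and> adj y u0. r y) = 0" "x0 = u0 \<Longrightarrow> loop_vec x0 r \<in> base_change t"
    and "f \<in> ideal (full_rels Hd)"
  shows "level_act x0 u0 r f v = 0"
  by (rule levels.act_ideal[OF level_act_rels assms(3)]) (use assms in auto)

definition Hd_coef :: "int ^ 'n \<Rightarrow> int ^ 'n \<Rightarrow> ((int ^ 'n \<Rightarrow> 'r, int ^ 'n) Hd_letter list \<Rightarrow>\<^sub>0 'r) \<Rightarrow> 'r" where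
  "Hd_coef x y f = level_act y y (\<lambda>_. 0) f (\<lambda>q. if q = (0, y) then 1 else 0) (if x = y then 0 else 1, x)"

lemma rels_Hd_free: "rels Hd \<subseteq> free_on (central Hd \<union> gens Hd)"
proof
  fix s assume "s \<in> rels Hd"
  have dual_add: "(\<lambda>v. \<psi>1 v + \<psi>2 v) \<in> lattice_dual t" if "\<psi>1 \<in> lattice_dual t" "\<psi>2 \<in> lattice_dual t" for \<psi>1 \<psi>2 :: "int ^ 'n \<Rightarrow> 'r"
    using that by (auto simp: lattice_dual_def algebra_simps)
  have arrow: "dd x y \<in> free_on (central Hd \<union> gens Hd)" if "adj x y" for x y
    using that by (simp add: adj_def)
  from \<open>s \<in> rels Hd\<close> show "s \<in> free_on (central Hd \<union> gens Hd)"
  proof (cases rule: rels_Hd_cases)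
    case (add \<psi>1 \<psi>2)
    show ?thesis unfolding add(1) by (intro free_on_intros) (use add dual_add[OF add(2,3)] in auto)
  next
    case (scal r \<psi>)
    show ?thesis unfolding scal(1) by (intro free_on_intros free_on_simps(3)) (use scal scaled_dual in auto)
  next
    case (idem x y)
    then show ?thesis by (cases "x = y") (auto intro!: free_on_intros)
  next
    case (left x u)
    show ?thesis unfolding left(1) by (intro free_on_intros arrow left) (use left in \<open>simp add: adj_def\<close>)
  next
    case (right x u)
    show ?thesis unfolding right(1) by (intro free_on_intros arrow right) (use right in \<open>simp add: adj_def\<close>)
  next
    case (loop i x)
    show ?thesis unfolding loop(1) alpha_iff[OF loop(2)]
      by (intro free_on_intros arrow) (use loop weight_dual in auto)
  next
    case (square x u y1 y2)
    show ?thesis unfolding square(1) by (intro free_on_intros arrow square)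
  next
    case (path x y u)
    then have "y \<in> {z \<in> L. l1_dist x z = 1 \<and> l1_dist z u = 1}" by simp
    then show ?thesis unfolding path(1) using path(2,3) by (intro free_on_intros arrow) (auto simp: adj_def)
  qed
qed

sublocale Dq: quiver_pres Hd L DIdem adj DD Hd_coef
proof
  show "rels Hd \<subseteq> free_on (central Hd \<union> gens Hd)" by (rule rels_Hd_free)
  show "adj x y \<Longrightarrow> x \<in> L \<and> y \<in> L" for x y by (simp add: adj_def)
  show "finite {y. adj x y \<and> adj y u}" for x u by (rule finite_common)
  show "z \<in> central Hd \<Longrightarrow> deg Hd z \<ge> 2" for z by auto
  show "\<exists>x\<in>L. gen g \<simeq>[full_rels Hd] gen (DIdem x)" if g0: "g \<in> gens Hd" "deg Hd g = 0" for g
  proof -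
    obtain x where "g = DIdem x" "x \<in> L" using g0 by auto
    then show ?thesis using cgr_refl by blast
  qed
  show "\<exists>x y. adj x y \<and> gen g \<simeq>[full_rels Hd] dd x y" if g1: "g \<in> gens Hd" "deg Hd g = 1" for g
  proof -
    obtain x y where "g = DD x y" "adj x y" using g1 by (auto simp: adj_def)
    then show ?thesis using cgr_refl by blast
  qed
  show "x \<in> L \<Longrightarrow> DIdem x \<in> gens Hd \<and> deg Hd (DIdem x) = 0" for x by simp
  show "adj x y \<Longrightarrow> DD x y \<in> gens Hd \<and> deg Hd (DD x y) = 1" for x y by (simp add: adj_def)
  show "x \<in> L \<Longrightarrow> y \<in> L \<Longrightarrow>
      gen (DIdem x) * gen (DIdem y) \<simeq>[full_rels Hd] (if x = y then gen (DIdem x) else 0)" for x y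
    by (rule Hd_idem)
  show "adj x y \<Longrightarrow> gen (DIdem x) * dd x y \<simeq>[full_rels Hd] dd x y" for x y
    by (rule dd_left)
  show "adj x y \<Longrightarrow> dd x y * gen (DIdem y) \<simeq>[full_rels Hd] dd x y" for x y
    by (rule dd_right)
  show "Hd_coef x y (f + g) = Hd_coef x y f + Hd_coef x y g" for x y f g
    by (simp add: Hd_coef_def levels.act_add)
  show "Hd_coef x y (scal r * f) = r * Hd_coef x y f" for x y r f
    by (simp add: Hd_coef_def levels.act_mult)
  have z: "loop_vec y (\<lambda>_. 0) \<in> base_change t" for y
    by (simp add: loop_vec_def base_change_intros)
  show "f \<in> ideal (full_rels Hd) \<Longrightarrow> Hd_coef x y f = 0" for x y f
    using level_act_ideal[of y y "\<lambda>_. 0" f] z by (simp add: Hd_coef_def)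
  show "Hd_coef x x (gen (DIdem y)) = (if x = y then 1 else 0)" for x y
    by (simp add: Hd_coef_def on_levels_simps)
  show "Hd_coef x y (dd x' y') = (if x = x' \<and> y = y' then 1 else 0)" if "adj x y" "adj x' y'" for x y x' y'
    using that by (auto simp: Hd_coef_def on_levels_simps adj_def)
qed

subsection \<open>The quadratic relations are orthogonal complements\<close>

lemma Hd_loops:
  assumes "x \<in> L"
  shows "(\<Sum>y\<in>Dq.M x x. scal (g (dir x y)) * (dd x y * dd y x))
    \<simeq>[full_rels Hd] dsym (\<lambda>v. \<Sum>j\<in>UNIV. g j * weight j v) * gen (DIdem x)"
proof -
  have "(\<Sum>y\<in>Dq.M x x. scal (g (dir x y)) * (dd x y * dd y x))
     = (\<Sum>j\<in>UNIV. \<Sum>y | y \<in> Dq.M x x \<and> dir x y = j. scal (g (dir x y)) * (dd x y * dd y x))"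
    using finite_common[of x x] by (intro sum.group[symmetric]) auto
  also have "\<dots> = (\<Sum>j\<in>UNIV. scal (g j) * (\<Sum>y\<in>{x + axis j 1, x - axis j 1} \<inter> L. dd x y * dd y x))"
    unfolding alpha_iff[OF assms] sum_distrib_left by (intro sum.cong) auto
  also have "\<dots> \<simeq>[full_rels Hd] (\<Sum>j\<in>UNIV. scal (g j) * (dsym (weight j) * gen (DIdem x)))"
    by (intro cgr_sum cgr_left dd_loop assms)
  also have "\<dots> = (\<Sum>j\<in>UNIV. scal (g j) * dsym (weight j)) * gen (DIdem x)"
    by (simp add: sum_distrib_right mult.assoc)
  also have "\<dots> \<simeq>[full_rels Hd] (\<Sum>j\<in>UNIV. dsym (\<lambda>v. g j * weight j v)) * gen (DIdem x)"
    by (intro cgr_right cgr_sum, rule cgr_sym, rule dsym_scal, rule weight_dual)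
  also have "\<dots> \<simeq>[full_rels Hd] dsym (\<lambda>v. \<Sum>j\<in>UNIV. g j * weight j v) * gen (DIdem x)"
    by (intro cgr_right, rule cgr_sym, rule dsym_sum, intro scaled_dual weight_dual)
  finally show ?thesis .
qed

text \<open>A covector vanishing on \<open>t\<close> is a relation between the weights \<open>t\<^sub>i\<close>.\<close>

lemma Hd_W_loopI:
  assumes "x \<in> L" "\<And>v. v \<in> t \<Longrightarrow> (\<Sum>j\<in>UNIV. g j * of_int (v $ j)) = 0" "\<And>y. adj x y \<Longrightarrow> k y = g (dir x y)"
  shows "k \<in> Dq.W x x"
proof -
  have "(\<lambda>v. \<Sum>j\<in>UNIV. g j * weight j v) = (\<lambda>v. 0)"
  proof
    fix v show "(\<Sum>j\<in>UNIV. g j * weight j v) = 0"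
      by (cases "v \<in> t") (use assms(2)[of v] in \<open>simp_all add: weight_def\<close>)
  qed
  then have "(\<Sum>y\<in>Dq.M x x. scal (g (dir x y)) * (dd x y * dd y x)) \<simeq>[full_rels Hd] dsym (\<lambda>v. 0) * gen (DIdem x)"
    using Hd_loops[OF assms(1), of g] by simp
  also have "\<dots> \<simeq>[full_rels Hd] 0 * gen (DIdem x)" by (intro cgr_right dsym_zero)
  finally have "(\<Sum>y\<in>Dq.M x x. scal (g (dir x y)) * (dd x y * dd y x)) \<in> ideal (full_rels Hd)"
    by (simp add: cgr_0)
  also have "(\<Sum>y\<in>Dq.M x x. scal (g (dir x y)) * (dd x y * dd y x)) = (\<Sum>y\<in>Dq.M x x. scal (k y) * (dd x y * dd y x))"
    using assms(3) by (intro sum.cong) auto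
  finally show ?thesis by (simp add: Dq.W_def)
qed

lemma Hd_W_pathI:
  assumes "x \<noteq> u" "\<And>y z. adj x y \<Longrightarrow> adj y u \<Longrightarrow> adj x z \<Longrightarrow> adj z u \<Longrightarrow> k y = k z"
  shows "k \<in> Dq.W x u"
proof (cases "Dq.M x u = {}")
  case True
  show ?thesis unfolding Dq.W_def True by (simp add: gen_ideal.zero)
next
  case False
  then obtain y where y: "adj x y" "adj y u" by blast
  show ?thesis
  proof (cases "Dq.M x u = {y}")
    case True
    have "scal (k y) * (dd x y * dd y u) \<simeq>[full_rels Hd] scal (k y) * 0"
      by (intro cgr_left dd_path assms True)
    then show ?thesis unfolding Dq.W_def True by (simp add: cgr_0)
  next
    case False
    then obtain z where z: "adj x z" "adj z u" "y \<noteq> z" using y by blast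
    have "Dq.M x u = {y, z}" by (rule common_two[OF assms(1) y z])
    moreover have "scal (k y) * (dd x y * dd y u + dd x z * dd z u) \<simeq>[full_rels Hd] scal (k y) * 0"
      by (intro cgr_left dd_square assms y z)
    moreover have "k z = k y" using assms(2) y z by blast
    ultimately show ?thesis using z(3) unfolding Dq.W_def by (simp add: cgr_0 distrib_left)
  qed
qed

text \<open>Apply a relation of the dual algebra to the generator of the module defined by \<open>k\<close>.\<close>

lemma W_orthogonal:
  assumes "x \<in> L" "u \<in> L" "k \<in> Hq.W x u" "k' \<in> Dq.W x u"
  shows "(\<Sum>y | adj x y \<and> adj y u. k y * k' y) = 0"
proof -
  have k: "x \<noteq> u \<Longrightarrow> (\<Sum>y | adj x y \<and> adj y u. k y) = 0" "x = u \<Longrightarrow> loop_vec x k \<in> base_change t"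
    using assms H_W_distinct H_W_loop by auto
  let ?f = "\<Sum>y\<in>Dq.M x u. scal (k' y) * (dd x y * dd y u)"
  let ?v = "\<lambda>q. if q = (0, u) then 1 else (0 :: 'r)"
  have "level_act x u k ?f ?v (2, x) = (\<Sum>y\<in>Dq.M x u. k' y * k y)"
    by (simp add: levels.act_sum levels.act_mult[of _ _ _ "scal _"] level_act_dd2 fun_sum_apply)
  moreover have "level_act x u k ?f ?v = 0"
    using assms(4) by (intro level_act_ideal k) (auto simp: Dq.W_def)
  ultimately show ?thesis by (simp add: mult.commute)
qed

text \<open>The first algebra has many relations between loops, since any two combinations that
  represent the same vector differ by one. Orthogonality to them forces the coefficients to come
  from a covector, and the covector then vanishes on \<open>t\<close>.\<close>

lemma Hd_W_complete:
  assumes x: "x \<in> L" "u \<in> L" and orth: "\<And>k. k \<in> Hq.W x u \<Longrightarrow> (\<Sum>y | adj x y \<and> adj y u. k y * k' y) = 0"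
  shows "k' \<in> Dq.W x u"
proof (cases "x = u")
  case False
  show ?thesis
  proof (rule Hd_W_pathI[OF False])
    fix y z assume yz: "adj x y" "adj y u" "adj x z" "adj z u"
    have e: "(\<Sum>w | adj x w \<and> adj w u. (if w = a then 1 else 0) * h w) = h a" if "adj x a" "adj a u" for a and h :: "int ^ 'n \<Rightarrow> 'r"
    proof -
      have "(\<Sum>w | adj x w \<and> adj w u. (if w = a then 1 else 0) * h w) = (\<Sum>w | adj x w \<and> adj w u. if w = a then h w else 0)"
        by (rule sum.cong) auto
      then show ?thesis using that finite_common[of x u] by simp
    qed
    let ?k = "\<lambda>w. (if w = y then 1 else 0) - (if w = z then 1 else (0 :: 'r))"
    have "(\<Sum>w | adj x w \<and> adj w u. ?k w) = 0"
      using e[of y "\<lambda>_. 1"] e[of z "\<lambda>_. 1"] yz by (simp add: sum_subtractf)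
    then have "?k \<in> Hq.W x u" using H_W_distinct[OF x False] by simp
    from orth[OF this] show "k' y = k' z"
      using e[of y k'] e[of z k'] yz by (simp add: left_diff_distrib sum_subtractf)
  qed
next
  case True
  let ?M = "{y. adj x y \<and> adj y x}"
  define \<rho> where "\<rho> = (\<lambda>j. loop_coef (axis j 1) x)"
  \<comment> \<open>The covector: pair \<open>k'\<close> with loops at \<open>x\<close> that represent the coordinate vectors.\<close>
  define g where "g = (\<lambda>j. \<Sum>y\<in>?M. \<rho> j y * k' y)"
  have \<rho>: "loop_vec x (\<rho> j) - axis j 1 \<in> base_change t" for j unfolding \<rho>_def by (rule loop_coef[OF x(1)])
  have orth': "(\<Sum>y\<in>?M. k y * k' y) = 0" if "loop_vec x k \<in> base_change t" for k
    using orth[of k] that H_W_loop[OF x(1), of k] True by simp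
  have "k' \<in> Dq.W x x"
  proof (rule Hd_W_loopI[OF x(1), of g])
    fix v assume v: "v \<in> t"
    let ?v = "cast v :: 'r ^ 'n"
    let ?k = "\<lambda>y. \<Sum>j\<in>UNIV. ?v $ j * \<rho> j y"
    have ax: "?v = (\<Sum>j\<in>UNIV. ?v $ j *s axis j 1)" by (rule basis_expansion[symmetric])
    have "loop_vec x ?k = (\<Sum>j\<in>UNIV. ?v $ j *s (loop_vec x (\<rho> j) - axis j 1)) + (\<Sum>j\<in>UNIV. ?v $ j *s axis j 1)"
      unfolding loop_vec_sum loop_vec_scale sum.distrib[symmetric] by (simp add: vec_eq_iff algebra_simps)
    also have "\<dots> = (\<Sum>j\<in>UNIV. ?v $ j *s (loop_vec x (\<rho> j) - axis j 1)) + ?v"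
      by (simp only: ax[symmetric])
    also have "\<dots> \<in> base_change t"
      by (intro base_change_intros(2) base_change_sum base_change_intros(4) \<rho> base_change_intros(5) v)
    finally have "(\<Sum>y\<in>?M. ?k y * k' y) = 0" by (rule orth')
    moreover have "(\<Sum>y\<in>?M. ?k y * k' y) = (\<Sum>y\<in>?M. \<Sum>j\<in>UNIV. g' j y)" if "g' = (\<lambda>j y. \<rho> j y * k' y * of_int (v $ j))" for g'
      unfolding that sum_distrib_right by (intro sum.cong) (auto simp: mult_ac)
    moreover have "(\<Sum>y\<in>?M. \<Sum>j\<in>UNIV. \<rho> j y * k' y * of_int (v $ j)) = (\<Sum>j\<in>UNIV. g j * of_int (v $ j))"
      unfolding g_def sum_distrib_right by (rule sum.swap)
    ultimately show "(\<Sum>j\<in>UNIV. g j * of_int (v $ j)) = 0" by metis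
  next
    fix y assume y: "adj x y"
    let ?k = "\<lambda>w. \<rho> (dir x y) w - (if w = y then 1 else 0)"
    have "loop_vec x ?k \<in> base_change t"
      unfolding loop_vec_diff loop_vec_single[OF y] by (rule \<rho>)
    then have "(\<Sum>w\<in>?M. ?k w * k' w) = 0" by (rule orth')
    moreover have "(\<Sum>w\<in>?M. (if w = y then 1 else 0) * k' w) = k' y"
    proof -
      have "(\<Sum>w\<in>?M. (if w = y then 1 else 0) * k' w) = (\<Sum>w\<in>?M. if w = y then k' w else 0)"
        by (rule sum.cong) auto
      then show ?thesis using y adj_sym[of x y] finite_common[of x x] by simp
    qed
    ultimately show "k' y = g (dir x y)" by (simp add: g_def left_diff_distrib sum_subtractf)
  qed
  then show ?thesis using True by simp
qed

text \<open>The constant family and the rows of the projection matrix are relations of the dual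
  algebra.\<close>

lemma H_W_complete:
  assumes x: "x \<in> L" "u \<in> L" and orth: "\<And>k'. k' \<in> Dq.W x u \<Longrightarrow> (\<Sum>y | adj x y \<and> adj y u. k y * k' y) = 0"
  shows "k \<in> Hq.W x u"
proof (cases "x = u")
  case False
  have "(\<lambda>_. 1) \<in> Dq.W x u" by (rule Hd_W_pathI[OF False]) simp
  from orth[OF this] show ?thesis using H_W_distinct[OF x False] by simp
next
  case True
  have "proj.prj (loop_vec x k) $ i = 0" for i
  proof -
    have "(\<lambda>y. of_int (mat i (dir x y))) \<in> Dq.W x x"
    proof (rule Hd_W_loopI[OF x(1), of "\<lambda>j. of_int (mat i j)"])
      fix v assume v: "v \<in> t"
      have "(\<Sum>j\<in>UNIV. of_int (mat i j) * of_int (v $ j)) = (of_int (\<Sum>j\<in>UNIV. mat i j * v $ j) :: 'r)" by simp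
      then show "(\<Sum>j\<in>UNIV. of_int (mat i j) * of_int (v $ j)) = (0 :: 'r)" by (simp only: proj.m_0[OF v] of_int_0)
    qed simp
    then have "0 = (\<Sum>y | adj x y \<and> adj y x. k y * of_int (mat i (dir x y)))" using orth True by simp
    also have "\<dots> = (\<Sum>y\<in>Hq.M x x. \<Sum>j\<in>UNIV. of_int (mat i j) * (if dir x y = j then k y else 0))"
      by (intro sum.cong) (auto simp: if_distrib[of "\<lambda>x. _ * x"] mult.commute cong: if_cong)
    also have "\<dots> = proj.prj (loop_vec x k) $ i"
      by (simp only: proj.prj_def vec_lambda_beta loop_vec_nth sum_distrib_left) (rule sum.swap)
    finally show ?thesis by simp
  qed
  then have "loop_vec x k \<in> base_change t" by (simp add: proj.base_change_iff vec_eq_iff)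
  then show ?thesis using H_W_loop[OF x(1)] True by simp
qed

sublocale dual: dual_quivers H L HIdem adj HC H_coef Hd DIdem DD Hd_coef
proof
  fix x u k assume xu: "x \<in> L" "u \<in> L"
  show "k \<in> Hq.W x u \<longleftrightarrow> (\<forall>k'\<in>Dq.W x u. (\<Sum>y | adj x y \<and> adj y u. k y * k' y) = 0)"
    using W_orthogonal[OF xu] H_W_complete[OF xu] by blast
next
  fix x u k' assume xu: "x \<in> L" "u \<in> L"
  show "k' \<in> Dq.W x u \<longleftrightarrow> (\<forall>k\<in>Hq.W x u. (\<Sum>y | adj x y \<and> adj y u. k y * k' y) = 0)"
    using W_orthogonal[OF xu] Hd_W_complete[OF xu] by blast
qed

end

subsection \<open>The dual algebra is quadratic\<close>

context chamber_ring
begin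

lemma tar_square:
  assumes "x \<noteq> u" "adj x y" "adj y u" "adj x z" "adj z u" "y \<noteq> z"
  shows "Dq.tar x y * Dq.tar y u \<simeq>[Dq.J] - (Dq.tar x z * Dq.tar z u)"
proof -
  have L: "x \<in> L" "u \<in> L" using assms by (auto simp: adj_def)
  have "(\<lambda>_. 1) \<in> Dq.W x u" by (rule Hd_W_pathI[OF assms(1)]) simp
  from Dq.J_quadratic[OF L this] show ?thesis
    unfolding common_two[OF assms] using assms(6) by (simp add: cgr_def)
qed

lemma tar_path:
  assumes "x \<noteq> u" "{y. adj x y \<and> adj y u} = {y}"
  shows "Dq.tar x y * Dq.tar y u \<simeq>[Dq.J] 0"
proof -
  have y: "adj x y" "adj y u" using assms(2) by blast+
  then have L: "x \<in> L" "u \<in> L" by (auto simp: adj_def)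
  have "(\<lambda>_. 1) \<in> Dq.W x u" by (rule Hd_W_pathI[OF assms(1)]) simp
  from Dq.J_quadratic[OF L this] show ?thesis
    unfolding assms(2) by (simp add: cgr_0)
qed

text \<open>\<open>z\<close> is a neighbour of \<open>x\<close> for which the square with the arrow from \<open>x\<close> to \<open>y\<close> as another
  side has all its corners among the chambers.\<close>

definition square_side :: "int ^ 'n \<Rightarrow> int ^ 'n \<Rightarrow> int ^ 'n \<Rightarrow> bool" where
  "square_side x y z \<longleftrightarrow> adj x z \<and> dir x z \<noteq> dir x y \<and> z + (y - x) \<in> L"

lemma square_side_opposite:
  assumes xy: "adj x y" and z: "square_side x y z"
  defines "w \<equiv> z + (y - x)"
  shows "square_side y x w" "dir y w = dir x z" "adj z w" "adj y w" "w + (x - y) = z" "x \<noteq> w" "z \<noteq> y"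
proof -
  have z': "adj x z" "dir x z \<noteq> dir x y" "w \<in> L" using z by (auto simp: square_side_def w_def)
  obtain k \<sigma> where k: "\<sigma> = 1 \<or> \<sigma> = - 1" "z = x + axis k \<sigma>" "dir x z = k" "z \<in> L" using z'(1) by (rule adjE)
  obtain l \<tau> where l: "\<tau> = 1 \<or> \<tau> = - 1" "y = x + axis l \<tau>" "dir x y = l" "y \<in> L" using xy by (rule adjE)
  have w: "w = y + axis k \<sigma>" "w = z + axis l \<tau>" unfolding w_def k(2) l(2) by simp_all
  have kl: "k \<noteq> l" using z'(2) k(3) l(3) by simp
  show yw: "adj y w" using adjI[of y k \<sigma>] l(4) z'(3) k(1) w(1) by simp
  show "adj z w" using adjI[of z l \<tau>] k(4) z'(3) l(1) w(2) by simp
  show d: "dir y w = dir x z" using k w(1) dir_step(1)[of \<sigma> y k] by auto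
  show b: "w + (x - y) = z" by (simp add: w_def)
  show "square_side y x w" unfolding square_side_def b d using yw z' k(4) by (simp add: dir_sym[of y x])
  show "z \<noteq> y" using z'(2) by auto
  have "w $ l \<noteq> x $ l" using l(1) kl unfolding w(1) l(2) by auto
  then show "x \<noteq> w" by auto
qed

text \<open>A second common neighbour would be the missing corner of the square.\<close>

lemma not_square_side:
  assumes xy: "adj x y" and z: "adj x z" "z \<noteq> y" "\<not> square_side x y z"
  shows "{a. adj z a \<and> adj a y} = {x}"
proof (rule ccontr)
  assume "{a. adj z a \<and> adj a y} \<noteq> {x}"
  moreover have zx: "adj z x" using z adj_sym by blast
  ultimately obtain a where a: "adj z a" "adj a y" "x \<noteq> a" using xy by blast
  obtain i j \<sigma> \<tau> where c: "i \<noteq> j" "\<sigma> = 1 \<or> \<sigma> = - 1" "\<tau> = 1 \<or> \<tau> = - 1"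
    "x = z + axis i \<sigma>" "a = z + axis j \<tau>" "y = z + axis i \<sigma> + axis j \<tau>"
    by (rule square_corners[OF z(2) zx xy a])
  have "y = x + axis j \<tau>" using c(4,6) by simp
  then have "dir x y = j" using c(3) dir_step(1)[of \<tau> x j] by auto
  moreover have "dir x z = i" using c(2,4) dir_step(2)[of \<sigma> z i] by auto
  moreover have "z + (y - x) = a" unfolding c(4-6) by simp
  ultimately have "square_side x y z" using z(1) a c(1) by (auto simp: square_side_def adj_def)
  with z(3) show False ..
qed

definition dual_coef :: "(int ^ 'n \<Rightarrow> 'r) \<Rightarrow> int ^ 'n \<Rightarrow> int ^ 'n \<Rightarrow> 'r" where
  "dual_coef \<psi> x y = \<psi> (proj.tvec (dir x y))"

text \<open>Moving a loop at \<open>x\<close> across the arrow to \<open>y\<close>: if it spans a square with the arrow it becomes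
  the opposite loop at \<open>y\<close>, two signs cancelling, and otherwise the product vanishes at both
  ends.\<close>

lemma dual_coef_commute: "Dq.loops_commute (dual_coef \<psi>)"
  unfolding Dq.loops_commute_def
proof (intro allI impI)
  fix x y assume xy: "adj x y"
  then have yx: "adj y x" using adj_sym by blast
  let ?K = "dual_coef \<psi>"
  let ?B = "\<lambda>w. Dq.tar x y * (Dq.tar y w * Dq.tar w y)"
  let ?G = "{z. square_side x y z}" and ?G' = "{w. square_side y x w}"
  have finG: "finite ?G" by (rule finite_subset[OF _ finite_neighbours[of x]]) (auto simp: square_side_def)
  have finG': "finite ?G'" by (rule finite_subset[OF _ finite_neighbours[of y]]) (auto simp: square_side_def)
  have GM: "?G \<subseteq> Dq.M x x" "?G' \<subseteq> Dq.M y y" using adj_sym by (auto simp: square_side_def)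
  have y_notin: "y \<notin> ?G" "x \<notin> ?G'" by (auto simp: square_side_def)
  have left: "Dq.tar x z * Dq.tar z x * Dq.tar x y \<simeq>[Dq.J] (if z = y then ?B x else if z \<in> ?G then ?B (z + (y - x)) else 0)"
    if "z \<in> Dq.M x x" for z
  proof -
    have z: "adj x z" "adj z x" using that by auto
    consider "z = y" | "z \<noteq> y" "z \<in> ?G" | "z \<noteq> y" "z \<notin> ?G" by blast
    then show ?thesis
    proof cases
      case 1
      then show ?thesis by (simp add: mult.assoc)
    next
      case 2
      let ?w = "z + (y - x)"
      note o = square_side_opposite[OF xy 2(2)[simplified]]
      have wy: "adj ?w y" using o(4) adj_sym by blast
      have "Dq.tar x z * Dq.tar z x * Dq.tar x y = Dq.tar x z * (Dq.tar z x * Dq.tar x y)" by (simp add: mult.assoc)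
      also have "\<dots> \<simeq>[Dq.J] Dq.tar x z * (- (Dq.tar z ?w * Dq.tar ?w y))"
        by (intro cgr_left tar_square 2(1) z xy o wy)
      also have "\<dots> = (Dq.tar x z * Dq.tar z ?w) * (- Dq.tar ?w y)" by (simp add: mult.assoc)
      also have "\<dots> \<simeq>[Dq.J] (- (Dq.tar x y * Dq.tar y ?w)) * (- Dq.tar ?w y)"
        by (intro cgr_right tar_square 2(1) z xy o)
      also have "\<dots> = ?B ?w" by (simp add: mult.assoc)
      finally show ?thesis using 2 by simp
    next
      case 3
      have "Dq.tar x z * (Dq.tar z x * Dq.tar x y) \<simeq>[Dq.J] Dq.tar x z * 0"
        by (intro cgr_left tar_path not_square_side 3 z xy) (use 3 in simp)
      then show ?thesis using 3 by (simp add: mult.assoc)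
    qed
  qed
  have right: "?B w \<simeq>[Dq.J] (if w = x then ?B x else if w \<in> ?G' then ?B w else 0)" if "w \<in> Dq.M y y" for w
  proof (cases "w = x \<or> w \<in> ?G'")
    case False
    then have w: "adj y w" "adj w y" "w \<noteq> x" "\<not> square_side y x w" using that by auto
    have "{a. adj x a \<and> adj a w} = {a. adj w a \<and> adj a x}" using adj_sym by blast
    also have "\<dots> = {y}" by (rule not_square_side[OF yx w(1,3,4)])
    finally have "Dq.tar x y * Dq.tar y w * Dq.tar w y \<simeq>[Dq.J] 0 * Dq.tar w y"
      using w(3) by (intro cgr_right tar_path) auto
    then show ?thesis using False by (simp add: mult.assoc)
  qed auto
  have split: "(\<Sum>a\<in>N. if a = b then f b else if a \<in> G then h a else 0) = f b + (\<Sum>a\<in>G. h a)"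
    if "finite N" "b \<in> N" "G \<subseteq> N" "b \<notin> G" for N G :: "(int ^ 'n) set" and b f and h :: "int ^ 'n \<Rightarrow> 'c :: comm_monoid_add"
  proof -
    have "(\<Sum>a\<in>N. if a = b then f b else if a \<in> G then h a else 0) = f b + (\<Sum>a\<in>N - {b}. if a \<in> G then h a else 0)"
      using that(1,2) by (subst sum.remove[of N b]) (auto intro!: arg_cong2[of _ _ _ _ plus] sum.cong)
    also have "(\<Sum>a\<in>N - {b}. if a \<in> G then h a else 0) = (\<Sum>a\<in>G. h a)"
      using that by (intro sum.mono_neutral_cong_right) auto
    finally show ?thesis .
  qed
  have "Dq.loops x (?K x) * Dq.tar x y = (\<Sum>z\<in>Dq.M x x. scal (?K x z) * (Dq.tar x z * Dq.tar z x * Dq.tar x y))"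
    by (simp add: Dq.loops_def sum_distrib_right mult.assoc)
  also have "\<dots> \<simeq>[Dq.J] (\<Sum>z\<in>Dq.M x x. scal (?K x z) * (if z = y then ?B x else if z \<in> ?G then ?B (z + (y - x)) else 0))"
    by (intro cgr_sum cgr_left left)
  also have "\<dots> = (\<Sum>z\<in>Dq.M x x. if z = y then (\<lambda>z. scal (?K x z) * ?B x) y else if z \<in> ?G then scal (?K x z) * ?B (z + (y - x)) else 0)"
    by (intro sum.cong) auto
  also have "\<dots> = scal (?K x y) * ?B x + (\<Sum>z\<in>?G. scal (?K x z) * ?B (z + (y - x)))"
    by (rule split) (use finite_common xy yx GM y_notin in auto)
  also have "(\<Sum>z\<in>?G. scal (?K x z) * ?B (z + (y - x))) = (\<Sum>w\<in>?G'. scal (?K y w) * ?B w)"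
  proof (rule sum.reindex_bij_witness[of _ "\<lambda>w. w + (x - y)" "\<lambda>z. z + (y - x)"])
    fix w assume "w \<in> ?G'"
    then show "w + (x - y) \<in> ?G" using square_side_opposite(1)[OF yx] by simp
  next
    fix z assume z: "z \<in> ?G"
    then show "z + (y - x) \<in> ?G'" using square_side_opposite(1)[OF xy] by simp
    show "scal (?K y (z + (y - x))) * ?B (z + (y - x)) = scal (?K x z) * ?B (z + (y - x))"
      using square_side_opposite(2)[OF xy, of z] z by (simp add: dual_coef_def)
  qed simp_all
  also have "scal (?K x y) * ?B x = (\<lambda>w. scal (?K y w) * ?B w) x"
    by (simp add: dual_coef_def dir_sym[of y x])
  also have "(\<lambda>w. scal (?K y w) * ?B w) x + (\<Sum>w\<in>?G'. scal (?K y w) * ?B w)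
     = (\<Sum>w\<in>Dq.M y y. if w = x then (\<lambda>w. scal (?K y w) * ?B w) x else if w \<in> ?G' then scal (?K y w) * ?B w else 0)"
    by (rule split[symmetric]) (use finite_common xy yx GM y_notin in auto)
  also have "\<dots> = (\<Sum>w\<in>Dq.M y y. scal (?K y w) * (if w = x then ?B x else if w \<in> ?G' then ?B w else 0))"
    by (intro sum.cong) auto
  also have "\<dots> \<simeq>[Dq.J] (\<Sum>w\<in>Dq.M y y. scal (?K y w) * ?B w)"
    by (intro cgr_sum cgr_left, rule cgr_sym, rule right)
  also have "\<dots> = Dq.tar x y * Dq.loops y (?K y)"
    by (simp add: Dq.loops_def sum_distrib_left scal_left_comm[of "Dq.tar x y"])
  finally show "Dq.loops x (?K x) * Dq.tar x y \<simeq>[Dq.J] Dq.tar x y * Dq.loops y (?K y)" .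
qed

definition Hd_inv :: "(int ^ 'n) set \<Rightarrow> (int ^ 'n \<Rightarrow> 'r, int ^ 'n) Hd_letter \<Rightarrow>
    ((int ^ 'n, ((int ^ 'n \<Rightarrow> 'r, int ^ 'n) Hd_letter list \<Rightarrow>\<^sub>0 'r)) tensor_letter list \<Rightarrow>\<^sub>0 'r)" where
  "Hd_inv X l = (case l of DSym \<psi> \<Rightarrow> Dq.loop_sum X (dual_coef \<psi>)
    | DIdem x \<Rightarrow> gen (TIdem x) | DD x y \<Rightarrow> Dq.tar x y)"

lemma Hd_inv_simps [simp]:
  "Hd_inv X (DSym \<psi>) = Dq.loop_sum X (dual_coef \<psi>)"
  "Hd_inv X (DIdem x) = gen (TIdem x)" "Hd_inv X (DD x y) = Dq.tar x y"
  by (simp_all add: Hd_inv_def)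

text \<open>The difference has coefficients from a row of the projection matrix, which vanishes on \<open>t\<close>.\<close>

lemma dual_coef_loop:
  assumes x: "x \<in> L"
  shows "(\<Sum>u\<in>{x + axis i 1, x - axis i 1} \<inter> L. Dq.tar x u * Dq.tar u x) \<simeq>[Dq.J] Dq.loops x (dual_coef (weight i) x)"
proof -
  let ?k = "\<lambda>y. (if dir x y = i then 1 else 0) - dual_coef (weight i) x y"
  have "?k \<in> Dq.W x x"
  proof (rule Hd_W_loopI[OF x, of "\<lambda>j. of_int (mat i j)"])
    fix v assume v: "v \<in> t"
    have "(\<Sum>j\<in>UNIV. of_int (mat i j) * of_int (v $ j)) = (of_int (\<Sum>j\<in>UNIV. mat i j * v $ j) :: 'r)" by simp
    then show "(\<Sum>j\<in>UNIV. of_int (mat i j) * of_int (v $ j)) = (0 :: 'r)" by (simp only: proj.m_0[OF v] of_int_0)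
  next
    fix y
    show "?k y = of_int (mat i (dir x y))"
      using proj.tvec_t[of "dir x y"] by (auto simp: dual_coef_def weight_def proj.tvec_def)
  qed
  then have "Dq.loops x ?k \<simeq>[Dq.J] 0" by (rule Dq.loops_ideal[OF x])
  moreover have "Dq.loops x (\<lambda>y. if dir x y = i then 1 else 0) = (\<Sum>u\<in>{x + axis i 1, x - axis i 1} \<inter> L. Dq.tar x u * Dq.tar u x)"
    unfolding Dq.loops_def alpha_iff[OF x] using finite_common[of x x]
    by (intro sum.mono_neutral_cong_right) auto
  ultimately show ?thesis unfolding Dq.loops_diff by (simp add: cgr_def)
qed

lemma Hd_inv_rels:
  assumes "s \<in> rels Hd"
  shows "\<forall>\<^sub>F X in finite_subsets_at_top L. lift (Hd_inv X) s \<in> ideal Dq.J"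
  using assms
proof (cases rule: rels_Hd_cases)
  case (add \<psi>1 \<psi>2)
  have "Dq.loop_sum X (dual_coef (\<lambda>v. \<psi>1 v + \<psi>2 v)) = Dq.loop_sum X (dual_coef \<psi>1) + Dq.loop_sum X (dual_coef \<psi>2)" for X
    unfolding Dq.loop_sum_def sum.distrib[symmetric] Dq.loops_add[symmetric] dual_coef_def ..
  then show ?thesis unfolding add(1) by (simp add: lift_diff gen_ideal.zero)
next
  case (scal r \<psi>)
  have "Dq.loop_sum X (dual_coef (\<lambda>v. r * \<psi> v)) = Defs.scal r * Dq.loop_sum X (dual_coef \<psi>)" for X
    unfolding Dq.loop_sum_def sum_distrib_left Dq.loops_scal[symmetric] dual_coef_def ..
  then show ?thesis unfolding scal(1) by (simp add: lift_diff lift_mult gen_ideal.zero)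
next
  case (idem x y)
  have "gen (TIdem x) * gen (TIdem y) \<simeq>[Dq.J] (if x = y then gen (TIdem x) else 0)"
    by (intro Dq.rels_T_sub Dq.T_idem idem)
  then have "lift (Hd_inv X) s \<in> ideal Dq.J" for X
    unfolding idem by (cases "x = y") (simp_all add: lift_diff lift_mult cgr_def)
  then show ?thesis by simp
next
  case (left x u)
  have "lift (Hd_inv X) s \<in> ideal Dq.J" for X
    using Dq.TIdem_tar_J[OF left(2)] unfolding left by (simp add: lift_diff lift_mult cgr_def)
  then show ?thesis by simp
next
  case (right x u)
  have "lift (Hd_inv X) s \<in> ideal Dq.J" for X
    using Dq.tar_TIdem_J[OF right(2)] unfolding right by (simp add: lift_diff lift_mult cgr_def)
  then show ?thesis by simp
next
  case (loop i x)
  show ?thesis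
  proof (rule eventually_large[of "{x}"])
    fix X assume X: "finite X" "{x} \<subseteq> X" "X \<subseteq> L"
    have "Dq.loop_sum X (dual_coef (weight i)) * gen (TIdem x) \<simeq>[Dq.J] Dq.loops x (dual_coef (weight i) x) * gen (TIdem x)"
      using Dq.loop_sum_left[OF X(1,3) loop(2) Dq.TIdem_TIdem[OF loop(2)]] X(2) by simp
    also have "\<dots> \<simeq>[Dq.J] Dq.loops x (dual_coef (weight i) x)" by (rule Dq.loops_TIdem)
    finally have "Dq.loop_sum X (dual_coef (weight i)) * gen (TIdem x) \<simeq>[Dq.J] Dq.loops x (dual_coef (weight i) x)" .
    from cgr_trans[OF dual_coef_loop[OF loop(2)] cgr_sym[OF this]]
    show "lift (Hd_inv X) s \<in> ideal Dq.J"
      unfolding loop(1) by (simp only: lift_diff lift_mult lift_sum lift_simps Hd_inv_simps cgr_def)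
  qed (use loop in auto)
next
  case (square x u y z)
  have "lift (Hd_inv X) s \<in> ideal Dq.J" for X
    using tar_square[OF square(2-)] unfolding square(1) by (simp add: lift_add lift_mult cgr_def)
  then show ?thesis by simp
next
  case (path x y u)
  have "{z \<in> L. l1_dist x z = 1 \<and> l1_dist z u = 1} = {y. adj x y \<and> adj y u}" using path by (auto simp: adj_def)
  moreover have "x \<noteq> u" using path(4) by auto
  ultimately have "lift (Hd_inv X) s \<in> ideal Dq.J" for X
    using tar_path[of x u y] path(5) unfolding path(1) by (simp add: lift_mult cgr_0)
  then show ?thesis by simp
qed

lemma Hd_inv_commute:
  assumes "g \<in> central Hd \<union> gens Hd"
  shows "\<forall>\<^sub>F X in finite_subsets_at_top L. lift (Hd_inv X) (dsym \<psi> * gen g - gen g * dsym \<psi>) \<in> ideal Dq.J"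
proof -
  consider \<psi>' where "g = DSym \<psi>'" | x where "g = DIdem x" "x \<in> L" | x y where "g = DD x y" "adj x y"
    using assms unfolding adj_def by auto
  then show ?thesis
  proof cases
    case 1
    show ?thesis
    proof (rule eventually_large[of "{}"])
      fix X assume X: "finite X" "X \<subseteq> L"
      show "lift (Hd_inv X) (dsym \<psi> * gen g - gen g * dsym \<psi>) \<in> ideal Dq.J"
        using Dq.loop_sum_commute[OF X dual_coef_commute, of \<psi> "dual_coef \<psi>'"]
        by (simp add: 1 lift_diff lift_mult cgr_def)
    qed auto
  next
    case 2
    show ?thesis
    proof (rule eventually_large[of "{}"])
      fix X assume X: "finite X" "X \<subseteq> L"
      show "lift (Hd_inv X) (dsym \<psi> * gen g - gen g * dsym \<psi>) \<in> ideal Dq.J"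
        using Dq.loop_sum_TIdem[OF X 2(2), of "dual_coef \<psi>"]
        by (simp add: 2 lift_diff lift_mult cgr_def)
    qed auto
  next
    case 3
    have L: "x \<in> L" "y \<in> L" using 3 by (auto simp: adj_def)
    show ?thesis
    proof (rule eventually_large[of "{x, y}"])
      fix X assume X: "finite X" "{x, y} \<subseteq> X" "X \<subseteq> L"
      have "Dq.loop_sum X (dual_coef \<psi>) * Dq.tar x y \<simeq>[Dq.J] Dq.loops x (dual_coef \<psi> x) * Dq.tar x y"
        using Dq.loop_sum_left[OF X(1,3) L(1) Dq.TIdem_tar_J[OF 3(2)]] X(2) by simp
      also have "\<dots> \<simeq>[Dq.J] Dq.tar x y * Dq.loops y (dual_coef \<psi> y)"
        using dual_coef_commute 3(2) by (simp add: Dq.loops_commute_def)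
      also have "\<dots> \<simeq>[Dq.J] Dq.tar x y * Dq.loop_sum X (dual_coef \<psi>)"
        using cgr_sym[OF Dq.loop_sum_right[OF X(1,3) L(2) Dq.tar_TIdem_J[OF 3(2)]]] X(2) by simp
      finally show "lift (Hd_inv X) (dsym \<psi> * gen g - gen g * dsym \<psi>) \<in> ideal Dq.J"
        by (simp add: 3 lift_diff lift_mult cgr_def)
    qed (use L in auto)
  qed
qed

text \<open>The central generator \<open>\<psi>\<close> is expanded in the weights \<open>t\<^sub>i\<close> and each of these is replaced by
  loops; centrality is the commutation of loops with arrows.\<close>

theorem Hd_quadratic: "is_quadratic Hd L DIdem"
proof (rule Dq.is_quadraticI[of Hd_inv])
  show "Dq.tm_image (gen g)" if g: "g \<in> gens Hd" for g
  proof -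
    consider x where "g = DIdem x" "x \<in> L" | x y where "g = DD x y" "adj x y"
      using g unfolding adj_def by auto
    then show ?thesis by cases (simp_all add: Dq.tm_image_e Dq.tm_image_ar)
  qed
next
  fix z x assume z: "z \<in> central Hd" and x: "x \<in> L"
  from z obtain \<psi> where \<psi>: "z = DSym \<psi>" "\<psi> \<in> lattice_dual t" by auto
  have "(\<lambda>v. \<Sum>j\<in>UNIV. \<psi> (proj.tvec j) * weight j v) = \<psi>"
  proof
    fix v show "(\<Sum>j\<in>UNIV. \<psi> (proj.tvec j) * weight j v) = \<psi> v"
      using proj.lattice_dual_expand[OF subtorus \<psi>(2), of v] \<psi>(2)
      by (cases "v \<in> t") (simp_all add: weight_def lattice_dual_def)
  qed
  then have "(\<Sum>y\<in>Dq.M x x. scal (\<psi> (proj.tvec (dir x y))) * (dd x y * dd y x)) \<simeq>[full_rels Hd] gen z * gen (DIdem x)"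
    using Hd_loops[OF x, of "\<lambda>j. \<psi> (proj.tvec j)"] by (simp add: \<psi>(1))
  then show "Dq.tm_image (gen z * gen (DIdem x))"
    by (rule Dq.tm_image_cgr[OF _ cgr_sym, rotated])
      (intro Dq.tm_image_sum Dq.tm_image_scal Dq.tm_image_mult Dq.tm_image_ar, auto)
next
  fix s assume "s \<in> full_rels Hd"
  then consider "s \<in> rels Hd" | \<psi> g where "s = dsym \<psi> * gen g - gen g * dsym \<psi>" "g \<in> central Hd \<union> gens Hd"
    unfolding full_rels_def Hd_simps(1) by blast
  then show "\<forall>\<^sub>F X in finite_subsets_at_top L. lift (Hd_inv X) s \<in> ideal Dq.J"
    by cases (use Hd_inv_rels Hd_inv_commute in simp_all)
qed simp_all

text \<open>The projections are given by integral matrices, so one argument serves all ground rings.\<close>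

theorem chambers_quadratically_dual:
  "delta_pairing L dual.pair1 \<and> quadratically_dual H HIdem Hd DIdem L dual.pair1"
proof
  show "delta_pairing L dual.pair1"
    unfolding delta_pairing_def
  proof (intro ballI allI impI, elim conjE)
    fix x y :: "int ^ 'n" and \<sigma> \<sigma>' :: int and i j
    assume L: "x \<in> L" "y \<in> L" "x + axis i \<sigma> \<in> L" "y + axis j \<sigma>' \<in> L" and s: "\<sigma> \<in> {1, - 1}" "\<sigma>' \<in> {1, - 1}"
    have a: "adj (x + axis i \<sigma>) x" "adj (y + axis j \<sigma>') y"
      using adjI[of x i \<sigma>] adjI[of y j \<sigma>'] L s adj_sym by auto
    have "axis i \<sigma> = axis j \<sigma>' \<longleftrightarrow> i = j \<and> \<sigma> = \<sigma>'" using s by (auto simp: axis_eq_axis)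
    then have "(x + axis i \<sigma> = y + axis j \<sigma>' \<and> x = y) \<longleftrightarrow> (x = y \<and> i = j \<and> \<sigma> = \<sigma>')" by auto
    then show "dual.pair1 (c_elem x \<sigma> i) (d_elem y \<sigma>' j) = (if x = y \<and> i = j \<and> \<sigma> = \<sigma>' then 1 else 0)"
      unfolding c_elem_def d_elem_def dual.pair1_arrows[OF a] by simp
  qed
  show "quadratically_dual H HIdem Hd DIdem L dual.pair1"
    by (rule dual.quadratically_dualI[OF H_quadratic Hd_quadratic])
qed

end

section \<open>Quadratic duality\<close>

theorem theorem3p24:
  fixes t :: "(int ^ 'n::finite) set" and p :: nat and \<phi> :: "int ^ 'n \<Rightarrow> int"
  assumes "subtorus t" and "unimodular t" and "prime p"
    and "\<phi> \<in> lattice_dual t" and "smooth_parameter t p \<phi>"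
  shows "(\<exists>\<beta> :: ((((int ^ 'n) set, int ^ 'n) H_letter list \<Rightarrow>\<^sub>0 int) \<Rightarrow>
                ((int ^ 'n \<Rightarrow> int, int ^ 'n) Hd_letter list \<Rightarrow>\<^sub>0 int) \<Rightarrow> int).
            delta_pairing (chambers t p \<phi>) \<beta> \<and>
            quadratically_dual (H_pres t p \<phi>) HIdem (Hd_pres t p \<phi>) DIdem (chambers t p \<phi>) \<beta>)
       \<and> (CHAR('k::field) = p \<longrightarrow>
          (\<exists>\<beta> :: ((((('k ^ 'n) set, int ^ 'n) H_letter list \<Rightarrow>\<^sub>0 'k) \<Rightarrow>
                ((int ^ 'n \<Rightarrow> 'k, int ^ 'n) Hd_letter list \<Rightarrow>\<^sub>0 'k) \<Rightarrow> 'k)).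
            delta_pairing (chambers t p \<phi>) \<beta> \<and>
            quadratically_dual (H_pres t p \<phi>) HIdem (Hd_pres t p \<phi>) DIdem (chambers t p \<phi>) \<beta>))"
proof -
  have p: "p > 0" using \<open>prime p\<close> by (rule prime_gt_0_nat)
  interpret Z: chamber_ring t p \<phi> "TYPE(int)"
    by (rule chamber_ring.intro) (fact assms p)+
  interpret K: chamber_ring t p \<phi> "TYPE('k)"
    by (rule chamber_ring.intro) (fact assms p)+
  show ?thesis using Z.chambers_quadratically_dual K.chambers_quadratically_dual by blast
qed

end
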